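(* Let $L_{\sigma^{-k}}$ denote the circular closure of the two-strand braid word $\sigma^{-k}=(\sigma^-)^k$, and let $H^{(3)}$ denote the filtered triply graded homology. As filtered triply graded $\mathbb Q$-vector spaces, for $n\ge0$ $$H^{(3)}(L_{\sigma^{-(2n+1)}})\cong(\mathbf t_s\mathbf a_q)^{-2n}\,H^{(3)}(\bigcirc)\otimes\Bigl(\mathbb Q\oplus\mathbf t_a\bigoplus_{k=0}^{n-1}\mathbf t_{\mathrm{tot}}^{2k+1}\bigl(\mathbf s_q\mathbb Q\oplus\mathbf a_q^{-1}\mathbb Q\bigr)\Bigr),$$ and for $n\ge1$ $$H^{(3)}(L_{\sigma^{-2n}})\cong(\mathbf t_s\mathbf a_q)^{-1}H^{(3)}(L_{\sigma^{-(2n-1)}})\ \oplus\ \mathbf t_s^{2n-1}\mathbf a_q^{-1}\mathbf t_a\,H^{(3)}(\bigcirc)\otimes\bigl(\mathbf a_q\mathbf s_q\mathbb Q[z]\oplus\mathbf s_q\mathbb Q[z]\oplus\mathbb Q\bigr),$$ where $H^{(3)}(\bigcirc)=\mathbf t_s\bigl(\mathbf a_q\mathbb Q[w]\oplus\mathbb Q[w]\bigr)$ is the homology of the one-strand unknot diagram, $\mathbf t_{\mathrm{tot}}=\mathbf t_a\mathbf s_q$, and $z,w$ are variables of $q$-degree $2$ (and filtration level $0$).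
   Context: Categories. Let $\mathbf x=(x_1,x_2)$, $\mathbf y=(y_1,y_2)$; $\mathbb Q[\mathbf x,\mathbf y]$ is graded by $q$-degree with $\deg x_i=\deg y_i=2$. $\mathbf D_2$ is the derived category of $q$-graded $\mathbb Q[\mathbf x,\mathbf y]$-modules with a decreasing filtration $F^\bullet$: objects are represented by filtered $q$-graded complexes, filtered quasi-isomorphisms (those inducing quasi-isomorphisms on all associated graded pieces) are inverted, and morphisms preserve $q$-degree and filtration. Its homological degree is called $a$-degree; differentials lower it by $1$. Shift functors: $\mathbf q$ ($q$-degree), $\mathbf a$ ($a$-degree), $\mathbf s$ (filtration, $F^i(\mathbf sA)=F^{i-1}A$). $\mathrm{Ch}(\mathcal A)$ is the category of bounded chain complexes over an additive category $\mathcal A$ ("outer" complexes, in square brackets); the outer degree is the $t$-degree with shift $\mathbf t$, outer differentials lower $t$-degree by $1$, and $a$-degree records total homological degree, so passing to one higher outer position is the shift $\mathbf t_a=\mathbf t\mathbf a$. Half-integer $t$- and $s$-shifts are allowed. Put $\mathbf a_q=\mathbf a\mathbf q^2$, $\mathbf s_q=\mathbf s\mathbf q^2$, $\mathbf t_s=(\mathbf t\mathbf s)^{1/2}$. $\mathbf K$ is the homotopy category of complexes of filtered $q$-graded $\mathbb Q$-vector spaces. Composition: $M\circ N=M(\mathbf z,\mathbf y)\otimes_{\mathbb Q[\mathbf y]}N(\mathbf y,\mathbf x)$ with tensor product filtration (total outer complex in the case of complexes), regarded as a $\mathbb Q[\mathbf x,\mathbf z]$-module. Bimodules. Put $x_\pm=x_2\pm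 x_1$, $y_\pm=y_2\pm y_1$. Let $I=\mathbb Q[\mathbf x,\mathbf y]/(y_1-x_1,y_2-x_2)$ with trivial filtration ($F^0$ everything, $F^1=0$), and let $B$ be the module $M=\mathbb Q[\mathbf x,\mathbf y]/(y_+-x_+,(y_-+x_-)(y_--x_-))$ with $F^0=M$, $F^1=(y_--x_-)M$, $F^2=0$ (so $F^0/F^1\cong I$); $\chi_-:B\to I$ is the projection. The filtered Rouquier complex of the negative elementary two-strand braid is $[\sigma^{-}]=(\mathbf t_s\mathbf a_q)^{-1}\bigl[\,\mathbf t_aB\xrightarrow{\chi_-}I\,\bigr]$, and $[(\sigma^-)^k]=[\sigma^-]\circ\cdots\circ[\sigma^-]$ ($k$ factors). Homology. For the circular closure $L_\beta$ of a two-strand braid word $\beta$, $[L_\beta]=\mathbf t_s^{2}\bigl([\beta]\overset{\mathrm L}{\otimes}_{\mathbb Q[\mathbf x,\mathbf y]}I\bigr)\in\mathrm{Ch}(\mathbf K)$ (derived tensor product applied termwise). $H_{\mathrm{in}}$ is the termwise homology with respect to the inner differential (that of objects of $\mathbf K$), $H_{\mathrm{out}}$ the subsequent homology with respect to the outer differential, both with induced filtrations; $H^{(3)}(L_\beta)=H_{\mathrm{out}}(H_{\mathrm{in}}([L_\beta]))$, graded by $q$-, $a$- and $t$-degrees and filtered. *)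

theory Defs
  imports Complex_Main "HOL-Library.Poly_Mapping" "HOL-Library.Product_Plus"
begin

section \<open>Degrees and shift functors\<close>

text \<open>A degree is a triple (q, a, t), where a is the total homological degree. Half-integer
  t-degrees and filtration levels occur, hence the rational components.\<close>

type_synonym deg = "int \<times> int \<times> rat"

text \<open>The shift functors \<open>q\<^sup>i a\<^sup>j t\<^sup>k s\<^sup>l\<close>, written multiplicatively.\<close>

datatype shift = Shift (qexp: int) (aexp: int) (texp: rat) (sexp: rat)

instantiation shift :: "{comm_monoid_mult, inverse}"
begin

definition one_shift :: shift where
  "1 = Shift 0 0 0 0"

definition times_shift :: "shift \<Rightarrow> shift \<Rightarrow> shift" where
  "g * h = Shift (qexp g + qexp h) (aexp g + aexp h) (texp g + texp h) (sexp g + sexp h)"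

definition inverse_shift :: "shift \<Rightarrow> shift" where
  "inverse g = Shift (- qexp g) (- aexp g) (- texp g) (- sexp g)"

definition divide_shift :: "shift \<Rightarrow> shift \<Rightarrow> shift" where
  "divide_shift g h = g * inverse h"

instance
  by standard (simp_all add: one_shift_def times_shift_def)

end

definition sh_q :: shift where "sh_q = Shift 1 0 0 0"
definition sh_a :: shift where "sh_a = Shift 0 1 0 0"
definition sh_t :: shift where "sh_t = Shift 0 0 1 0"
definition sh_s :: shift where "sh_s = Shift 0 0 0 1"

definition sh_aq :: shift where "sh_aq = sh_a * sh_q ^ 2"
definition sh_sq :: shift where "sh_sq = sh_s * sh_q ^ 2"
definition sh_ta :: shift where "sh_ta = sh_t * sh_a"
definition sh_ts :: shift where "sh_ts = Shift 0 0 (1/2) (1/2)"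
definition sh_ttot :: shift where "sh_ttot = sh_ta * sh_sq"

lemma sh_ts_square: "sh_ts ^ 2 = sh_t * sh_s"
  by (simp add: sh_ts_def sh_t_def sh_s_def times_shift_def power2_eq_square)


section \<open>The ambient vector space\<close>

text \<open>Iterated tensor products change the underlying vector space, so that a recursion over them
  needs a type closed under direct sums and tensor products. All spaces below are subquotients
  of the free \<open>\<rat>\<close>-vector space on the following labels: monomials, tagged labels
  \<open>In i k\<close> for the \<open>i\<close>-th summand of a direct sum, and \<open>Tn d e k l\<close> for the basis vector
  \<open>k \<otimes> l\<close> of the tensor product of the degree \<open>d\<close> piece of the first factor with the degree \<open>e\<close>
  piece of the second one.\<close>

datatype lab = Mono "nat \<Rightarrow>\<^sub>0 nat" | In nat lab | Tn deg deg lab lab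

abbreviation "lookup \<equiv> Poly_Mapping.lookup"
abbreviation "keys \<equiv> Poly_Mapping.keys"

type_synonym vec = "lab \<Rightarrow>\<^sub>0 rat"

definition scl :: "rat \<Rightarrow> vec \<Rightarrow> vec" where
  "scl c v = Poly_Mapping.map ((*) c) v"

lemma lookup_scl: "lookup (scl c v) l = c * lookup v l"
  by (simp add: scl_def Poly_Mapping.map.rep_eq when_def)

interpretation vec: vector_space scl
  by unfold_locales (auto intro!: poly_mapping_eqI simp: lookup_scl lookup_add algebra_simps)

definition bv :: "lab \<Rightarrow> vec" where
  "bv l = Poly_Mapping.single l 1"

definition lift :: "(lab \<Rightarrow> vec) \<Rightarrow> vec \<Rightarrow> vec" where
  "lift f v = (\<Sum>l\<in>keys v. scl (lookup v l) (f l))"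

definition incl :: "nat \<Rightarrow> vec \<Rightarrow> vec" where
  "incl i = lift (\<lambda>l. bv (In i l))"

definition tn :: "deg \<Rightarrow> deg \<Rightarrow> vec \<Rightarrow> vec \<Rightarrow> vec" where
  "tn d e v w = (\<Sum>k\<in>keys v. \<Sum>l\<in>keys w. scl (lookup v k * lookup w l) (bv (Tn d e k l)))"

text \<open>The operator \<open>f \<otimes> g\<close>, for \<open>f\<close> and \<open>g\<close> of degrees \<open>\<delta>\<close> and \<open>\<epsilon>\<close>.\<close>

definition tmap :: "deg \<Rightarrow> deg \<Rightarrow> (vec \<Rightarrow> vec) \<Rightarrow> (vec \<Rightarrow> vec) \<Rightarrow> vec \<Rightarrow> vec" where
  "tmap \<delta> \<epsilon> f g = lift (\<lambda>l. case l of
     Tn d e k k' \<Rightarrow> tn (d + \<delta>) (e + \<epsilon>) (f (bv k)) (g (bv k')) | _ \<Rightarrow> 0)"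


section \<open>Filtered triply graded vector spaces\<close>

text \<open>The degree \<open>d\<close> component is the quotient \<open>piece d / rels d\<close>; it is filtered by the subspaces
  \<open>filt i d / rels d\<close>, where \<open>rels d \<subseteq> filt i d \<subseteq> piece d\<close>. The total space is the external direct
  sum of the components. The filtration is decreasing; one that is indexed by the integers is
  extended to rational levels by \<open>F\<^sup>i = F\<^sup>j\<close> with \<open>j = \<lceil>i\<rceil>\<close>.\<close>

record fsp =
  piece :: "deg \<Rightarrow> vec set"
  rels :: "deg \<Rightarrow> vec set"
  filt :: "rat \<Rightarrow> deg \<Rightarrow> vec set"

definition shift :: "shift \<Rightarrow> 'a fsp_scheme \<Rightarrow> 'a fsp_scheme"  (infixr \<open>\<triangleright>\<close> 75) where
  "g \<triangleright> M = (let \<delta> = (qexp g, aexp g, texp g) in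
     M\<lparr>piece := \<lambda>d. piece M (d - \<delta>),
       rels := \<lambda>d. rels M (d - \<delta>),
       filt := \<lambda>i d. filt M (i - sexp g) (d - \<delta>)\<rparr>)"

definition dsum :: "'a fsp_scheme list \<Rightarrow> fsp" where
  "dsum Ms = \<lparr>
     piece = \<lambda>d. vec.span (\<Union>k<length Ms. incl k ` piece (Ms ! k) d),
     rels = \<lambda>d. vec.span (\<Union>k<length Ms. incl k ` rels (Ms ! k) d),
     filt = \<lambda>i d. vec.span (\<Union>k<length Ms. incl k ` filt (Ms ! k) i d)\<rparr>"

definition tens_rels :: "'a fsp_scheme \<Rightarrow> 'b fsp_scheme \<Rightarrow> deg \<Rightarrow> vec set" where
  "tens_rels M N d = vec.span
     ({tn e e' v w | e e' v w. e + e' = d \<and> v \<in> rels M e \<and> w \<in> piece N e'} \<union>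
      {tn e e' v w | e e' v w. e + e' = d \<and> v \<in> piece M e \<and> w \<in> rels N e'})"

definition tens :: "'a fsp_scheme \<Rightarrow> 'b fsp_scheme \<Rightarrow> fsp"  (infixr \<open>\<otimes>\<close> 70) where
  "M \<otimes> N = \<lparr>
     piece = \<lambda>d. vec.span
       {tn e e' v w | e e' v w. e + e' = d \<and> v \<in> piece M e \<and> w \<in> piece N e'},
     rels = tens_rels M N,
     filt = \<lambda>i d. vec.span
       ({tn e e' v w | e e' v w j j'. e + e' = d \<and> j + j' = i \<and>
           v \<in> filt M j e \<and> w \<in> filt N j' e'} \<union> tens_rels M N d)\<rparr>"

definition quot :: "(deg \<Rightarrow> vec set) \<Rightarrow> 'a fsp_scheme \<Rightarrow> 'a fsp_scheme" where
  "quot R M = M\<lparr>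
     rels := \<lambda>d. vec.span (rels M d \<union> R d),
     filt := \<lambda>i d. vec.span (filt M i d \<union> R d)\<rparr>"

text \<open>Homology with respect to a differential \<open>D\<close> of degree \<open>\<delta>\<close>, with the induced filtration:
  \<open>F\<^sup>i\<close> consists of the classes that are represented by cycles in \<open>F\<^sup>i\<close>.\<close>

definition homology :: "deg \<Rightarrow> (vec \<Rightarrow> vec) \<Rightarrow> 'a fsp_scheme \<Rightarrow> 'a fsp_scheme" where
  "homology \<delta> D M = (let
     Z = (\<lambda>d. {v \<in> piece M d. D v \<in> rels M (d + \<delta>)});
     B = (\<lambda>d. {r + D w | r w. r \<in> rels M d \<and> w \<in> piece M (d - \<delta>)})
     in M\<lparr>piece := Z, rels := B,
          filt := \<lambda>i d. {z + b | z b. z \<in> Z d \<and> z \<in> filt M i d \<and> b \<in> B d}\<rparr>)"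

text \<open>Isomorphism of filtered triply graded vector spaces: \<open>\<phi> d\<close> induces a bijection
  \<open>piece M d / rels M d \<rightarrow> piece N d / rels N d\<close> that maps each filtration level of \<open>M\<close> onto that
  of \<open>N\<close>. Every linear map between these quotients is induced by a linear map of \<open>vec\<close>.\<close>

definition fiso :: "'a fsp_scheme \<Rightarrow> 'b fsp_scheme \<Rightarrow> bool"  (infix \<open>\<cong>\<close> 50) where
  "M \<cong> N \<longleftrightarrow> (\<exists>\<phi>. \<forall>d. Vector_Spaces.linear scl scl (\<phi> d) \<and>
     (\<forall>v \<in> piece M d. \<phi> d v \<in> piece N d \<and> (\<phi> d v \<in> rels N d \<longleftrightarrow> v \<in> rels M d)) \<and>
     (\<forall>w \<in> piece N d. \<exists>v \<in> piece M d. w - \<phi> d v \<in> rels N d) \<and>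
     (\<forall>i. \<forall>v \<in> piece M d. \<phi> d v \<in> filt N i d \<longleftrightarrow> v \<in> filt M i d))"


section \<open>Polynomial rings and cyclic modules\<close>

type_synonym mpoly = "(nat \<Rightarrow>\<^sub>0 nat) \<Rightarrow>\<^sub>0 rat"

definition pvar :: "nat \<Rightarrow> mpoly" where
  "pvar i = Poly_Mapping.single (Poly_Mapping.single i 1) 1"

definition Qpoly :: "nat set \<Rightarrow> mpoly set" where
  "Qpoly S = {p. \<forall>m \<in> keys p. keys m \<subseteq> S}"

definition homog :: "deg \<Rightarrow> mpoly set" where
  "homog d = {p. \<forall>m \<in> keys p. d = (2 * int (\<Sum>i\<in>keys m. lookup m i), 0, 0)}"

definition emb :: "mpoly \<Rightarrow> vec" where
  "emb p = (\<Sum>m\<in>keys p. scl (lookup p m) (bv (Mono m)))"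

definition mulop :: "mpoly \<Rightarrow> vec \<Rightarrow> vec" where
  "mulop p = lift (\<lambda>l. case l of Mono m \<Rightarrow> emb (p * Poly_Mapping.single m 1) | _ \<Rightarrow> 0)"

text \<open>The quotient \<open>A / J\<close>, where \<open>F i\<close> is the preimage in \<open>A\<close> of the filtration level \<open>i\<close>.\<close>

definition cyclic :: "mpoly set \<Rightarrow> mpoly set \<Rightarrow> (rat \<Rightarrow> mpoly set) \<Rightarrow> fsp" where
  "cyclic A J F = \<lparr>
     piece = \<lambda>d. emb ` (A \<inter> homog d),
     rels = \<lambda>d. emb ` (J \<inter> homog d),
     filt = \<lambda>i d. emb ` (F i \<inter> homog d)\<rparr>"

definition trivial_filt :: "mpoly set \<Rightarrow> mpoly set \<Rightarrow> rat \<Rightarrow> mpoly set" where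
  "trivial_filt A J i = (if i \<le> 0 then A else J)"

definition poly_space :: "nat set \<Rightarrow> fsp" where
  "poly_space S = cyclic (Qpoly S) {0} (trivial_filt (Qpoly S) {0})"

definition QQ :: fsp where "QQ = poly_space {}"
definition QQ1 :: fsp where "QQ1 = poly_space {1}"


section \<open>The bimodules\<close>

text \<open>The variables \<open>x\<^sub>1, x\<^sub>2\<close> have index 1, 2 and \<open>y\<^sub>1, y\<^sub>2\<close> have index 3, 4.\<close>

definition xv :: "nat \<Rightarrow> mpoly" where "xv i = pvar i"
definition yv :: "nat \<Rightarrow> mpoly" where "yv i = pvar (2 + i)"

definition xp :: mpoly where "xp = xv 2 + xv 1"
definition xm :: mpoly where "xm = xv 2 - xv 1"
definition yp :: mpoly where "yp = yv 2 + yv 1"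
definition ym :: mpoly where "ym = yv 2 - yv 1"

definition Qxy :: "mpoly set" where "Qxy = Qpoly {1..4}"

definition ideal2 :: "mpoly \<Rightarrow> mpoly \<Rightarrow> mpoly set" where
  "ideal2 f g = {p * f + r * g | p r. p \<in> Qxy \<and> r \<in> Qxy}"

text \<open>A module over \<open>\<rat>[x,y]\<close> is given by the operators \<open>x\<^sub>i\<close> and \<open>y\<^sub>i\<close> for \<open>i \<in> {1,2}\<close>.\<close>

record fbim = fsp +
  xact :: "nat \<Rightarrow> vec \<Rightarrow> vec"
  yact :: "nat \<Rightarrow> vec \<Rightarrow> vec"

definition cyclic_bim :: "mpoly set \<Rightarrow> (rat \<Rightarrow> mpoly set) \<Rightarrow> fbim" where
  "cyclic_bim J F = fsp.extend (cyclic Qxy J F)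
     (fbim.fields (\<lambda>i. mulop (xv i)) (\<lambda>i. mulop (yv i)))"

definition Rbim :: fbim where
  "Rbim = cyclic_bim {0} (trivial_filt Qxy {0})"

definition JI :: "mpoly set" where "JI = ideal2 (yv 1 - xv 1) (yv 2 - xv 2)"

definition Ibim :: fbim where
  "Ibim = cyclic_bim JI (trivial_filt Qxy JI)"

definition JB :: "mpoly set" where "JB = ideal2 (yp - xp) ((ym + xm) * (ym - xm))"

definition Bbim :: fbim where
  "Bbim = cyclic_bim JB (\<lambda>i. if i \<le> 0 then Qxy
     else if i \<le> 1 then {p * (ym - xm) + r | p r. p \<in> Qxy \<and> r \<in> JB} else JB)"

definition blocks :: "(vec \<Rightarrow> vec) list \<Rightarrow> vec \<Rightarrow> vec" where
  "blocks fs = lift (\<lambda>l. case l of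
     In k l' \<Rightarrow> if k < length fs then incl k ((fs ! k) (bv l')) else 0 | _ \<Rightarrow> 0)"

definition dsum_bim :: "fbim list \<Rightarrow> fbim" where
  "dsum_bim Ms = fsp.extend (dsum Ms)
     (fbim.fields (\<lambda>i. blocks (map (\<lambda>M. xact M i) Ms)) (\<lambda>i. blocks (map (\<lambda>M. yact M i) Ms)))"

definition deg_x :: deg where "deg_x = (2, 0, 0)"

text \<open>Tensor product over a polynomial ring, where each pair \<open>(f, g) \<in> S\<close> consists of the actions of
  a generator (of degree 2) on the two factors.\<close>

definition tens_over :: "((vec \<Rightarrow> vec) \<times> (vec \<Rightarrow> vec)) set \<Rightarrow>
    'a fsp_scheme \<Rightarrow> 'b fsp_scheme \<Rightarrow> fsp" where
  "tens_over S M N = quot (\<lambda>d.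
     {tn (e + deg_x) e' (f v) w - tn e (e' + deg_x) v (g w) | e e' f g v w.
        e + e' + deg_x = d \<and> (f, g) \<in> S \<and> v \<in> piece M e \<and> w \<in> piece N e'}) (M \<otimes> N)"


section \<open>Outer complexes of bimodules\<close>

text \<open>An object of \<open>Ch(D\<^sub>2)\<close> whose terms are filtered graded modules, as for \<open>[\<beta>]\<close>; the sum of all its terms
  is a single graded module. The outer differential lowers \<open>t\<close> and the total degree \<open>a\<close>.\<close>

record fch = fbim +
  dout :: "vec \<Rightarrow> vec"

definition deg_out :: deg where "deg_out = (0, -1, -1)"
definition deg_in :: deg where "deg_in = (0, -1, 0)"

text \<open>\<open>M(z,y)\<close> and \<open>N(y,x)\<close> are composed over the ring acting on \<open>M\<close> by \<open>xact\<close> and on \<open>N\<close> by \<open>yact\<close>.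
  The sign in the differential of the total complex is \<open>(-1)\<^sup>j\<close> with \<open>j = \<lfloor>t\<rfloor>\<close>, since \<open>t\<close> may be a
  half-integer; it alternates along the complex.\<close>

definition comp_ch :: "fch \<Rightarrow> fch \<Rightarrow> fch"  (infixr \<open>\<odot>\<close> 70) where
  "M \<odot> N = fbim.extend
     (fsp.extend (tens_over {(xact M i, yact N i) | i. i \<in> {1, 2}} M N) (fbim.fields
       (\<lambda>i. tmap 0 deg_x id (xact N i))
       (\<lambda>i. tmap deg_x 0 (yact M i) id)))
     (fch.fields (lift (\<lambda>l. case l of
        Tn d e k k' \<Rightarrow> tn (d + deg_out) e (dout M (bv k)) (bv k') +
          scl ((-1) powi \<lfloor>snd (snd d)\<rfloor>) (tn d (e + deg_out) (bv k) (dout N (bv k')))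
      | _ \<Rightarrow> 0)))"

text \<open>Since the module \<open>B\<close> and its quotient \<open>I\<close> are presented by the same polynomials, the
  projection \<open>\<chi>\<^sub>-\<close> is induced by the identity.\<close>

definition sigma_neg :: fch where
  "sigma_neg = inverse (sh_ts * sh_aq) \<triangleright>
     fbim.extend (dsum_bim [sh_ta \<triangleright> Bbim, Ibim]) (fch.fields
       (lift (\<lambda>l. case l of In k l' \<Rightarrow> if k = 0 then bv (In 1 l') else 0 | _ \<Rightarrow> 0)))"

text \<open>The empty braid word gives the identity bimodule.\<close>

fun sigma_neg_power :: "nat \<Rightarrow> fch" where
  "sigma_neg_power 0 = fbim.extend Ibim (fch.fields (\<lambda>_. 0))"
| "sigma_neg_power (Suc 0) = sigma_neg"
| "sigma_neg_power (Suc (Suc k)) = sigma_neg \<odot> sigma_neg_power (Suc k)"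


section \<open>Derived closure and homology\<close>

record fcx = fbim +
  kdiff :: "vec \<Rightarrow> vec"

text \<open>The Koszul complex of \<open>y\<^sub>1 - x\<^sub>1, y\<^sub>2 - x\<^sub>2\<close>, a free resolution of \<open>I\<close> over \<open>\<rat>[x,y]\<close> (see
  \<open>koszul_resolution\<close> below). Both have trivial filtration, so that it is a filtered free
  replacement of \<open>I\<close> by which the derived tensor product with \<open>I\<close> is computed.\<close>

definition koszul :: fcx where
  "koszul = fbim.extend
     (dsum_bim [Rbim, sh_aq \<triangleright> Rbim, sh_aq \<triangleright> Rbim, sh_aq ^ 2 \<triangleright> Rbim]) (fcx.fields
       (lift (\<lambda>l. case l of
          In k l' \<Rightarrow>
            (if k = 1 then incl 0 (mulop (yv 1 - xv 1) (bv l'))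
             else if k = 2 then incl 0 (mulop (yv 2 - xv 2) (bv l'))
             else if k = 3 then incl 2 (mulop (yv 1 - xv 1) (bv l')) -
                                incl 1 (mulop (yv 2 - xv 2) (bv l'))
             else 0)
        | _ \<Rightarrow> 0)))"

record fdc = fsp +
  din :: "vec \<Rightarrow> vec"
  dout_dc :: "vec \<Rightarrow> vec"

definition derived_tens_I :: "fch \<Rightarrow> fdc" where
  "derived_tens_I M = fsp.extend
     (tens_over ({(xact M i, xact koszul i) | i. i \<in> {1, 2}} \<union>
                 {(yact M i, yact koszul i) | i. i \<in> {1, 2}}) M koszul) (fdc.fields
     (tmap 0 deg_in id (kdiff koszul))
     (tmap deg_out 0 (dout M) id))"

definition closure2 :: "fch \<Rightarrow> fdc" where
  "closure2 M = sh_ts ^ 2 \<triangleright> derived_tens_I M"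

definition H_in :: "fdc \<Rightarrow> fdc" where
  "H_in C = homology deg_in (din C) C"

definition H_out :: "fdc \<Rightarrow> fsp" where
  "H_out C = fsp.truncate (homology deg_out (dout_dc C) C)"

definition H3 :: "nat \<Rightarrow> fsp" where
  "H3 k = H_out (H_in (closure2 (sigma_neg_power k)))"

text \<open>The homology of the one-strand unknot diagram, where \<open>QQ1\<close> is \<open>\<rat>[w]\<close>.\<close>

definition H3_unknot :: fsp where
  "H3_unknot = sh_ts \<triangleright> dsum [sh_aq \<triangleright> QQ1, QQ1]"


section \<open>The Koszul complex is a resolution of \<open>I\<close>\<close>

lemma pm_induct [case_names zero single add]:
  fixes p :: "'a \<Rightarrow>\<^sub>0 'b::comm_monoid_add"
  assumes "P 0" "\<And>k c. P (Poly_Mapping.single k c)" "\<And>p q. P p \<Longrightarrow> P q \<Longrightarrow> P (p + q)"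
  shows "P p"
proof -
  have eq: "p = (\<Sum>k\<in>keys p. Poly_Mapping.single k (lookup p k))"
    by (rule poly_mapping_eqI)
       (auto simp: lookup_sum lookup_single when_def in_keys_iff sum.delta)
  have "P (\<Sum>k\<in>A. Poly_Mapping.single k (lookup p k))" if "finite A" for A
    using that by (induction A rule: finite_induct) (auto intro: assms)
  then show ?thesis using eq by (metis finite_keys)
qed

lemma lift_eq:
  assumes "finite A" "keys v \<subseteq> A"
  shows "lift f v = (\<Sum>l\<in>A. scl (lookup v l) (f l))"
  unfolding lift_def using assms
  by (intro sum.mono_neutral_left) (auto simp: in_keys_iff)

lemma lift_add: "lift f (v + w) = lift f v + lift f w"
proof -
  let ?A = "keys v \<union> keys w"
  have "lift f (v + w) = (\<Sum>l\<in>?A. scl (lookup (v + w) l) (f l))"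
    by (rule lift_eq[OF _ keys_add]) simp
  also have "\<dots> = lift f v + lift f w"
    by (simp add: lift_eq[of ?A] lookup_add vec.scale_left_distrib sum.distrib)
  finally show ?thesis .
qed

lemma lift_0 [simp]: "lift f 0 = 0"
  by (simp add: lift_def)

lemma lift_bv [simp]: "lift f (bv l) = f l"
  by (simp add: lift_def bv_def)

lemma lift_scl: "lift f (scl c v) = scl c (lift f v)"
proof -
  have "lift f (scl c v) = (\<Sum>l\<in>keys v. scl (lookup (scl c v) l) (f l))"
    by (rule lift_eq) (auto simp: in_keys_iff lookup_scl)
  then show ?thesis by (simp add: lift_def lookup_scl vec.scale_sum_right)
qed

lemma lift_linear: "Vector_Spaces.linear scl scl (lift f)"
  by unfold_locales (auto simp: lift_add lift_scl)

lemma scl_neg1: "scl (- 1) v = - v"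
  by (simp add: vec.scale_minus_left)

lemma lift_uminus: "lift f (- v) = - lift f v"
  using lift_scl[of f "-1" v] by (simp add: scl_neg1)

lemma lift_diff: "lift f (v - w) = lift f v - lift f w"
  using lift_add[of f v "- w"] by (simp add: lift_uminus)

lemma single_vec: "Poly_Mapping.single l c = scl c (bv l)"
  by (rule poly_mapping_eqI) (simp add: bv_def lookup_scl lookup_single when_def)

lemma vec_induct [case_names zero scl add]:
  assumes "P 0" "\<And>l c. P (scl c (bv l))" "\<And>v w. P v \<Longrightarrow> P w \<Longrightarrow> P (v + w)"
  shows "P v"
  by (induction v rule: pm_induct) (auto simp: single_vec intro: assms)

lemma lift_incl: "lift f (incl k v) = lift (\<lambda>l. f (In k l)) v"
  by (induction v rule: vec_induct) (auto simp: incl_def lift_scl lift_add)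

lemma incl_0 [simp]: "incl k 0 = 0" by (simp add: incl_def)
lemma incl_bv [simp]: "incl k (bv l) = bv (In k l)" by (simp add: incl_def)
lemma incl_add: "incl k (v + w) = incl k v + incl k w" by (simp add: incl_def lift_add)
lemma incl_scl: "incl k (scl c v) = scl c (incl k v)" by (simp add: incl_def lift_scl)
lemma incl_uminus: "incl k (- v) = - incl k v" by (simp add: incl_def lift_uminus)
lemma incl_diff: "incl k (v - w) = incl k v - incl k w" by (simp add: incl_def lift_diff)

lemma lift_bv_id: "lift bv v = v"
  by (induction v rule: vec_induct) (auto simp: lift_scl lift_add)

lemma lift_comp:
  assumes "\<And>v w. g (v + w) = g v + g w" "\<And>c v. g (scl c v) = scl c (g v)"
  shows "lift (\<lambda>l. g (f l)) v = g (lift f v)"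
proof (induction v rule: vec_induct)
  case zero show ?case using assms(2)[of 0 0] by simp
qed (auto simp: lift_scl lift_add assms)

lemma lift_zero_fun: "lift (\<lambda>l. 0) v = 0"
  by (simp add: lift_def)

lemma emb_eq:
  assumes "finite A" "keys p \<subseteq> A"
  shows "emb p = (\<Sum>m\<in>A. scl (lookup p m) (bv (Mono m)))"
  unfolding emb_def using assms
  by (intro sum.mono_neutral_left) (auto simp: in_keys_iff)

lemma emb_add: "emb (p + q) = emb p + emb q"
proof -
  let ?A = "keys p \<union> keys q"
  have "emb (p + q) = (\<Sum>l\<in>?A. scl (lookup (p + q) l) (bv (Mono l)))"
    by (rule emb_eq[OF _ keys_add]) simp
  also have "\<dots> = emb p + emb q"
    by (simp add: emb_eq[of ?A] lookup_add vec.scale_left_distrib sum.distrib)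
  finally show ?thesis .
qed

lemma emb_0 [simp]: "emb 0 = 0" by (simp add: emb_def)

lemma emb_single: "emb (Poly_Mapping.single m c) = scl c (bv (Mono m))"
  by (simp add: emb_def)

lemma emb_uminus: "emb (- p) = - emb p"
  using emb_add[of p "- p"] by (simp add: eq_neg_iff_add_eq_0 add.commute)

lemma emb_diff: "emb (p - q) = emb p - emb q"
  using emb_add[of p "- q"] by (simp add: emb_uminus)

lemma lookup_emb: "lookup (emb p) (Mono m) = lookup p m"
  by (induction p rule: pm_induct)
     (auto simp: emb_single emb_add lookup_add lookup_scl bv_def lookup_single when_def)

lemma emb_inj: "emb p = emb q \<longleftrightarrow> p = q"
  by (metis lookup_emb poly_mapping_eqI)

lemma emb_eq_0: "emb p = 0 \<longleftrightarrow> p = 0"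
  using emb_inj[of p 0] by simp

definition pscl :: "rat \<Rightarrow> mpoly \<Rightarrow> mpoly" where
  "pscl c p = Poly_Mapping.single 0 c * p"

lemma lookup_pscl: "lookup (pscl c p) m = c * lookup p m"
  unfolding pscl_def mult_map_scale_conv_mult[symmetric]
  by (simp add: Poly_Mapping.map.rep_eq when_def)

lemma emb_pscl: "emb (pscl c p) = scl c (emb p)"
  by (induction p rule: pm_induct)
     (auto simp: pscl_def emb_single emb_add mult_single distrib_left vec.scale_right_distrib)

lemma mulop_emb: "mulop f (emb p) = emb (f * p)"
proof (induction p rule: pm_induct)
  case (single m c)
  have "f * Poly_Mapping.single m c = pscl c (f * Poly_Mapping.single m 1)"
    unfolding pscl_def
    by (subst mult.left_commute) (simp add: mult_single)
  then show ?case by (simp add: emb_single mulop_def lift_scl emb_pscl)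
qed (auto simp: mulop_def emb_add lift_add distrib_left)

definition msub :: "nat \<Rightarrow> nat \<Rightarrow> (nat \<Rightarrow>\<^sub>0 nat) \<Rightarrow> (nat \<Rightarrow>\<^sub>0 nat)" where
  "msub i j m = Poly_Mapping.update i 0 m + Poly_Mapping.single j (lookup m i)"

lemma msub_add: "msub i j (m + n) = msub i j m + msub i j n"
  by (rule poly_mapping_eqI)
     (simp add: msub_def lookup_add lookup_update lookup_single when_def)

definition psub :: "nat \<Rightarrow> nat \<Rightarrow> mpoly \<Rightarrow> mpoly" where
  "psub i j p = (\<Sum>m\<in>keys p. Poly_Mapping.single (msub i j m) (lookup p m))"

lemma psub_eq:
  assumes "finite A" "keys p \<subseteq> A"
  shows "psub i j p = (\<Sum>m\<in>A. Poly_Mapping.single (msub i j m) (lookup p m))"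
  unfolding psub_def using assms
  by (intro sum.mono_neutral_left) (auto simp: in_keys_iff)

lemma psub_add: "psub i j (p + q) = psub i j p + psub i j q"
proof -
  let ?A = "keys p \<union> keys q"
  have "psub i j (p + q) = (\<Sum>l\<in>?A. Poly_Mapping.single (msub i j l) (lookup (p + q) l))"
    by (rule psub_eq[OF _ keys_add]) simp
  also have "\<dots> = psub i j p + psub i j q"
    by (simp add: psub_eq[of ?A] lookup_add single_add sum.distrib)
  finally show ?thesis .
qed

lemma psub_0 [simp]: "psub i j 0 = 0" by (simp add: psub_def)

lemma psub_single: "psub i j (Poly_Mapping.single m c) = Poly_Mapping.single (msub i j m) c"
  by (simp add: psub_def)

lemma psub_mult: "psub i j (p * q) = psub i j p * psub i j q"
proof (induction p rule: pm_induct)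
  case (single m c)
  show ?case
    by (induction q rule: pm_induct)
       (auto simp: mult_single psub_single msub_add psub_add distrib_left)
qed (auto simp: psub_add distrib_right)

lemma pvar_sub: assumes "i \<noteq> j" shows "psub i j (pvar k) = (if k = i then pvar j else pvar k)"
proof -
  have "msub i j (Poly_Mapping.single k 1) = (if k = i then Poly_Mapping.single j 1 else Poly_Mapping.single k 1)"
    using assms
    by (intro poly_mapping_eqI) (auto simp: msub_def lookup_add lookup_update lookup_single when_def split: if_splits)
  then show ?thesis by (simp add: pvar_def psub_single)
qed

lemma psub_diff: "psub i j (p - q) = psub i j p - psub i j q"
  using psub_add[of i j "p - q" q] by simp

lemma single_pow: "Poly_Mapping.single (Poly_Mapping.single i n) 1 = (pvar i ^ n :: mpoly)"
proof (induction n)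
  case (Suc n)
  have "(pvar i ^ Suc n :: mpoly) = pvar i * Poly_Mapping.single (Poly_Mapping.single i n) 1"
    using Suc by simp
  also have "\<dots> = Poly_Mapping.single (Poly_Mapping.single i 1 + Poly_Mapping.single i n) 1"
    by (simp add: pvar_def mult_single)
  also have "Poly_Mapping.single i (1::nat) + Poly_Mapping.single i n = Poly_Mapping.single i (Suc n)"
    by (simp flip: single_add)
  finally show ?case by simp
qed simp

lemma psub_dvd: assumes "i \<noteq> j" shows "pvar i - pvar j dvd p - psub i j p"
proof (induction p rule: pm_induct)
  case (single m c)
  define m0 where "m0 = Poly_Mapping.update i 0 m"
  have m: "m = m0 + Poly_Mapping.single i (lookup m i)"
    by (rule poly_mapping_eqI) (simp add: m0_def lookup_add lookup_update lookup_single when_def)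
  have A: "Poly_Mapping.single (m0 + Poly_Mapping.single k n) c
      = Poly_Mapping.single m0 c * (pvar k ^ n)" for k n
    by (simp add: mult_single flip: single_pow)
  have "Poly_Mapping.single m c - psub i j (Poly_Mapping.single m c)
     = Poly_Mapping.single m0 c * (pvar i ^ lookup m i - pvar j ^ lookup m i)"
    unfolding psub_single msub_def m0_def[symmetric] A
    using A[of i "lookup m i"] m by (simp add: right_diff_distrib)
  moreover have "pvar i - pvar j dvd pvar i ^ lookup m i - pvar j ^ lookup m i"
    by (simp add: power_diff_sumr2)
  ultimately show ?case by (metis dvd_mult)
next
  case (add p q)
  then show ?case
    unfolding psub_add by (metis add_diff_add dvd_add)
qed auto

lemma pvar_inj: "pvar i = pvar j \<longleftrightarrow> i = j"
proof
  assume "pvar i = pvar j"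
  then have "keys (pvar i) = keys (pvar j)" by simp
  then have "Poly_Mapping.single i (1::nat) = Poly_Mapping.single j 1" by (simp add: pvar_def)
  then have "keys (Poly_Mapping.single i (1::nat)) = keys (Poly_Mapping.single j (1::nat))" by simp
  then show "i = j" by simp
qed simp

abbreviation "yx1 \<equiv> yv 1 - xv 1"
abbreviation "yx2 \<equiv> yv 2 - xv 2"

lemma u_nz: "yx1 \<noteq> 0" "yx2 \<noteq> 0"
  by (simp_all add: yv_def xv_def pvar_inj)

lemma syzygy:
  assumes "yx1 * p1 + yx2 * p2 = 0"
  shows "\<exists>r. p1 = - (yx2 * r) \<and> p2 = yx1 * r"
proof -
  have "psub 3 1 (yx1 * p1 + yx2 * p2) = 0" using assms by simp
  moreover have "psub 3 1 yx1 = 0" "psub 3 1 yx2 = yx2"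
    by (simp_all add: yv_def xv_def psub_diff pvar_sub)
  ultimately have "yx2 * psub 3 1 p2 = 0" by (simp add: psub_add psub_mult)
  then have "psub 3 1 p2 = 0" using u_nz by simp
  then have "yx1 dvd p2" using psub_dvd[of 3 1 p2] by (simp add: yv_def xv_def)
  then obtain r where r: "p2 = yx1 * r" by (auto elim: dvdE)
  have "yx1 * (p1 + yx2 * r) = 0" using assms r by (simp add: algebra_simps)
  then have "p1 + yx2 * r = 0" using u_nz by (metis mult_eq_0_iff)
  then have "p1 = - (yx2 * r)" by (simp only: eq_neg_iff_add_eq_0)
  then show ?thesis using r by blast
qed

definition mons :: "deg \<Rightarrow> (nat \<Rightarrow>\<^sub>0 nat) set" where
  "mons d = {m. keys m \<subseteq> {1..4} \<and> d = (2 * int (\<Sum>i\<in>keys m. lookup m i), 0, 0)}"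

lemma P_iff: "p \<in> Qxy \<inter> homog d \<longleftrightarrow> keys p \<subseteq> mons d"
  by (auto simp: Qxy_def Qpoly_def homog_def mons_def)

lemma PM: "Qxy \<inter> homog d = {p. keys p \<subseteq> mons d}"
  using P_iff by blast

lift_definition prj :: "'a set \<Rightarrow> ('a \<Rightarrow>\<^sub>0 'b::zero) \<Rightarrow> 'a \<Rightarrow>\<^sub>0 'b" is
  "\<lambda>S p m. if m \<in> S then p m else 0"
  by (rule finite_subset) auto

lemma prj_id: "keys p \<subseteq> S \<Longrightarrow> prj S p = p"
  by (rule poly_mapping_eqI) (auto simp: prj.rep_eq in_keys_iff subset_iff)

lemma keys_prj: "keys (prj S p) \<subseteq> S"
  by (auto simp: in_keys_iff prj.rep_eq split: if_splits)

lemma prj_add: "prj S (p + q :: mpoly) = prj S p + prj S q"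
  by (rule poly_mapping_eqI) (auto simp: prj.rep_eq lookup_add)
lemma prj_diff: "prj S (p - q :: mpoly) = prj S p - prj S q"
  by (rule poly_mapping_eqI) (auto simp: prj.rep_eq lookup_minus)
lemma prj_0 [simp]: "prj S 0 = 0"
  by (rule poly_mapping_eqI) (auto simp: prj.rep_eq)

lemma prj_single: "prj S (Poly_Mapping.single m c) = (if m \<in> S then Poly_Mapping.single m c else 0)"
  by (rule poly_mapping_eqI) (auto simp: prj.rep_eq lookup_single when_def)

lemma mdeg_eq: assumes "finite A" "keys m \<subseteq> A" shows "(\<Sum>i\<in>keys m. lookup m i) = (\<Sum>i\<in>A. lookup m i)"
  using assms by (intro sum.mono_neutral_left) (auto simp: in_keys_iff)

lemma mons_add:
  assumes "k \<in> {1..4}"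
  shows "Poly_Mapping.single k 1 + m \<in> mons (d + deg_x) \<longleftrightarrow> m \<in> mons d"
proof -
  have k: "keys (Poly_Mapping.single k 1 + m) = insert k (keys m)"
    by (auto simp: in_keys_iff lookup_add lookup_single when_def split: if_splits)
  have "(\<Sum>i\<in>insert k (keys m). lookup (Poly_Mapping.single k 1 + m) i)
      = (\<Sum>i\<in>insert k (keys m). lookup m i) + 1"
    by (simp add: lookup_add sum.distrib lookup_single when_def sum.delta)
  then have s: "(\<Sum>i\<in>keys (Poly_Mapping.single k 1 + m). lookup (Poly_Mapping.single k 1 + m) i)
      = (\<Sum>i\<in>keys m. lookup m i) + 1"
    unfolding k using mdeg_eq[of "insert k (keys m)" m, OF _ subset_insertI] by simp
  obtain q a t where d: "d = (q, a, t)" by (cases d)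
  show ?thesis unfolding mons_def mem_Collect_eq s unfolding k
    using assms by (auto simp: d deg_x_def)
qed

lemma prj_pvar:
  assumes "k \<in> {1..4}"
  shows "prj (mons (d + deg_x)) (pvar k * p) = pvar k * prj (mons d) p"
  by (induction p rule: pm_induct)
     (auto simp: pvar_def mult_single prj_single distrib_left prj_add mons_add[OF assms, simplified])

lemma prj_u:
  "prj (mons (d + deg_x)) (yx1 * p) = yx1 * prj (mons d) p"
  "prj (mons (d + deg_x)) (yx2 * p) = yx2 * prj (mons d) p"
  by (auto simp: left_diff_distrib prj_diff xv_def yv_def prj_pvar)


lemma lookup_incl: "lookup (incl k v) (In k' l) = (if k = k' then lookup v l else 0)"
proof (induction v rule: vec_induct)
  case (scl l c)
  show ?case by (simp add: incl_scl lookup_scl) (simp add: bv_def lookup_single when_def)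
qed (simp_all add: incl_add lookup_add)

definition kv :: "mpoly \<Rightarrow> mpoly \<Rightarrow> mpoly \<Rightarrow> mpoly \<Rightarrow> vec" where
  "kv p0 p1 p2 p3 = incl 0 (emb p0) + incl 1 (emb p1) + incl 2 (emb p2) + incl 3 (emb p3)"

lemma kv_inj: "kv p0 p1 p2 p3 = kv q0 q1 q2 q3 \<longleftrightarrow> p0 = q0 \<and> p1 = q1 \<and> p2 = q2 \<and> p3 = q3"
proof
  assume a: "kv p0 p1 p2 p3 = kv q0 q1 q2 q3"
  have *: "lookup (kv p0 p1 p2 p3) (In k (Mono m)) = lookup (kv q0 q1 q2 q3) (In k (Mono m))" for k m
    using a by simp
  show "p0 = q0 \<and> p1 = q1 \<and> p2 = q2 \<and> p3 = q3"
    using *[of 0] *[of 1] *[of 2] *[of 3]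
    by (auto intro!: poly_mapping_eqI simp: kv_def lookup_add lookup_incl lookup_emb)
qed simp

lemma kv_0: "kv 0 0 0 0 = 0" by (simp add: kv_def)
lemma kv_add: "kv (p0+q0) (p1+q1) (p2+q2) (p3+q3) = kv p0 p1 p2 p3 + kv q0 q1 q2 q3"
  by (simp add: kv_def emb_add incl_add algebra_simps)
lemma kv_scl: "kv (pscl c p0) (pscl c p1) (pscl c p2) (pscl c p3) = scl c (kv p0 p1 p2 p3)"
  by (simp add: kv_def emb_pscl incl_scl vec.scale_right_distrib)

definition kset :: "deg \<Rightarrow> vec set" where
  "kset d = {kv p0 p1 p2 p3 | p0 p1 p2 p3. keys p0 \<subseteq> mons d \<and> keys p1 \<subseteq> mons (d - (2,1,0)) \<and>
     keys p2 \<subseteq> mons (d - (2,1,0)) \<and> keys p3 \<subseteq> mons (d - (4,2,0))}"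

lemma keys_pscl: "keys (pscl c p) \<subseteq> keys p"
  by (auto simp: in_keys_iff lookup_pscl)

lemma kset_mem: assumes "keys p0 \<subseteq> mons d" "keys p1 \<subseteq> mons (d - (2,1,0))"
     "keys p2 \<subseteq> mons (d - (2,1,0))" "keys p3 \<subseteq> mons (d - (4,2,0))"
   shows "kv p0 p1 p2 p3 \<in> kset d"
  using assms unfolding kset_def by blast

lemma kset_subspace: "vec.subspace (kset d)"
proof (rule vec.subspaceI)
  show "0 \<in> kset d" unfolding kset_def mem_Collect_eq
    by (intro exI[of _ 0]) (simp add: kv_0)
next
  fix x y assume "x \<in> kset d" "y \<in> kset d"
  then obtain p0 p1 p2 p3 q0 q1 q2 q3 where
    x: "x = kv p0 p1 p2 p3" "keys p0 \<subseteq> mons d" "keys p1 \<subseteq> mons (d - (2,1,0))"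
      "keys p2 \<subseteq> mons (d - (2,1,0))" "keys p3 \<subseteq> mons (d - (4,2,0))" and
    y: "y = kv q0 q1 q2 q3" "keys q0 \<subseteq> mons d" "keys q1 \<subseteq> mons (d - (2,1,0))"
      "keys q2 \<subseteq> mons (d - (2,1,0))" "keys q3 \<subseteq> mons (d - (4,2,0))"
    unfolding kset_def by (elim CollectE exE conjE) rule
  have k: "keys p \<subseteq> S \<Longrightarrow> keys q \<subseteq> S \<Longrightarrow> keys (p + q) \<subseteq> S" for p q :: mpoly and S
    using keys_add[of p q] by blast
  show "x + y \<in> kset d"
    unfolding x(1) y(1) kv_add[symmetric] using x y by (intro kset_mem k)
next
  fix c x assume "x \<in> kset d"
  then obtain p0 p1 p2 p3 where
    x: "x = kv p0 p1 p2 p3" "keys p0 \<subseteq> mons d" "keys p1 \<subseteq> mons (d - (2,1,0))"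
      "keys p2 \<subseteq> mons (d - (2,1,0))" "keys p3 \<subseteq> mons (d - (4,2,0))"
    unfolding kset_def by (elim CollectE exE conjE) rule
  show "scl c x \<in> kset d"
    unfolding x(1) kv_scl[symmetric] using x by (intro kset_mem order_trans[OF keys_pscl])
qed

lemma sel_shift: "piece (g \<triangleright> M) d = piece M (d - (qexp g, aexp g, texp g))"
  "rels (g \<triangleright> M) d = rels M (d - (qexp g, aexp g, texp g))"
  "filt (g \<triangleright> M) i d = filt M (i - sexp g) (d - (qexp g, aexp g, texp g))"
  by (simp_all add: shift_def Let_def)

lemma sh_aq_eq: "sh_aq = Shift 2 1 0 0" "sh_aq ^ 2 = Shift 4 2 0 0"
  by (simp_all add: sh_aq_def sh_a_def sh_q_def times_shift_def power2_eq_square)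

lemma cyc_sel: "piece (cyclic_bim J F) d = emb ` (Qxy \<inter> homog d)"
  "rels (cyclic_bim J F) d = emb ` (J \<inter> homog d)"
  "filt (cyclic_bim J F) i d = emb ` (F i \<inter> homog d)"
  by (simp_all add: cyclic_bim_def cyclic_def fsp.defs fbim.defs)

lemma kos_sel:
  "piece koszul = piece (dsum [Rbim, sh_aq \<triangleright> Rbim, sh_aq \<triangleright> Rbim, sh_aq ^ 2 \<triangleright> Rbim])"
  "rels koszul = rels (dsum [Rbim, sh_aq \<triangleright> Rbim, sh_aq \<triangleright> Rbim, sh_aq ^ 2 \<triangleright> Rbim])"
  "filt koszul = filt (dsum [Rbim, sh_aq \<triangleright> Rbim, sh_aq \<triangleright> Rbim, sh_aq ^ 2 \<triangleright> Rbim])"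
  by (simp_all add: koszul_def dsum_bim_def fsp.defs fbim.defs fcx.defs)

lemma dsum4:
  "piece (dsum [a,b,c,e]) d = vec.span (incl 0 ` piece a d \<union> incl 1 ` piece b d \<union> incl 2 ` piece c d \<union> incl 3 ` piece e d)"
  "rels (dsum [a,b,c,e]) d = vec.span (incl 0 ` rels a d \<union> incl 1 ` rels b d \<union> incl 2 ` rels c d \<union> incl 3 ` rels e d)"
  "filt (dsum [a,b,c,e]) i d = vec.span (incl 0 ` filt a i d \<union> incl 1 ` filt b i d \<union> incl 2 ` filt c i d \<union> incl 3 ` filt e i d)"
proof -
  have *: "(\<Union>k<length [a,b,c,e]. f k ([a,b,c,e] ! k)) = f 0 a \<union> f 1 b \<union> f 2 c \<union> f 3 e" for f :: "nat \<Rightarrow> _ \<Rightarrow> vec set"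
    by (simp add: lessThan_Suc numeral_eq_Suc Un_ac)
  show "piece (dsum [a,b,c,e]) d = vec.span (incl 0 ` piece a d \<union> incl 1 ` piece b d \<union> incl 2 ` piece c d \<union> incl 3 ` piece e d)"
  "rels (dsum [a,b,c,e]) d = vec.span (incl 0 ` rels a d \<union> incl 1 ` rels b d \<union> incl 2 ` rels c d \<union> incl 3 ` rels e d)"
  "filt (dsum [a,b,c,e]) i d = vec.span (incl 0 ` filt a i d \<union> incl 1 ` filt b i d \<union> incl 2 ` filt c i d \<union> incl 3 ` filt e i d)"
    using *[of "\<lambda>k M. incl k ` piece M d"] *[of "\<lambda>k M. incl k ` rels M d"]
      *[of "\<lambda>k M. incl k ` filt M i d"]
    by (simp_all only: dsum_def fsp.select_convs)
qed

lemma piece_R: "piece Rbim d = emb ` {p. keys p \<subseteq> mons d}"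
  by (simp add: Rbim_def cyc_sel PM)

lemma rels_R: "rels Rbim d = {0}"
  by (auto simp: Rbim_def cyc_sel homog_def)

lemma filt_R: "filt Rbim i d = (if i \<le> 0 then piece Rbim d else {0})"
  by (auto simp: Rbim_def cyc_sel trivial_filt_def homog_def)

lemma piece_kos: "piece koszul d = kset d"
proof -
  let ?U = "incl 0 ` emb ` {p. keys p \<subseteq> mons d} \<union> incl 1 ` emb ` {p. keys p \<subseteq> mons (d - (2,1,0))} \<union>
     incl 2 ` emb ` {p. keys p \<subseteq> mons (d - (2,1,0))} \<union> incl 3 ` emb ` {p. keys p \<subseteq> mons (d - (4,2,0))}"
  have e: "piece koszul d = vec.span ?U"
    unfolding kos_sel dsum4 sh_aq_eq(2) by (simp only: sel_shift sh_aq_eq(1) piece_R shift.sel)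

  have "?U \<subseteq> kset d"
  proof -
    have "incl 0 (emb p) = kv p 0 0 0" "incl 1 (emb p) = kv 0 p 0 0"
      "incl 2 (emb p) = kv 0 0 p 0" "incl 3 (emb p) = kv 0 0 0 p" for p
      by (simp_all add: kv_def)
    then show ?thesis by (auto intro!: kset_mem simp del: One_nat_def)
  qed
  then have 1: "vec.span ?U \<subseteq> kset d" by (rule vec.span_minimal[OF _ kset_subspace])
  have 2: "kset d \<subseteq> vec.span ?U"
    unfolding kset_def kv_def
    by (clarify, intro vec.span_add) (rule vec.span_base, blast)+
  show ?thesis using e 1 2 by blast
qed

lemma rels_kos: "rels koszul d = {0}"
  unfolding kos_sel dsum4 by (simp add: sel_shift rels_R)

lemma filt_kos: "filt koszul i d = (if i \<le> 0 then piece koszul d else {0})"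
  unfolding kos_sel dsum4 sh_aq_eq(2) by (simp add: sel_shift sh_aq_eq(1) filt_R)

lemma lift_mul: "lift (\<lambda>l. incl k (mulop f (bv l))) (emb p) = incl k (emb (f * p))"
proof -
  have "lift (\<lambda>l. incl k (mulop f (bv l))) (emb p) = incl k (mulop f (lift bv (emb p)))"
    by (rule lift_comp) (simp_all add: mulop_def lift_add lift_scl incl_add incl_scl)
  then show ?thesis by (simp add: lift_bv_id mulop_emb)
qed

lemma lift_diff_fun: "lift (\<lambda>l. f l - g l) v = lift f v - lift g v"
proof (induction v rule: vec_induct)
  case (add v w)
  then show ?case by (simp only: lift_add) simp
qed (simp_all add: lift_scl vec.scale_right_diff_distrib)

lemma kdiff_kv: "kdiff koszul (kv p0 p1 p2 p3) =
   kv (yx1 * p1 + yx2 * p2) (- (yx2 * p3)) (yx1 * p3) 0"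
  unfolding koszul_def kv_def
  by (simp add: fbim.defs fcx.defs lift_add lift_incl lift_zero_fun lift_mul lift_diff_fun
     emb_add emb_uminus incl_add incl_uminus del: One_nat_def)

definition koszul_aug :: "vec \<Rightarrow> vec" where
  "koszul_aug = lift (\<lambda>l. case l of In k l' \<Rightarrow> if k = 0 then bv l' else 0 | _ \<Rightarrow> 0)"

lemma aug_kv: "koszul_aug (kv p0 p1 p2 p3) = emb p0"
  by (simp add: koszul_aug_def kv_def lift_add lift_incl lift_zero_fun lift_bv_id)

lemma degs: "d + deg_in - (2,1,0) + deg_x = d - (0,2,0)" "d - deg_in - (2,1,0) + deg_x = d"
   "d - deg_in - (4,2,0) + deg_x = d - (2,1,0)"
  by (cases d; simp add: deg_in_def deg_x_def)+

lemma keys_u: "keys p \<subseteq> mons d \<Longrightarrow> keys (yx1 * p) \<subseteq> mons (d + deg_x)"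
   "keys p \<subseteq> mons d \<Longrightarrow> keys (yx2 * p) \<subseteq> mons (d + deg_x)"
  by (metis prj_u keys_prj prj_id)+

lemma rels_I: "emb p \<in> rels Ibim d \<longleftrightarrow>
  (\<exists>p1 p2. keys p1 \<subseteq> mons (d - deg_x) \<and> keys p2 \<subseteq> mons (d - deg_x) \<and> p = yx1 * p1 + yx2 * p2)"
    (is "_ \<longleftrightarrow> ?R")
proof
  assume "emb p \<in> rels Ibim d"
  then have p: "p \<in> JI" "p \<in> homog d" by (auto simp: Ibim_def cyc_sel emb_inj)
  then obtain a b where ab: "a \<in> Qxy" "b \<in> Qxy" "p = yx1 * a + yx2 * b"
    by (auto simp: JI_def ideal2_def mult.commute)
  have c: "x \<in> Qxy \<Longrightarrow> y \<in> Qxy \<Longrightarrow> x + y \<in> Qxy" "x \<in> Qxy \<Longrightarrow> y \<in> Qxy \<Longrightarrow> x * y \<in> Qxy" 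
     "x \<in> Qxy \<Longrightarrow> - x \<in> Qxy" for x y
  proof -
    show "x \<in> Qxy \<Longrightarrow> y \<in> Qxy \<Longrightarrow> x + y \<in> Qxy"
      unfolding Qxy_def Qpoly_def using keys_add[of x y] by blast
    show "x * y \<in> Qxy" if xy: "x \<in> Qxy" "y \<in> Qxy"
      unfolding Qxy_def Qpoly_def
    proof (intro CollectI ballI)
      fix m assume "m \<in> keys (x * y)"
      then obtain a b where "m = a + b" "a \<in> keys x" "b \<in> keys y"
        using keys_mult[of x y] by auto
      moreover then have "keys a \<subseteq> {1..4}" "keys b \<subseteq> {1..4}"
        using xy unfolding Qxy_def Qpoly_def by blast+
      ultimately show "keys m \<subseteq> {1..4}" using keys_add[of a b] by blast
    qed
    show "x \<in> Qxy \<Longrightarrow> - x \<in> Qxy"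
      unfolding Qxy_def Qpoly_def by simp
  qed
  have u: "yx1 \<in> Qxy" "yx2 \<in> Qxy"
    unfolding Qxy_def Qpoly_def xv_def yv_def pvar_def
    by (auto simp: in_keys_iff lookup_minus lookup_single when_def split: if_splits)
  have "p \<in> Qxy" using ab u c by simp
  then have "keys p \<subseteq> mons d" using p P_iff by blast
  then have "p = prj (mons ((d - deg_x) + deg_x)) p" by (simp add: prj_id)
  also have "\<dots> = yx1 * prj (mons (d - deg_x)) a + yx2 * prj (mons (d - deg_x)) b"
    unfolding ab(3) prj_add prj_u ..
  finally have "p = yx1 * prj (mons (d - deg_x)) a + yx2 * prj (mons (d - deg_x)) b" .
  then show ?R by (intro exI conjI) (rule keys_prj)+
next
  assume ?R
  then obtain a b where ab: "keys a \<subseteq> mons (d - deg_x)" "keys b \<subseteq> mons (d - deg_x)" "p = yx1 * a + yx2 * b"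
    by blast
  have "keys p \<subseteq> mons d"
    using keys_u(1)[OF ab(1)] keys_u(2)[OF ab(2)] keys_add[of "yx1 * a" "yx2 * b"] ab(3) by auto
  moreover have "a \<in> Qxy" "b \<in> Qxy" using ab(1,2) by (auto simp: P_iff[symmetric])
  then have "p \<in> JI" using ab(3) by (auto simp: JI_def ideal2_def mult.commute)
  ultimately show "emb p \<in> rels Ibim d" by (auto simp: Ibim_def cyc_sel emb_inj P_iff[symmetric])
qed

definition koszul_H :: fcx where "koszul_H = homology deg_in (kdiff koszul) koszul"

lemma koszul_H_sel: "piece koszul_H d = {v \<in> kset d. kdiff koszul v = 0}"
   "rels koszul_H d = kdiff koszul ` kset (d - deg_in)"
   "filt koszul_H i d = {z + b | z b. z \<in> piece koszul_H d \<and> z \<in> filt koszul i d \<and> b \<in> rels koszul_H d}"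
  by (auto simp: koszul_H_def homology_def Let_def piece_kos rels_kos)

lemma kdiff_0: "kdiff koszul 0 = 0"
  using kdiff_kv[of 0 0 0 0] by (simp add: kv_0)

lemma koszul_H_cycle:
  assumes "v \<in> piece koszul_H d"
  obtains p0 r where "v = kv p0 (- (yx2 * r)) (yx1 * r) 0" "keys p0 \<subseteq> mons d"
     "keys r \<subseteq> mons (d - deg_in - (4,2,0))"
proof -
  from assms obtain p0 p1 p2 p3 where v: "v = kv p0 p1 p2 p3" and
    k: "keys p0 \<subseteq> mons d" "keys p1 \<subseteq> mons (d - (2,1,0))" "keys p2 \<subseteq> mons (d - (2,1,0))"
       "keys p3 \<subseteq> mons (d - (4,2,0))" and z: "kdiff koszul v = kv 0 0 0 0"
    by (auto simp: koszul_H_sel kset_def kv_0)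
  have z': "yx1 * p1 + yx2 * p2 = 0" "yx1 * p3 = 0"
    using z unfolding v kdiff_kv kv_inj by auto
  then have p3: "p3 = 0" using u_nz by (metis mult_eq_0_iff)
  obtain r where r: "p1 = - (yx2 * r)" "p2 = yx1 * r" using syzygy[OF z'(1)] by blast
  let ?e = "d - deg_in - (4,2,0)"
  let ?r = "prj (mons ?e) r"
  have "p2 = prj (mons (?e + deg_x)) p2" using k(3) by (simp only: degs prj_id)
  then have p2: "p2 = yx1 * ?r" unfolding r(2) prj_u .
  then have "yx1 * (r - ?r) = 0" unfolding r(2) by (simp only: right_diff_distrib diff_self)
  then have "r = ?r" using u_nz by (metis mult_eq_0_iff eq_iff_diff_eq_0)
  then have "p1 = - (yx2 * ?r)" using r by simp
  then show ?thesis using that[of p0 ?r] v p3 p2 k(1) keys_prj by metis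
qed

text \<open>The augmentation \<open>K \<rightarrow> I\<close> induces an isomorphism of filtered graded spaces from the
  homology of the Koszul complex to \<open>I\<close>.\<close>

lemma koszul_resolution:
  "v \<in> piece koszul_H d \<Longrightarrow> koszul_aug v \<in> piece Ibim d"
  "v \<in> piece koszul_H d \<Longrightarrow> koszul_aug v \<in> rels Ibim d \<longleftrightarrow> v \<in> rels koszul_H d"
  "w \<in> piece Ibim d \<Longrightarrow> \<exists>v \<in> piece koszul_H d. koszul_aug v = w"
  "v \<in> piece koszul_H d \<Longrightarrow> koszul_aug v \<in> filt Ibim i d \<longleftrightarrow> v \<in> filt koszul_H i d"
proof -
  have pI: "piece Ibim d = emb ` {p. keys p \<subseteq> mons d}" for d
    by (simp add: Ibim_def cyc_sel PM)
  show 1: "koszul_aug v \<in> piece Ibim d" if "v \<in> piece koszul_H d" for v d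
    using that by (rule koszul_H_cycle) (auto simp: aug_kv pI)
  show 2: "koszul_aug v \<in> rels Ibim d \<longleftrightarrow> v \<in> rels koszul_H d" if "v \<in> piece koszul_H d" for v d
  proof -
    from that obtain p0 r where v: "v = kv p0 (- (yx2 * r)) (yx1 * r) 0" and
      k: "keys p0 \<subseteq> mons d" "keys r \<subseteq> mons (d - deg_in - (4,2,0))" by (rule koszul_H_cycle)
    have e: "d - deg_in - (2,1,0) = d - deg_x" by (cases d) (simp add: deg_in_def deg_x_def)
    have "v \<in> rels koszul_H d \<longleftrightarrow> (\<exists>p1 p2. keys p1 \<subseteq> mons (d - deg_x) \<and> keys p2 \<subseteq> mons (d - deg_x) \<and> p0 = yx1 * p1 + yx2 * p2)"
    proof
      assume "v \<in> rels koszul_H d"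
      then show "\<exists>p1 p2. keys p1 \<subseteq> mons (d - deg_x) \<and> keys p2 \<subseteq> mons (d - deg_x) \<and> p0 = yx1 * p1 + yx2 * p2"
        unfolding koszul_H_sel kset_def e v
        by (elim imageE CollectE exE conjE, hypsubst, unfold kdiff_kv kv_inj) blast
    next
      assume "\<exists>p1 p2. keys p1 \<subseteq> mons (d - deg_x) \<and> keys p2 \<subseteq> mons (d - deg_x) \<and> p0 = yx1 * p1 + yx2 * p2"
      then obtain p1 p2 where p: "keys p1 \<subseteq> mons (d - deg_x)" "keys p2 \<subseteq> mons (d - deg_x)"
         "p0 = yx1 * p1 + yx2 * p2" by blast
      have "kv 0 p1 p2 r \<in> kset (d - deg_in)"
        using p k by (intro kset_mem) (auto simp: e)
      moreover have "kdiff koszul (kv 0 p1 p2 r) = v" by (simp add: v kdiff_kv p)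
      ultimately show "v \<in> rels koszul_H d" by (auto simp: koszul_H_sel)
    qed
    then show ?thesis by (simp add: v aug_kv rels_I)
  qed
  show "\<exists>v \<in> piece koszul_H d. koszul_aug v = w" if w: "w \<in> piece Ibim d" for w d
  proof -
    from w obtain p where p: "keys p \<subseteq> mons d" "w = emb p" by (auto simp: pI)
    have "kv p 0 0 0 \<in> piece koszul_H d"
      using p by (auto simp: koszul_H_sel kdiff_kv kv_0 intro!: kset_mem)
    then show ?thesis using p aug_kv by blast
  qed
  show "koszul_aug v \<in> filt Ibim i d \<longleftrightarrow> v \<in> filt koszul_H i d" if v: "v \<in> piece koszul_H d" for v d i
  proof -
    have fI: "filt Ibim i d = (if i \<le> 0 then piece Ibim d else rels Ibim d)"
      by (auto simp: Ibim_def cyc_sel trivial_filt_def)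
    have z0: "0 \<in> kset d'" for d' by (rule vec.subspace_0[OF kset_subspace])
    have z: "0 \<in> piece koszul_H d" "0 \<in> rels koszul_H d"
      unfolding koszul_H_sel by (simp add: z0 kdiff_0) (rule image_eqI[of _ _ 0], simp_all add: z0 kdiff_0)
    have fH: "v \<in> filt koszul_H i d \<longleftrightarrow> (if i \<le> 0 then True else v \<in> rels koszul_H d)"
    proof (cases "i \<le> 0")
      case True
      then have "v \<in> filt koszul i d" using v by (simp add: filt_kos piece_kos koszul_H_sel)
      then show ?thesis using True v z by (force simp: koszul_H_sel(3))
    next
      case False
      then show ?thesis using z by (auto simp: koszul_H_sel(3) filt_kos)
    qed
    show ?thesis using 1[OF v] 2[OF v] fI fH by simp
  qed
qed

end

theory Submission
  imports Defs
begin

text \<open>Let \<open>N\<^sup>t\<^sup>w\<close> denote \<open>N\<close> with \<open>y\<^sub>-\<close> acting by its negative. As a filtered bimodule \<open>B \<circ> N\<close>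
  is an extension of \<open>N\<close> by \<open>s\<^sub>q N\<^sup>t\<^sup>w\<close>, which splits for \<open>N = B\<close> and \<open>N = B\<^sup>t\<^sup>w\<close>. For these \<open>N\<close> Gaussian
  elimination in \<open>[\<sigma>\<^sup>-] \<circ> N\<close> cancels a copy of \<open>N\<close>, and by induction
  the \<open>k\<close>-fold composite of \<open>[\<sigma>\<^sup>-]\<close> has a filtered deformation retraction onto a shift of
  \<open>\<dots> \<rightarrow> s\<^sub>q\<^sup>2 B \<rightarrow> s\<^sub>q B\<^sup>t\<^sup>w \<rightarrow> B \<rightarrow> I\<close> with \<open>k\<close> alternating copies of \<open>B\<close> and \<open>B\<^sup>t\<^sup>w\<close>. On this complex
  \<open>y\<^sub>+ - x\<^sub>+\<close> vanishes, so tensoring with the Koszul resolution of \<open>I\<close> leaves two copies of the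
  cone of \<open>y\<^sub>- - x\<^sub>-\<close>. The inner homology has an explicit homogeneous basis, on which the outer
  differential is, up to nonzero scalars, a partial matching; the unmatched basis elements have the
  degrees and filtration levels of the right-hand sides.\<close>

text \<open>The twist is forced by the relation (y_- + x_-)(y_- - x_-) = 0 of B: on the submodule of
  B \<circ> N generated by y_- - x_-, the outer y_- equals minus the middle variable, which is the
  y_- of N. The extension splits when sending the generator of N to 1 \<otimes> 1 is compatible with
  its relation y_-^2 = x_-^2. For N = I the generator satisfies y_- = x_- instead, which fails for 1
  \<otimes> 1. Hence every further factor enlarges the complex by exactly one term. Parity enters
  because y_- - x_- generates F^1 of B but annihilates F^1 of B^tw.

  The obstacle is the filtration. A bijective filtered map need not be strict, so every comparison
  is a pair of filtered maps, inverse to each other modulo relations or up to homotopy. In the braid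
  complexes the homotopy has to be bimodule linear, because it is tensored afterwards; once homology
  is taken it only contributes boundaries and may lower the filtration. Since spaces are presented
  as \<open>piece / rels\<close>, identities are congruences modulo \<open>rels\<close> until a
  space with a basis of labels is reached.\<close>

declare split_paired_All [simp del] split_paired_Ex [simp del]

section \<open>Linear maps and coordinate subspaces\<close>

definition lin :: "(vec \<Rightarrow> vec) \<Rightarrow> bool" where
  "lin f \<longleftrightarrow> (\<forall>v w. f (v + w) = f v + f w) \<and> (\<forall>c v. f (scl c v) = scl c (f v))"

lemma linI: "(\<And>v w. f (v + w) = f v + f w) \<Longrightarrow> (\<And>c v. f (scl c v) = scl c (f v)) \<Longrightarrow> lin f"
  by (simp add: lin_def)

lemma lin_add: "lin f \<Longrightarrow> f (v + w) = f v + f w"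
  and lin_scl: "lin f \<Longrightarrow> f (scl c v) = scl c (f v)"
  by (simp_all add: lin_def)

lemma lin_0: "lin f \<Longrightarrow> f 0 = 0"
  using lin_scl[of f 0 0] by simp

lemma lin_uminus: "lin f \<Longrightarrow> f (- v) = - f v"
  using lin_scl[of f "-1" v] by (simp add: scl_neg1)

lemma lin_diff: "lin f \<Longrightarrow> f (v - w) = f v - f w"
  using lin_add[of f v "- w"] by (simp add: lin_uminus)

lemmas lin_simps = lin_add lin_scl lin_0 lin_uminus lin_diff

lemma lin_linear: "lin f \<Longrightarrow> Vector_Spaces.linear scl scl f"
  by unfold_locales (auto simp: lin_def)

named_theorems lins

text \<open>Most rules in \<open>lins\<close> are stated for a composite with an arbitrary linear
  \<open>g\<close> rather than for the bare operator, so that linearity of a nested term is found by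
  introduction rules alone.\<close>

lemma lin_lift [lins]: "lin g \<Longrightarrow> lin (\<lambda>v. lift f (g v))" by (simp add: lin_def lift_add lift_scl)
lemma lin_incl [lins]: "lin g \<Longrightarrow> lin (\<lambda>v. incl k (g v))" by (simp add: lin_def incl_add incl_scl)
lemma lin_id [lins]: "lin id" "lin (\<lambda>v. v)" by (simp_all add: lin_def)
lemma lin_zero [lins]: "lin (\<lambda>v. 0)" by (simp add: lin_def)
lemma lin_plus [lins]: "lin f \<Longrightarrow> lin g \<Longrightarrow> lin (\<lambda>v. f v + g v)"
  by (simp add: lin_def vec.scale_right_distrib)
lemma lin_neg [lins]: "lin f \<Longrightarrow> lin (\<lambda>v. - f v)"
  by (simp add: lin_def)
lemma lin_minus [lins]: "lin f \<Longrightarrow> lin g \<Longrightarrow> lin (\<lambda>v. f v - g v)"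
  by (simp add: lin_def vec.scale_right_diff_distrib)
lemma lin_scale [lins]: "lin f \<Longrightarrow> lin (\<lambda>v. scl c (f v))"
  by (simp add: lin_def vec.scale_right_distrib mult.commute)
lemma lin_comp: "lin f \<Longrightarrow> lin g \<Longrightarrow> lin (\<lambda>v. f (g v))"
  by (simp add: lin_def)
lemma lin_o: "lin f \<Longrightarrow> lin g \<Longrightarrow> lin (f \<circ> g)"
  by (simp add: lin_def)
lemma lin_funpow: "lin f \<Longrightarrow> lin (f ^^ n)"
  by (induction n) (simp_all add: lins lin_o)

lemma lin_ext: "lin f \<Longrightarrow> lin g \<Longrightarrow> (\<And>l. f (bv l) = g (bv l)) \<Longrightarrow> f v = g v"
  by (induction v rule: vec_induct) (simp_all add: lin_simps)

lemma lift_fun_add: "lift (\<lambda>l. f l + g l) v = lift f v + lift g v"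
  by (rule lin_ext) (auto intro!: lins)

lemma lift_fun_scl: "lift (\<lambda>l. scl c (f l)) v = scl c (lift f v)"
  by (rule lin_ext) (auto intro!: lins)

lemma lin_lift_fun: "(\<And>l. lin (f l)) \<Longrightarrow> lin (\<lambda>w. lift (\<lambda>l. f l w) v)"
  by (rule linI) (simp_all add: lin_simps lift_fun_add lift_fun_scl)

lemma lin_span:
  assumes "lin f" "vec.subspace U" "\<And>x. x \<in> S \<Longrightarrow> f x \<in> U" "v \<in> vec.span S"
  shows "f v \<in> U"
  using assms(4)
proof (induction rule: vec.span_induct_alt)
  case base then show ?case using assms by (simp add: lin_0 vec.subspace_0)
next
  case (step c x y)
  then show ?case using assms by (simp add: lin_simps vec.subspace_add vec.subspace_scale)
qed

definition sp :: "lab set \<Rightarrow> vec set" where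
  "sp A = {v. keys v \<subseteq> A}"

lemma subspace_sp [simp]: "vec.subspace (sp A)"
proof (rule vec.subspaceI)
  show "v + w \<in> sp A" if "v \<in> sp A" "w \<in> sp A" for v w
    using that keys_add[of v w] by (auto simp: sp_def)
  show "scl c v \<in> sp A" if "v \<in> sp A" for c v
    using that by (force simp: sp_def in_keys_iff lookup_scl)
qed (simp add: sp_def)

lemma bv_sp [simp]: "bv l \<in> sp A \<longleftrightarrow> l \<in> A"
  by (simp add: bv_def sp_def)

lemma vec_sum: "v = (\<Sum>l\<in>keys v. scl (lookup v l) (bv l))"
  using lift_bv_id[of v] by (simp add: lift_def)

lemma sp_span: "sp A = vec.span (bv ` A)"
proof
  show "vec.span (bv ` A) \<subseteq> sp A"
    by (rule vec.span_minimal) auto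
  show "sp A \<subseteq> vec.span (bv ` A)"
  proof
    fix v assume "v \<in> sp A"
    then have "(\<Sum>l\<in>keys v. scl (lookup v l) (bv l)) \<in> vec.span (bv ` A)"
      by (intro vec.span_sum vec.span_scale vec.span_base) (auto simp: sp_def)
    then show "v \<in> vec.span (bv ` A)" using vec_sum by metis
  qed
qed

lemma lin_sp:
  assumes "lin f" "vec.subspace U" "\<And>l. l \<in> A \<Longrightarrow> f (bv l) \<in> U" "v \<in> sp A"
  shows "f v \<in> U"
  using assms(4) unfolding sp_span by (rule lin_span[OF assms(1,2), rotated]) (auto simp: assms)

lemma lin_sp_eq:
  assumes "lin f" "lin g" "\<And>l. l \<in> A \<Longrightarrow> f (bv l) = g (bv l)" "v \<in> sp A"
  shows "f v = g v"
proof -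
  have "f v - g v \<in> {0}"
    by (rule lin_sp[OF _ _ _ assms(4)]) (auto intro: lins assms simp: vec.subspace_single_0)
  then show ?thesis by simp
qed

subsection \<open>Tensor products of maps\<close>

lemma tn_lift: "tn d e v w = lift (\<lambda>k. lift (\<lambda>l. bv (Tn d e k l)) w) v"
  by (simp add: tn_def lift_def vec.scale_sum_right)

lemma lin_tn_right: "lin f \<Longrightarrow> lin (\<lambda>x. tn d e v (f x))"
  unfolding tn_lift by (rule lin_comp[OF lin_lift_fun]) (auto intro!: lins)

lemma lin_tn_left: "lin f \<Longrightarrow> lin (\<lambda>x. tn d e (f x) w)"
  unfolding tn_lift by (intro lins)

declare lin_tn_right [lins] lin_tn_left [lins]

lemma tn_bv [simp]: "tn d e (bv k) (bv l) = bv (Tn d e k l)"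
  by (simp add: tn_lift)

lemmas tn_simps = lin_simps[OF lin_tn_right[OF lin_id(2)]] lin_simps[OF lin_tn_left[OF lin_id(2)]]

text \<open>A signed form of \<open>tmap\<close>: \<open>s\<close> is evaluated at the degree of the
  first factor, which provides the signs in the total complex of a composite.\<close>

definition tm :: "(deg \<Rightarrow> rat) \<Rightarrow> deg \<Rightarrow> deg \<Rightarrow> (vec \<Rightarrow> vec) \<Rightarrow> (vec \<Rightarrow> vec) \<Rightarrow> vec \<Rightarrow> vec" where
  "tm s \<delta> \<epsilon> f g = lift (\<lambda>l. case l of
     Tn d e k k' \<Rightarrow> scl (s d) (tn (d + \<delta>) (e + \<epsilon>) (f (bv k)) (g (bv k'))) | _ \<Rightarrow> 0)"

lemma tmap_tm: "tmap = tm (\<lambda>_. 1)"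
  unfolding tmap_def tm_def by (intro ext arg_cong2[of _ _ _ _ lift]) (auto split: lab.split)

lemma lin_tm [lins]: "lin k \<Longrightarrow> lin (\<lambda>v. tm s \<delta> \<epsilon> f g (k v))" unfolding tm_def by (intro lins)

lemma lin2_ext:
  assumes "\<And>w. lin (\<lambda>v. F v w)" "\<And>v. lin (F v)" "\<And>w. lin (\<lambda>v. G v w)" "\<And>v. lin (G v)"
    "\<And>k l. F (bv k) (bv l) = G (bv k) (bv l)"
  shows "F v w = G v w"
  by (rule lin_ext[of "\<lambda>v. F v w" "\<lambda>v. G v w"], (rule assms)+)
     (rule lin_ext[of "F _" "G _"], (rule assms)+)

lemma tm_tn: "lin f \<Longrightarrow> lin g \<Longrightarrow>
   tm s \<delta> \<epsilon> f g (tn d e v w) = scl (s d) (tn (d + \<delta>) (e + \<epsilon>) (f v) (g w))"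
  by (rule lin2_ext[where F = "\<lambda>v w. tm s \<delta> \<epsilon> f g (tn d e v w)" and
        G = "\<lambda>v w. scl (s d) (tn (d + \<delta>) (e + \<epsilon>) (f v) (g w))"])
     ((intro lins | assumption)+, simp add: tm_def)

text \<open>The sign \<open>s\<close> sees the first factor after \<open>f'\<close> has changed its
  degree, hence its argument \<open>d + \<delta>'\<close>.\<close>

lemma tm_comp:
  assumes "lin f" "lin g"
  shows "tm s \<delta> \<epsilon> f g (tm s' \<delta>' \<epsilon>' f' g' v) =
    tm (\<lambda>d. s' d * s (d + \<delta>')) (\<delta>' + \<delta>) (\<epsilon>' + \<epsilon>) (\<lambda>v. f (f' v)) (\<lambda>v. g (g' v)) v"
proof (rule lin_ext[of "\<lambda>v. tm s \<delta> \<epsilon> f g (tm s' \<delta>' \<epsilon>' f' g' v)"])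
  show "tm s \<delta> \<epsilon> f g (tm s' \<delta>' \<epsilon>' f' g' (bv l)) =
    tm (\<lambda>d. s' d * s (d + \<delta>')) (\<delta>' + \<delta>) (\<epsilon>' + \<epsilon>) (\<lambda>v. f (f' v)) (\<lambda>v. g (g' v)) (bv l)" for l
    by (cases l) (simp_all add: tm_def[of s'] tm_def[of "\<lambda>d. s' d * s (d + \<delta>')"] lin_simps lin_simps[OF lin_tm[OF lin_id(2)]]
        tm_tn assms add.assoc)
qed (intro lins)+

subsection \<open>Filtered graded maps\<close>

definition gm :: "deg \<Rightarrow> 'a fsp_scheme \<Rightarrow> 'b fsp_scheme \<Rightarrow> (vec \<Rightarrow> vec) \<Rightarrow> bool" where
  "gm \<delta> M N f \<longleftrightarrow> lin f \<and> (\<forall>d. \<forall>v\<in>piece M d. f v \<in> piece N (d + \<delta>)) \<and>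
     (\<forall>d. \<forall>v\<in>rels M d. f v \<in> rels N (d + \<delta>))"

definition fm :: "deg \<Rightarrow> 'a fsp_scheme \<Rightarrow> 'b fsp_scheme \<Rightarrow> (vec \<Rightarrow> vec) \<Rightarrow> bool" where
  "fm \<delta> M N f \<longleftrightarrow> gm \<delta> M N f \<and> (\<forall>i d. \<forall>v\<in>filt M i d. f v \<in> filt N i (d + \<delta>))"

text \<open>Equality of the maps induced on \<open>piece / rels\<close>; commutation and inverse
  laws can only be expected in this sense.\<close>

definition eqm :: "deg \<Rightarrow> 'a fsp_scheme \<Rightarrow> 'b fsp_scheme \<Rightarrow> (vec \<Rightarrow> vec) \<Rightarrow> (vec \<Rightarrow> vec) \<Rightarrow> bool" where
  "eqm \<delta> M N f g \<longleftrightarrow> (\<forall>d. \<forall>v\<in>piece M d. f v - g v \<in> rels N (d + \<delta>))"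

definition wfsp :: "'a fsp_scheme \<Rightarrow> bool" where
  "wfsp M \<longleftrightarrow> (\<forall>d. vec.subspace (rels M d)) \<and> (\<forall>i d. vec.subspace (filt M i d)) \<and>
     (\<forall>i d. rels M d \<subseteq> filt M i d)"

text \<open>A filtered isomorphism given together with a filtered inverse. In this form it composes,
  can be reversed, and survives shifts and direct sums.\<close>

definition eqv :: "'a fsp_scheme \<Rightarrow> 'b fsp_scheme \<Rightarrow> bool" where
  "eqv M N \<longleftrightarrow> wfsp M \<and> wfsp N \<and> (\<exists>f g. fm 0 M N f \<and> fm 0 N M g \<and>
     eqm 0 M M (\<lambda>v. g (f v)) (\<lambda>v. v) \<and> eqm 0 N N (\<lambda>v. f (g v)) (\<lambda>v. v))"

lemma gmD: "gm \<delta> M N f \<Longrightarrow> lin f" "gm \<delta> M N f \<Longrightarrow> v \<in> piece M d \<Longrightarrow> f v \<in> piece N (d + \<delta>)"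
  "gm \<delta> M N f \<Longrightarrow> v \<in> rels M d \<Longrightarrow> f v \<in> rels N (d + \<delta>)"
  by (auto simp: gm_def)

lemma fmD: "fm \<delta> M N f \<Longrightarrow> gm \<delta> M N f" "fm \<delta> M N f \<Longrightarrow> v \<in> filt M i d \<Longrightarrow> f v \<in> filt N i (d + \<delta>)"
  by (auto simp: fm_def)

lemma fm0D: assumes "fm 0 M N f"
  shows "v \<in> piece M d \<Longrightarrow> f v \<in> piece N d" "v \<in> rels M d \<Longrightarrow> f v \<in> rels N d"
    "v \<in> filt M i d \<Longrightarrow> f v \<in> filt N i d" "lin f"
  using assms by (force simp: fm_def gm_def)+

lemma eqmD: "eqm \<delta> M N f g \<Longrightarrow> v \<in> piece M d \<Longrightarrow> f v - g v \<in> rels N (d + \<delta>)"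
  by (simp add: eqm_def)

lemma eqm0D: "eqm 0 M N f g \<Longrightarrow> v \<in> piece M d \<Longrightarrow> f v - g v \<in> rels N d"
  using eqmD[of 0] by fastforce

lemma wfspD: assumes "wfsp M"
  shows "vec.subspace (rels M d)" "vec.subspace (filt M i d)" "v \<in> rels M d \<Longrightarrow> v \<in> filt M i d"
  using assms by (simp_all add: wfsp_def subset_iff)

lemma gm_id [simp]: "gm 0 M M (\<lambda>v. v)" "fm 0 M M (\<lambda>v. v)" "gm 0 M M id" "fm 0 M M id"
  by (simp_all add: gm_def fm_def lins)

lemma gm_comp: "gm \<delta> M N f \<Longrightarrow> gm \<epsilon> N P g \<Longrightarrow> \<delta> + \<epsilon> = \<eta> \<Longrightarrow> gm \<eta> M P (\<lambda>v. g (f v))"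
  unfolding gm_def by (auto intro!: lin_comp[of g f] simp flip: add.assoc)

lemma fm_comp: "fm \<delta> M N f \<Longrightarrow> fm \<epsilon> N P g \<Longrightarrow> \<delta> + \<epsilon> = \<eta> \<Longrightarrow> fm \<eta> M P (\<lambda>v. g (f v))"
  using gm_comp[of \<delta> M N f \<epsilon> P g] unfolding fm_def by (auto simp flip: add.assoc)

lemma fm_comp0: "fm 0 M N f \<Longrightarrow> fm 0 N P g \<Longrightarrow> fm 0 M P (\<lambda>v. g (f v))"
  using fm_comp[of 0 M N f 0 P g] by simp

lemma eqm_refl: "wfsp N \<Longrightarrow> eqm \<delta> M N f f"
  by (auto simp: eqm_def wfsp_def vec.subspace_0)

lemma eqm_trans:
  assumes "wfsp N" "eqm \<delta> M N f g" "eqm \<delta> M N g h" shows "eqm \<delta> M N f h"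
  unfolding eqm_def
proof (intro allI ballI)
  fix d v assume "v \<in> piece M d"
  then have "(f v - g v) + (g v - h v) \<in> rels N (d + \<delta>)"
    using assms by (intro vec.subspace_add wfspD eqmD)
  then show "f v - h v \<in> rels N (d + \<delta>)" by simp
qed

lemma eqm_sym: "wfsp N \<Longrightarrow> eqm \<delta> M N f g \<Longrightarrow> eqm \<delta> M N g f"
  unfolding eqm_def wfsp_def by (metis vec.subspace_neg minus_diff_eq)

lemma eqm_add:
  assumes "wfsp N" "eqm \<delta> M N f g" "eqm \<delta> M N f' g'"
  shows "eqm \<delta> M N (\<lambda>v. f v + f' v) (\<lambda>v. g v + g' v)"
  unfolding eqm_def
proof (intro allI ballI)
  fix d v assume "v \<in> piece M d"
  then have "(f v - g v) + (f' v - g' v) \<in> rels N (d + \<delta>)"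
    using assms by (intro vec.subspace_add wfspD eqmD)
  then show "f v + f' v - (g v + g' v) \<in> rels N (d + \<delta>)" by (simp add: algebra_simps)
qed

lemma eqm_pre: "eqm \<epsilon> N P g g' \<Longrightarrow> gm \<delta> M N f \<Longrightarrow> \<delta> + \<epsilon> = \<eta> \<Longrightarrow> eqm \<eta> M P (\<lambda>v. g (f v)) (\<lambda>v. g' (f v))"
  unfolding eqm_def gm_def by (metis add.assoc)

lemma eqm_post: "eqm \<delta> M N f f' \<Longrightarrow> gm \<epsilon> N P g \<Longrightarrow> \<delta> + \<epsilon> = \<eta> \<Longrightarrow> eqm \<eta> M P (\<lambda>v. g (f v)) (\<lambda>v. g (f' v))"
  unfolding eqm_def gm_def by (metis add.assoc lin_diff)

lemma eqv_sym: "eqv M N \<Longrightarrow> eqv N M" unfolding eqv_def by blast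

lemma eqv_trans:
  assumes "eqv M N" "eqv N P" shows "eqv M P"
proof -
  from assms obtain f g f' g' where
    w: "wfsp M" "wfsp N" "wfsp P" and
    m: "fm 0 M N f" "fm 0 N M g" "fm 0 N P f'" "fm 0 P N g'" and
    e: "eqm 0 M M (\<lambda>v. g (f v)) (\<lambda>v. v)" "eqm 0 N N (\<lambda>v. f (g v)) (\<lambda>v. v)"
       "eqm 0 N N (\<lambda>v. g' (f' v)) (\<lambda>v. v)" "eqm 0 P P (\<lambda>v. f' (g' v)) (\<lambda>v. v)"
    unfolding eqv_def by blast
  have "eqm 0 M M (\<lambda>v. g (g' (f' (f v)))) (\<lambda>v. g (f v))"
    using eqm_post[OF eqm_pre[OF e(3) fmD(1)[OF m(1)]] fmD(1)[OF m(2)]] by simp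
  then have 1: "eqm 0 M M (\<lambda>v. g (g' (f' (f v)))) (\<lambda>v. v)" using e(1) w eqm_trans by blast
  have "eqm 0 P P (\<lambda>v. f' (f (g (g' v)))) (\<lambda>v. f' (g' v))"
    using eqm_post[OF eqm_pre[OF e(2) fmD(1)[OF m(4)]] fmD(1)[OF m(3)]] by simp
  then have 2: "eqm 0 P P (\<lambda>v. f' (f (g (g' v)))) (\<lambda>v. v)" using e(4) w eqm_trans by blast
  show ?thesis unfolding eqv_def
    using w 1 2 fm_comp0[OF m(1) m(3)] fm_comp0[OF m(4) m(2)]
    by (intro conjI exI[of _ "\<lambda>v. f' (f v)"] exI[of _ "\<lambda>v. g (g' v)"]) auto
qed

lemma eqv_fiso: assumes "eqv M N" shows "M \<cong> N"
proof -
  from assms obtain f g where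
    w: "wfsp M" "wfsp N" and m: "fm 0 M N f" "fm 0 N M g" and
    e: "eqm 0 M M (\<lambda>v. g (f v)) (\<lambda>v. v)" "eqm 0 N N (\<lambda>v. f (g v)) (\<lambda>v. v)"
    unfolding eqv_def by blast
  note f = fm0D[OF m(1)] and g = fm0D[OF m(2)] and wM = wfspD[OF w(1)] and wN = wfspD[OF w(2)]
  have gf: "g (f v) - v \<in> rels M d" if "v \<in> piece M d" for v d using eqm0D[OF _ that] e by blast
  have fg: "f (g v) - v \<in> rels N d" if "v \<in> piece N d" for v d using eqm0D[OF _ that] e by blast
  \<comment> \<open>A vector differs from \<open>g (f v)\<close> by a relation, and relations lie in
    every filtration level. So \<open>f\<close> reflects \<open>rels\<close> and
    \<open>filt\<close>, which yields the equivalences demanded by \<open>fiso\<close>.\<close>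
  have v: "v = g (f v) - (g (f v) - v)" for v by simp
  have r: "f v \<in> rels N d \<longleftrightarrow> v \<in> rels M d" if "v \<in> piece M d" for v d
    using f g gf[OF that] wM(1) v by (metis vec.subspace_diff)
  have i: "f v \<in> filt N i d \<longleftrightarrow> v \<in> filt M i d" if "v \<in> piece M d" for v d i
    using f g gf[OF that] wM(2,3) v by (metis vec.subspace_diff)
  have s: "\<exists>v \<in> piece M d. w - f v \<in> rels N d" if "w \<in> piece N d" for w d
    using fg[OF that] g(1)[OF that] wN(1) by (metis minus_diff_eq vec.subspace_neg)
  show ?thesis unfolding fiso_def
    by (intro exI[of _ "\<lambda>_. f"] allI conjI ballI) (simp_all add: lin_linear[OF f(4)] f(1) r i s)
qed

subsection \<open>Homology\<close>

lemma homology_sel: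
  "piece (homology \<delta> D M) d = {v \<in> piece M d. D v \<in> rels M (d + \<delta>)}"
  "rels (homology \<delta> D M) d = {r + D w | r w. r \<in> rels M d \<and> w \<in> piece M (d - \<delta>)}"
  "filt (homology \<delta> D M) i d = {z + b | z b. z \<in> piece M d \<and> D z \<in> rels M (d + \<delta>) \<and> z \<in> filt M i d \<and>
      b \<in> rels (homology \<delta> D M) d}"
  by (auto simp: homology_def Let_def)

lemma wfsp_homology:
  assumes "wfsp M" "\<And>d. vec.subspace (piece M d)" "lin D"
  shows "wfsp (homology \<delta> D M)"
proof -
  note w = wfspD[OF assms(1)]
  have B: "vec.subspace (rels (homology \<delta> D M) d)" for d
  proof (rule vec.subspaceI)
    show "0 \<in> rels (homology \<delta> D M) d" unfolding homology_sel mem_Collect_eq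
      using w(1)[of d] assms(2)[of "d - \<delta>"] lin_0[OF assms(3)] vec.subspace_0 by (metis add_0)
    fix x y c assume "x \<in> rels (homology \<delta> D M) d"
    then obtain r v where x: "x = r + D v" "r \<in> rels M d" "v \<in> piece M (d - \<delta>)"
      by (auto simp: homology_sel)
    have "scl c x = scl c r + D (scl c v)"
      using x assms(3) by (simp add: lin_simps vec.scale_right_distrib)
    then show "scl c x \<in> rels (homology \<delta> D M) d"
      using x w(1) assms(2) vec.subspace_scale unfolding homology_sel by blast
    assume "y \<in> rels (homology \<delta> D M) d"
    then obtain r' v' where y: "y = r' + D v'" "r' \<in> rels M d" "v' \<in> piece M (d - \<delta>)"
      by (auto simp: homology_sel)
    have "x + y = (r + r') + D (v + v')"
      using x y assms(3) by (simp add: lin_simps algebra_simps)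
    then show "x + y \<in> rels (homology \<delta> D M) d"
      using x y w(1) assms(2) vec.subspace_add unfolding homology_sel by blast
  qed
  have F: "vec.subspace (filt (homology \<delta> D M) i d)" for i d
  proof (rule vec.subspaceI)
    have "0 \<in> piece M d \<and> D 0 \<in> rels M (d + \<delta>) \<and> 0 \<in> filt M i d"
      using w assms(2)[of d] lin_0[OF assms(3)] vec.subspace_0 by metis
    then show "0 \<in> filt (homology \<delta> D M) i d" unfolding homology_sel(3) mem_Collect_eq
      using vec.subspace_0[OF B] by (metis add_0)
    fix x y c assume "x \<in> filt (homology \<delta> D M) i d"
    then obtain z b where x: "x = z + b" "z \<in> piece M d" "D z \<in> rels M (d + \<delta>)" "z \<in> filt M i d"
      "b \<in> rels (homology \<delta> D M) d"
      unfolding homology_sel(3) by blast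
    have "scl c x = scl c z + scl c b" using x by (simp add: vec.scale_right_distrib)
    moreover have "D (scl c z) \<in> rels M (d + \<delta>)"
      using x w(1) assms(3) by (simp add: lin_simps vec.subspace_scale)
    ultimately show "scl c x \<in> filt (homology \<delta> D M) i d"
      unfolding homology_sel(3) mem_Collect_eq
      using x w(2) assms(2) vec.subspace_scale B by blast
    assume "y \<in> filt (homology \<delta> D M) i d"
    then obtain z' b' where y: "y = z' + b'" "z' \<in> piece M d" "D z' \<in> rels M (d + \<delta>)" "z' \<in> filt M i d"
      "b' \<in> rels (homology \<delta> D M) d"
      unfolding homology_sel(3) by blast
    have "x + y = (z + z') + (b + b')" using x y by (simp add: algebra_simps)
    moreover have "D (z + z') \<in> rels M (d + \<delta>)"
      using x y w(1) assms(3) by (simp add: lin_simps vec.subspace_add)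
    ultimately show "x + y \<in> filt (homology \<delta> D M) i d"
      unfolding homology_sel(3) mem_Collect_eq
      using x y w(2) assms(2) vec.subspace_add B by blast
  qed
  have "rels (homology \<delta> D M) d \<subseteq> filt (homology \<delta> D M) i d" for i d
  proof
    fix b assume b: "b \<in> rels (homology \<delta> D M) d"
    have "0 \<in> piece M d \<and> D 0 \<in> rels M (d + \<delta>) \<and> 0 \<in> filt M i d"
      using w assms(2)[of d] lin_0[OF assms(3)] vec.subspace_0 by metis
    then show "b \<in> filt (homology \<delta> D M) i d" unfolding homology_sel(3) mem_Collect_eq
      using b by (metis add_0)
  qed
  then show ?thesis using B F by (auto simp: wfsp_def)
qed

lemma subspace_piece_homology:
  assumes "wfsp M" "\<And>d. vec.subspace (piece M d)" "lin D"
  shows "vec.subspace (piece (homology \<delta> D M) d)"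
  using wfspD(1)[OF assms(1), of "d + \<delta>"] assms(2)[of d] assms(3)
  unfolding homology_sel
  by (intro vec.subspaceI) (auto simp: lin_simps vec.subspace_0 vec.subspace_add vec.subspace_scale)

lemma fm_homology:
  assumes f: "fm \<epsilon> M N f" and c: "eqm (\<epsilon> + \<delta>) M N (\<lambda>v. f (D v)) (\<lambda>v. D' (f v))"
    and w: "wfsp N"
  shows "fm \<epsilon> (homology \<delta> D M) (homology \<delta> D' N) f"
proof -
  note w = wfspD[OF w]
  note g = gmD[OF fmD(1)[OF f]]
  have c': "f (D v) - D' (f v) \<in> rels N (d + \<epsilon> + \<delta>)" if "v \<in> piece M d" for v d
    using c that by (auto simp: eqm_def add.assoc)
  have Z: "f v \<in> piece N (d + \<epsilon>) \<and> D' (f v) \<in> rels N (d + \<epsilon> + \<delta>)"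
    if "v \<in> piece M d" "D v \<in> rels M (d + \<delta>)" for v d
  proof -
    have "f (D v) \<in> rels N (d + \<epsilon> + \<delta>)" using g(3)[OF that(2)] by (simp add: algebra_simps)
    moreover have "D' (f v) = f (D v) - (f (D v) - D' (f v))" by simp
    ultimately show ?thesis using c'[OF that(1)] g(2)[OF that(1)] w(1) vec.subspace_diff by metis
  qed
  have B: "f b \<in> rels (homology \<delta> D' N) (d + \<epsilon>)" if "b \<in> rels (homology \<delta> D M) d" for b d
  proof -
    from that obtain r v where b: "b = r + D v" "r \<in> rels M d" "v \<in> piece M (d - \<delta>)"
      by (auto simp: homology_sel)
    \<comment> \<open>\<open>f\<close> commutes with the differentials only modulo relations; the
      error is moved into the relation part of the boundary.\<close>
    have "f (D v) - D' (f v) \<in> rels N (d + \<epsilon>)" using c'[OF b(3)] by simp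
    then have "f r + (f (D v) - D' (f v)) \<in> rels N (d + \<epsilon>)"
      using g(3)[OF b(2)] w(1) vec.subspace_add by blast
    moreover have "f v \<in> piece N (d + \<epsilon> - \<delta>)" using g(2)[OF b(3)] by (simp add: algebra_simps)
    moreover have "f b = (f r + (f (D v) - D' (f v))) + D' (f v)" using b g(1) by (simp add: lin_simps)
    ultimately show ?thesis unfolding homology_sel mem_Collect_eq by blast
  qed
  have F: "f x \<in> filt (homology \<delta> D' N) i (d + \<epsilon>)" if "x \<in> filt (homology \<delta> D M) i d" for x i d
  proof -
    from that obtain z b where x: "x = z + b" "z \<in> piece M d" "D z \<in> rels M (d + \<delta>)" "z \<in> filt M i d"
      "b \<in> rels (homology \<delta> D M) d"
      unfolding homology_sel(3) by blast
    then show ?thesis unfolding homology_sel(3) mem_Collect_eq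
      using Z[OF x(2,3)] fmD(2)[OF f x(4)] B[OF x(5)] g(1) lin_add by blast
  qed
  show ?thesis unfolding fm_def gm_def using g(1) B F Z by (auto simp: homology_sel(1))
qed

lemma eqm_homology:
  assumes "eqm \<epsilon> M N f g" "\<And>d. vec.subspace (piece N d)" "lin D'"
  shows "eqm \<epsilon> (homology \<delta> D M) (homology \<delta> D' N) f g"
  unfolding eqm_def
proof (intro allI ballI)
  fix d v assume "v \<in> piece (homology \<delta> D M) d"
  then have "f v - g v \<in> rels N (d + \<epsilon>)" using assms by (auto simp: homology_sel eqm_def)
  moreover have "f v - g v = (f v - g v) + D' 0" using assms by (simp add: lin_0)
  ultimately show "f v - g v \<in> rels (homology \<delta> D' N) (d + \<epsilon>)"
    unfolding homology_sel mem_Collect_eq using vec.subspace_0[OF assms(2)] by blast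
qed

text \<open>On a cycle \<open>h (D v)\<close> is a relation and \<open>D (h v)\<close> a boundary.
  All boundaries are relations of the homology, whatever their filtration level, so \<open>h\<close>
  may lower the filtration, as \<open>eta\<close> does below.\<close>

lemma eqm_homotopic:
  assumes h: "gm (- \<delta>) M M h" and e: "eqm 0 M M F (\<lambda>v. v + (D (h v) + h (D v)))" and M: "wfsp M"
  shows "eqm 0 (homology \<delta> D M) (homology \<delta> D M) F (\<lambda>v. v)"
proof -
  have "F v - v \<in> rels (homology \<delta> D M) d" if v: "v \<in> piece M d" "D v \<in> rels M (d + \<delta>)" for v d
  proof -
    have "F v - (v + (D (h v) + h (D v))) \<in> rels M d" using eqm0D[OF e v(1)] .
    moreover have "h (D v) \<in> rels M d" using gmD(3)[OF h v(2)] by simp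
    ultimately have "(F v - (v + (D (h v) + h (D v)))) + h (D v) \<in> rels M d"
      using wfspD(1)[OF M] vec.subspace_add by blast
    moreover have "h v \<in> piece M (d - \<delta>)" using gmD(2)[OF h v(1)] by simp
    moreover have "F v - v = ((F v - (v + (D (h v) + h (D v)))) + h (D v)) + D (h v)" by simp
    ultimately show ?thesis unfolding homology_sel mem_Collect_eq by blast
  qed
  then show ?thesis by (simp add: eqm_def homology_sel(1))
qed

definition hretr :: "deg \<Rightarrow> 'a fsp_scheme \<Rightarrow> (vec \<Rightarrow> vec) \<Rightarrow> 'b fsp_scheme \<Rightarrow> (vec \<Rightarrow> vec) \<Rightarrow>
    (vec \<Rightarrow> vec) \<Rightarrow> (vec \<Rightarrow> vec) \<Rightarrow> (vec \<Rightarrow> vec) \<Rightarrow> bool" where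
  "hretr \<delta> M D N D' f g h \<longleftrightarrow> fm 0 M N f \<and> fm 0 N M g \<and> gm (- \<delta>) M M h \<and>
     eqm \<delta> M N (\<lambda>v. f (D v)) (\<lambda>v. D' (f v)) \<and> eqm \<delta> N M (\<lambda>v. g (D' v)) (\<lambda>v. D (g v)) \<and>
     eqm 0 N N (\<lambda>v. f (g v)) (\<lambda>v. v) \<and> eqm 0 M M (\<lambda>v. g (f v)) (\<lambda>v. v + (D (h v) + h (D v)))"

lemma hretr_eqv:
  assumes h: "hretr \<delta> M D N D' f g h" and M: "wfsp M" "\<And>d. vec.subspace (piece M d)" "lin D"
    and N: "wfsp N" "\<And>d. vec.subspace (piece N d)" "lin D'"
  shows "eqv (homology \<delta> D M) (homology \<delta> D' N)"
proof -
  note h = h[unfolded hretr_def]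
  have 1: "fm 0 (homology \<delta> D M) (homology \<delta> D' N) f" "fm 0 (homology \<delta> D' N) (homology \<delta> D M) g"
    using h M N by (auto intro!: fm_homology)
  have 2: "eqm 0 (homology \<delta> D' N) (homology \<delta> D' N) (\<lambda>v. f (g v)) (\<lambda>v. v)"
    using h N by (auto intro!: eqm_homology)
  have 3: "eqm 0 (homology \<delta> D M) (homology \<delta> D M) (\<lambda>v. g (f v)) (\<lambda>v. v)"
    using h M by (auto intro!: eqm_homotopic)
  show ?thesis unfolding eqv_def using 1 2 3 wfsp_homology[OF M] wfsp_homology[OF N] by blast
qed

subsection \<open>Maps out of tensor products\<close>

lemma tens_over_sel:
  "piece (tens_over S M N) d = vec.span
     {tn e e' v w | e e' v w. e + e' = d \<and> v \<in> piece M e \<and> w \<in> piece N e'}"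
  "rels (tens_over S M N) d = vec.span (tens_rels M N d \<union>
     {tn (e + deg_x) e' (f v) w - tn e (e' + deg_x) v (g w) | e e' f g v w.
        e + e' + deg_x = d \<and> (f, g) \<in> S \<and> v \<in> piece M e \<and> w \<in> piece N e'})"
  "filt (tens_over S M N) i d = vec.span (filt (M \<otimes> N) i d \<union>
     {tn (e + deg_x) e' (f v) w - tn e (e' + deg_x) v (g w) | e e' f g v w.
        e + e' + deg_x = d \<and> (f, g) \<in> S \<and> v \<in> piece M e \<and> w \<in> piece N e'})"
  by (simp_all add: tens_over_def quot_def tens_def)

lemma subspace_tens_over [simp]: "vec.subspace (piece (tens_over S M N) d)"
  "vec.subspace (rels (tens_over S M N) d)" "vec.subspace (filt (tens_over S M N) i d)"
  by (simp_all add: tens_over_sel)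

lemma wfsp_tens_over [simp]: "wfsp (tens_over S M N)"
proof -
  have "rels (tens_over S M N) d \<subseteq> filt (tens_over S M N) i d" for i d
    unfolding tens_over_sel
    by (rule vec.span_mono, rule Un_mono) (auto simp: tens_def intro: vec.span_base)
  then show ?thesis by (simp add: wfsp_def)
qed

lemma tn_piece: "v \<in> piece M e \<Longrightarrow> w \<in> piece N e' \<Longrightarrow> e + e' = d \<Longrightarrow>
    tn e e' v w \<in> piece (tens_over S M N) d"
  unfolding tens_over_sel by (rule vec.span_base) blast

lemma tn_rels:
  "v \<in> rels M e \<Longrightarrow> w \<in> piece N e' \<Longrightarrow> e + e' = d \<Longrightarrow> tn e e' v w \<in> rels (tens_over S M N) d"
  "v \<in> piece M e \<Longrightarrow> w \<in> rels N e' \<Longrightarrow> e + e' = d \<Longrightarrow> tn e e' v w \<in> rels (tens_over S M N) d"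
  unfolding tens_over_sel tens_rels_def
  by (rule vec.span_base, rule UnI1, rule vec.span_base, blast)+

lemma tn_over: "(f, g) \<in> S \<Longrightarrow> v \<in> piece M e \<Longrightarrow> w \<in> piece N e' \<Longrightarrow> e + e' + deg_x = d \<Longrightarrow>
    tn (e + deg_x) e' (f v) w - tn e (e' + deg_x) v (g w) \<in> rels (tens_over S M N) d"
  unfolding tens_over_sel by (rule vec.span_base, rule UnI2) blast

lemma tn_filt: "v \<in> filt M j e \<Longrightarrow> w \<in> filt N j' e' \<Longrightarrow> e + e' = d \<Longrightarrow> j + j' = i \<Longrightarrow>
    tn e e' v w \<in> filt (tens_over S M N) i d"
  unfolding tens_over_sel tens_def fsp.select_convs
  by (rule vec.span_base, rule UnI1, rule vec.span_base, rule UnI1) blast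

text \<open>Elementary tensors span, and the relations of a tensor product over a ring come from
  either factor or from balancing: hence the four cases.\<close>

lemma gm_tensI:
  assumes F: "lin F" and P: "\<And>d. vec.subspace (piece P d)" "wfsp P"
    and 1: "\<And>e e' v w. v \<in> piece M e \<Longrightarrow> w \<in> piece N e' \<Longrightarrow> F (tn e e' v w) \<in> piece P (e + e' + \<delta>)"
    and 2: "\<And>e e' v w. v \<in> rels M e \<Longrightarrow> w \<in> piece N e' \<Longrightarrow> F (tn e e' v w) \<in> rels P (e + e' + \<delta>)"
    and 3: "\<And>e e' v w. v \<in> piece M e \<Longrightarrow> w \<in> rels N e' \<Longrightarrow> F (tn e e' v w) \<in> rels P (e + e' + \<delta>)"
    and 4: "\<And>e e' v w f g. (f, g) \<in> S \<Longrightarrow> v \<in> piece M e \<Longrightarrow> w \<in> piece N e' \<Longrightarrow>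
       F (tn (e + deg_x) e' (f v) w) - F (tn e (e' + deg_x) v (g w)) \<in> rels P (e + e' + deg_x + \<delta>)"
  shows "gm \<delta> (tens_over S M N) P F"
proof -
  note w = wfspD[OF P(2)]
  have T: "F v \<in> rels P (d + \<delta>)" if "v \<in> tens_rels M N d" for v d
    using that unfolding tens_rels_def by (rule lin_span[OF F w(1), rotated]) (use 2 3 in blast)
  have "F v \<in> piece P (d + \<delta>)" if "v \<in> piece (tens_over S M N) d" for v d
    using that unfolding tens_over_sel by (rule lin_span[OF F P(1), rotated]) (use 1 in blast)
  moreover have "F v \<in> rels P (d + \<delta>)" if "v \<in> rels (tens_over S M N) d" for v d
    using that unfolding tens_over_sel
  proof (rule lin_span[OF F w(1), rotated], elim UnE)
    fix x assume "x \<in> {tn (e + deg_x) e' (f v) w - tn e (e' + deg_x) v (g w) | e e' f g v w.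
        e + e' + deg_x = d \<and> (f, g) \<in> S \<and> v \<in> piece M e \<and> w \<in> piece N e'}"
    then show "F x \<in> rels P (d + \<delta>)" using 4 by (auto simp: lin_diff[OF F])
  qed (use T in blast)
  ultimately show ?thesis using F by (simp add: gm_def)
qed

lemma fm_tensI:
  assumes F: "gm \<delta> (tens_over S M N) P F" and P: "wfsp P"
    and 5: "\<And>e e' v w j j'. v \<in> filt M j e \<Longrightarrow> w \<in> filt N j' e' \<Longrightarrow>
        F (tn e e' v w) \<in> filt P (j + j') (e + e' + \<delta>)"
  shows "fm \<delta> (tens_over S M N) P F"
proof -
  note w = wfspD[OF P] and g = gmD[OF F]
  have r: "F v \<in> filt P i (d + \<delta>)" if "v \<in> rels (tens_over S M N) d" for v d i
    using g(3)[OF that] w(3) by blast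
  have "F v \<in> filt P i (d + \<delta>)" if "v \<in> filt (tens_over S M N) i d" for v i d
    using that unfolding tens_over_sel
  proof (rule lin_span[OF g(1) w(2), rotated], elim UnE)
    fix x assume "x \<in> filt (M \<otimes> N) i d"
    then show "F x \<in> filt P i (d + \<delta>)" unfolding tens_def fsp.select_convs
    proof (rule lin_span[OF g(1) w(2), rotated], elim UnE)
      fix x assume "x \<in> {tn e e' v w |e e' v w j j'. e + e' = d \<and> j + j' = i \<and> v \<in> filt M j e \<and> w \<in> filt N j' e'}"
      then show "F x \<in> filt P i (d + \<delta>)" using 5 by blast
    next
      fix x assume "x \<in> tens_rels M N d"
      then show "F x \<in> filt P i (d + \<delta>)" by (intro r) (simp add: tens_over_sel vec.span_base)
    qed
  next
    fix x assume "x \<in> {tn (e + deg_x) e' (f v) w - tn e (e' + deg_x) v (g w) | e e' f g v w.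
        e + e' + deg_x = d \<and> (f, g) \<in> S \<and> v \<in> piece M e \<and> w \<in> piece N e'}"
    then show "F x \<in> filt P i (d + \<delta>)" by (intro r) (simp add: tens_over_sel vec.span_base)
  qed
  then show ?thesis using F by (simp add: fm_def)
qed

lemma eqm_tensI:
  assumes "lin F" "lin G" "wfsp P"
    and "\<And>e e' v w. v \<in> piece M e \<Longrightarrow> w \<in> piece N e' \<Longrightarrow>
        F (tn e e' v w) - G (tn e e' v w) \<in> rels P (e + e' + \<delta>)"
  shows "eqm \<delta> (tens_over S M N) P F G"
  unfolding eqm_def
proof (intro allI ballI)
  fix d v assume "v \<in> piece (tens_over S M N) d"
  then show "F v - G v \<in> rels P (d + \<delta>)" unfolding tens_over_sel
    by (rule lin_span[where f = "\<lambda>v. F v - G v", rotated 3]) (use assms in \<open>auto intro: lins wfspD\<close>)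
qed

lemma fm_tm:
  assumes \<phi>: "fm \<delta> M M' \<phi>" and \<psi>: "fm \<epsilon> N N' \<psi>" and s: "\<And>e. s (e + deg_x) = s e"
    and c: "\<And>f g. (f, g) \<in> S \<Longrightarrow> \<exists>f' g'. (f', g') \<in> S' \<and>
       eqm (\<delta> + deg_x) M M' (\<lambda>v. \<phi> (f v)) (\<lambda>v. f' (\<phi> v)) \<and> eqm (\<epsilon> + deg_x) N N' (\<lambda>v. \<psi> (g v)) (\<lambda>v. g' (\<psi> v))"
    and \<eta>: "\<delta> + \<epsilon> = \<eta>"
  shows "fm \<eta> (tens_over S M N) (tens_over S' M' N') (tm s \<delta> \<epsilon> \<phi> \<psi>)"
proof -
  note p = gmD[OF fmD(1)[OF \<phi>]] and q = gmD[OF fmD(1)[OF \<psi>]]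
  note tt = tm_tn[OF p(1) q(1)]
  have d: "e + \<delta> + (e' + \<epsilon>) = e + e' + \<eta>" for e e' using \<eta> by (simp add: algebra_simps)
  have "gm \<eta> (tens_over S M N) (tens_over S' M' N') (tm s \<delta> \<epsilon> \<phi> \<psi>)"
  proof (rule gm_tensI)
    fix e e' v w f g assume a: "(f, g) \<in> S" "v \<in> piece M e" "w \<in> piece N e'"
    from c[OF a(1)] obtain f' g' where S': "(f', g') \<in> S'" and
      ef: "eqm (\<delta> + deg_x) M M' (\<lambda>v. \<phi> (f v)) (\<lambda>v. f' (\<phi> v))" and
      eg: "eqm (\<epsilon> + deg_x) N N' (\<lambda>v. \<psi> (g v)) (\<lambda>v. g' (\<psi> v))" by blast
    let ?R = "rels (tens_over S' M' N') (e + e' + deg_x + \<eta>)"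
    have dx: "e + e' + deg_x + \<eta> = (e + deg_x + \<delta>) + (e' + \<epsilon>)"
      "e + e' + deg_x + \<eta> = (e + \<delta>) + (e' + deg_x + \<epsilon>)"
      "e + e' + deg_x + \<eta> = (e + \<delta>) + (e' + \<epsilon>) + deg_x"
      using \<eta> by (simp_all add: algebra_simps)
    have "\<phi> (f v) - f' (\<phi> v) \<in> rels M' (e + deg_x + \<delta>)" using eqmD[OF ef a(2)] by (simp add: ac_simps)
    then have 1: "tn (e + deg_x + \<delta>) (e' + \<epsilon>) (\<phi> (f v) - f' (\<phi> v)) (\<psi> w) \<in> ?R"
      by (rule tn_rels(1)[OF _ q(2)[OF a(3)] dx(1)[symmetric]])
    have "\<psi> (g w) - g' (\<psi> w) \<in> rels N' (e' + deg_x + \<epsilon>)" using eqmD[OF eg a(3)] by (simp add: ac_simps)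
    then have 2: "tn (e + \<delta>) (e' + deg_x + \<epsilon>) (\<phi> v) (\<psi> (g w) - g' (\<psi> w)) \<in> ?R"
      by (rule tn_rels(2)[OF p(2)[OF a(2)] _ dx(2)[symmetric]])
    have 3: "tn (e + \<delta> + deg_x) (e' + \<epsilon>) (f' (\<phi> v)) (\<psi> w) - tn (e + \<delta>) (e' + \<epsilon> + deg_x) (\<phi> v) (g' (\<psi> w)) \<in> ?R"
      using S' p(2)[OF a(2)] q(2)[OF a(3)] by (intro tn_over) (simp_all add: dx)
    have e: "e + \<delta> + deg_x = e + deg_x + \<delta>" "e' + \<epsilon> + deg_x = e' + deg_x + \<epsilon>" by (simp_all add: ac_simps)
    \<comment> \<open>The image of a balancing relation is one of the target plus two errors, from
      commuting \<phi> past \<open>f\<close> and \<psi> past \<open>g\<close>. The common factor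
      \<open>s e\<close> exists because degree \<open>deg_x\<close> leaves the sign
      unchanged.\<close>
    have "scl (s e) (tn (e + deg_x + \<delta>) (e' + \<epsilon>) (\<phi> (f v) - f' (\<phi> v)) (\<psi> w)
        + (tn (e + \<delta> + deg_x) (e' + \<epsilon>) (f' (\<phi> v)) (\<psi> w) - tn (e + \<delta>) (e' + \<epsilon> + deg_x) (\<phi> v) (g' (\<psi> w)))
        - tn (e + \<delta>) (e' + deg_x + \<epsilon>) (\<phi> v) (\<psi> (g w) - g' (\<psi> w))) \<in> ?R"
      by (rule vec.subspace_scale[OF subspace_tens_over(2)
            vec.subspace_diff[OF subspace_tens_over(2) vec.subspace_add[OF subspace_tens_over(2) 1 3] 2]])
    also have "scl (s e) (tn (e + deg_x + \<delta>) (e' + \<epsilon>) (\<phi> (f v) - f' (\<phi> v)) (\<psi> w)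
        + (tn (e + \<delta> + deg_x) (e' + \<epsilon>) (f' (\<phi> v)) (\<psi> w) - tn (e + \<delta>) (e' + \<epsilon> + deg_x) (\<phi> v) (g' (\<psi> w)))
        - tn (e + \<delta>) (e' + deg_x + \<epsilon>) (\<phi> v) (\<psi> (g w) - g' (\<psi> w)))
      = tm s \<delta> \<epsilon> \<phi> \<psi> (tn (e + deg_x) e' (f v) w) - tm s \<delta> \<epsilon> \<phi> \<psi> (tn e (e' + deg_x) v (g w))"
      unfolding e tt s by (simp add: tn_simps vec.scale_right_diff_distrib vec.scale_right_distrib)
    finally show "tm s \<delta> \<epsilon> \<phi> \<psi> (tn (e + deg_x) e' (f v) w) - tm s \<delta> \<epsilon> \<phi> \<psi> (tn e (e' + deg_x) v (g w)) \<in> ?R" .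
  qed (auto simp: tt d intro!: lins vec.subspace_scale intro: tn_piece tn_rels p q)
  then show ?thesis
  proof (rule fm_tensI)
    show "tm s \<delta> \<epsilon> \<phi> \<psi> (tn e e' v w) \<in> filt (tens_over S' M' N') (j + j') (e + e' + \<eta>)"
      if "v \<in> filt M j e" "w \<in> filt N j' e'" for e e' v w j j'
      unfolding tt using tn_filt[OF fmD(2)[OF \<phi> that(1)] fmD(2)[OF \<psi> that(2)] d]
      by (intro vec.subspace_scale) simp_all
  qed simp
qed

lemma eqm_tm_right:
  assumes "gm \<delta> M M' \<phi>" "eqm \<epsilon> N N' \<psi> \<psi>'" "lin \<psi>" "lin \<psi>'" "\<delta> + \<epsilon> = \<eta>"
  shows "eqm \<eta> (tens_over S M N) (tens_over S' M' N') (tm s \<delta> \<epsilon> \<phi> \<psi>) (tm s \<delta> \<epsilon> \<phi> \<psi>')"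
proof (rule eqm_tensI)
  fix e e' v w assume a: "v \<in> piece M e" "w \<in> piece N e'"
  note p = gmD[OF assms(1)]
  have "tn (e + \<delta>) (e' + \<epsilon>) (\<phi> v) (\<psi> w - \<psi>' w) \<in> rels (tens_over S' M' N') (e + e' + \<eta>)"
    using p(2)[OF a(1)] eqmD[OF assms(2) a(2)] assms(5) by (intro tn_rels(2)) (auto simp: algebra_simps)
  then have "scl (s e) (tn (e + \<delta>) (e' + \<epsilon>) (\<phi> v) (\<psi> w - \<psi>' w)) \<in> rels (tens_over S' M' N') (e + e' + \<eta>)"
    by (intro vec.subspace_scale) simp_all
  then show "tm s \<delta> \<epsilon> \<phi> \<psi> (tn e e' v w) - tm s \<delta> \<epsilon> \<phi> \<psi>' (tn e e' v w) \<in> rels (tens_over S' M' N') (e + e' + \<eta>)"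
    by (simp add: tm_tn p(1) assms tn_simps vec.scale_right_diff_distrib)
qed (auto intro!: lins)

lemma eqm_tm_left:
  assumes "gm \<epsilon> N N' \<psi>" "eqm \<delta> M M' \<phi> \<phi>'" "lin \<phi>" "lin \<phi>'" "\<delta> + \<epsilon> = \<eta>"
  shows "eqm \<eta> (tens_over S M N) (tens_over S' M' N') (tm s \<delta> \<epsilon> \<phi> \<psi>) (tm s \<delta> \<epsilon> \<phi>' \<psi>)"
proof (rule eqm_tensI)
  fix e e' v w assume a: "v \<in> piece M e" "w \<in> piece N e'"
  note p = gmD[OF assms(1)]
  have "tn (e + \<delta>) (e' + \<epsilon>) (\<phi> v - \<phi>' v) (\<psi> w) \<in> rels (tens_over S' M' N') (e + e' + \<eta>)"
    using p(2)[OF a(2)] eqmD[OF assms(2) a(1)] assms(5) by (intro tn_rels(1)) (auto simp: algebra_simps)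
  then have "scl (s e) (tn (e + \<delta>) (e' + \<epsilon>) (\<phi> v - \<phi>' v) (\<psi> w)) \<in> rels (tens_over S' M' N') (e + e' + \<eta>)"
    by (intro vec.subspace_scale) simp_all
  then show "tm s \<delta> \<epsilon> \<phi> \<psi> (tn e e' v w) - tm s \<delta> \<epsilon> \<phi>' \<psi> (tn e e' v w) \<in> rels (tens_over S' M' N') (e + e' + \<eta>)"
    by (simp add: tm_tn p(1) assms tn_simps vec.scale_right_diff_distrib)
qed (auto intro!: lins)

subsection \<open>Deformation retracts of complexes of bimodules\<close>

text \<open>The notions above read only the three fields of \<open>fsp\<close>, so they can be
  transported between record extensions.\<close>

lemma trunc_cong:
  assumes "fsp.truncate M = fsp.truncate M'" "fsp.truncate N = fsp.truncate N'"
  shows "gm \<delta> M N f = gm \<delta> M' N' f" "fm \<delta> M N f = fm \<delta> M' N' f" "eqm \<delta> M N f g = eqm \<delta> M' N' f g"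
    "wfsp M = wfsp M'" "eqv M N = eqv M' N'"
proof -
  have 1: "piece M = piece M'" "rels M = rels M'" "filt M = filt M'"
   "piece N = piece N'" "rels N = rels N'" "filt N = filt N'"
    using assms by (simp_all add: fsp.truncate_def)
  show "gm \<delta> M N f = gm \<delta> M' N' f" "fm \<delta> M N f = fm \<delta> M' N' f" "eqm \<delta> M N f g = eqm \<delta> M' N' f g"
    "wfsp M = wfsp M'" "eqv M N = eqv M' N'"
    unfolding gm_def fm_def eqm_def wfsp_def eqv_def 1 by (rule refl)+
qed

definition bm :: "deg \<Rightarrow> 'a fbim_scheme \<Rightarrow> 'b fbim_scheme \<Rightarrow> (vec \<Rightarrow> vec) \<Rightarrow> bool" where
  "bm \<delta> M N f \<longleftrightarrow> fm \<delta> M N f \<and> (\<forall>i\<in>{1,2}.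
     eqm (\<delta> + deg_x) M N (\<lambda>v. f (xact M i v)) (\<lambda>v. xact N i (f v)) \<and>
     eqm (\<delta> + deg_x) M N (\<lambda>v. f (yact M i v)) (\<lambda>v. yact N i (f v)))"

definition wfch :: "'a fch_scheme \<Rightarrow> bool" where
  "wfch M \<longleftrightarrow> wfsp M \<and> (\<forall>d. vec.subspace (piece M d)) \<and> lin (dout M) \<and>
     (\<forall>i\<in>{1,2}. lin (xact M i) \<and> lin (yact M i))"

text \<open>The homotopy is a bimodule map as well, since it is going to be tensored with further
  factors and with the Koszul complex.\<close>

definition retr :: "fch \<Rightarrow> fch \<Rightarrow> bool" where
  "retr M N \<longleftrightarrow> wfch M \<and> wfch N \<and> (\<exists>f g h. bm 0 M N f \<and> bm 0 N M g \<and> bm (- deg_out) M M h \<and>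
     eqm deg_out M N (\<lambda>v. f (dout M v)) (\<lambda>v. dout N (f v)) \<and>
     eqm deg_out N M (\<lambda>v. g (dout N v)) (\<lambda>v. dout M (g v)) \<and>
     eqm 0 N N (\<lambda>v. f (g v)) (\<lambda>v. v) \<and>
     eqm 0 M M (\<lambda>v. g (f v)) (\<lambda>v. v + (dout M (h v) + h (dout M v))))"

lemma bmD: assumes "bm \<delta> M N f"
  shows "fm \<delta> M N f" "gm \<delta> M N f" "lin f"
    "i \<in> {1,2} \<Longrightarrow> eqm (\<delta> + deg_x) M N (\<lambda>v. f (xact M i v)) (\<lambda>v. xact N i (f v))"
    "i \<in> {1,2} \<Longrightarrow> eqm (\<delta> + deg_x) M N (\<lambda>v. f (yact M i v)) (\<lambda>v. yact N i (f v))"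
  using assms by (auto simp: bm_def fm_def gm_def)

lemma wfchD: assumes "wfch M"
  shows "wfsp M" "vec.subspace (piece M d)" "lin (dout M)"
    "i \<in> {1,2} \<Longrightarrow> lin (xact M i)" "i \<in> {1,2} \<Longrightarrow> lin (yact M i)"
  using assms by (auto simp: wfch_def)

lemma bm_comp:
  assumes f: "bm \<delta> M N f" and g: "bm \<epsilon> N P g" and \<eta>: "\<delta> + \<epsilon> = \<eta>" and P: "wfsp P"
  shows "bm \<eta> M P (\<lambda>v. g (f v))"
  unfolding bm_def
proof (intro conjI ballI)
  show "fm \<eta> M P (\<lambda>v. g (f v))" using bmD(1)[OF f] bmD(1)[OF g] \<eta> by (rule fm_comp)
  fix i :: nat assume i: "i \<in> {1,2}"
  have d: "\<delta> + deg_x + \<epsilon> = \<eta> + deg_x" "\<delta> + (\<epsilon> + deg_x) = \<eta> + deg_x" using \<eta> by (simp_all add: ac_simps)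
  show "eqm (\<eta> + deg_x) M P (\<lambda>v. g (f (xact M i v))) (\<lambda>v. xact P i (g (f v)))"
    by (rule eqm_trans[OF P eqm_post[OF bmD(4)[OF f i] bmD(2)[OF g] d(1)] eqm_pre[OF bmD(4)[OF g i] bmD(2)[OF f] d(2)]])
  show "eqm (\<eta> + deg_x) M P (\<lambda>v. g (f (yact M i v))) (\<lambda>v. yact P i (g (f v)))"
    by (rule eqm_trans[OF P eqm_post[OF bmD(5)[OF f i] bmD(2)[OF g] d(1)] eqm_pre[OF bmD(5)[OF g i] bmD(2)[OF f] d(2)]])
qed

lemma bm_add:
  assumes f: "bm \<delta> M N f" and g: "bm \<delta> M N g" and N: "wfch N"
  shows "bm \<delta> M N (\<lambda>v. f v + g v)"
  unfolding bm_def
proof (intro conjI ballI)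
  note w = wfspD[OF wfchD(1)[OF N]]
  show "fm \<delta> M N (\<lambda>v. f v + g v)" unfolding fm_def gm_def
    by (intro conjI allI ballI lins vec.subspace_add w wfchD(2)[OF N] gmD[OF bmD(2)[OF f]]
        gmD[OF bmD(2)[OF g]] fmD(2)[OF bmD(1)[OF f]] fmD(2)[OF bmD(1)[OF g]] bmD(3)[OF f] bmD(3)[OF g])
  fix i :: nat assume i: "i \<in> {1,2}"
  show "eqm (\<delta> + deg_x) M N (\<lambda>v. f (xact M i v) + g (xact M i v)) (\<lambda>v. xact N i (f v + g v))"
    using eqm_add[OF wfchD(1)[OF N] bmD(4)[OF f i] bmD(4)[OF g i]]
    by (simp add: lin_add[OF wfchD(4)[OF N i]])
  show "eqm (\<delta> + deg_x) M N (\<lambda>v. f (yact M i v) + g (yact M i v)) (\<lambda>v. yact N i (f v + g v))"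
    using eqm_add[OF wfchD(1)[OF N] bmD(5)[OF f i] bmD(5)[OF g i]]
    by (simp add: lin_add[OF wfchD(5)[OF N i]])
qed

lemma retr_trans:
  assumes MN: "retr M N" and NP: "retr N P" shows "retr M P"
proof -
  from MN obtain f g h where M: "wfch M" and N: "wfch N" and
    a: "bm 0 M N f" "bm 0 N M g" "bm (- deg_out) M M h"
     "eqm deg_out M N (\<lambda>v. f (dout M v)) (\<lambda>v. dout N (f v))"
     "eqm deg_out N M (\<lambda>v. g (dout N v)) (\<lambda>v. dout M (g v))"
     "eqm 0 N N (\<lambda>v. f (g v)) (\<lambda>v. v)"
     "eqm 0 M M (\<lambda>v. g (f v)) (\<lambda>v. v + (dout M (h v) + h (dout M v)))"
    unfolding retr_def by blast
  from NP obtain f' g' h' where P: "wfch P" and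
    b: "bm 0 N P f'" "bm 0 P N g'" "bm (- deg_out) N N h'"
     "eqm deg_out N P (\<lambda>v. f' (dout N v)) (\<lambda>v. dout P (f' v))"
     "eqm deg_out P N (\<lambda>v. g' (dout P v)) (\<lambda>v. dout N (g' v))"
     "eqm 0 P P (\<lambda>v. f' (g' v)) (\<lambda>v. v)"
     "eqm 0 N N (\<lambda>v. g' (f' v)) (\<lambda>v. v + (dout N (h' v) + h' (dout N v)))"
    unfolding retr_def by blast
  note wM = wfchD(1)[OF M] and wN = wfchD(1)[OF N] and wP = wfchD(1)[OF P]
  \<comment> \<open>The homotopy of a composite retract: that of \<open>M\<close> plus that of
    \<open>N\<close>, transported along \<open>f\<close> and \<open>g\<close>.\<close>
  let ?h = "\<lambda>v. h v + g (h' (f v))"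
  have hb: "bm (- deg_out) M M (\<lambda>v. g (h' (f v)))"
    using bm_comp[OF bm_comp[OF a(1) b(3) _ wN] a(2) _ wM] by simp
  have "eqm deg_out M P (\<lambda>v. f' (f (dout M v))) (\<lambda>v. f' (dout N (f v)))"
    using eqm_post[OF a(4) bmD(2)[OF b(1)]] by simp
  moreover have "eqm deg_out M P (\<lambda>v. f' (dout N (f v))) (\<lambda>v. dout P (f' (f v)))"
    using eqm_pre[OF b(4) bmD(2)[OF a(1)]] by simp
  ultimately have 1: "eqm deg_out M P (\<lambda>v. f' (f (dout M v))) (\<lambda>v. dout P (f' (f v)))"
    using eqm_trans[OF wP] by blast
  have "eqm deg_out P M (\<lambda>v. g (g' (dout P v))) (\<lambda>v. g (dout N (g' v)))"
    using eqm_post[OF b(5) bmD(2)[OF a(2)]] by simp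
  moreover have "eqm deg_out P M (\<lambda>v. g (dout N (g' v))) (\<lambda>v. dout M (g (g' v)))"
    using eqm_pre[OF a(5) bmD(2)[OF b(2)]] by simp
  ultimately have 2: "eqm deg_out P M (\<lambda>v. g (g' (dout P v))) (\<lambda>v. dout M (g (g' v)))"
    using eqm_trans[OF wM] by blast
  have "eqm 0 P P (\<lambda>v. f' (f (g (g' v)))) (\<lambda>v. f' (g' v))"
    using eqm_post[OF eqm_pre[OF a(6) bmD(2)[OF b(2)]] bmD(2)[OF b(1)]] by simp
  then have 3: "eqm 0 P P (\<lambda>v. f' (f (g (g' v)))) (\<lambda>v. v)" using b(6) eqm_trans[OF wP] by blast
  have gh: "gm (- deg_out) M N (\<lambda>v. h' (f v))" using gm_comp[OF bmD(2)[OF a(1)] bmD(2)[OF b(3)]] by simp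
  have gh': "gm (- deg_out) N M (\<lambda>v. g (h' v))" using gm_comp[OF bmD(2)[OF b(3)] bmD(2)[OF a(2)]] by simp
  have "eqm 0 M M (\<lambda>v. g (g' (f' (f v)))) (\<lambda>v. g (f v + (dout N (h' (f v)) + h' (dout N (f v)))))"
    using eqm_post[OF eqm_pre[OF b(7) bmD(2)[OF a(1)]] bmD(2)[OF a(2)]] by simp
  then have "eqm 0 M M (\<lambda>v. g (g' (f' (f v)))) (\<lambda>v. g (f v) + (g (dout N (h' (f v))) + g (h' (dout N (f v)))))"
    by (simp add: lin_add[OF bmD(3)[OF a(2)]])
  moreover have "eqm 0 M M (\<lambda>v. g (f v) + (g (dout N (h' (f v))) + g (h' (dout N (f v)))))
     (\<lambda>v. (v + (dout M (h v) + h (dout M v))) + (dout M (g (h' (f v))) + g (h' (f (dout M v)))))"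
    using eqm_pre[OF a(5) gh] eqm_sym[OF wM eqm_post[OF a(4) gh']]
    by (intro eqm_add wM a(7)) simp_all
  ultimately have "eqm 0 M M (\<lambda>v. g (g' (f' (f v))))
     (\<lambda>v. (v + (dout M (h v) + h (dout M v))) + (dout M (g (h' (f v))) + g (h' (f (dout M v)))))"
    using eqm_trans[OF wM] by blast
  then have 4: "eqm 0 M M (\<lambda>v. g (g' (f' (f v)))) (\<lambda>v. v + (dout M (?h v) + ?h (dout M v)))"
    by (simp add: lin_add[OF wfchD(3)[OF M]] algebra_simps)
  show ?thesis unfolding retr_def
    using M P bm_comp[OF a(1) b(1) _ wP] bm_comp[OF b(2) a(2) _ wM] bm_add[OF a(3) hb M] 1 2 3 4
    by (intro conjI exI[of _ "\<lambda>v. f' (f v)"] exI[of _ "\<lambda>v. g (g' v)"] exI[of _ ?h]) simp_all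
qed

subsection \<open>Retracts and composition\<close>

definition sgn_t :: "deg \<Rightarrow> rat" where "sgn_t d = (-1) powi \<lfloor>snd (snd d)\<rfloor>"

text \<open>Lowering t by 1 lowers its floor by 1, so the sign alternates also for half-integer t.
  It does not see \<open>deg_x\<close>, which makes signed operators compatible with
  balancing.\<close>

lemma sgn_t_simps [simp]: "sgn_t (d + deg_out) = - sgn_t d" "sgn_t (d - deg_out) = - sgn_t d"
  "sgn_t d * sgn_t d = 1" "sgn_t (d + deg_x) = sgn_t d" "sgn_t (d + - deg_out) = - sgn_t d"
proof -
  have p: "(-1) powi (k - 1) = - ((-1) powi k :: rat)" "(-1) powi (k + 1) = - ((-1) powi k :: rat)"
    "(-1) powi k * (-1) powi k = (1 :: rat)" for k
    by (auto simp: power_int_minus_left)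
  show "sgn_t (d + deg_out) = - sgn_t d" "sgn_t (d - deg_out) = - sgn_t d" "sgn_t (d + deg_x) = sgn_t d"
    "sgn_t d * sgn_t d = 1" "sgn_t (d + - deg_out) = - sgn_t d"
    using p by (cases d; simp add: sgn_t_def deg_out_def deg_x_def)+
qed

abbreviation over_mid :: "'a fbim_scheme \<Rightarrow> 'b fbim_scheme \<Rightarrow> ((vec \<Rightarrow> vec) \<times> (vec \<Rightarrow> vec)) set" where
  "over_mid M N \<equiv> {(xact M i, yact N i) | i. i \<in> {1, 2}}"

lemma comp_ch_sel:
  "fsp.truncate (M \<odot> N) = tens_over (over_mid M N) M N"
  "xact (M \<odot> N) i = tm (\<lambda>_. 1) 0 deg_x id (xact N i)"
  "yact (M \<odot> N) i = tm (\<lambda>_. 1) deg_x 0 (yact M i) id"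
  by (simp_all add: comp_ch_def fsp.defs fbim.defs fch.defs tmap_tm)

lemma trunc_tens_over [simp]: "fsp.truncate (tens_over S M N) = tens_over S M N"
  by (simp add: fsp.truncate_def)

lemma dout_comp_ch: "dout (M \<odot> N) =
   (\<lambda>v. tm (\<lambda>_. 1) deg_out 0 (dout M) id v + tm sgn_t 0 deg_out id (dout N) v)"
proof
  have "lin (dout (M \<odot> N))"
    unfolding comp_ch_def fsp.defs fbim.defs fch.defs fch.select_convs by (intro lins)
  then show "dout (M \<odot> N) v = tm (\<lambda>_. 1) deg_out 0 (dout M) id v + tm sgn_t 0 deg_out id (dout N) v" for v
    by (rule lin_ext)
       (auto intro!: lins split: lab.split simp: comp_ch_def fsp.defs fbim.defs fch.defs tm_def sgn_t_def)
qed

lemma sel_cong: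
  assumes "fsp.truncate M = M'"
  shows "piece M = piece M'" "rels M = rels M'" "filt M = filt M'"
  using assms by (auto simp: fsp.truncate_def)

lemma wfch_comp: "wfch M \<Longrightarrow> wfch N \<Longrightarrow> wfch (M \<odot> N)"
  unfolding wfch_def trunc_cong(4)[OF comp_ch_sel(1)[THEN trans, OF trunc_tens_over[symmetric]] refl]
  by (auto simp: sel_cong[OF comp_ch_sel(1)] comp_ch_sel(2,3) dout_comp_ch intro!: lins)

lemma comp_ch_trunc: "fsp.truncate (M \<odot> N) = fsp.truncate (tens_over (over_mid M N) M N)"
  by (simp add: comp_ch_sel)

lemmas comp_ch_cong = trunc_cong(1-3)[OF comp_ch_trunc comp_ch_trunc]

lemma eqm_eq: "(\<And>v. f v = g v) \<Longrightarrow> wfsp N \<Longrightarrow> eqm \<delta> M N f g"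
  by (simp add: eqm_def wfsp_def vec.subspace_0)

lemma bm_right:
  assumes f: "bm \<epsilon> N N' f" and s: "\<And>e. s (e + deg_x) = s e"
    and M: "wfch M" and N: "\<And>i. i \<in> {1,2} \<Longrightarrow> lin (xact N i)" "\<And>i. i \<in> {1,2} \<Longrightarrow> lin (xact N' i)"
  shows "bm \<epsilon> (M \<odot> N) (M \<odot> N') (tm s 0 \<epsilon> id f)"
  unfolding bm_def comp_ch_cong comp_ch_sel
proof (intro conjI ballI)
  note l = bmD(3)[OF f]
  show "fm \<epsilon> (tens_over (over_mid M N) M N) (tens_over (over_mid M N') M N') (tm s 0 \<epsilon> id f)"
  proof (rule fm_tm)
    fix g g' assume "(g, g') \<in> over_mid M N"
    then obtain i where i: "g = xact M i" "g' = yact N i" "i \<in> {1,2}" by blast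
    show "\<exists>g2 g2'. (g2, g2') \<in> over_mid M N' \<and> eqm (0 + deg_x) M M (\<lambda>v. id (g v)) (\<lambda>v. g2 (id v)) \<and>
        eqm (\<epsilon> + deg_x) N N' (\<lambda>v. f (g' v)) (\<lambda>v. g2' (f v))"
    proof (intro exI conjI)
      show "(xact M i, yact N' i) \<in> over_mid M N'" using i(3) by blast
    qed (use i bmD(5)[OF f i(3)] eqm_refl[OF wfchD(1)[OF M]] in simp_all)
  qed (use bmD(1)[OF f] s in simp_all)
  fix i :: nat assume i: "i \<in> {1,2}"
  have "eqm (\<epsilon> + deg_x) (tens_over (over_mid M N) M N) (tens_over (over_mid M N') M N')
     (tm s 0 (\<epsilon> + deg_x) id (\<lambda>v. f (xact N i v))) (tm s 0 (\<epsilon> + deg_x) id (\<lambda>v. xact N' i (f v)))"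
    by (rule eqm_tm_right[OF gm_id(3) bmD(4)[OF f i] lin_comp[OF l N(1)[OF i]] lin_comp[OF N(2)[OF i] l]]) simp
  then show "eqm (\<epsilon> + deg_x) (tens_over (over_mid M N) M N) (tens_over (over_mid M N') M N')
     (\<lambda>v. tm s 0 \<epsilon> id f (tm (\<lambda>_. 1) 0 deg_x id (xact N i) v))
     (\<lambda>v. tm (\<lambda>_. 1) 0 deg_x id (xact N' i) (tm s 0 \<epsilon> id f v))"
    using i by (simp add: tm_comp l lins N add.commute del: id_apply) (simp add: id_def)
  show "eqm (\<epsilon> + deg_x) (tens_over (over_mid M N) M N) (tens_over (over_mid M N') M N')
     (\<lambda>v. tm s 0 \<epsilon> id f (tm (\<lambda>_. 1) deg_x 0 (yact M i) id v))
     (\<lambda>v. tm (\<lambda>_. 1) deg_x 0 (yact M i) id (tm s 0 \<epsilon> id f v))"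
    using wfchD(5)[OF M i] by (intro eqm_eq) (simp_all add: tm_comp l lins s)
qed

lemma bm_left:
  assumes f: "bm \<epsilon> M M' f" and N: "wfch N"
    and M: "\<And>i. i \<in> {1,2} \<Longrightarrow> lin (yact M i)" "\<And>i. i \<in> {1,2} \<Longrightarrow> lin (yact M' i)"
  shows "bm \<epsilon> (M \<odot> N) (M' \<odot> N) (tm (\<lambda>_. 1) \<epsilon> 0 f id)"
  unfolding bm_def comp_ch_cong comp_ch_sel
proof (intro conjI ballI)
  note l = bmD(3)[OF f]
  show "fm \<epsilon> (tens_over (over_mid M N) M N) (tens_over (over_mid M' N) M' N) (tm (\<lambda>_. 1) \<epsilon> 0 f id)"
  proof (rule fm_tm)
    fix g g' assume "(g, g') \<in> over_mid M N"
    then obtain i where i: "g = xact M i" "g' = yact N i" "i \<in> {1,2}" by blast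
    show "\<exists>g2 g2'. (g2, g2') \<in> over_mid M' N \<and> eqm (\<epsilon> + deg_x) M M' (\<lambda>v. f (g v)) (\<lambda>v. g2 (f v)) \<and>
        eqm (0 + deg_x) N N (\<lambda>v. id (g' v)) (\<lambda>v. g2' (id v))"
    proof (intro exI conjI)
      show "(xact M' i, yact N i) \<in> over_mid M' N" using i(3) by blast
    qed (use i bmD(4)[OF f i(3)] eqm_refl[OF wfchD(1)[OF N]] in simp_all)
  qed (use bmD(1)[OF f] in simp_all)
  fix i :: nat assume i: "i \<in> {1,2}"
  have "eqm (\<epsilon> + deg_x) (tens_over (over_mid M N) M N) (tens_over (over_mid M' N) M' N)
     (tm (\<lambda>_. 1) (\<epsilon> + deg_x) 0 (\<lambda>v. f (yact M i v)) id) (tm (\<lambda>_. 1) (\<epsilon> + deg_x) 0 (\<lambda>v. yact M' i (f v)) id)"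
    by (rule eqm_tm_left[OF gm_id(3) bmD(5)[OF f i] lin_comp[OF l M(1)[OF i]] lin_comp[OF M(2)[OF i] l]]) simp
  then show "eqm (\<epsilon> + deg_x) (tens_over (over_mid M N) M N) (tens_over (over_mid M' N) M' N)
     (\<lambda>v. tm (\<lambda>_. 1) \<epsilon> 0 f id (tm (\<lambda>_. 1) deg_x 0 (yact M i) id v))
     (\<lambda>v. tm (\<lambda>_. 1) deg_x 0 (yact M' i) id (tm (\<lambda>_. 1) \<epsilon> 0 f id v))"
    using i by (simp add: tm_comp l lins M add.commute del: id_apply) (simp add: id_def)
  show "eqm (\<epsilon> + deg_x) (tens_over (over_mid M N) M N) (tens_over (over_mid M' N) M' N)
     (\<lambda>v. tm (\<lambda>_. 1) \<epsilon> 0 f id (tm (\<lambda>_. 1) 0 deg_x id (xact N i) v))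
     (\<lambda>v. tm (\<lambda>_. 1) 0 deg_x id (xact N i) (tm (\<lambda>_. 1) \<epsilon> 0 f id v))"
    using wfchD(4)[OF N i] by (intro eqm_eq) (simp_all add: tm_comp l lins)
qed

lemma retr_right:
  assumes NN: "retr N N'" and M: "wfch M"
  shows "retr (M \<odot> N) (M \<odot> N')"
proof -
  from NN obtain f g h where N: "wfch N" "wfch N'" and
    a: "bm 0 N N' f" "bm 0 N' N g" "bm (- deg_out) N N h"
     "eqm deg_out N N' (\<lambda>v. f (dout N v)) (\<lambda>v. dout N' (f v))"
     "eqm deg_out N' N (\<lambda>v. g (dout N' v)) (\<lambda>v. dout N (g v))"
     "eqm 0 N' N' (\<lambda>v. f (g v)) (\<lambda>v. v)"
     "eqm 0 N N (\<lambda>v. g (f v)) (\<lambda>v. v + (dout N (h v) + h (dout N v)))"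
    unfolding retr_def by blast
  note l = bmD(3)[OF a(1)] bmD(3)[OF a(2)] bmD(3)[OF a(3)] wfchD(3)[OF N(1)] wfchD(3)[OF N(2)] wfchD(3)[OF M]
  \<comment> \<open>The sign in \<open>?h\<close> makes it anticommute with the part of the
    differential that acts on \<open>M\<close>, so that the mixed terms cancel.\<close>
  let ?f = "tm (\<lambda>_. 1) 0 0 id f" and ?g = "tm (\<lambda>_. 1) 0 0 id g" and ?h = "tm sgn_t 0 (- deg_out) id h"
  let ?T = "tens_over (over_mid M N) M N" and ?T' = "tens_over (over_mid M N') M N'"
  have comm: "eqm deg_out (tens_over (over_mid M N1) M N1) (tens_over (over_mid M N2) M N2)
      (\<lambda>v. tm (\<lambda>_. 1) 0 0 id f (dout (M \<odot> N1) v)) (\<lambda>v. dout (M \<odot> N2) (tm (\<lambda>_. 1) 0 0 id f v))"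
    if e: "eqm deg_out N1 N2 (\<lambda>v. f (dout N1 v)) (\<lambda>v. dout N2 (f v))"
     and lf: "lin f" "lin (dout N1)" "lin (dout N2)" for f N1 N2
  proof -
    have "eqm deg_out (tens_over (over_mid M N1) M N1) (tens_over (over_mid M N2) M N2)
       (\<lambda>v. tm (\<lambda>_. 1) deg_out 0 (dout M) f v + tm sgn_t 0 deg_out id (\<lambda>v. f (dout N1 v)) v)
       (\<lambda>v. tm (\<lambda>_. 1) deg_out 0 (dout M) f v + tm sgn_t 0 deg_out id (\<lambda>v. dout N2 (f v)) v)"
      using e lf by (intro eqm_add eqm_refl eqm_tm_right[where \<delta> = 0]) (auto intro: lin_comp)
    then show ?thesis
      using lf l by (simp add: dout_comp_ch lin_add lins tm_comp) (simp add: id_def)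
  qed
  have 1: "bm 0 (M \<odot> N) (M \<odot> N') ?f" "bm 0 (M \<odot> N') (M \<odot> N) ?g" "bm (- deg_out) (M \<odot> N) (M \<odot> N) ?h"
    by (intro bm_right a M wfchD(4)[OF N(1)] wfchD(4)[OF N(2)] sgn_t_simps refl | assumption)+
  have 2: "eqm deg_out (M \<odot> N) (M \<odot> N') (\<lambda>v. ?f (dout (M \<odot> N) v)) (\<lambda>v. dout (M \<odot> N') (?f v))"
    "eqm deg_out (M \<odot> N') (M \<odot> N) (\<lambda>v. ?g (dout (M \<odot> N') v)) (\<lambda>v. dout (M \<odot> N) (?g v))"
    unfolding comp_ch_cong by (intro comm a l)+
  have 3: "eqm 0 (M \<odot> N') (M \<odot> N') (\<lambda>v. ?f (?g v)) (\<lambda>v. v)"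
    unfolding comp_ch_cong
  proof (rule eqm_tensI)
    fix e e' v w assume "v \<in> piece M e" "w \<in> piece N' e'"
    then have "tn e e' v (f (g w) - w) \<in> rels ?T' (e + e' + 0)"
      using eqm0D[OF a(6)] by (intro tn_rels(2)) auto
    then show "?f (?g (tn e e' v w)) - tn e e' v w \<in> rels ?T' (e + e' + 0)"
      using l by (simp add: tm_tn lins tn_simps)
  qed (auto intro!: lins)
  have 4: "eqm 0 (M \<odot> N) (M \<odot> N) (\<lambda>v. ?g (?f v)) (\<lambda>v. v + (dout (M \<odot> N) (?h v) + ?h (dout (M \<odot> N) v)))"
    unfolding comp_ch_cong
  proof (rule eqm_tensI)
    fix e e' v w assume "v \<in> piece M e" "w \<in> piece N e'"
    then have "tn e e' v (g (f w) - (w + (dout N (h w) + h (dout N w)))) \<in> rels ?T (e + e' + 0)"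
      using eqm0D[OF a(7)] by (intro tn_rels(2)) auto
    then show "?g (?f (tn e e' v w)) - (tn e e' v w + (dout (M \<odot> N) (?h (tn e e' v w)) +
        ?h (dout (M \<odot> N) (tn e e' v w)))) \<in> rels ?T (e + e' + 0)"
      using l by (simp add: tm_tn lins tn_simps dout_comp_ch lin_simps[OF lin_tm[OF lin_id(2)]] vec.scale_right_distrib)
  next
    show "lin (\<lambda>v. v + (dout (M \<odot> N) (?h v) + ?h (dout (M \<odot> N) v)))"
      unfolding dout_comp_ch by (intro lins)
  qed (auto intro!: lins)
  show ?thesis unfolding retr_def
    using wfch_comp[OF M N(1)] wfch_comp[OF M N(2)] 1 2 3 4
    by (intro conjI exI[of _ ?f] exI[of _ ?g] exI[of _ ?h])
qed

lemma retr_left: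
  assumes MM: "retr M M'" and N: "wfch N"
  shows "retr (M \<odot> N) (M' \<odot> N)"
proof -
  from MM obtain f g h where M: "wfch M" "wfch M'" and
    a: "bm 0 M M' f" "bm 0 M' M g" "bm (- deg_out) M M h"
     "eqm deg_out M M' (\<lambda>v. f (dout M v)) (\<lambda>v. dout M' (f v))"
     "eqm deg_out M' M (\<lambda>v. g (dout M' v)) (\<lambda>v. dout M (g v))"
     "eqm 0 M' M' (\<lambda>v. f (g v)) (\<lambda>v. v)"
     "eqm 0 M M (\<lambda>v. g (f v)) (\<lambda>v. v + (dout M (h v) + h (dout M v)))"
    unfolding retr_def by blast
  note l = bmD(3)[OF a(1)] bmD(3)[OF a(2)] bmD(3)[OF a(3)] wfchD(3)[OF M(1)] wfchD(3)[OF M(2)] wfchD(3)[OF N]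
  \<comment> \<open>Here \<open>?h\<close> carries no sign: \<open>h\<close> shifts t by one, so the
    sign in front of \<open>dout N\<close> already changes and the mixed terms cancel.\<close>
  let ?f = "tm (\<lambda>_. 1) 0 0 f id" and ?g = "tm (\<lambda>_. 1) 0 0 g id" and ?h = "tm (\<lambda>_. 1) (- deg_out) 0 h id"
  let ?T = "tens_over (over_mid M N) M N" and ?T' = "tens_over (over_mid M' N) M' N"
  have comm: "eqm deg_out (tens_over (over_mid M1 N) M1 N) (tens_over (over_mid M2 N) M2 N)
      (\<lambda>v. tm (\<lambda>_. 1) 0 0 f id (dout (M1 \<odot> N) v)) (\<lambda>v. dout (M2 \<odot> N) (tm (\<lambda>_. 1) 0 0 f id v))"
    if e: "eqm deg_out M1 M2 (\<lambda>v. f (dout M1 v)) (\<lambda>v. dout M2 (f v))"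
     and lf: "lin f" "lin (dout M1)" "lin (dout M2)" for f M1 M2
  proof -
    have "eqm deg_out (tens_over (over_mid M1 N) M1 N) (tens_over (over_mid M2 N) M2 N)
       (\<lambda>v. tm (\<lambda>_. 1) deg_out 0 (\<lambda>v. f (dout M1 v)) id v + tm sgn_t 0 deg_out f (dout N) v)
       (\<lambda>v. tm (\<lambda>_. 1) deg_out 0 (\<lambda>v. dout M2 (f v)) id v + tm sgn_t 0 deg_out f (dout N) v)"
      using e lf by (intro eqm_add eqm_refl eqm_tm_left[where \<epsilon> = 0]) (auto intro: lin_comp)
    then show ?thesis
      using lf l by (simp add: dout_comp_ch lin_add lins tm_comp) (simp add: id_def)
  qed
  have 1: "bm 0 (M \<odot> N) (M' \<odot> N) ?f" "bm 0 (M' \<odot> N) (M \<odot> N) ?g" "bm (- deg_out) (M \<odot> N) (M \<odot> N) ?h"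
    by (intro bm_left a N wfchD(5)[OF M(1)] wfchD(5)[OF M(2)] | assumption)+
  have 2: "eqm deg_out (M \<odot> N) (M' \<odot> N) (\<lambda>v. ?f (dout (M \<odot> N) v)) (\<lambda>v. dout (M' \<odot> N) (?f v))"
    "eqm deg_out (M' \<odot> N) (M \<odot> N) (\<lambda>v. ?g (dout (M' \<odot> N) v)) (\<lambda>v. dout (M \<odot> N) (?g v))"
    unfolding comp_ch_cong by (intro comm a l)+
  have 3: "eqm 0 (M' \<odot> N) (M' \<odot> N) (\<lambda>v. ?f (?g v)) (\<lambda>v. v)"
    unfolding comp_ch_cong
  proof (rule eqm_tensI)
    fix e e' v w assume "v \<in> piece M' e" "w \<in> piece N e'"
    then have "tn e e' (f (g v) - v) w \<in> rels ?T' (e + e' + 0)"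
      using eqm0D[OF a(6)] by (intro tn_rels(1)) auto
    then show "?f (?g (tn e e' v w)) - tn e e' v w \<in> rels ?T' (e + e' + 0)"
      using l by (simp add: tm_tn lins tn_simps)
  qed (auto intro!: lins)
  have 4: "eqm 0 (M \<odot> N) (M \<odot> N) (\<lambda>v. ?g (?f v)) (\<lambda>v. v + (dout (M \<odot> N) (?h v) + ?h (dout (M \<odot> N) v)))"
    unfolding comp_ch_cong
  proof (rule eqm_tensI)
    fix e e' v w assume "v \<in> piece M e" "w \<in> piece N e'"
    then have "tn e e' (g (f v) - (v + (dout M (h v) + h (dout M v)))) w \<in> rels ?T (e + e' + 0)"
      using eqm0D[OF a(7)] by (intro tn_rels(1)) auto
    then show "?g (?f (tn e e' v w)) - (tn e e' v w + (dout (M \<odot> N) (?h (tn e e' v w)) +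
        ?h (dout (M \<odot> N) (tn e e' v w)))) \<in> rels ?T (e + e' + 0)"
      using l by (simp add: tm_tn lins tn_simps dout_comp_ch lin_simps[OF lin_tm[OF lin_id(2)]] vec.scale_right_distrib)
  next
    show "lin (\<lambda>v. v + (dout (M \<odot> N) (?h v) + ?h (dout (M \<odot> N) v)))"
      unfolding dout_comp_ch by (intro lins)
  qed (auto intro!: lins)
  show ?thesis unfolding retr_def
    using wfch_comp[OF M(1) N] wfch_comp[OF M(2) N] 1 2 3 4
    by (intro conjI exI[of _ ?f] exI[of _ ?g] exI[of _ ?h])
qed

subsection \<open>Retracts and homology\<close>

definition over_kos :: "'a fbim_scheme \<Rightarrow> ((vec \<Rightarrow> vec) \<times> (vec \<Rightarrow> vec)) set" where
  "over_kos M = {(xact M i, xact koszul i) | i. i \<in> {1, 2}} \<union> {(yact M i, yact koszul i) | i. i \<in> {1, 2}}"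

abbreviation kos_tens :: "'a fbim_scheme \<Rightarrow> fsp" where
  "kos_tens M \<equiv> tens_over (over_kos M) M koszul"

definition H2 :: "fch \<Rightarrow> fsp" where
  "H2 M = homology deg_in (tm (\<lambda>_. 1) 0 deg_in id (kdiff koszul)) (kos_tens M)"

definition H3' :: "fch \<Rightarrow> fsp" where
  "H3' M = homology deg_out (tm (\<lambda>_. 1) deg_out 0 (dout M) id) (H2 M)"

lemma trunc_homology: "fsp.truncate (homology \<delta> D M) = homology \<delta> D (fsp.truncate M)"
  by (simp add: homology_def fsp.truncate_def Let_def)

lemma trunc_shift: "fsp.truncate (g \<triangleright> M) = g \<triangleright> fsp.truncate M"
  by (simp add: shift_def fsp.truncate_def Let_def)

lemma homology_shift: "homology \<delta> D (g \<triangleright> (M :: fsp)) = g \<triangleright> homology \<delta> D M"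
proof -
  have e: "d + \<delta> - e = d - e + \<delta>" "d - \<delta> - e = d - e - \<delta>" for d e :: deg by (simp_all add: algebra_simps)
  show ?thesis by (simp add: homology_def Let_def shift_def e)
qed

text \<open>Shifts commute with both homologies, and the result depends only on the fields of
  \<open>fsp\<close> and the two differentials. This reduces the closure to \<open>H3'\<close>,
  which is free of record extensions.\<close>

lemma H3_trunc: "H_out (H_in (closure2 M)) = sh_ts ^ 2 \<triangleright> H3' M"
proof -
  have 1: "din (closure2 M) = tm (\<lambda>_. 1) 0 deg_in id (kdiff koszul)"
    "dout_dc (H_in (closure2 M)) = tm (\<lambda>_. 1) deg_out 0 (dout M) id"
    by (simp_all add: closure2_def derived_tens_I_def shift_def Let_def fsp.defs fdc.defs H_in_def homology_def tmap_tm)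
  have "fsp.truncate (derived_tens_I M) = kos_tens M"
    by (simp add: derived_tens_I_def fsp.defs fdc.defs over_kos_def)
  then have 2: "fsp.truncate (closure2 M) = sh_ts ^ 2 \<triangleright> kos_tens M"
    by (simp add: closure2_def trunc_shift)
  have 3: "fsp.truncate (H_in (closure2 M)) = sh_ts ^ 2 \<triangleright> H2 M"
    unfolding H_in_def trunc_homology 1 2 homology_shift H2_def ..
  show ?thesis
    unfolding H_out_def trunc_homology 1 3 homology_shift H3'_def ..
qed

lemma deg_diff_swap: "d + \<delta> - e = d - e + \<delta>" for d e :: deg
  by (simp add: algebra_simps)

lemma fm_shift: "fm \<delta> M N f \<Longrightarrow> fm \<delta> (g \<triangleright> M) (g \<triangleright> N) f"
  by (simp add: fm_def gm_def sel_shift deg_diff_swap)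

lemma eqm_shift: "eqm \<delta> M N f f' \<Longrightarrow> eqm \<delta> (g \<triangleright> M) (g \<triangleright> N) f f'"
  by (simp add: eqm_def sel_shift deg_diff_swap)

lemma wfsp_shift: "wfsp M \<Longrightarrow> wfsp (g \<triangleright> M)"
  by (simp add: wfsp_def sel_shift)

lemma eqvI:
  assumes "wfsp M" "wfsp N" "fm 0 M N f" "fm 0 N M g"
    "eqm 0 M M (\<lambda>v. g (f v)) (\<lambda>v. v)" "eqm 0 N N (\<lambda>v. f (g v)) (\<lambda>v. v)"
  shows "eqv M N"
  unfolding eqv_def by (intro conjI exI) (fact assms)+

lemma eqvE:
  assumes "eqv M N"
  obtains f g where "wfsp M" "wfsp N" "fm 0 M N f" "fm 0 N M g"
    "eqm 0 M M (\<lambda>v. g (f v)) (\<lambda>v. v)" "eqm 0 N N (\<lambda>v. f (g v)) (\<lambda>v. v)"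
  using assms unfolding eqv_def by (elim conjE exE)

lemma eqv_shift: "eqv M N \<Longrightarrow> eqv (g \<triangleright> M) (g \<triangleright> N)"
  by (elim eqvE, rule eqvI) (intro wfsp_shift fm_shift eqm_shift | assumption)+

lemma lin_kdiff: "lin (kdiff koszul)"
  by (auto simp: koszul_def fbim.defs fcx.defs intro!: lins)

lemma wf_H2: "wfsp (H2 M)" "vec.subspace (piece (H2 M) d)"
  unfolding H2_def by (intro wfsp_homology subspace_piece_homology wfsp_tens_over subspace_tens_over lins)+

lemma fm_kos:
  assumes f: "bm \<delta> M N f"
  shows "fm \<delta> (H2 M) (H2 N) (tm (\<lambda>_. 1) \<delta> 0 f id)"
  unfolding H2_def
proof (rule fm_homology)
  show "fm \<delta> (kos_tens M) (kos_tens N) (tm (\<lambda>_. 1) \<delta> 0 f id)"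
  proof (rule fm_tm)
    fix g g' assume "(g, g') \<in> over_kos M"
    then obtain i where i: "i \<in> {1,2}" and gg: "g = xact M i \<and> g' = xact koszul i \<or> g = yact M i \<and> g' = yact koszul i"
      unfolding over_kos_def by blast
    have e: "eqm (0 + deg_x) koszul koszul (\<lambda>v. id (g' v)) (\<lambda>v. g' (id v))"
      by (simp add: eqm_def rels_kos)
    have m: "(xact N i, xact koszul i) \<in> over_kos N" "(yact N i, yact koszul i) \<in> over_kos N"
      using i unfolding over_kos_def by blast+
    show "\<exists>g2 g2'. (g2, g2') \<in> over_kos N \<and> eqm (\<delta> + deg_x) M N (\<lambda>v. f (g v)) (\<lambda>v. g2 (f v)) \<and>
        eqm (0 + deg_x) koszul koszul (\<lambda>v. id (g' v)) (\<lambda>v. g2' (id v))"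
      using gg m e bmD(4,5)[OF f i] by blast
  qed (use bmD(1)[OF f] in simp_all)
  show "eqm (\<delta> + deg_in) (kos_tens M) (kos_tens N)
     (\<lambda>v. tm (\<lambda>_. 1) \<delta> 0 f id (tm (\<lambda>_. 1) 0 deg_in id (kdiff koszul) v))
     (\<lambda>v. tm (\<lambda>_. 1) 0 deg_in id (kdiff koszul) (tm (\<lambda>_. 1) \<delta> 0 f id v))"
    by (intro eqm_eq) (simp_all add: tm_comp bmD(3)[OF f] lins lin_kdiff)
qed simp

text \<open>The maps of a retract, tensored with the identity of the Koszul complex, commute with
  the inner differential, which lives on the other factor. They descend to inner homology and form a
  retract there for the outer differential.\<close>

lemma retr_H3':
  assumes MM: "retr M N" shows "eqv (H3' M) (H3' N)"
proof -
  from MM obtain f g h where w: "wfch M" "wfch N" and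
    a: "bm 0 M N f" "bm 0 N M g" "bm (- deg_out) M M h"
     "eqm deg_out M N (\<lambda>v. f (dout M v)) (\<lambda>v. dout N (f v))"
     "eqm deg_out N M (\<lambda>v. g (dout N v)) (\<lambda>v. dout M (g v))"
     "eqm 0 N N (\<lambda>v. f (g v)) (\<lambda>v. v)"
     "eqm 0 M M (\<lambda>v. g (f v)) (\<lambda>v. v + (dout M (h v) + h (dout M v)))"
    unfolding retr_def by blast
  note l = bmD(3)[OF a(1)] bmD(3)[OF a(2)] bmD(3)[OF a(3)] wfchD(3)[OF w(1)] wfchD(3)[OF w(2)]
  let ?f = "tm (\<lambda>_. 1) 0 0 f id" and ?g = "tm (\<lambda>_. 1) 0 0 g id" and ?h = "tm (\<lambda>_. 1) (- deg_out) 0 h id"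
  let ?D = "\<lambda>M. tm (\<lambda>_. 1) deg_out 0 (dout M) id"
  have comm: "eqm deg_out (H2 M1) (H2 M2) (\<lambda>v. tm (\<lambda>_. 1) 0 0 f id (?D M1 v)) (\<lambda>v. ?D M2 (tm (\<lambda>_. 1) 0 0 f id v))"
    if e: "eqm deg_out M1 M2 (\<lambda>v. f (dout M1 v)) (\<lambda>v. dout M2 (f v))"
     and lf: "lin f" "lin (dout M1)" "lin (dout M2)" for f M1 M2
    unfolding H2_def
  proof (rule eqm_homology)
    have "eqm deg_out (kos_tens M1) (kos_tens M2)
       (tm (\<lambda>_. 1) deg_out 0 (\<lambda>v. f (dout M1 v)) id) (tm (\<lambda>_. 1) deg_out 0 (\<lambda>v. dout M2 (f v)) id)"
      using e lf by (intro eqm_tm_left[where \<epsilon> = 0]) (auto intro: lin_comp)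
    then show "eqm deg_out (kos_tens M1) (kos_tens M2) (\<lambda>v. tm (\<lambda>_. 1) 0 0 f id (?D M1 v)) (\<lambda>v. ?D M2 (tm (\<lambda>_. 1) 0 0 f id v))"
      using lf by (simp add: lins tm_comp) (simp add: id_def)
  qed (auto intro!: lins)
  have 3: "eqm 0 (H2 N) (H2 N) (\<lambda>v. ?f (?g v)) (\<lambda>v. v)"
    unfolding H2_def
  proof (intro eqm_homology eqm_tensI)
    fix e e' v w assume "v \<in> piece N e" "w \<in> piece koszul e'"
    then have "tn e e' (f (g v) - v) w \<in> rels (kos_tens N) (e + e' + 0)"
      using eqm0D[OF a(6)] by (intro tn_rels(1)) auto
    then show "?f (?g (tn e e' v w)) - tn e e' v w \<in> rels (kos_tens N) (e + e' + 0)"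
      using l by (simp add: tm_tn lins tn_simps)
  qed (auto intro!: lins)
  have 4: "eqm 0 (H2 M) (H2 M) (\<lambda>v. ?g (?f v)) (\<lambda>v. v + (?D M (?h v) + ?h (?D M v)))"
    unfolding H2_def
  proof (intro eqm_homology eqm_tensI)
    fix e e' v w assume "v \<in> piece M e" "w \<in> piece koszul e'"
    then have "tn e e' (g (f v) - (v + (dout M (h v) + h (dout M v)))) w \<in> rels (kos_tens M) (e + e' + 0)"
      using eqm0D[OF a(7)] by (intro tn_rels(1)) auto
    then show "?g (?f (tn e e' v w)) - (tn e e' v w + (?D M (?h (tn e e' v w)) + ?h (?D M (tn e e' v w))))
       \<in> rels (kos_tens M) (e + e' + 0)"
      using l by (simp add: tm_tn lins tn_simps)
  qed (auto intro!: lins)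
  have "hretr deg_out (H2 M) (?D M) (H2 N) (?D N) ?f ?g ?h"
    unfolding hretr_def
    using fm_kos[OF a(1)] fm_kos[OF a(2)] fmD(1)[OF fm_kos[OF a(3)]] comm[OF a(4)] comm[OF a(5)] l 3 4 by simp
  then show ?thesis unfolding H3'_def by (rule hretr_eqv) (intro wf_H2 lins)+
qed

subsection \<open>Spaces with a homogeneous basis\<close>

text \<open>The spaces in which computations take place: the filtration is split by the level
  \<open>lv\<close> of each label, so that maps out of them are checked label by label.\<close>

definition based :: "'a fsp_scheme \<Rightarrow> lab set \<Rightarrow> (lab \<Rightarrow> deg) \<Rightarrow> (lab \<Rightarrow> rat) \<Rightarrow> bool" where
  "based M L dg lv \<longleftrightarrow> (\<forall>d. piece M d = sp {l \<in> L. dg l = d}) \<and> (\<forall>d. rels M d = {0}) \<and>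
     (\<forall>i d. filt M i d = sp {l \<in> L. dg l = d \<and> i \<le> lv l})"

lemma basedD: assumes "based M L dg lv"
  shows "piece M d = sp {l \<in> L. dg l = d}" "rels M d = {0}" "filt M i d = sp {l \<in> L. dg l = d \<and> i \<le> lv l}"
  using assms by (auto simp: based_def)

lemma sp_mono: "A \<subseteq> B \<Longrightarrow> v \<in> sp A \<Longrightarrow> v \<in> sp B"
  by (auto simp: sp_def)

lemma sp_0 [simp]: "0 \<in> sp A" by (simp add: sp_def)

lemma wfsp_based: "based M L dg lv \<Longrightarrow> wfsp M"
  by (auto simp: wfsp_def basedD vec.subspace_single_0)

lemma subspace_based: "based M L dg lv \<Longrightarrow> vec.subspace (piece M d)"
  by (simp add: basedD)

lemma gm_based:
  assumes "based M L dg lv" "lin f" "wfsp N" "\<And>d. vec.subspace (piece N d)"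
    "\<And>l. l \<in> L \<Longrightarrow> f (bv l) \<in> piece N (dg l + \<delta>)"
  shows "gm \<delta> M N f"
  unfolding gm_def basedD[OF assms(1)]
proof (intro conjI allI ballI)
  show "f v \<in> piece N (d + \<delta>)" if "v \<in> sp {l \<in> L. dg l = d}" for v d
    by (rule lin_sp[OF assms(2,4) _ that]) (use assms(5) in blast)
  show "f v \<in> rels N (d + \<delta>)" if "v \<in> {0}" for v d
    using that assms(2) wfspD(1)[OF assms(3)] by (simp add: lin_0 vec.subspace_0)
qed fact

lemma fm_based:
  assumes "based M L dg lv" "gm \<delta> M N f" "wfsp N"
    "\<And>l i. l \<in> L \<Longrightarrow> i \<le> lv l \<Longrightarrow> f (bv l) \<in> filt N i (dg l + \<delta>)"
  shows "fm \<delta> M N f"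
  unfolding fm_def basedD[OF assms(1)]
proof (intro conjI allI ballI)
  show "f v \<in> filt N i (d + \<delta>)" if "v \<in> sp {l \<in> L. dg l = d \<and> i \<le> lv l}" for v i d
    by (rule lin_sp[OF gmD(1)[OF assms(2)] wfspD(2)[OF assms(3)] _ that]) (use assms(4) in blast)
qed fact

lemma fm_based2:
  assumes "based M L dg lv" "based N L' dg' lv'" "lin f"
    "\<And>l. l \<in> L \<Longrightarrow> f (bv l) \<in> sp {m \<in> L'. dg' m = dg l + \<delta> \<and> lv l \<le> lv' m}"
  shows "fm \<delta> M N f"
proof (rule fm_based[OF assms(1) gm_based[OF assms(1,3)]])
  show "f (bv l) \<in> piece N (dg l + \<delta>)" if "l \<in> L" for l
    unfolding basedD[OF assms(2)] by (rule sp_mono[OF _ assms(4)[OF that]]) blast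
  show "f (bv l) \<in> filt N i (dg l + \<delta>)" if "l \<in> L" "i \<le> lv l" for l i
    unfolding basedD[OF assms(2)] by (rule sp_mono[OF _ assms(4)[OF that(1)]]) (use that in auto)
qed (use assms wfsp_based subspace_based in blast)+

lemma eqm_based:
  assumes "based M L dg lv" "lin f" "lin g" "wfsp N"
    "\<And>l. l \<in> L \<Longrightarrow> f (bv l) - g (bv l) \<in> rels N (dg l + \<delta>)"
  shows "eqm \<delta> M N f g"
  unfolding eqm_def basedD[OF assms(1)]
proof (intro allI ballI)
  show "f v - g v \<in> rels N (d + \<delta>)" if "v \<in> sp {l \<in> L. dg l = d}" for v d
    by (rule lin_sp[OF lin_minus[OF assms(2,3)] wfspD(1)[OF assms(4)] _ that]) (use assms(5) in blast)
qed

lemma eqm_based_eq: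
  assumes "based M L dg lv" "lin f" "lin g" "wfsp N" "\<And>l. l \<in> L \<Longrightarrow> f (bv l) = g (bv l)"
  shows "eqm \<delta> M N f g"
  by (rule eqm_based[OF assms(1-4)]) (simp add: assms(5) vec.subspace_0 wfspD(1)[OF assms(4)])

lemma lin2_sp:
  assumes "\<And>w. lin (\<lambda>v. F v w)" "\<And>v. lin (F v)" "vec.subspace U"
    "\<And>k l. k \<in> A \<Longrightarrow> l \<in> B \<Longrightarrow> F (bv k) (bv l) \<in> U" "v \<in> sp A" "w \<in> sp B"
  shows "F v w \<in> U"
  by (rule lin_sp[OF assms(1,3) _ assms(5)], rule lin_sp[OF assms(2,3) _ assms(6)], rule assms(4))

lemma fm_tens_based:
  assumes M: "based M L dg lv" and N: "based N L' dg' lv'" and F: "lin F"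
    and P: "\<And>d. vec.subspace (piece P d)" "wfsp P"
    and 1: "\<And>k l. k \<in> L \<Longrightarrow> l \<in> L' \<Longrightarrow> F (bv (Tn (dg k) (dg' l) k l)) \<in> piece P (dg k + dg' l + \<delta>)"
    and S: "\<And>f g. (f, g) \<in> S \<Longrightarrow> lin f \<and> lin g"
    and 2: "\<And>k l f g. (f, g) \<in> S \<Longrightarrow> k \<in> L \<Longrightarrow> l \<in> L' \<Longrightarrow>
       F (tn (dg k + deg_x) (dg' l) (f (bv k)) (bv l)) - F (tn (dg k) (dg' l + deg_x) (bv k) (g (bv l)))
         \<in> rels P (dg k + dg' l + deg_x + \<delta>)"
    and 3: "\<And>k l i. k \<in> L \<Longrightarrow> l \<in> L' \<Longrightarrow> i \<le> lv k + lv' l \<Longrightarrow>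
       F (bv (Tn (dg k) (dg' l) k l)) \<in> filt P i (dg k + dg' l + \<delta>)"
  shows "fm \<delta> (tens_over S M N) P F"
proof -
  note w = wfspD[OF P(2)] and F' = lin_comp[OF F]
  have lf: "lin (\<lambda>x. tn e e' (f x) y)" if "lin f" for e e' f y using that by (rule lin_tn_left)
  have lt: "lin (\<lambda>v. F (tn e e' v w))" "lin (\<lambda>w. F (tn e e' v w))" for e e' v w
    by (rule F', intro lins)+
  have "gm \<delta> (tens_over S M N) P F"
  proof (rule gm_tensI[OF F P])
    fix e e' v w
    {
      assume "v \<in> piece M e" "w \<in> piece N e'"
      then show "F (tn e e' v w) \<in> piece P (e + e' + \<delta>)"
        unfolding basedD[OF M] basedD[OF N]
        by (rule lin2_sp[OF lt P(1), rotated]) (use 1 in force)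
    next
      assume "v \<in> rels M e" then show "F (tn e e' v w) \<in> rels P (e + e' + \<delta>)"
        using w(1) F by (auto simp: basedD[OF M] tn_simps lin_0 vec.subspace_0)
    next
      assume "w \<in> rels N e'" then show "F (tn e e' v w) \<in> rels P (e + e' + \<delta>)"
        using w(1) F by (auto simp: basedD[OF N] tn_simps lin_0 vec.subspace_0)
    next
      fix f g assume a: "(f, g) \<in> S" "v \<in> piece M e" "w \<in> piece N e'"
      note l = S[OF a(1), THEN conjunct1] S[OF a(1), THEN conjunct2]
      have ll: "lin (\<lambda>v. F (tn (e + deg_x) e' (f v) w) - F (tn e (e' + deg_x) v (g w)))"
        "lin (\<lambda>w. F (tn (e + deg_x) e' (f v) w) - F (tn e (e' + deg_x) v (g w)))" for v w
        by (intro lins F' l)+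
      show "F (tn (e + deg_x) e' (f v) w) - F (tn e (e' + deg_x) v (g w)) \<in> rels P (e + e' + deg_x + \<delta>)"
        using a(2,3) unfolding basedD[OF M] basedD[OF N]
        by (rule lin2_sp[OF ll w(1), rotated]) (use 2[OF a(1)] in force)
    }
  qed
  then show ?thesis
  proof (rule fm_tensI[OF _ P(2)])
    show "F (tn e e' v w) \<in> filt P (j + j') (e + e' + \<delta>)" if "v \<in> filt M j e" "w \<in> filt N j' e'" for e e' v w j j'
      using that unfolding basedD[OF M] basedD[OF N]
      by (rule lin2_sp[OF lt w(2), rotated]) (auto intro!: 3)
  qed
qed

lemma eqm_tens_based:
  assumes M: "based M L dg lv" and N: "based N L' dg' lv'" and F: "lin F" and G: "lin G" and P: "wfsp P"
    and 1: "\<And>k l. k \<in> L \<Longrightarrow> l \<in> L' \<Longrightarrow> F (bv (Tn (dg k) (dg' l) k l)) - G (bv (Tn (dg k) (dg' l) k l))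
        \<in> rels P (dg k + dg' l + \<delta>)"
  shows "eqm \<delta> (tens_over S M N) P F G"
proof (rule eqm_tensI[OF F G P])
  fix e e' v w assume a: "v \<in> piece M e" "w \<in> piece N e'"
  have ll: "lin (\<lambda>v. F (tn e e' v w) - G (tn e e' v w))" "lin (\<lambda>w. F (tn e e' v w) - G (tn e e' v w))" for v w
    by (intro lins lin_comp[OF F] lin_comp[OF G])+
  show "F (tn e e' v w) - G (tn e e' v w) \<in> rels P (e + e' + \<delta>)"
    using a unfolding basedD[OF M] basedD[OF N]
    by (rule lin2_sp[OF ll wfspD(1)[OF P], rotated]) (use 1 in force)
qed

text \<open>Recovers x_1 = (x_+ - x_-)/2 and x_2 = (x_+ + x_-)/2 from the operators of x_+ and x_-,
  and likewise y_1 and y_2.\<close>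

definition half :: "(vec \<Rightarrow> vec) \<Rightarrow> (vec \<Rightarrow> vec) \<Rightarrow> nat \<Rightarrow> vec \<Rightarrow> vec" where
  "half P Q i v = scl (1 / 2) (P v + scl (if i = 1 then - 1 else 1) (Q v))"

lemma lin_half [lins]: "lin P \<Longrightarrow> lin Q \<Longrightarrow> lin g \<Longrightarrow> lin (\<lambda>v. half P Q i (g v))"
  unfolding half_def by (intro lins lin_comp[of P g] lin_comp[of Q g])

lemma half_mem: "vec.subspace S \<Longrightarrow> P v \<in> S \<Longrightarrow> Q v \<in> S \<Longrightarrow> half P Q i v \<in> S"
  unfolding half_def by (intro vec.subspace_scale vec.subspace_add)

lemma eqm_half:
  assumes N: "wfsp N" and f: "lin f" and P: "eqm \<eta> M N (\<lambda>v. f (P v)) (\<lambda>v. P' (f v))"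
    and Q: "eqm \<eta> M N (\<lambda>v. f (Q v)) (\<lambda>v. Q' (f v))"
  shows "eqm \<eta> M N (\<lambda>v. f (half P Q i v)) (\<lambda>v. half P' Q' i (f v))"
  unfolding eqm_def
proof (intro allI ballI)
  fix d v assume v: "v \<in> piece M d"
  let ?c = "if i = 1 then - 1 else 1 :: rat"
  note w = wfspD(1)[OF N]
  have "scl (1/2) ((f (P v) - P' (f v)) + scl ?c (f (Q v) - Q' (f v))) \<in> rels N (d + \<eta>)"
    by (intro vec.subspace_scale[OF w] vec.subspace_add[OF w] eqmD[OF P v] eqmD[OF Q v])
  then show "f (half P Q i v) - half P' Q' i (f v) \<in> rels N (d + \<eta>)"
    by (simp add: half_def lin_simps[OF f] vec.scale_right_distrib vec.scale_right_diff_distrib algebra_simps)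
qed

subsection \<open>The reduced complexes\<close>

text \<open>In the complex \<open>T k\<close> below, the outer position \<open>p\<close> is \<open>I\<close> for \<open>p = 0\<close>, \<open>B\<close> for odd \<open>p\<close> and
  \<open>B\<^sup>t\<^sup>w\<close> for even \<open>p > 0\<close>. The label \<open>L4 p e i j\<close> stands for
  \<open>(y\<^sub>- - eps p x\<^sub>-)\<^sup>e x\<^sub>-\<^sup>i x\<^sub>+\<^sup>j\<close> in position \<open>p > 0\<close>. The generator of \<open>I\<close> is given \<open>e = 1\<close>, which makes
  the formulas for \<open>y\<^sub>-\<close> and for the differential uniform in \<open>p\<close>.\<close>

definition L4 :: "nat \<Rightarrow> nat \<Rightarrow> nat \<Rightarrow> nat \<Rightarrow> lab" where
  "L4 p e i j = In p (In e (In i (In j (Mono 0))))"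

fun q4 :: "lab \<Rightarrow> (nat \<times> nat \<times> nat \<times> nat) option" where
  "q4 (In p (In e (In i (In j (Mono m))))) = (if m = 0 then Some (p, e, i, j) else None)"
| "q4 _ = None"

lemma q4_L4 [simp]: "q4 (L4 p e i j) = Some (p, e, i, j)"
  by (simp add: L4_def)

lemma q4_Some: "q4 l = Some (p, e, i, j) \<longleftrightarrow> l = L4 p e i j"
  by (cases l rule: q4.cases) (auto simp: L4_def)

lemma L4_inj [simp]: "L4 p e i j = L4 p' e' i' j' \<longleftrightarrow> p = p' \<and> e = e' \<and> i = i' \<and> j = j'"
  by (simp add: L4_def)

abbreviation lb :: "nat \<Rightarrow> nat \<Rightarrow> nat \<Rightarrow> nat \<Rightarrow> vec" where
  "lb p e i j \<equiv> bv (L4 p e i j)"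

definition opl :: "(nat \<Rightarrow> nat \<Rightarrow> nat \<Rightarrow> nat \<Rightarrow> vec) \<Rightarrow> vec \<Rightarrow> vec" where
  "opl F = lift (\<lambda>l. case q4 l of Some (p, e, i, j) \<Rightarrow> F p e i j | None \<Rightarrow> 0)"

lemma lin_opl [lins]: "lin g \<Longrightarrow> lin (\<lambda>v. opl F (g v))"
  unfolding opl_def by (intro lins)

lemma opl_bv: "opl F (bv l) = (case q4 l of Some (p, e, i, j) \<Rightarrow> F p e i j | None \<Rightarrow> 0)"
  by (simp add: opl_def)

lemma opl_lb [simp]: "opl F (lb p e i j) = F p e i j"
  by (simp add: opl_bv)

lemmas opl_simps = lin_simps[OF lin_opl[OF lin_id(2)]]

definition inop :: "(nat \<Rightarrow> vec \<Rightarrow> vec) \<Rightarrow> vec \<Rightarrow> vec" where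
  "inop F = lift (\<lambda>l. case l of In c l' \<Rightarrow> F c (bv l') | _ \<Rightarrow> 0)"

lemma lin_inop [lins]: "lin g \<Longrightarrow> lin (\<lambda>v. inop F (g v))"
  unfolding inop_def by (intro lins)

lemma inop_bv [simp]: "inop F (bv (In c l)) = F c (bv l)"
  by (simp add: inop_def)

lemma inop_incl: "lin (F c) \<Longrightarrow> inop F (incl c v) = F c v"
  by (rule lin_ext[where f = "\<lambda>v. inop F (incl c v)"]) (auto intro!: lins)

lemmas inop_simps = lin_simps[OF lin_inop[OF lin_id(2)]]
lemmas incl_simps = lin_simps[OF lin_incl[OF lin_id(2)]]

text \<open>The value is 1 for B and -1 for B^tw. At position 0 the value -1 fits I: its labels have
  e = 1, and y_- acts on such a label as \<open>- eps p\<close> times x_-, that is as x_-.\<close>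

definition eps :: "nat \<Rightarrow> rat" where "eps p = (if odd p then 1 else - 1)"

lemma eps_simps [simp]: "eps 0 = -1" "eps (Suc p) = - eps p" "eps p * eps p = 1"
  by (auto simp: eps_def)

definition Xm :: "vec \<Rightarrow> vec" where "Xm = opl (\<lambda>p e i j. lb p e (Suc i) j)"
definition Xp :: "vec \<Rightarrow> vec" where "Xp = opl (\<lambda>p e i j. lb p e i (Suc j))"
text \<open>Division with remainder by y_- - eps x_-: for e = 0 this is y_- = (y_- - eps x_-) + eps
  x_-, for e = 1 the relation (y_- + eps x_-)(y_- - eps x_-) = 0.\<close>

definition Ym :: "vec \<Rightarrow> vec" where
  "Ym = opl (\<lambda>p e i j. if e = 0 then lb p 1 i j + scl (eps p) (lb p 0 (Suc i) j)
     else scl (- eps p) (lb p e (Suc i) j))"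
text \<open>The generator of a position goes to the generator of F^1 one position lower, or to that
  of I. The signs alternate, so y_- - eps x_- of the upper position kills this image, which is why
  labels with e = 1 go to 0.\<close>

definition dT :: "vec \<Rightarrow> vec" where
  "dT = opl (\<lambda>p e i j. if e = 0 \<and> p > 0 then lb (p - 1) 1 i j else 0)"

lemma lin_XYd [lins]: assumes "lin g"
  shows "lin (\<lambda>v. Xm (g v))" "lin (\<lambda>v. Xp (g v))" "lin (\<lambda>v. Ym (g v))" "lin (\<lambda>v. dT (g v))"
  unfolding Xm_def Xp_def Ym_def dT_def using assms by (intro lins; assumption)+

lemmas XYd_simps = lin_XYd[OF lin_id(2), THEN lin_add] lin_XYd[OF lin_id(2), THEN lin_scl]
   lin_XYd[OF lin_id(2), THEN lin_uminus] lin_XYd[OF lin_id(2), THEN lin_0] lin_XYd[OF lin_id(2), THEN lin_diff]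

lemma XYd_lb [simp]: "Xm (lb p e i j) = lb p e (Suc i) j" "Xp (lb p e i j) = lb p e i (Suc j)"
  "Ym (lb p 0 i j) = lb p 1 i j + scl (eps p) (lb p 0 (Suc i) j)"
  "e \<noteq> 0 \<Longrightarrow> Ym (lb p e i j) = scl (- eps p) (lb p e (Suc i) j)"
  "dT (lb (Suc p) 0 i j) = lb p 1 i j" "e \<noteq> 0 \<Longrightarrow> dT (lb p e i j) = 0" "dT (lb 0 e i j) = 0"
  by (simp_all add: Xm_def Xp_def Ym_def dT_def)

lemma opl_ext:
  assumes "lin f" "lin g" "\<And>p e i j. f (lb p e i j) = g (lb p e i j)"
    "\<And>l. q4 l = None \<Longrightarrow> f (bv l) = g (bv l)"
  shows "f v = g v"
proof (rule lin_ext[OF assms(1,2)])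
  fix l show "f (bv l) = g (bv l)"
  proof (cases "q4 l")
    case None then show ?thesis by (rule assms(4))
  next
    case (Some a)
    then show ?thesis using assms(3) q4_Some by (cases a) auto
  qed
qed

lemma XYd_None [simp]: assumes "q4 l = None"
  shows "Xm (bv l) = 0" "Xp (bv l) = 0" "Ym (bv l) = 0" "dT (bv l) = 0"
  by (simp_all add: Xm_def Xp_def Ym_def dT_def opl_bv assms)

lemma XY_comm: "Xm (Xp v) = Xp (Xm v)" "Ym (Xm v) = Xm (Ym v)" "Ym (Xp v) = Xp (Ym v)"
  "Ym (Ym v) = Xm (Xm v)"
proof -
  have e: "e = 0 \<or> e \<noteq> 0" for e :: nat by blast
  show "Xm (Xp v) = Xp (Xm v)"
    by (rule opl_ext[where f = "\<lambda>v. Xm (Xp v)" and g = "\<lambda>v. Xp (Xm v)"]) (intro lins | simp add: XYd_simps)+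
  show "Ym (Xm v) = Xm (Ym v)"
  proof (rule opl_ext[where f = "\<lambda>v. Ym (Xm v)" and g = "\<lambda>v. Xm (Ym v)"])
    show "Ym (Xm (lb p e i j)) = Xm (Ym (lb p e i j))" for p e i j
      by (cases "e = 0") (simp_all add: XYd_simps)
  qed (intro lins | simp add: XYd_simps)+
  show "Ym (Xp v) = Xp (Ym v)"
  proof (rule opl_ext[where f = "\<lambda>v. Ym (Xp v)" and g = "\<lambda>v. Xp (Ym v)"])
    show "Ym (Xp (lb p e i j)) = Xp (Ym (lb p e i j))" for p e i j
      by (cases "e = 0") (simp_all add: XYd_simps)
  qed (intro lins | simp add: XYd_simps)+
  show "Ym (Ym v) = Xm (Xm v)"
  proof (rule opl_ext[where f = "\<lambda>v. Ym (Ym v)" and g = "\<lambda>v. Xm (Xm v)"])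
    show "Ym (Ym (lb p e i j)) = Xm (Xm (lb p e i j))" for p e i j
      by (cases "e = 0") (simp_all add: XYd_simps vec.scale_right_distrib)
  qed (intro lins | simp add: XYd_simps)+
qed

definition LT :: "nat \<Rightarrow> lab set" where
  "LT k = {L4 p e i j | p e i j. p \<le> k \<and> e \<le> 1 \<and> (p = 0 \<longrightarrow> e = 1)}"

text \<open>Position p carries t_a^p s_q^(p-1), the whole complex the shift (t_s a_q)^(-k), and the
  factor y_- - eps x_- one more q^2 and, in \<open>lvT\<close>, one more filtration step. At p = 0
  the summand -1 and e = 1 cancel.\<close>

definition dgT :: "nat \<Rightarrow> lab \<Rightarrow> deg" where
  "dgT k l = (case q4 l of Some (p, e, i, j) \<Rightarrow>
     (2 * (int p - 1 + int e + int i + int j - int k), int p - int k, of_nat p - of_nat k / 2) | None \<Rightarrow> 0)"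

definition lvT :: "nat \<Rightarrow> lab \<Rightarrow> rat" where
  "lvT k l = (case q4 l of Some (p, e, i, j) \<Rightarrow> of_nat p - 1 + of_nat e - of_nat k / 2 | None \<Rightarrow> 0)"

lemma LT_iff [simp]: "L4 p e i j \<in> LT k \<longleftrightarrow> p \<le> k \<and> e \<le> 1 \<and> (p = 0 \<longrightarrow> e = 1)"
  by (auto simp: LT_def)

lemma LT_cases [consumes 1]:
  assumes "l \<in> LT k"
  obtains i j where "l = L4 0 1 i j" | p i j where "p < k" "l = L4 (Suc p) 0 i j"
    | p i j where "p < k" "l = L4 (Suc p) 1 i j"
proof -
  from assms obtain p e i j where l: "l = L4 p e i j" "p \<le> k" "e \<le> 1" "p = 0 \<longrightarrow> e = 1" by (auto simp: LT_def)
  show ?thesis using l that by (cases p; cases "e = 0") (auto simp: Suc_le_eq le_Suc_eq)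
qed

lemma dgT_L4 [simp]: "dgT k (L4 p e i j) =
   (2 * (int p - 1 + int e + int i + int j - int k), int p - int k, of_nat p - of_nat k / 2)"
  by (simp add: dgT_def)

lemma lvT_L4 [simp]: "lvT k (L4 p e i j) = of_nat p - 1 + of_nat e - of_nat k / 2"
  by (simp add: lvT_def)

definition T :: "nat \<Rightarrow> fch" where
  "T k = \<lparr>piece = \<lambda>d. sp {l \<in> LT k. dgT k l = d}, rels = \<lambda>d. {0},
     filt = \<lambda>i d. sp {l \<in> LT k. dgT k l = d \<and> i \<le> lvT k l},
     xact = half Xp Xm, yact = half Xp Ym, dout = dT\<rparr>"

lemma based_T: "based (T k) (LT k) (dgT k) (lvT k)"
  by (simp add: based_def T_def)

lemma T_sel [simp]: "xact (T k) = half Xp Xm" "yact (T k) = half Xp Ym" "dout (T k) = dT"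
  by (simp_all add: T_def)

lemma wfch_T: "wfch (T k)"
  unfolding wfch_def T_sel
  by (intro conjI allI ballI wfsp_based[OF based_T] subspace_based[OF based_T] lins)

subsection \<open>Composition with an elementary braid, and its reduction\<close>

text \<open>\<open>K k\<close> is \<open>T 1 \<odot> T k\<close> written in terms of a basis of \<open>T 1\<close> over the polynomial ring acting from
  the right: the component \<open>c = 0, 1\<close> belongs to \<open>1\<close> and \<open>y\<^sub>- - x\<^sub>-\<close> in \<open>B\<close>, and \<open>c = 2\<close> to the generator of \<open>I\<close>.\<close>

definition KX :: "(vec \<Rightarrow> vec) \<Rightarrow> vec \<Rightarrow> vec" where
  "KX X = inop (\<lambda>c v. incl c (X v))"

text \<open>On 1 \<otimes> v one has y_- = (y_- - x_-) + x_-, on (y_- - x_-) \<otimes> v one has y_-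
  = -x_-, and the x_- of \<open>T 1\<close> is the y_- of \<open>T k\<close>. The second clause is
  the origin of the twist.\<close>

definition KY :: "vec \<Rightarrow> vec" where
  "KY = inop (\<lambda>c v. if c = 0 then incl 1 v + incl 0 (Ym v) else if c = 1 then - incl 1 (Ym v)
     else if c = 2 then incl 2 (Ym v) else 0)"

text \<open>The terms of \<open>T 1\<close> have t-degrees 1/2 and -1/2, whose floors are 0 and -1:
  hence \<open>dT\<close> has the sign + on B and - on I.\<close>

definition dK :: "vec \<Rightarrow> vec" where
  "dK = inop (\<lambda>c v. if c = 0 then incl 2 v + incl 0 (dT v) else if c = 1 then incl 1 (dT v)
     else if c = 2 then - incl 2 (dT v) else 0)"

definition LK :: "nat \<Rightarrow> lab set" where "LK k = {In c l | c l. c \<le> 2 \<and> l \<in> LT k}"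

definition genT :: "nat \<Rightarrow> lab" where
  "genT c = (if c = 0 then L4 1 0 0 0 else if c = 1 then L4 1 1 0 0 else L4 0 1 0 0)"

definition dgK :: "nat \<Rightarrow> lab \<Rightarrow> deg" where
  "dgK k l = (case l of In c l' \<Rightarrow> dgT 1 (genT c) + dgT k l' | _ \<Rightarrow> 0)"
definition lvK :: "nat \<Rightarrow> lab \<Rightarrow> rat" where
  "lvK k l = (case l of In c l' \<Rightarrow> lvT 1 (genT c) + lvT k l' | _ \<Rightarrow> 0)"

definition K :: "nat \<Rightarrow> fch" where
  "K k = \<lparr>piece = \<lambda>d. sp {l \<in> LK k. dgK k l = d}, rels = \<lambda>d. {0},
     filt = \<lambda>i d. sp {l \<in> LK k. dgK k l = d \<and> i \<le> lvK k l},
     xact = half (KX Xp) (KX Xm), yact = half (KX Xp) KY, dout = dK\<rparr>"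

lemma based_K: "based (K k) (LK k) (dgK k) (lvK k)"
  by (simp add: based_def K_def)

lemma K_sel [simp]: "xact (K k) = half (KX Xp) (KX Xm)" "yact (K k) = half (KX Xp) KY" "dout (K k) = dK"
  by (simp_all add: K_def)

lemma lin_K [lins]: assumes "lin g" shows "lin (\<lambda>v. KX X (g v))" "lin (\<lambda>v. KY (g v))" "lin (\<lambda>v. dK (g v))"
  unfolding KX_def KY_def dK_def using assms by (intro lins; assumption)+

lemma wfch_K: "wfch (K k)"
  unfolding wfch_def K_sel
  by (intro conjI allI ballI wfsp_based[OF based_K] subspace_based[OF based_K] lins)

lemma LK_cases [consumes 1]:
  assumes "l \<in> LK k" obtains c l' where "c \<in> {0,1,2}" "l = In c l'" "l' \<in> LT k"
proof -
  from assms obtain c l' where "l = In c l'" "c \<le> 2" "l' \<in> LT k" by (auto simp: LK_def)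
  moreover from this(2) have "c \<in> {0,1,2}" by auto
  ultimately show ?thesis using that by blast
qed

lemma LK_iff [simp]: "In c l \<in> LK k \<longleftrightarrow> c \<le> 2 \<and> l \<in> LT k" by (auto simp: LK_def)
lemma dgK_In [simp]: "dgK k (In c l) = dgT 1 (genT c) + dgT k l" by (simp add: dgK_def)
lemma lvK_In [simp]: "lvK k (In c l) = lvT 1 (genT c) + lvT k l" by (simp add: lvK_def)

lemma KX_incl: "lin X \<Longrightarrow> KX X (incl c v) = incl c (X v)"
  unfolding KX_def by (rule inop_incl) (rule lin_incl)

text \<open>Gaussian elimination: for \<open>p > 0\<close> the component \<open>c = 2\<close> (that is, \<open>I \<circ> T k\<close>) is cancelled against its
  copy in \<open>B \<circ> T k\<close>.\<close>

definition fK :: "vec \<Rightarrow> vec" where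
  "fK = inop (\<lambda>c. opl (\<lambda>p e i j. if c = 2 then scl ((-1) ^ p) (lb p e i j)
     else if c = 1 then scl ((-1) ^ (p + 1 + e)) (lb (Suc p) e i j)
     else if e = 1 then scl ((-1) ^ p) (lb (Suc p) 0 i j) else 0))"

text \<open>Passing to the twist changes the sign of y_- - eps x_-, whence (-1)^e. As
  \<open>dT\<close> lowers p and raises e by one, (-1)^(p+e) is compatible with the differential.
  Position 1 is B \<circ> I = B, which does not split and is kept whole.\<close>

definition gK :: "vec \<Rightarrow> vec" where
  "gK = opl (\<lambda>p e i j. if p = 0 then incl 2 (lb 0 e i j) else if p = 1 then incl e (lb 0 1 i j)
     else scl ((-1) ^ (p + e)) (incl 1 (lb (p - 1) e i j)))"

text \<open>Minus the bimodule section of B \<circ> N \<rightarrow> N that sends the generator to 1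
  \<otimes> 1. On a label with e = 1 it is y_- - eps x_- applied to this image, which produces the
  summand in component 1.\<close>

definition hK :: "vec \<Rightarrow> vec" where
  "hK = inop (\<lambda>c. opl (\<lambda>p e i j. if c = 2 \<and> p > 0 then
     (if e = 0 then - incl 0 (lb p 0 i j) else - (incl 1 (lb p 0 i j) + incl 0 (lb p 1 i j))) else 0))"

lemma lin_fghK [lins]: assumes "lin g" shows "lin (\<lambda>v. fK (g v))" "lin (\<lambda>v. gK (g v))" "lin (\<lambda>v. hK (g v))"
  unfolding fK_def gK_def hK_def using assms by (intro lins; assumption)+

lemma K_bv [simp]:
  "KX X (bv (In c l)) = incl c (X (bv l))"
  "KY (bv (In 0 l)) = bv (In 1 l) + incl 0 (Ym (bv l))" "KY (bv (In (Suc 0) l)) = - incl 1 (Ym (bv l))"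
  "KY (bv (In 2 l)) = incl 2 (Ym (bv l))"
  "dK (bv (In 0 l)) = bv (In 2 l) + incl 0 (dT (bv l))" "dK (bv (In (Suc 0) l)) = incl 1 (dT (bv l))"
  "dK (bv (In 2 l)) = - incl 2 (dT (bv l))"
  by (simp_all add: KX_def KY_def dK_def)

lemma fK_bv [simp]: "fK (bv (In 2 (L4 p e i j))) = scl ((-1) ^ p) (lb p e i j)"
  "fK (bv (In (Suc 0) (L4 p e i j))) = scl ((-1) ^ (p + 1 + e)) (lb (Suc p) e i j)"
  "fK (bv (In 0 (L4 p 0 i j))) = 0" "fK (bv (In 0 (L4 p (Suc 0) i j))) = scl ((-1) ^ p) (lb (Suc p) 0 i j)"
  by (simp_all add: fK_def)

lemma gK_bv [simp]: "gK (lb 0 e i j) = bv (In 2 (L4 0 e i j))" "gK (lb (Suc 0) e i j) = bv (In e (L4 0 1 i j))"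
  "gK (lb (Suc (Suc p)) e i j) = scl ((-1) ^ (p + e)) (bv (In 1 (L4 (Suc p) e i j)))"
  by (simp_all add: gK_def)

lemma hK_bv [simp]: "c \<noteq> 2 \<Longrightarrow> hK (bv (In c (L4 p e i j))) = 0" "hK (bv (In 2 (L4 0 e i j))) = 0"
  "hK (bv (In 2 (L4 (Suc p) 0 i j))) = - bv (In 0 (L4 (Suc p) 0 i j))"
  "hK (bv (In 2 (L4 (Suc p) (Suc 0) i j))) = - (bv (In 1 (L4 (Suc p) 0 i j)) + bv (In 0 (L4 (Suc p) 1 i j)))"
  by (simp_all add: hK_def)

lemma K_incl:
  "KY (incl 0 v) = incl 1 v + incl 0 (Ym v)" "KY (incl 1 v) = - incl 1 (Ym v)" "KY (incl 2 v) = incl 2 (Ym v)"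
  "dK (incl 0 v) = incl 2 v + incl 0 (dT v)" "dK (incl 1 v) = incl 1 (dT v)" "dK (incl 2 v) = - incl 2 (dT v)"
proof -
  show "KY (incl 0 v) = incl 1 v + incl 0 (Ym v)"
    by (rule lin_ext[of "\<lambda>v. KY (incl 0 v)" "\<lambda>v. incl 1 v + incl 0 (Ym v)"]; (intro lins)?) simp
  show "KY (incl 1 v) = - incl 1 (Ym v)"
    by (rule lin_ext[of "\<lambda>v. KY (incl 1 v)" "\<lambda>v. - incl 1 (Ym v)"]; (intro lins)?) simp
  show "KY (incl 2 v) = incl 2 (Ym v)"
    by (rule lin_ext[of "\<lambda>v. KY (incl 2 v)" "\<lambda>v. incl 2 (Ym v)"]; (intro lins)?) simp
  show "dK (incl 0 v) = incl 2 v + incl 0 (dT v)"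
    by (rule lin_ext[of "\<lambda>v. dK (incl 0 v)" "\<lambda>v. incl 2 v + incl 0 (dT v)"]; (intro lins)?) simp
  show "dK (incl 1 v) = incl 1 (dT v)"
    by (rule lin_ext[of "\<lambda>v. dK (incl 1 v)" "\<lambda>v. incl 1 (dT v)"]; (intro lins)?) simp
  show "dK (incl 2 v) = - incl 2 (dT v)"
    by (rule lin_ext[of "\<lambda>v. dK (incl 2 v)" "\<lambda>v. - incl 2 (dT v)"]; (intro lins)?) simp
qed

lemmas fghK_simps = lin_fghK[OF lin_id(2), THEN lin_add] lin_fghK[OF lin_id(2), THEN lin_scl]
   lin_fghK[OF lin_id(2), THEN lin_uminus] lin_fghK[OF lin_id(2), THEN lin_0] lin_fghK[OF lin_id(2), THEN lin_diff]
lemmas K_simps = lin_K[OF lin_id(2), THEN lin_add] lin_K[OF lin_id(2), THEN lin_scl]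
   lin_K[OF lin_id(2), THEN lin_uminus] lin_K[OF lin_id(2), THEN lin_0] lin_K[OF lin_id(2), THEN lin_diff]

lemmas all_simps = fghK_simps K_simps XYd_simps incl_simps vec.scale_right_distrib vec.scale_right_diff_distrib

lemma sp_ops: "v \<in> sp A \<Longrightarrow> w \<in> sp A \<Longrightarrow> v + w \<in> sp A" "v \<in> sp A \<Longrightarrow> scl c v \<in> sp A" "v \<in> sp A \<Longrightarrow> - v \<in> sp A"
  "v \<in> sp A \<Longrightarrow> w \<in> sp A \<Longrightarrow> v - w \<in> sp A"
  by (simp_all add: vec.subspace_add vec.subspace_scale vec.subspace_neg vec.subspace_diff)

lemma bm_halfI:
  assumes "fm \<delta> M N f" "wfsp N" "xact M = half P Q" "xact N = half P' Q'" "yact M = half P R" "yact N = half P' R'"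
    "eqm (\<delta> + deg_x) M N (\<lambda>v. f (P v)) (\<lambda>v. P' (f v))"
    "eqm (\<delta> + deg_x) M N (\<lambda>v. f (Q v)) (\<lambda>v. Q' (f v))"
    "eqm (\<delta> + deg_x) M N (\<lambda>v. f (R v)) (\<lambda>v. R' (f v))"
  shows "bm \<delta> M N f"
  unfolding bm_def assms(3-6)
  by (intro conjI ballI assms(1) eqm_half assms(2) gmD(1)[OF fmD(1)[OF assms(1)]] assms(7-9))

text \<open>Component 2 in positions p > 0 cancels against the image of the section. What is left is
  component 1 in positions p > 0, moved up by one position, together with B \<circ> I = B and I in
  positions 1 and 0.\<close>

lemma retr_K: "retr (K k) (T (Suc k))"
proof -
  note wK = wfsp_based[OF based_K] and wT = wfsp_based[OF based_T]
  note eqs = eqm_based_eq[OF based_K _ _ wT] eqm_based_eq[OF based_T _ _ wK] eqm_based_eq[OF based_T _ _ wT]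
     eqm_based_eq[OF based_K _ _ wK]
  have f: "bm 0 (K k) (T (Suc k)) fK"
  proof (rule bm_halfI[OF _ wT K_sel(1) T_sel(1) K_sel(2) T_sel(2)])
    show "fm 0 (K k) (T (Suc k)) fK"
    proof (rule fm_based2[OF based_K based_T])
      fix l assume "l \<in> LK k"
      then show "fK (bv l) \<in> sp {m \<in> LT (Suc k). dgT (Suc k) m = dgK k l + 0 \<and> lvK k l \<le> lvT (Suc k) m}"
        by (elim LK_cases LT_cases insertE) (auto simp: genT_def field_simps intro!: sp_ops)
    qed (intro lins)
  qed ((rule eqs; (intro lins)?), elim LK_cases LT_cases insertE; simp add: all_simps)+
  have g: "bm 0 (T (Suc k)) (K k) gK"
  proof (rule bm_halfI[OF _ wK T_sel(1) K_sel(1) T_sel(2) K_sel(2)])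
    show "fm 0 (T (Suc k)) (K k) gK"
    proof (rule fm_based2[OF based_T based_K])
      fix l assume "l \<in> LT (Suc k)"
      then show "gK (bv l) \<in> sp {m \<in> LK k. dgK k m = dgT (Suc k) l + 0 \<and> lvT (Suc k) l \<le> lvK k m}"
      proof (cases rule: LT_cases)
        case (2 p i j) then show ?thesis by (cases p) (auto simp: genT_def field_simps intro!: sp_ops)
      next
        case (3 p i j) then show ?thesis by (cases p) (auto simp: genT_def field_simps intro!: sp_ops)
      qed (auto simp: genT_def field_simps intro!: sp_ops)
    qed (intro lins)
    have "gK (Xp (bv l)) = KX Xp (gK (bv l)) \<and> gK (Xm (bv l)) = KX Xm (gK (bv l)) \<and> gK (Ym (bv l)) = KY (gK (bv l))"
      if "l \<in> LT (Suc k)" for l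
      using that
    proof (cases rule: LT_cases)
      case (2 p i j) then show ?thesis by (cases p) (auto simp: all_simps)
    next
      case (3 p i j) then show ?thesis by (cases p) (auto simp: all_simps)
    qed (auto simp: all_simps)
    then show "eqm (0 + deg_x) (T (Suc k)) (K k) (\<lambda>v. gK (Xp v)) (\<lambda>v. KX Xp (gK v))"
      "eqm (0 + deg_x) (T (Suc k)) (K k) (\<lambda>v. gK (Xm v)) (\<lambda>v. KX Xm (gK v))"
      "eqm (0 + deg_x) (T (Suc k)) (K k) (\<lambda>v. gK (Ym v)) (\<lambda>v. KY (gK v))"
      by (intro eqs lins; blast)+
  qed
  have h: "bm (- deg_out) (K k) (K k) hK"
  proof (rule bm_halfI[OF _ wK K_sel(1) K_sel(1) K_sel(2) K_sel(2)])
    show "fm (- deg_out) (K k) (K k) hK"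
    proof (rule fm_based2[OF based_K based_K])
      fix l assume "l \<in> LK k"
      then show "hK (bv l) \<in> sp {m \<in> LK k. dgK k m = dgK k l + - deg_out \<and> lvK k l \<le> lvK k m}"
        by (elim LK_cases LT_cases insertE) (auto simp: genT_def field_simps deg_out_def intro!: sp_ops)
    qed (intro lins)
  qed ((rule eqs; (intro lins)?), elim LK_cases LT_cases insertE; simp add: all_simps)+
  have 1: "eqm deg_out (K k) (T (Suc k)) (\<lambda>v. fK (dout (K k) v)) (\<lambda>v. dout (T (Suc k)) (fK v))"
    unfolding K_sel T_sel by ((rule eqs; (intro lins)?), elim LK_cases LT_cases insertE; simp add: all_simps)
  have 4: "eqm 0 (K k) (K k) (\<lambda>v. gK (fK v)) (\<lambda>v. v + (dout (K k) (hK v) + hK (dout (K k) v)))"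
    unfolding K_sel
  proof (rule eqs(4))
    fix l assume "l \<in> LK k"
    then show "gK (fK (bv l)) = bv l + (dK (hK (bv l)) + hK (dK (bv l)))"
    proof (elim LK_cases LT_cases insertE)
      fix c l' p i j assume "c \<in> {}" then show "gK (fK (bv l)) = bv l + (dK (hK (bv l)) + hK (dK (bv l)))" by simp
    next
      \<comment> \<open>The case p = 0 is separate: \<open>dT\<close> then leads to position 0,
        where \<open>hK\<close> vanishes, and \<open>gK\<close> has its own clause for position
        1.\<close>
      fix c l' p i j assume "l = In c l'" "c = 2" "l' = L4 (Suc p) 0 i j"
      then show "gK (fK (bv l)) = bv l + (dK (hK (bv l)) + hK (dK (bv l)))"
        by (cases p) (simp_all add: all_simps)
    next
      fix c l' p i j assume "l = In c l'" "c = 2" "l' = L4 (Suc p) 1 i j"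
      then show "gK (fK (bv l)) = bv l + (dK (hK (bv l)) + hK (dK (bv l)))"
        by (cases p) (simp_all add: all_simps)
    qed (simp_all add: all_simps)
  qed (intro lins)+
  have dg: "gK (dT (bv l)) = dK (gK (bv l))" "fK (gK (bv l)) = bv l" if "l \<in> LT (Suc k)" for l
    using that
  proof (atomize (full), cases rule: LT_cases)
    \<comment> \<open>\<open>gK\<close> has three clauses according to the position, and
      \<open>dT\<close> moves between neighbouring ones.\<close>
    case (2 p i j) then show "gK (dT (bv l)) = dK (gK (bv l)) \<and> fK (gK (bv l)) = bv l"
      by (cases p; cases "p - 1") (auto simp: all_simps)
  next
    case (3 p i j) then show "gK (dT (bv l)) = dK (gK (bv l)) \<and> fK (gK (bv l)) = bv l" by (cases p) (auto simp: all_simps)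
  qed (auto simp: all_simps)
  have 2: "eqm deg_out (T (Suc k)) (K k) (\<lambda>v. gK (dout (T (Suc k)) v)) (\<lambda>v. dout (K k) (gK v))"
    unfolding K_sel T_sel by (intro eqs(2) lins dg(1))
  have 3: "eqm 0 (T (Suc k)) (T (Suc k)) (\<lambda>v. fK (gK v)) (\<lambda>v. v)"
    by (intro eqs(3) lins dg(2))
  show ?thesis unfolding retr_def
    using wfch_K wfch_T f g h 1 2 3 4 by (intro conjI exI[of _ fK] exI[of _ gK] exI[of _ hK])
qed

subsection \<open>Composition of reduced complexes\<close>

definition dx :: "nat \<Rightarrow> deg" where "dx n = (2 * int n, 0, 0)"

lemma dx_simps [simp]: "dx 0 = 0" "dx (Suc n) = dx n + deg_x"
  by (simp_all add: dx_def deg_x_def zero_prod_def)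

lemma filt_T: "filt (T k) r d = sp {l \<in> LT k. dgT k l = d \<and> r \<le> lvT k l}"
  and piece_T: "piece (T k) d = sp {l \<in> LT k. dgT k l = d}"
  by (simp_all add: T_def)

lemma XY_fm: "fm deg_x (T k) (T k) Xm" "fm deg_x (T k) (T k) Xp" "fm deg_x (T k) (T k) Ym"
proof -
  show "fm deg_x (T k) (T k) Xm"
  proof (rule fm_based2[OF based_T based_T])
    fix l assume "l \<in> LT k"
    then show "Xm (bv l) \<in> sp {m \<in> LT k. dgT k m = dgT k l + deg_x \<and> lvT k l \<le> lvT k m}"
      by (cases rule: LT_cases) (auto simp: deg_x_def)
  qed (intro lins)
  show "fm deg_x (T k) (T k) Xp"
  proof (rule fm_based2[OF based_T based_T])
    fix l assume "l \<in> LT k"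
    then show "Xp (bv l) \<in> sp {m \<in> LT k. dgT k m = dgT k l + deg_x \<and> lvT k l \<le> lvT k m}"
      by (cases rule: LT_cases) (auto simp: deg_x_def)
  qed (intro lins)
  show "fm deg_x (T k) (T k) Ym"
  proof (rule fm_based2[OF based_T based_T])
    fix l assume "l \<in> LT k"
    then show "Ym (bv l) \<in> sp {m \<in> LT k. dgT k m = dgT k l + deg_x \<and> lvT k l \<le> lvT k m}"
      by (cases rule: LT_cases) (auto simp: deg_x_def intro!: sp_ops)
  qed (intro lins)
qed

lemma fm_funpow: "fm deg_x M M f \<Longrightarrow> fm (dx n) M M (f ^^ n)"
proof (induction n)
  case (Suc n)
  then show ?case using fm_comp[of "dx n" M M "f ^^ n" deg_x M f "dx (Suc n)"] by (simp add: comp_def)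
qed simp

lemma funpow_comm: "(\<And>v. f (g v) = g (f v)) \<Longrightarrow> f ((g ^^ n) v) = (g ^^ n) (f v)"
  by (induction n) simp_all

lemma lin_pow_XY [lins]: assumes "lin g"
  shows "lin (\<lambda>v. (Xm ^^ n) (g v))" "lin (\<lambda>v. (Xp ^^ n) (g v))" "lin (\<lambda>v. (Ym ^^ n) (g v))"
  by (rule lin_comp[OF lin_funpow assms], intro lins)+

lemma fm_half: assumes "fm \<delta> M M P" "fm \<delta> M M Q" "wfsp M" "\<And>d. vec.subspace (piece M d)"
  shows "fm \<delta> M M (half P Q i)"
  unfolding fm_def gm_def
  by (intro conjI allI ballI half_mem lin_half[OF _ _ lin_id(2)] assms(4) wfspD(1,2)[OF assms(3)] fmD(2)[OF assms(1)] fmD(2)[OF assms(2)]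
     gmD[OF fmD(1)[OF assms(1)]] gmD[OF fmD(1)[OF assms(2)]])

lemma incl_sp: "v \<in> sp A \<Longrightarrow> (\<And>l. l \<in> A \<Longrightarrow> In c l \<in> B) \<Longrightarrow> incl c v \<in> sp B"
  by (rule lin_sp[where f = "incl c"]) (auto intro!: lins)

text \<open>\<open>T 1\<close> is free over its right-acting ring on the generators
  \<open>genT c\<close>. Moving x_-^i x_+^j across the tensor sign turns it into y_-^i x_+^j acting
  on \<open>w\<close>, since y_+ = x_+ there.\<close>

definition bt :: "vec \<Rightarrow> vec \<Rightarrow> vec" where
  "bt v w = opl (\<lambda>P E i j. incl (if P = 0 then 2 else E) ((Ym ^^ i) ((Xp ^^ j) w))) v"

lemma lin_bt [lins]: "lin f \<Longrightarrow> lin (\<lambda>v. bt (f v) w)" "lin f \<Longrightarrow> lin (\<lambda>w. bt v (f w))"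
proof -
  show "lin f \<Longrightarrow> lin (\<lambda>v. bt (f v) w)" unfolding bt_def by (intro lins)
  have "lin (\<lambda>w. bt v w)"
    unfolding bt_def opl_def
  proof (rule lin_lift_fun)
    fix l
    show "lin (\<lambda>w. case q4 l of Some (p, e, i, j) \<Rightarrow> incl (if p = 0 then 2 else e) ((Ym ^^ i) ((Xp ^^ j) w)) | None \<Rightarrow> 0)"
    proof (cases "q4 l")
      case (Some a) then show ?thesis by (cases a) (simp add: lins)
    qed (simp add: lins)
  qed
  then show "lin f \<Longrightarrow> lin (\<lambda>w. bt v (f w))" by (rule lin_comp)
qed

lemmas bt_simps = lin_bt(1)[OF lin_id(2), THEN lin_add] lin_bt(1)[OF lin_id(2), THEN lin_scl]
  lin_bt(1)[OF lin_id(2), THEN lin_uminus] lin_bt(1)[OF lin_id(2), THEN lin_0]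
  lin_bt(2)[OF lin_id(2), THEN lin_add] lin_bt(2)[OF lin_id(2), THEN lin_scl]
  lin_bt(2)[OF lin_id(2), THEN lin_uminus] lin_bt(2)[OF lin_id(2), THEN lin_0]

lemma bt_lb [simp]: "bt (lb P E i j) w = incl (if P = 0 then 2 else E) ((Ym ^^ i) ((Xp ^^ j) w))"
  by (simp add: bt_def)

lemma bt_None: "q4 l = None \<Longrightarrow> bt (bv l) w = 0"
  by (simp add: bt_def opl_bv)

lemma bt_rel: "bt (Xm v) w = bt v (Ym w)" "bt (Xp v) w = bt v (Xp w)"
proof -
  show "bt (Xm v) w = bt v (Ym w)"
  proof (rule opl_ext[where f = "\<lambda>v. bt (Xm v) w" and g = "\<lambda>v. bt v (Ym w)"])
    show "bt (Xm (lb p e i j)) w = bt (lb p e i j) (Ym w)" for p e i j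
      by (simp add: funpow_swap1 funpow_comm[of Ym Xp, OF XY_comm(3)])
  qed (intro lins | simp add: bt_None bt_simps)+
  show "bt (Xp v) w = bt v (Xp w)"
  proof (rule opl_ext[where f = "\<lambda>v. bt (Xp v) w" and g = "\<lambda>v. bt v (Xp w)"])
    show "bt (Xp (lb p e i j)) w = bt (lb p e i j) (Xp w)" for p e i j
      by (simp add: funpow_swap1)
  qed (intro lins | simp add: bt_None bt_simps)+
qed

lemma bt_KX: assumes X: "lin X" "\<And>v. X (Ym v) = Ym (X v)" "\<And>v. X (Xp v) = Xp (X v)"
  shows "bt v (X w) = KX X (bt v w)"
proof (rule opl_ext[where f = "\<lambda>v. bt v (X w)" and g = "\<lambda>v. KX X (bt v w)"])
  show "bt (lb p e i j) (X w) = KX X (bt (lb p e i j) w)" for p e i j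
    using funpow_comm[of X Ym, OF X(2)] funpow_comm[of X Xp, OF X(3)]
    by (simp add: KX_incl X(1) del: funpow.simps)
qed (intro lins | simp add: bt_None K_simps)+

definition fT :: "vec \<Rightarrow> vec" where
  "fT = lift (\<lambda>l. case l of Tn d e k l' \<Rightarrow> bt (bv k) (bv l') | _ \<Rightarrow> 0)"

lemma lin_fT [lins]: "lin g \<Longrightarrow> lin (\<lambda>v. fT (g v))" unfolding fT_def by (intro lins)

lemma fT_tn: "fT (tn d e v w) = bt v w"
  by (rule lin2_ext[where F = "\<lambda>v w. fT (tn d e v w)" and G = bt]) (intro lins | simp add: fT_def)+

lemmas fT_simps = lin_fT[OF lin_id(2), THEN lin_add] lin_fT[OF lin_id(2), THEN lin_scl]
  lin_fT[OF lin_id(2), THEN lin_uminus] lin_fT[OF lin_id(2), THEN lin_0]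

definition gT :: "nat \<Rightarrow> vec \<Rightarrow> vec" where
  "gT k = inop (\<lambda>c. lift (\<lambda>l. tn (dgT 1 (genT c)) (dgT k l) (bv (genT c)) (bv l)))"

lemma lin_gT [lins]: "lin g \<Longrightarrow> lin (\<lambda>v. gT k (g v))" unfolding gT_def by (intro lins)

lemma gT_bv: "gT k (bv (In c l)) = bv (Tn (dgT 1 (genT c)) (dgT k l) (genT c) l)"
  by (simp add: gT_def)

text \<open>A label \<open>Tn\<close> records the degrees of its factors, so a formula for
  \<open>gT\<close> on vectors needs \<open>v\<close> to be homogeneous.\<close>

lemma gT_incl: "v \<in> piece (T k) d \<Longrightarrow> gT k (incl c v) = tn (dgT 1 (genT c)) d (bv (genT c)) v"
  unfolding piece_T by (rule lin_sp_eq[where f = "\<lambda>v. gT k (incl c v)"]) (intro lins | auto simp: gT_bv)+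

lemma genT_LT: "c \<le> 2 \<Longrightarrow> genT c \<in> LT 1" by (auto simp: genT_def)

lemma LT_1_cases [consumes 1]:
  assumes "l \<in> LT 1"
  obtains c i j where "c \<le> 2" "l = L4 (if c = 2 then 0 else 1) (if c = 0 then 0 else 1) i j"
    "genT c = L4 (if c = 2 then 0 else 1) (if c = 0 then 0 else 1) 0 0"
    "(if (if c = 2 then 0 else 1) = (0::nat) then 2 else (if c = 0 then 0 else 1)) = c"
  using assms
proof (cases rule: LT_cases)
  case (1 i j) then show ?thesis using that[of 2 i j] by (simp add: genT_def)
next
  case (2 p i j) then show ?thesis using that[of 0 i j] by (simp add: genT_def)
next
  case (3 p i j) then show ?thesis using that[of 1 i j] by (simp add: genT_def)
qed

lemma sgn_T1: "sgn_t (dgT 1 (L4 P E i j)) = (if P = 0 then -1 else (-1) ^ (P - 1))"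
proof -
  have f: "\<lfloor>of_nat P - of_nat 1 / 2 :: rat\<rfloor> = int P - 1"
    by (rule floor_unique) (simp_all add: field_simps)
  show ?thesis unfolding sgn_t_def dgT_L4 snd_conv f by (cases P) simp_all
qed

lemma half_sum: "half P Q 2 v + half P Q 1 v = P v" "half P Q 2 v - half P Q 1 v = Q v"
  by (simp_all add: half_def flip: vec.scale_right_distrib vec.scale_right_diff_distrib)
     (simp_all flip: vec.scale_left_distrib add: vec.scale_right_distrib)

text \<open>Balancing is given for x_1, x_2 against y_1, y_2; sum and difference of the two
  relations give it for x_+ against y_+, which acts as \<open>Xp\<close> on \<open>T k\<close>, and
  for x_- against y_-.\<close>

lemma tn_half:
  assumes "M = T 1" "N = T k" "v \<in> piece M d" "w \<in> piece N e" "d + e + deg_x = c"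
  shows "tn (d + deg_x) e (Xp v) w - tn d (e + deg_x) v (Xp w) \<in> rels (tens_over (over_mid M N) M N) c"
    "tn (d + deg_x) e (Xm v) w - tn d (e + deg_x) v (Ym w) \<in> rels (tens_over (over_mid M N) M N) c"
proof -
  let ?R = "rels (tens_over (over_mid M N) M N) c"
  have 1: "tn (d + deg_x) e (half Xp Xm i v) w - tn d (e + deg_x) v (half Xp Ym i w) \<in> ?R" if "i \<in> {1,2}" for i
    using that assms by (intro tn_over) auto
  have "(tn (d + deg_x) e (half Xp Xm 2 v) w - tn d (e + deg_x) v (half Xp Ym 2 w)) +
     (tn (d + deg_x) e (half Xp Xm 1 v) w - tn d (e + deg_x) v (half Xp Ym 1 w)) \<in> ?R"
    by (rule vec.subspace_add[OF subspace_tens_over(2)]; rule 1) simp_all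
  also have "(tn (d + deg_x) e (half Xp Xm 2 v) w - tn d (e + deg_x) v (half Xp Ym 2 w)) +
     (tn (d + deg_x) e (half Xp Xm 1 v) w - tn d (e + deg_x) v (half Xp Ym 1 w)) =
     tn (d + deg_x) e (half Xp Xm 2 v + half Xp Xm 1 v) w - tn d (e + deg_x) v (half Xp Ym 2 w + half Xp Ym 1 w)"
    by (simp add: tn_simps)
  finally show "tn (d + deg_x) e (Xp v) w - tn d (e + deg_x) v (Xp w) \<in> ?R" unfolding half_sum .
  have "(tn (d + deg_x) e (half Xp Xm 2 v) w - tn d (e + deg_x) v (half Xp Ym 2 w)) -
     (tn (d + deg_x) e (half Xp Xm 1 v) w - tn d (e + deg_x) v (half Xp Ym 1 w)) \<in> ?R"
    by (rule vec.subspace_diff[OF subspace_tens_over(2)]; rule 1) simp_all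
  also have "(tn (d + deg_x) e (half Xp Xm 2 v) w - tn d (e + deg_x) v (half Xp Ym 2 w)) -
     (tn (d + deg_x) e (half Xp Xm 1 v) w - tn d (e + deg_x) v (half Xp Ym 1 w)) =
     tn (d + deg_x) e (half Xp Xm 2 v - half Xp Xm 1 v) w - tn d (e + deg_x) v (half Xp Ym 2 w - half Xp Ym 1 w)"
    by (simp add: tn_simps)
  finally show "tn (d + deg_x) e (Xm v) w - tn d (e + deg_x) v (Ym w) \<in> ?R" unfolding half_sum .
qed

lemma tn_iter:
  assumes R: "\<And>d e v w. v \<in> piece M d \<Longrightarrow> w \<in> piece N e \<Longrightarrow>
      tn (d + deg_x) e (X v) w - tn d (e + deg_x) v (Y w) \<in> rels (tens_over S M N) (d + e + deg_x)"
    and Y: "gm deg_x N N Y" and X: "gm deg_x M M X"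
    and v: "v \<in> piece M d" and w: "w \<in> piece N e"
  shows "tn (d + dx n) e ((X ^^ n) v) w - tn d (e + dx n) v ((Y ^^ n) w) \<in> rels (tens_over S M N) (d + e + dx n)"
  using w
proof (induction n arbitrary: w e)
  case 0 then show ?case by (simp add: vec.subspace_0)
next
  case (Suc n)
  have Xn: "(X ^^ n) v \<in> piece M (d + dx n)"
  proof (induction n)
    case (Suc n) then show ?case using gmD(2)[OF X Suc] by (simp add: add.assoc)
  qed (use v in simp)
  have 1: "tn (d + dx n + deg_x) e (X ((X ^^ n) v)) w - tn (d + dx n) (e + deg_x) ((X ^^ n) v) (Y w)
      \<in> rels (tens_over S M N) (d + e + dx (Suc n))"
    using R[OF Xn Suc.prems] by (simp add: ac_simps)
  have 2: "tn (d + dx n) (e + deg_x) ((X ^^ n) v) (Y w) - tn d (e + deg_x + dx n) v ((Y ^^ n) (Y w))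
      \<in> rels (tens_over S M N) (d + e + dx (Suc n))"
    using Suc.IH[OF gmD(2)[OF Y Suc.prems]] by (simp add: ac_simps)
  from vec.subspace_add[OF subspace_tens_over(2) 1 2] show ?case
    by (simp add: funpow_swap1 ac_simps)
qed

lemma bmI:
  assumes "fm \<delta> M N f"
   "\<And>i. i \<in> {1,2} \<Longrightarrow> eqm (\<delta> + deg_x) M N (\<lambda>v. f (xact M i v)) (\<lambda>v. xact N i (f v))"
   "\<And>i. i \<in> {1,2} \<Longrightarrow> eqm (\<delta> + deg_x) M N (\<lambda>v. f (yact M i v)) (\<lambda>v. yact N i (f v))"
  shows "bm \<delta> M N f"
  unfolding bm_def by (intro conjI ballI assms)

lemma half_KX: "half (KX P) (KX Q) i v = KX (half P Q i) v" if "lin P" "lin Q"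
proof (rule lin_ext[where f = "half (KX P) (KX Q) i" and g = "\<lambda>v. KX (half P Q i) v"])
  show "half (KX P) (KX Q) i (bv l) = KX (half P Q i) (bv l)" for l
  proof (cases l)
    case (In c l') then show ?thesis by (simp add: half_def incl_simps)
  qed (simp_all add: half_def KX_def inop_def)
qed (intro lins that)+

lemma dT_comm: "dT (Xm v) = Xm (dT v)" "dT (Ym v) = Ym (dT v)" "dT (Xp v) = Xp (dT v)"
proof -
  show "dT (Xm v) = Xm (dT v)"
  proof (rule opl_ext[where f = "\<lambda>v. dT (Xm v)" and g = "\<lambda>v. Xm (dT v)"])
    show "dT (Xm (lb p e i j)) = Xm (dT (lb p e i j))" for p e i j
      by (cases "e = 0"; cases p) (simp_all add: XYd_simps)
  qed (intro lins | simp add: XYd_simps)+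
  show "dT (Ym v) = Ym (dT v)"
  proof (rule opl_ext[where f = "\<lambda>v. dT (Ym v)" and g = "\<lambda>v. Ym (dT v)"])
    show "dT (Ym (lb p e i j)) = Ym (dT (lb p e i j))" for p e i j
      by (cases "e = 0"; cases p) (simp_all add: XYd_simps)
  qed (intro lins | simp add: XYd_simps)+
  show "dT (Xp v) = Xp (dT v)"
  proof (rule opl_ext[where f = "\<lambda>v. dT (Xp v)" and g = "\<lambda>v. Xp (dT v)"])
    show "dT (Xp (lb p e i j)) = Xp (dT (lb p e i j))" for p e i j
      by (cases "e = 0"; cases p) (simp_all add: XYd_simps)
  qed (intro lins | simp add: XYd_simps)+
qed

lemma bm_zero: assumes "wfch M" "wfch N" shows "bm \<delta> M N (\<lambda>_. 0)"
proof (rule bmI)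
  note w = wfspD[OF wfchD(1)[OF assms(2)]]
  show "fm \<delta> M N (\<lambda>_. 0)" unfolding fm_def gm_def
    by (intro conjI allI ballI lins vec.subspace_0 w(1,2) wfchD(2)[OF assms(2)])
  fix i :: nat assume i: "i \<in> {1,2}"
  show "eqm (\<delta> + deg_x) M N (\<lambda>v. 0) (\<lambda>v. xact N i 0)" "eqm (\<delta> + deg_x) M N (\<lambda>v. 0) (\<lambda>v. yact N i 0)"
    by (rule eqm_eq; simp add: lin_0[OF wfchD(4)[OF assms(2) i]] lin_0[OF wfchD(5)[OF assms(2) i]] wfchD(1)[OF assms(2)])+
qed

lemma retr_iso:
  assumes w: "wfch M" "wfch N" and m: "bm 0 M N f" "bm 0 N M g"
    "eqm deg_out M N (\<lambda>v. f (dout M v)) (\<lambda>v. dout N (f v))"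
    "eqm deg_out N M (\<lambda>v. g (dout N v)) (\<lambda>v. dout M (g v))"
    "eqm 0 N N (\<lambda>v. f (g v)) (\<lambda>v. v)" "eqm 0 M M (\<lambda>v. g (f v)) (\<lambda>v. v)"
  shows "retr M N"
proof -
  have "eqm 0 M M (\<lambda>v. g (f v)) (\<lambda>v. v + (dout M 0 + 0))"
    using m(6) by (simp add: lin_0[OF wfchD(3)[OF w(1)]])
  then show ?thesis unfolding retr_def using w m(1-5) bm_zero[OF w(1) w(1)] by blast
qed

text \<open>\<open>fT\<close> and \<open>gT\<close> express the freeness of \<open>T 1\<close> over
  the ring in the middle. On labels \<open>fT\<close> after \<open>gT\<close> is the identity on the
  nose; the other composite, and the left action on \<open>gT\<close>, return to the generators of
  \<open>T 1\<close> only modulo balancing.\<close>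

lemma retr_TT: "retr (T 1 \<odot> T k) (K k)"
proof -
  let ?T = "tens_over (over_mid (T 1) (T k)) (T 1) (T k)"
  note wK = wfsp_based[OF based_K]
  note cg = trunc_cong(1-3)[OF comp_ch_trunc[of "T 1" "T k"] refl] trunc_cong(1-3)[OF refl comp_ch_trunc[of "T 1" "T k"]]
    comp_ch_cong
  have pow: "(Ym ^^ i) ((Xp ^^ j) (bv l)) \<in> sp {m \<in> LT k. dgT k m = dgT k l + dx j + dx i \<and> lvT k l \<le> lvT k m}"
    if "l \<in> LT k" for i j l
    using fmD(2)[OF fm_funpow[OF XY_fm(3)] fmD(2)[OF fm_funpow[OF XY_fm(2)], of "bv l" k "lvT k l" "dgT k l" j], of i]
      that by (simp add: filt_T)
  have dgen: "dgT 1 (L4 P E i j) = dgT 1 (L4 P E 0 0) + dx j + dx i" "lvT 1 (L4 P E i j) = lvT 1 (L4 P E 0 0)" for P E i j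
    by (simp_all add: dx_def)
  have fbt: "bt (bv m) (bv l) \<in> sp {n \<in> LK k. dgK k n = dgT 1 m + dgT k l \<and> lvT 1 m + lvT k l \<le> lvK k n}"
    if "m \<in> LT 1" "l \<in> LT k" for m l
    using that(1)
  proof (cases rule: LT_1_cases)
    case (1 c i j)
    show ?thesis unfolding 1(2) bt_lb 1(4) dgen[of _ _ i j] 1(3)[symmetric]
      by (rule incl_sp[OF pow[OF that(2)]]) (use 1(1) in \<open>simp add: ac_simps\<close>)
  qed
  have f1: "fm 0 (T 1 \<odot> T k) (K k) fT"
    unfolding cg
  proof (rule fm_tens_based[OF based_T based_T])
    fix m l assume a: "m \<in> LT 1" "l \<in> LT k"
    show "fT (bv (Tn (dgT 1 m) (dgT k l) m l)) \<in> piece (K k) (dgT 1 m + dgT k l + 0)"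
      unfolding basedD[OF based_K] by (rule sp_mono[OF _ fbt[OF a, folded fT_tn[of "dgT 1 m" "dgT k l"], unfolded tn_bv]]) auto
    show "fT (bv (Tn (dgT 1 m) (dgT k l) m l)) \<in> filt (K k) i (dgT 1 m + dgT k l + 0)" if "i \<le> lvT 1 m + lvT k l" for i
      unfolding basedD[OF based_K] by (rule sp_mono[OF _ fbt[OF a, folded fT_tn[of "dgT 1 m" "dgT k l"], unfolded tn_bv]])
        (use that in auto)
  next
    fix m l f g assume "(f, g) \<in> over_mid (T 1) (T k)"
    then obtain i where "f = half Xp Xm i" "g = half Xp Ym i" by auto
    then show "fT (tn (dgT 1 m + deg_x) (dgT k l) (f (bv m)) (bv l)) - fT (tn (dgT 1 m) (dgT k l + deg_x) (bv m) (g (bv l)))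
       \<in> rels (K k) (dgT 1 m + dgT k l + deg_x + 0)"
      by (simp add: fT_tn half_def bt_simps bt_rel basedD[OF based_K])
  qed (auto intro!: lins wK subspace_based[OF based_K])
  have f: "bm 0 (T 1 \<odot> T k) (K k) fT"
  proof (rule bmI[OF f1])
    fix i :: nat assume i: "i \<in> {1,2}"
    show "eqm (0 + deg_x) (T 1 \<odot> T k) (K k) (\<lambda>v. fT (xact (T 1 \<odot> T k) i v)) (\<lambda>v. xact (K k) i (fT v))"
      unfolding cg comp_ch_sel
    proof (rule eqm_tens_based[OF based_T based_T _ _ wK])
      fix m l show "fT (tm (\<lambda>_. 1) 0 deg_x id (xact (T k) i) (bv (Tn (dgT 1 m) (dgT k l) m l))) -
         xact (K k) i (fT (bv (Tn (dgT 1 m) (dgT k l) m l))) \<in> rels (K k) (dgT 1 m + dgT k l + (0 + deg_x))"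
        unfolding tn_bv[symmetric]
        by (simp add: tm_tn lins fT_tn half_KX basedD[OF based_K] del: tn_bv)
           (simp add: half_def bt_simps K_simps bt_KX lins XY_comm half_KX[symmetric])
    qed (auto intro!: lins)
    show "eqm (0 + deg_x) (T 1 \<odot> T k) (K k) (\<lambda>v. fT (yact (T 1 \<odot> T k) i v)) (\<lambda>v. yact (K k) i (fT v))"
      unfolding cg comp_ch_sel
    proof (rule eqm_tens_based[OF based_T based_T _ _ wK])
      fix m l assume "m \<in> LT 1" "l \<in> LT k"
      have "bt (Xp (bv m)) w = KX Xp (bt (bv m) w)" for w
        by (simp add: bt_rel bt_KX lins XY_comm)
      moreover have "bt (Ym (bv m)) w = KY (bt (bv m) w)" for w
        using \<open>m \<in> LT 1\<close> by (cases rule: LT_cases) (simp_all add: bt_simps K_incl[simplified] incl_simps)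
      ultimately show "fT (tm (\<lambda>_. 1) deg_x 0 (yact (T 1) i) id (bv (Tn (dgT 1 m) (dgT k l) m l))) -
         yact (K k) i (fT (bv (Tn (dgT 1 m) (dgT k l) m l))) \<in> rels (K k) (dgT 1 m + dgT k l + (0 + deg_x))"
        unfolding tn_bv[symmetric]
        by (simp add: tm_tn lins fT_tn basedD[OF based_K] del: tn_bv) (simp add: half_def bt_simps)
    qed (auto intro!: lins)
  qed
  have f2: "eqm deg_out (T 1 \<odot> T k) (K k) (\<lambda>v. fT (dout (T 1 \<odot> T k) v)) (\<lambda>v. dout (K k) (fT v))"
    unfolding cg dout_comp_ch T_sel K_sel
  proof (rule eqm_tens_based[OF based_T based_T _ _ wK])
    fix m l assume "m \<in> LT 1" "l \<in> LT k"
    note c = funpow_comm[of dT Ym, OF dT_comm(2)] funpow_comm[of dT Xp, OF dT_comm(3)]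
    have "bt (dT (bv m)) w + scl (sgn_t (dgT 1 m)) (bt (bv m) (dT w)) = dK (bt (bv m) w)" for w
      using \<open>m \<in> LT 1\<close>
      by (cases rule: LT_cases) (simp_all add: bt_simps K_incl[simplified] incl_simps sgn_T1[unfolded One_nat_def] c scl_neg1 flip: c
          del: dgT_L4)
    then show "fT (tm (\<lambda>_. 1) deg_out 0 dT id (bv (Tn (dgT 1 m) (dgT k l) m l)) +
        tm sgn_t 0 deg_out id dT (bv (Tn (dgT 1 m) (dgT k l) m l))) - dK (fT (bv (Tn (dgT 1 m) (dgT k l) m l)))
        \<in> rels (K k) (dgT 1 m + dgT k l + deg_out)"
      unfolding tn_bv[symmetric]
      by (simp add: tm_tn lins fT_tn fT_simps basedD[OF based_K] del: tn_bv)
  qed (auto intro!: lins)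
  have gp: "gT k (bv (In c l)) \<in> piece ?T (dgK k (In c l) + 0)"
    "i \<le> lvK k (In c l) \<Longrightarrow> gT k (bv (In c l)) \<in> filt ?T i (dgK k (In c l) + 0)"
    if "c \<le> 2" "l \<in> LT k" for c l i
  proof -
    note g = genT_LT[OF that(1)]
    show "gT k (bv (In c l)) \<in> piece ?T (dgK k (In c l) + 0)"
      unfolding gT_bv tn_bv[symmetric] using g that by (intro tn_piece) (auto simp: piece_T simp del: One_nat_def)
    show "gT k (bv (In c l)) \<in> filt ?T i (dgK k (In c l) + 0)" if i: "i \<le> lvK k (In c l)"
      unfolding gT_bv tn_bv[symmetric] using g \<open>l \<in> LT k\<close> i
      by (intro tn_filt[where j = "lvT 1 (genT c)" and j' = "i - lvT 1 (genT c)"]) (auto simp: filt_T simp del: One_nat_def)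
  qed
  have g1: "fm 0 (K k) (T 1 \<odot> T k) (gT k)"
    unfolding cg
  proof (rule fm_based[OF based_K gm_based[OF based_K]])
    fix l assume "l \<in> LK k"
    then obtain c l' where l: "l = In c l'" "c \<le> 2" "l' \<in> LT k" by (auto simp: LK_def)
    show "gT k (bv l) \<in> piece ?T (dgK k l + 0)" "\<And>i. i \<le> lvK k l \<Longrightarrow> gT k (bv l) \<in> filt ?T i (dgK k l + 0)"
      using gp[OF l(2,3)] l(1) by blast+
  qed (intro lins wfsp_tens_over subspace_tens_over)+
  have pT: "bv l \<in> piece (T k) (dgT k l)" if "l \<in> LT k" for l k using that by (simp add: piece_T)
  have XYp: "Xp (bv l) \<in> piece (T k) (dgT k l + deg_x)" "Xm (bv l) \<in> piece (T k) (dgT k l + deg_x)"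
    "Ym (bv l) \<in> piece (T k) (dgT k l + deg_x)" if "l \<in> LT k" for l k
    using XY_fm[THEN fmD(1), THEN gmD(2), OF pT[OF that]] by auto
  have hp: "half P Q i v \<in> piece (T k) d" if "P v \<in> piece (T k) d" "Q v \<in> piece (T k) d" for P Q v d i
    using that unfolding half_def piece_T by (intro sp_ops)
  have g: "bm 0 (K k) (T 1 \<odot> T k) (gT k)"
  proof (rule bmI[OF g1])
    fix i :: nat assume i: "i \<in> {1,2}"
    show "eqm (0 + deg_x) (K k) (T 1 \<odot> T k) (\<lambda>v. gT k (xact (K k) i v)) (\<lambda>v. xact (T 1 \<odot> T k) i (gT k v))"
      unfolding cg comp_ch_sel
    proof (rule eqm_based_eq[OF based_K])
      fix l assume "l \<in> LK k"
      then obtain c l' where l: "l = In c l'" "c \<le> 2" "l' \<in> LT k" by (auto simp: LK_def)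
      have 1: "gT k (incl c (half Xp Xm i (bv l'))) = tn (dgT 1 (genT c)) (dgT k l' + deg_x) (bv (genT c)) (half Xp Xm i (bv l'))"
        by (rule gT_incl, rule hp, rule XYp(1)[OF l(3)], rule XYp(2)[OF l(3)])
      show "gT k (xact (K k) i (bv l)) = tm (\<lambda>_. 1) 0 deg_x id (xact (T k) i) (gT k (bv l))"
        unfolding l gT_bv tn_bv[symmetric]
        by (simp add: tm_tn lins half_KX 1[simplified] del: tn_bv)
    qed (auto intro!: lins)
    show "eqm (0 + deg_x) (K k) (T 1 \<odot> T k) (\<lambda>v. gT k (yact (K k) i v)) (\<lambda>v. yact (T 1 \<odot> T k) i (gT k v))"
      unfolding cg comp_ch_sel
    proof (rule eqm_based[OF based_K])
      fix l assume "l \<in> LK k"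
      then obtain c l' where l: "l = In c l'" "c \<le> 2" "l' \<in> LT k" by (auto simp: LK_def)
      let ?G = "genT c" and ?c = "dgK k (In c l') + deg_x"
      let ?R = "rels ?T ?c"
      note G = pT[OF genT_LT[OF l(2)]]
      have deg: "dgT 1 ?G + dgT k l' + deg_x = ?c" by simp
      note th = tn_half[OF refl refl G pT[OF l(3)] deg]
      \<comment> \<open>Multiplication from the left leads out of the span of the generators; the
        x-variables that appear are moved across the tensor sign.\<close>
      have P: "gT k (KX Xp (bv (In c l'))) - tn (dgT 1 ?G + deg_x) (dgT k l') (Xp (bv ?G)) (bv l') \<in> ?R"
        using vec.subspace_neg[OF subspace_tens_over(2) th(1)] gT_incl[OF XYp(1)[OF l(3)], of c] by simp
      have Q: "gT k (KY (bv (In c l'))) - tn (dgT 1 ?G + deg_x) (dgT k l') (Ym (bv ?G)) (bv l') \<in> ?R"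
      proof -
        have gi: "gT k (incl c (Ym (bv l'))) = tn (dgT 1 (genT c)) (dgT k l' + deg_x) (bv (genT c)) (Ym (bv l'))" for c
          by (rule gT_incl[OF XYp(3)[OF l(3)]])
        have neg: "x \<in> ?R \<Longrightarrow> - x \<in> ?R" for x by (rule vec.subspace_neg[OF subspace_tens_over(2)])
        have add: "gT k (v + w) = gT k v + gT k w" "gT k (- v) = - gT k v" for v w
          using lin_gT[OF lin_id(2), of k] by (simp_all add: lin_simps)
        from l(2) consider "c = 0" | "c = 1" | "c = 2" by linarith
        then show ?thesis
        proof cases
          case 1
          have "dgT 1 (genT 1) = dgT 1 (genT 0) + deg_x" by (simp add: genT_def deg_x_def)
          then show ?thesis using neg[OF th(2)] gi[of 0] gT_bv[of k 1 l'] unfolding 1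
            by (simp add: add genT_def tn_simps flip: tn_bv)
        next
          case 2
          then show ?thesis using th(2) gi[of 1]
            by (simp add: add genT_def tn_simps)
        next
          case 3
          then show ?thesis using neg[OF th(2)] gi[of 2]
            by (simp add: genT_def tn_simps)
        qed
      qed
      let ?s = "if i = 1 then - 1 else 1 :: rat"
      have "scl (1/2) ((gT k (KX Xp (bv (In c l'))) - tn (dgT 1 ?G + deg_x) (dgT k l') (Xp (bv ?G)) (bv l')) +
          scl ?s (gT k (KY (bv (In c l'))) - tn (dgT 1 ?G + deg_x) (dgT k l') (Ym (bv ?G)) (bv l'))) \<in> ?R"
        by (intro vec.subspace_scale vec.subspace_add subspace_tens_over P Q)
      also have "scl (1/2) ((gT k (KX Xp (bv (In c l'))) - tn (dgT 1 ?G + deg_x) (dgT k l') (Xp (bv ?G)) (bv l')) +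
          scl ?s (gT k (KY (bv (In c l'))) - tn (dgT 1 ?G + deg_x) (dgT k l') (Ym (bv ?G)) (bv l')))
        = gT k (half (KX Xp) KY i (bv (In c l'))) - tn (dgT 1 ?G + deg_x) (dgT k l') (half Xp Ym i (bv ?G)) (bv l')"
        unfolding half_def lin_scl[OF lin_gT[OF lin_id(2)]] lin_add[OF lin_gT[OF lin_id(2)]] tn_simps
        by (simp only: vec.scale_right_distrib vec.scale_right_diff_distrib) (simp only: add_diff_add diff_add_eq add.commute)
      finally show "gT k (yact (K k) i (bv l)) - tm (\<lambda>_. 1) deg_x 0 (yact (T 1) i) id (gT k (bv l)) \<in> rels ?T (dgK k l + (0 + deg_x))"
        unfolding l gT_bv tn_bv[symmetric] by (simp add: tm_tn lins del: tn_bv)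
    qed (auto intro!: lins)
  qed
  have g2: "eqm deg_out (K k) (T 1 \<odot> T k) (\<lambda>v. gT k (dout (K k) v)) (\<lambda>v. dout (T 1 \<odot> T k) (gT k v))"
    unfolding cg dout_comp_ch T_sel K_sel
  proof (rule eqm_based_eq[OF based_K])
    fix l assume "l \<in> LK k"
    then obtain c l' where l: "l = In c l'" "c \<le> 2" "l' \<in> LT k" by (auto simp: LK_def)
    have dTp: "dT (bv l') \<in> piece (T k) (dgT k l' + deg_out)"
      using l(3) by (cases rule: LT_cases) (auto simp: piece_T deg_out_def)
    have gi: "gT k (incl c (dT (bv l'))) = tn (dgT 1 (genT c)) (dgT k l' + deg_out) (bv (genT c)) (dT (bv l'))" for c
      by (rule gT_incl[OF dTp])
    have add: "gT k (v + w) = gT k v + gT k w" "gT k (- v) = - gT k v" for v w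
      using lin_gT[OF lin_id(2), of k] by (simp_all add: lin_simps)
    have sg: "sgn_t (dgT 1 (genT c)) = (if c = 2 then -1 else 1)"
      using l(2) unfolding genT_def by (auto simp: sgn_T1[unfolded One_nat_def] simp del: dgT_L4)
    from l(2) consider "c = 0" | "c = 1" | "c = 2" by linarith
    then show "gT k (dK (bv l)) = tm (\<lambda>_. 1) deg_out 0 dT id (gT k (bv l)) + tm sgn_t 0 deg_out id dT (gT k (bv l))"
    proof cases
      case 1
      have "dgT 1 (genT 2) = dgT 1 (genT 0) + deg_out" by (simp add: genT_def deg_out_def)
      then show ?thesis unfolding l gT_bv tn_bv[symmetric] using sg 1 gi[of 0] gT_bv[of k 2 l']
        by (simp add: tm_tn lins add del: tn_bv dgT_L4 One_nat_def) (simp add: genT_def)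
    next
      case 2
      then show ?thesis unfolding l gT_bv tn_bv[symmetric] using sg gi[of 1]
        by (simp add: tm_tn lins add del: tn_bv dgT_L4) (simp add: genT_def tn_simps)
    next
      case 3
      then show ?thesis unfolding l gT_bv tn_bv[symmetric] using sg gi[of 2]
        by (simp add: tm_tn lins add scl_neg1 del: tn_bv dgT_L4) (simp add: genT_def tn_simps)
    qed
  qed (auto intro!: lins)
  have fg: "eqm 0 (K k) (K k) (\<lambda>v. fT (gT k v)) (\<lambda>v. v)"
  proof (rule eqm_based_eq[OF based_K _ _ wK])
    fix l assume "l \<in> LK k"
    then show "fT (gT k (bv l)) = bv l"
      by (elim LK_cases insertE) (auto simp: gT_bv genT_def fT_tn simp flip: tn_bv simp del: dgT_L4)
  qed (intro lins)+
  have gf: "eqm 0 (T 1 \<odot> T k) (T 1 \<odot> T k) (\<lambda>v. gT k (fT v)) (\<lambda>v. v)"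
    unfolding comp_ch_cong
  proof (rule eqm_tens_based[OF based_T based_T])
    fix m l assume a: "m \<in> LT 1" "l \<in> LT k"
    from a(1) show "gT k (fT (bv (Tn (dgT 1 m) (dgT k l) m l))) -
        bv (Tn (dgT 1 m) (dgT k l) m l) \<in> rels ?T (dgT 1 m + dgT k l + 0)"
    proof (cases rule: LT_1_cases)
      case (1 c i j)
      let ?G = "genT c" let ?w = "(Ym ^^ i) ((Xp ^^ j) (bv l))"
      have G: "bv ?G \<in> piece (T 1) (dgT 1 ?G)" by (rule pT[OF genT_LT[OF 1(1)]])
      have G2: "(Xp ^^ j) (bv ?G) \<in> piece (T 1) (dgT 1 ?G + dx j)"
        by (rule gmD(2)[OF fmD(1)[OF fm_funpow[OF XY_fm(2)]] G])
      have w1: "(Xp ^^ j) (bv l) \<in> piece (T k) (dgT k l + dx j)"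
        by (rule gmD(2)[OF fmD(1)[OF fm_funpow[OF XY_fm(2)]] pT[OF a(2)]])
      have w2: "(Ym ^^ i) (bv l) \<in> piece (T k) (dgT k l + dx i)"
        by (rule gmD(2)[OF fmD(1)[OF fm_funpow[OF XY_fm(3)]] pT[OF a(2)]])
      have w: "?w \<in> piece (T k) (dgT k l + dx j + dx i)"
        by (rule gmD(2)[OF fmD(1)[OF fm_funpow[OF XY_fm(3)]] w1])
      have yx: "(Xp ^^ j) ((Ym ^^ i) (bv l)) = ?w"
        by (rule funpow_comm[of "Xp ^^ j" Ym, OF funpow_comm[of Ym Xp, OF XY_comm(3), symmetric]])
      have lbm: "bv m = (Xm ^^ i) ((Xp ^^ j) (bv ?G))"
      proof -
        have "(Xp ^^ j) (lb p e 0 0) = lb p e 0 j" for p e by (induction j) simp_all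
        moreover have "(Xm ^^ i) (lb p e 0 j) = lb p e i j" for p e by (induction i) simp_all
        ultimately show ?thesis unfolding 1(2,3) by simp
      qed
      have dm: "dgT 1 m = dgT 1 ?G + dx j + dx i" unfolding 1(2,3) by (rule dgen)
      \<comment> \<open>First x_-^i, then x_+^j is moved across; \<open>yx\<close> puts the
        resulting operators on \<open>bv l\<close> into the order used by \<open>bt\<close>.\<close>
      have r1: "tn (dgT 1 ?G + dx j + dx i) (dgT k l) ((Xm ^^ i) ((Xp ^^ j) (bv ?G))) (bv l) -
          tn (dgT 1 ?G + dx j) (dgT k l + dx i) ((Xp ^^ j) (bv ?G)) ((Ym ^^ i) (bv l)) \<in> rels ?T (dgT 1 ?G + dx j + dgT k l + dx i)"
        by (rule tn_iter[OF tn_half(2)[OF refl refl _ _ refl] fmD(1)[OF XY_fm(3)] fmD(1)[OF XY_fm(1)] G2 pT[OF a(2)]])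
      have r2: "tn (dgT 1 ?G + dx j) (dgT k l + dx i) ((Xp ^^ j) (bv ?G)) ((Ym ^^ i) (bv l)) -
          tn (dgT 1 ?G) (dgT k l + dx i + dx j) (bv ?G) ((Xp ^^ j) ((Ym ^^ i) (bv l))) \<in> rels ?T (dgT 1 ?G + (dgT k l + dx i) + dx j)"
        by (rule tn_iter[OF tn_half(1)[OF refl refl _ _ refl] fmD(1)[OF XY_fm(2)] fmD(1)[OF XY_fm(2)] G w2])
      have e: "dgT 1 ?G + dx j + dgT k l + dx i = dgT 1 m + dgT k l" "dgT 1 ?G + (dgT k l + dx i) + dx j = dgT 1 m + dgT k l"
        unfolding dm by (simp_all add: ac_simps)
      have "gT k (fT (bv (Tn (dgT 1 m) (dgT k l) m l))) = gT k (incl c ?w)"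
        unfolding tn_bv[symmetric] fT_tn unfolding 1(2) bt_lb 1(4) ..
      also have "\<dots> = tn (dgT 1 ?G) (dgT k l + dx i + dx j) (bv ?G) ((Xp ^^ j) ((Ym ^^ i) (bv l)))"
        unfolding yx gT_incl[OF w] by (simp add: ac_simps)
      finally show ?thesis
        using vec.subspace_neg[OF subspace_tens_over(2) vec.subspace_add[OF subspace_tens_over(2) r1[unfolded e] r2[unfolded e]]]
        unfolding tn_bv[symmetric] lbm dm
        by simp
    qed
  qed (intro lins wfsp_tens_over)+
  show ?thesis
    by (rule retr_iso[OF wfch_comp[OF wfch_T wfch_T] wfch_K f g f2 g2 fg gf])
qed

subsection \<open>Polynomials acting on the reduced complexes\<close>

text \<open>Indexed like the variables of the polynomial ring: 1, 2 are x_1, x_2 and 3, 4 are y_1,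
  y_2.\<close>

definition ZT :: "nat \<Rightarrow> vec \<Rightarrow> vec" where
  "ZT i = (if i \<le> 2 then half Xp Xm i else half Xp Ym (i - 2))"

lemma ZT_comm: "ZT i (ZT j v) = ZT j (ZT i v)"
  by (simp add: ZT_def half_def XYd_simps XY_comm vec.scale_right_distrib algebra_simps)

lemma lin_ZT [lins]: "lin g \<Longrightarrow> lin (\<lambda>v. ZT i (g v))"
  unfolding ZT_def by (cases "i \<le> 2") (auto intro!: lins)

lemma fm_ZT: "fm deg_x (T k) (T k) (ZT i)"
  unfolding ZT_def using fm_half[OF XY_fm(2) XY_fm(1) wfsp_based[OF based_T] subspace_based[OF based_T]]
   fm_half[OF XY_fm(2) XY_fm(3) wfsp_based[OF based_T] subspace_based[OF based_T]] by simp

text \<open>Variables with other indices act as 1, so that \<open>mact_add\<close> and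
  \<open>pac_mult\<close> hold on the whole type of polynomials.\<close>

definition mact :: "(nat \<Rightarrow>\<^sub>0 nat) \<Rightarrow> vec \<Rightarrow> vec" where
  "mact m v = (ZT 1 ^^ lookup m 1) ((ZT 2 ^^ lookup m 2) ((ZT 3 ^^ lookup m 3) ((ZT 4 ^^ lookup m 4) v)))"

definition mdeg :: "(nat \<Rightarrow>\<^sub>0 nat) \<Rightarrow> nat" where
  "mdeg m = lookup m 1 + lookup m 2 + lookup m 3 + lookup m 4"

lemma funpow_comm2: "(\<And>v. f (g v) = g (f v)) \<Longrightarrow> (f ^^ m) ((g ^^ n) v) = (g ^^ n) ((f ^^ m) v)"
  by (rule funpow_comm[of "f ^^ m" g]) (rule funpow_comm[of g f, symmetric], simp)

lemma mact_add: "mact (m + m') v = mact m (mact m' v)"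
proof -
  have c: "(ZT i ^^ a) ((ZT j ^^ b) w) = (ZT j ^^ b) ((ZT i ^^ a) w)" for i j a b w
    by (rule funpow_comm2) (rule ZT_comm)
  show ?thesis unfolding mact_def lookup_add funpow_add comp_def
    by (simp only: c[of _ 2 _ 1] c[of _ 3 _ 1] c[of _ 4 _ 1] c[of _ 3 _ 2] c[of _ 4 _ 2] c[of _ 4 _ 3])
qed

lemma lin_mact [lins]: "lin g \<Longrightarrow> lin (\<lambda>v. mact m (g v))"
  unfolding mact_def by (intro lin_comp[OF lin_funpow[OF lin_ZT[OF lin_id(2)]]])

lemma dx_add: "dx (m + n) = dx m + dx n" by (simp add: dx_def)

lemma fm_mact: "fm (dx (mdeg m)) (T k) (T k) (mact m)"
proof -
  note f = fm_funpow[OF fm_ZT]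
  show ?thesis unfolding mact_def
    by (rule fm_comp[OF fm_comp[OF fm_comp[OF f f refl] f refl] f]) (simp add: mdeg_def dx_add ac_simps)
qed

lemma mact_0 [simp]: "mact 0 v = v" by (simp add: mact_def)

lemma mact_single: "i \<in> {1..4} \<Longrightarrow> mact (Poly_Mapping.single i 1) v = ZT i v"
proof -
  assume "i \<in> {1..4}"
  then have "i = 1 \<or> i = 2 \<or> i = 3 \<or> i = 4" by auto
  then show ?thesis by (auto simp: mact_def lookup_single)
qed

lemma mact_dT: "dT (mact m v) = mact m (dT v)"
proof -
  have "dT (ZT i v) = ZT i (dT v)" for i v
    by (simp add: ZT_def half_def XYd_simps dT_comm)
  from funpow_comm[of dT "ZT _", OF this] show ?thesis by (simp add: mact_def)
qed

definition pac :: "mpoly \<Rightarrow> vec \<Rightarrow> vec" where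
  "pac p v = lift (\<lambda>l. case l of Mono m \<Rightarrow> mact m v | _ \<Rightarrow> 0) (emb p)"

lemma pac_add: "pac (p + q) v = pac p v + pac q v" by (simp add: pac_def emb_add lift_add)
lemma pac_diff: "pac (p - q) v = pac p v - pac q v" by (simp add: pac_def emb_diff lift_diff)
lemma pac_0 [simp]: "pac 0 v = 0" by (simp add: pac_def)
lemma pac_single: "pac (Poly_Mapping.single m c) v = scl c (mact m v)"
  by (simp add: pac_def emb_single lift_scl)
lemma lin_pac [lins]: "lin g \<Longrightarrow> lin (\<lambda>v. pac p (g v))"
proof -
  have "lin (\<lambda>v. pac p v)" unfolding pac_def
  proof (rule lin_lift_fun)
    show "lin (\<lambda>v. case l of Mono m \<Rightarrow> mact m v | _ \<Rightarrow> 0)" for l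
      by (cases l) (simp_all add: lins)
  qed
  then show "lin g \<Longrightarrow> lin (\<lambda>v. pac p (g v))" by (rule lin_comp)
qed
lemmas pac_simps = lin_simps[OF lin_pac[OF lin_id(2)]]

lemma pac_mult: "pac (p * q) v = pac p (pac q v)"
proof (induction p rule: pm_induct)
  case (single m c)
  show ?case
    by (induction q rule: pm_induct)
       (simp_all add: mult_single pac_single mact_add distrib_left pac_add lin_simps[OF lin_mact[OF lin_id(2)]] vec.scale_right_distrib)
qed (simp_all add: distrib_right pac_add)

lemma pac_1 [simp]: "pac 1 v = v"
proof -
  have "(1 :: mpoly) = Poly_Mapping.single 0 1" by simp
  then show ?thesis by (metis pac_single mact_0 vec.scale_one)
qed

lemma pac_pow: "pac (q ^ n) v = (pac q ^^ n) v"
  by (induction n) (simp_all add: pac_mult)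

lemma pac_dT: "dT (pac p v) = pac p (dT v)"
  by (induction p rule: pm_induct) (simp_all add: pac_single pac_add XYd_simps mact_dT)

lemma pac_vars: "pac (xv 1) v = half Xp Xm 1 v" "pac (xv 2) v = half Xp Xm 2 v"
  "pac (yv 1) v = half Xp Ym 1 v" "pac (yv 2) v = half Xp Ym 2 v"
  unfolding xv_def yv_def pvar_def pac_single vec.scale_one by (subst mact_single; simp add: ZT_def)+

lemma pac_xy: "pac xp = Xp" "pac xm = Xm" "pac yp = Xp" "pac ym = Ym"
  using half_sum by (auto simp: xp_def xm_def yp_def ym_def pac_add pac_diff pac_vars simp del: One_nat_def)

lemma pac_v: "i \<in> {1,2} \<Longrightarrow> pac (xv i) = half Xp Xm i" "i \<in> {1,2} \<Longrightarrow> pac (yv i) = half Xp Ym i"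
  using pac_vars by (auto simp del: One_nat_def)

text \<open>Both generators of the ideal act by 0 in every position, because y_+ = x_+ and y_-^2 =
  x_-^2 there. This makes \<open>fS\<close> well defined on B.\<close>

lemma pac_JB: "p \<in> JB \<Longrightarrow> pac p v = 0"
  by (auto simp: JB_def ideal2_def pac_add pac_mult pac_diff pac_xy XY_comm pac_simps XYd_simps)

text \<open>The relation y_- = x_- belongs to position 0, so the ideal of I is tested on the
  generator of I.\<close>

lemma pac_JI: assumes "p \<in> JI" shows "pac p (lb 0 1 0 0) = 0"
proof -
  have "Ym (lb 0 1 0 0) = Xm (lb 0 1 0 0)" by simp
  then show ?thesis using assms
    by (auto simp: JI_def ideal2_def pac_add pac_mult pac_diff pac_vars[unfolded One_nat_def] half_def pac_simps)
qed

lemma mons_iff: "m \<in> mons d \<longleftrightarrow> keys m \<subseteq> {1..4} \<and> d = dx (mdeg m)"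
proof -
  have "{1..4} = {1, 2, 3, 4 :: nat}" by auto
  then have "keys m \<subseteq> {1..4} \<Longrightarrow> (\<Sum>i\<in>keys m. lookup m i) = mdeg m"
    using mdeg_eq[of "{1..4}" m] by (simp add: mdeg_def)
  then show ?thesis by (auto simp: mons_def dx_def simp del: of_nat_sum)
qed

lemma mons_mult: assumes "keys p \<subseteq> mons d" "keys q \<subseteq> mons e" shows "keys (p * q) \<subseteq> mons (d + e)"
proof
  fix m assume "m \<in> keys (p * q)"
  then obtain a b where m: "m = a + b" "a \<in> mons d" "b \<in> mons e" using keys_mult[of p q] assms by blast
  then show "m \<in> mons (d + e)"
    using keys_add[of a b] unfolding mons_iff by (auto simp: mdeg_def lookup_add dx_def)
qed

lemma mons_add_closed: "keys p \<subseteq> S \<Longrightarrow> keys q \<subseteq> S \<Longrightarrow> keys (p + q) \<subseteq> S" for p q :: mpoly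
  using keys_add[of p q] by blast

lemma mons_diff_closed: "keys p \<subseteq> S \<Longrightarrow> keys q \<subseteq> S \<Longrightarrow> keys (p - q) \<subseteq> S" for p q :: mpoly
  using keys_diff[of p q] by blast

lemma mons_pvar: "i \<in> {1..4} \<Longrightarrow> keys (pvar i) \<subseteq> mons deg_x"
proof -
  assume "i \<in> {1..4}"
  then have "i = 1 \<or> i = 2 \<or> i = 3 \<or> i = 4" by auto
  then show ?thesis by (auto simp: pvar_def mons_iff mdeg_def lookup_single dx_def deg_x_def)
qed

lemma mons_1: "keys (1 :: mpoly) \<subseteq> mons 0"
  by (auto simp: mons_iff mdeg_def dx_def zero_prod_def)

lemma mons_pow: "keys p \<subseteq> mons deg_x \<Longrightarrow> keys (p ^ n) \<subseteq> mons (dx n)"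
proof (induction n)
  case (Suc n) then show ?case using mons_mult[of p deg_x "p ^ n" "dx n"] by (simp add: add.commute)
qed (use mons_1 in simp)

lemma mons_xy: "keys xp \<subseteq> mons deg_x" "keys xm \<subseteq> mons deg_x" "keys yp \<subseteq> mons deg_x" "keys ym \<subseteq> mons deg_x"
  "i \<in> {1,2} \<Longrightarrow> keys (xv i) \<subseteq> mons deg_x" "i \<in> {1,2} \<Longrightarrow> keys (yv i) \<subseteq> mons deg_x"
  unfolding xp_def xm_def yp_def ym_def xv_def yv_def
  by (intro mons_add_closed mons_diff_closed mons_pvar; auto)+

lemma pac_filt: assumes p: "keys p \<subseteq> mons e" and v: "v \<in> filt (T k) r d" shows "pac p v \<in> filt (T k) r (d + e)"
  unfolding pac_def
proof (rule lin_sp[OF lin_lift[OF lin_id(2)]])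
  show "emb p \<in> sp (Mono ` mons e)" unfolding emb_def
    using p by (intro vec.subspace_sum[OF subspace_sp] sp_ops) auto
  fix l assume "l \<in> Mono ` mons e"
  then obtain m where m: "l = Mono m" "e = dx (mdeg m)" by (auto simp: mons_iff)
  show "lift (\<lambda>l. case l of Mono m \<Rightarrow> mact m v | _ \<Rightarrow> 0) (bv l) \<in> filt (T k) r (d + e)"
    using fmD(2)[OF fm_mact v, of m] m by simp
qed (simp add: filt_T)

subsection \<open>The elementary braid\<close>

lemma Qxy_closed: "p \<in> Qxy \<Longrightarrow> q \<in> Qxy \<Longrightarrow> p + q \<in> Qxy" "p \<in> Qxy \<Longrightarrow> q \<in> Qxy \<Longrightarrow> p * q \<in> Qxy"
  "p \<in> Qxy \<Longrightarrow> - p \<in> Qxy" "0 \<in> Qxy" "1 \<in> Qxy"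
proof -
  show "p \<in> Qxy \<Longrightarrow> q \<in> Qxy \<Longrightarrow> p + q \<in> Qxy"
    unfolding Qxy_def Qpoly_def using keys_add[of p q] by blast
  show "p * q \<in> Qxy" if xy: "p \<in> Qxy" "q \<in> Qxy"
    unfolding Qxy_def Qpoly_def
  proof (intro CollectI ballI)
    fix m assume "m \<in> keys (p * q)"
    then obtain a b where "m = a + b" "a \<in> keys p" "b \<in> keys q"
      using keys_mult[of p q] by auto
    moreover then have "keys a \<subseteq> {1..4}" "keys b \<subseteq> {1..4}"
      using xy unfolding Qxy_def Qpoly_def by blast+
    ultimately show "keys m \<subseteq> {1..4}" using keys_add[of a b] by blast
  qed
qed (simp_all add: Qxy_def Qpoly_def)

lemma Qxy_mons: "keys p \<subseteq> mons d \<Longrightarrow> p \<in> Qxy"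
  using P_iff[of p d] by blast

lemmas Qxy_vars = mons_xy[THEN Qxy_mons]

lemma Qxy_diff: "p \<in> Qxy \<Longrightarrow> q \<in> Qxy \<Longrightarrow> p - q \<in> Qxy"
  using Qxy_closed(1)[of p "- q"] Qxy_closed(3) by simp

definition Jsig :: "nat \<Rightarrow> mpoly set" where "Jsig c = (if c = 0 then JB else JI)"
definition Fsig :: "nat \<Rightarrow> rat \<Rightarrow> mpoly set" where
  "Fsig c i = (if i \<le> 0 then Qxy else if c = 0 \<and> i \<le> 1 then {p * (ym - xm) + r | p r. p \<in> Qxy \<and> r \<in> JB} else Jsig c)"
text \<open>Minus the degree of the generator of summand \<open>c\<close>: an element of degree
  \<open>d\<close> is represented by a polynomial of degree \<open>d + sdeg c\<close>.\<close>

definition sdeg :: "nat \<Rightarrow> deg" where "sdeg c = (if c = 0 then (2, 0, -1/2) else (2, 1, 1/2))"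

lemma ideal2_mult: assumes q: "q \<in> Qxy" and p: "p \<in> ideal2 f g" shows "q * p \<in> ideal2 f g"
proof -
  from p obtain a b where "p = a * f + b * g" "a \<in> Qxy" "b \<in> Qxy" by (auto simp: ideal2_def)
  then have "q * p = (q * a) * f + (q * b) * g" "q * a \<in> Qxy" "q * b \<in> Qxy"
    using q by (auto simp: algebra_simps Qxy_closed)
  then show ?thesis unfolding ideal2_def by blast
qed

lemma ideal2_Qxy: "f \<in> Qxy \<Longrightarrow> g \<in> Qxy \<Longrightarrow> p \<in> ideal2 f g \<Longrightarrow> p \<in> Qxy"
  by (auto simp: ideal2_def Qxy_closed)

lemma ideal2I: "a \<in> Qxy \<Longrightarrow> b \<in> Qxy \<Longrightarrow> p = a * f + b * g \<Longrightarrow> p \<in> ideal2 f g"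
  unfolding ideal2_def by blast

lemma ideal2_0: "0 \<in> ideal2 f g"
  unfolding ideal2_def mem_Collect_eq by (rule exI[of _ 0], rule exI[of _ 0]) (simp add: Qxy_closed)

lemma ideal2_gen: "a \<in> Qxy \<Longrightarrow> a * f \<in> ideal2 f g" "a \<in> Qxy \<Longrightarrow> a * g \<in> ideal2 f g"
proof -
  assume a: "a \<in> Qxy"
  have "a * f = a * f + 0 * g" "a * g = 0 * f + a * g" by simp_all
  then show "a * f \<in> ideal2 f g" "a * g \<in> ideal2 f g"
    unfolding ideal2_def using a Qxy_closed(4) by blast+
qed

lemma Jsig_Qxy: "p \<in> Jsig c \<Longrightarrow> p \<in> Qxy"
  unfolding Jsig_def JB_def JI_def
  by (erule ideal2_Qxy[rotated 2] | simp split: if_splits; elim ideal2_Qxy[rotated 2];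
      intro Qxy_closed Qxy_diff Qxy_vars; simp)+

lemma Jsig_mult: "q \<in> Qxy \<Longrightarrow> p \<in> Jsig c \<Longrightarrow> q * p \<in> Jsig c"
  by (auto simp: Jsig_def JB_def JI_def ideal2_mult)

lemma Jsig_Fsig: "Jsig c \<subseteq> Fsig c i"
proof
  fix p assume p: "p \<in> Jsig c"
  have "\<exists>a r. p = a * (ym - xm) + r \<and> a \<in> Qxy \<and> r \<in> JB" if "c = 0"
    using p that Qxy_closed(4) by (intro exI[of _ 0] exI[of _ p]) (simp add: Jsig_def)
  then show "p \<in> Fsig c i" using p Jsig_Qxy[OF p] unfolding Fsig_def by simp
qed

lemma sig_shift: "inverse (sh_ts * sh_aq) = Shift (-2) (-1) (-1/2) (-1/2)" "sh_ta = Shift 0 1 1 0"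
  by (simp_all add: sh_aq_eq sh_ts_def times_shift_def inverse_shift_def sh_ta_def sh_t_def sh_a_def)

lemma sigma_sel_raw:
  "piece sigma_neg d = piece (dsum [sh_ta \<triangleright> Bbim, Ibim]) (d - (-2, -1, -1/2))"
  "rels sigma_neg d = rels (dsum [sh_ta \<triangleright> Bbim, Ibim]) (d - (-2, -1, -1/2))"
  "filt sigma_neg i d = filt (dsum [sh_ta \<triangleright> Bbim, Ibim]) (i + 1/2) (d - (-2, -1, -1/2))"
  by (simp_all add: sigma_neg_def sel_shift sig_shift dsum_bim_def fsp.defs fbim.defs fch.defs)

lemma dsum2:
  "piece (dsum [a,b]) d = vec.span (incl 0 ` piece a d \<union> incl 1 ` piece b d)"
  "rels (dsum [a,b]) d = vec.span (incl 0 ` rels a d \<union> incl 1 ` rels b d)"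
  "filt (dsum [a,b]) i d = vec.span (incl 0 ` filt a i d \<union> incl 1 ` filt b i d)"
proof -
  have *: "(\<Union>k<length [a,b]. f k ([a,b] ! k)) = f 0 a \<union> f 1 b" for f :: "nat \<Rightarrow> _ \<Rightarrow> vec set"
    by (simp add: lessThan_Suc numeral_eq_Suc Un_ac)
  show "piece (dsum [a,b]) d = vec.span (incl 0 ` piece a d \<union> incl 1 ` piece b d)"
  "rels (dsum [a,b]) d = vec.span (incl 0 ` rels a d \<union> incl 1 ` rels b d)"
  "filt (dsum [a,b]) i d = vec.span (incl 0 ` filt a i d \<union> incl 1 ` filt b i d)"
    using *[of "\<lambda>k M. incl k ` piece M d"] *[of "\<lambda>k M. incl k ` rels M d"] *[of "\<lambda>k M. incl k ` filt M i d"]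
    by (simp_all only: dsum_def fsp.select_convs)
qed

lemma sigma_sel:
  "piece sigma_neg d = vec.span {incl c (emb p) | c p. c \<in> {0,1} \<and> p \<in> Qxy \<inter> homog (d + sdeg c)}"
  "rels sigma_neg d = vec.span {incl c (emb p) | c p. c \<in> {0,1} \<and> p \<in> Jsig c \<inter> homog (d + sdeg c)}"
  "filt sigma_neg i d = vec.span {incl c (emb p) | c p. c \<in> {0,1} \<and> p \<in> Fsig c (i + 1/2) \<inter> homog (d + sdeg c)}"
proof -
  have d: "d + sdeg 1 - (0, 1, 1) = d + sdeg 0" "d - (-2, -1, -1/2) = d + sdeg 1"
    by (cases d; simp add: sdeg_def)+
  have s: "{incl c (emb p) | c p. c \<in> {0,1} \<and> p \<in> A c} = incl 0 ` emb ` A 0 \<union> incl 1 ` emb ` A 1" for A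
    by blast
  show "piece sigma_neg d = vec.span {incl c (emb p) | c p. c \<in> {0,1} \<and> p \<in> Qxy \<inter> homog (d + sdeg c)}"
    unfolding s sigma_sel_raw dsum2 sel_shift sig_shift shift.sel Bbim_def Ibim_def cyc_sel d ..
  show "rels sigma_neg d = vec.span {incl c (emb p) | c p. c \<in> {0,1} \<and> p \<in> Jsig c \<inter> homog (d + sdeg c)}"
    unfolding s sigma_sel_raw dsum2 sel_shift sig_shift shift.sel Bbim_def Ibim_def cyc_sel d
    by (simp add: Jsig_def)
  show "filt sigma_neg i d = vec.span {incl c (emb p) | c p. c \<in> {0,1} \<and> p \<in> Fsig c (i + 1/2) \<inter> homog (d + sdeg c)}"
    unfolding s sigma_sel_raw dsum2 sel_shift sig_shift shift.sel Bbim_def Ibim_def cyc_sel d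
    by (simp add: Jsig_def Fsig_def trivial_filt_def)
qed

definition MS :: "mpoly \<Rightarrow> vec \<Rightarrow> vec" where
  "MS q = inop (\<lambda>c v. if c < 2 then incl c (mulop q v) else 0)"

lemma lin_MS [lins]: "lin g \<Longrightarrow> lin (\<lambda>v. MS q (g v))" unfolding MS_def by (intro lins)

lemma lin_mulop [lins]: "lin g \<Longrightarrow> lin (\<lambda>v. mulop q (g v))" unfolding mulop_def by (intro lins)

lemma MS_incl: "c < 2 \<Longrightarrow> MS q (incl c (emb p)) = incl c (emb (q * p))"
  unfolding MS_def by (subst inop_incl) (simp_all add: mulop_emb lins)

lemma sigma_act: "xact sigma_neg i = MS (xv i)" "yact sigma_neg i = MS (yv i)"
proof -
  have b: "blocks [mulop q, mulop q] v = MS q v" for q v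
  proof (rule lin_ext[where f = "blocks [mulop q, mulop q]" and g = "MS q"])
    show "blocks [mulop q, mulop q] (bv l) = MS q (bv l)" for l
      by (cases l) (auto simp: blocks_def MS_def inop_def less_2_cases_iff nth_Cons')
  qed (rule lin_MS[OF lin_id(2)] | unfold blocks_def, rule lin_lift[OF lin_id(2)])+
  show "xact sigma_neg i = MS (xv i)" "yact sigma_neg i = MS (yv i)"
    by (auto simp: sigma_neg_def shift_def Let_def dsum_bim_def Bbim_def Ibim_def cyclic_bim_def
        fsp.defs fbim.defs fch.defs b)
qed

lemma sigma_dout: "dout sigma_neg (incl 0 v) = incl 1 v" "dout sigma_neg (incl 1 v) = 0" "lin (dout sigma_neg)"
proof -
  have d: "dout sigma_neg = lift (\<lambda>l. case l of In k l' \<Rightarrow> if k = 0 then bv (In 1 l') else 0 | _ \<Rightarrow> 0)"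
    by (simp add: sigma_neg_def shift_def Let_def dsum_bim_def fsp.defs fbim.defs fch.defs)
  show "dout sigma_neg (incl 0 v) = incl 1 v" "dout sigma_neg (incl 1 v) = 0"
    unfolding d lift_incl by (simp_all add: incl_def lift_zero_fun)
  show "lin (dout sigma_neg)" unfolding d by (intro lins)
qed

lemma wfsp_sigma: "wfsp sigma_neg"
  unfolding wfsp_def sigma_sel
  using Jsig_Fsig by (intro conjI allI vec.subspace_span vec.span_mono) blast

lemma wfch_sigma: "wfch sigma_neg"
  unfolding wfch_def sigma_act
  by (intro conjI allI ballI wfsp_sigma sigma_dout lins) (simp add: sigma_sel)

lemma eqm_sigma:
  assumes "lin F" "lin G" "wfsp P"
   "\<And>c p d. c \<in> {0,1} \<Longrightarrow> keys p \<subseteq> mons (d + sdeg c) \<Longrightarrow> F (incl c (emb p)) - G (incl c (emb p)) \<in> rels P (d + \<delta>)"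
  shows "eqm \<delta> sigma_neg P F G"
  unfolding eqm_def
proof (intro allI ballI)
  fix d v assume "v \<in> piece sigma_neg d"
  then show "F v - G v \<in> rels P (d + \<delta>)" unfolding sigma_sel
    by (rule lin_span[OF lin_minus[OF assms(1,2)] wfspD(1)[OF assms(3)], rotated])
       (use assms(4) P_iff in blast)
qed

lemma sigma_rels: "c \<in> {0,1} \<Longrightarrow> p \<in> Jsig c \<Longrightarrow> keys p \<subseteq> mons (d + sdeg c) \<Longrightarrow> incl c (emb p) \<in> rels sigma_neg d"
  unfolding sigma_sel using P_iff[of p "d + sdeg c"] by (intro vec.span_base) blast

lemma gm_MS: assumes "keys q \<subseteq> mons e" shows "gm e sigma_neg sigma_neg (MS q)"
  unfolding gm_def
proof (intro conjI allI ballI)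
  show "lin (MS q)" by (rule lin_MS[OF lin_id(2)])
  have k: "q * p \<in> Qxy \<inter> homog (d + e + sdeg c)" if "p \<in> Qxy \<inter> homog (d + sdeg c)" for p d c
    using mons_mult[OF assms, of p "d + sdeg c"] that unfolding P_iff by (simp add: ac_simps)
  show "MS q v \<in> piece sigma_neg (d + e)" if "v \<in> piece sigma_neg d" for v d
    using that unfolding sigma_sel
  proof (rule lin_span[OF lin_MS[OF lin_id(2)] vec.subspace_span, rotated])
    fix x assume "x \<in> {incl c (emb p) | c p. c \<in> {0,1} \<and> p \<in> Qxy \<inter> homog (d + sdeg c)}"
    then obtain c p where x: "x = incl c (emb p)" "c \<in> {0,1}" "p \<in> Qxy \<inter> homog (d + sdeg c)" by blast
    then have "MS q x = incl c (emb (q * p))" by (auto simp: MS_incl)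
    then show "MS q x \<in> vec.span {incl c (emb p) | c p. c \<in> {0,1} \<and> p \<in> Qxy \<inter> homog (d + e + sdeg c)}"
      using x(2) k[OF x(3)] by (intro vec.span_base) blast
  qed
  show "MS q v \<in> rels sigma_neg (d + e)" if "v \<in> rels sigma_neg d" for v d
    using that unfolding sigma_sel
  proof (rule lin_span[OF lin_MS[OF lin_id(2)] vec.subspace_span, rotated])
    fix x assume "x \<in> {incl c (emb p) | c p. c \<in> {0,1} \<and> p \<in> Jsig c \<inter> homog (d + sdeg c)}"
    then obtain c p where x: "x = incl c (emb p)" "c \<in> {0,1}" "p \<in> Jsig c \<inter> homog (d + sdeg c)" by blast
    then have "MS q x = incl c (emb (q * p))" by (auto simp: MS_incl)
    then show "MS q x \<in> vec.span {incl c (emb p) | c p. c \<in> {0,1} \<and> p \<in> Jsig c \<inter> homog (d + e + sdeg c)}"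
      using x(2,3) k[of p d c] Jsig_mult[OF Qxy_mons[OF assms], of p c] Jsig_Qxy by (intro vec.span_base) blast
  qed
qed

text \<open>\<open>sigma_neg\<close> lists B first, while B is position 1 and I position 0 of
  \<open>T 1\<close>; for the same reason \<open>gS\<close> uses \<open>1 - P\<close>.\<close>

definition sgen :: "nat \<Rightarrow> lab" where "sgen c = (if c = 0 then L4 1 0 0 0 else L4 0 1 0 0)"

definition fS :: "vec \<Rightarrow> vec" where
  "fS = inop (\<lambda>c. lift (\<lambda>l. case l of Mono m \<Rightarrow> mact m (bv (sgen c)) | _ \<Rightarrow> 0))"

lemma lin_fS [lins]: "lin g \<Longrightarrow> lin (\<lambda>v. fS (g v))" unfolding fS_def by (intro lins)

lemma fS_incl: "fS (incl c (emb p)) = pac p (bv (sgen c))"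
  unfolding fS_def pac_def by (subst inop_incl) (auto intro!: lins)

text \<open>The polynomial that the label \<open>L4 P E i j\<close> stands for. In position 0 the
  value E = 1 is a convention and contributes no factor.\<close>

definition bpoly :: "nat \<Rightarrow> nat \<Rightarrow> nat \<Rightarrow> nat \<Rightarrow> mpoly" where
  "bpoly P E i j = xm ^ i * xp ^ j * (if P = 0 then 1 else (ym - xm) ^ E)"

definition gS :: "vec \<Rightarrow> vec" where
  "gS = opl (\<lambda>P E i j. incl (1 - P) (emb (bpoly P E i j)))"

lemma lin_gS [lins]: "lin g \<Longrightarrow> lin (\<lambda>v. gS (g v))" unfolding gS_def by (intro lins)
lemma gS_lb [simp]: "gS (lb P E i j) = incl (1 - P) (emb (bpoly P E i j))" by (simp add: gS_def)
lemmas gS_simps = lin_simps[OF lin_gS[OF lin_id(2)]]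

lemma keys_bpoly: "keys (bpoly P E i j) \<subseteq> mons (dx (i + j + (if P = 0 then 0 else E)))"
proof -
  have k: "keys (xm ^ i * xp ^ j) \<subseteq> mons (dx i + dx j)" by (intro mons_mult mons_pow mons_xy)
  have "keys ((ym - xm) ^ E) \<subseteq> mons (dx E)" by (intro mons_pow mons_diff_closed mons_xy)
  from mons_mult[OF k this] k show ?thesis by (simp add: bpoly_def dx_add)
qed

lemma sgen_deg: "dgT 1 (sgen c) + sdeg c = 0"
  by (simp add: sgen_def sdeg_def zero_prod_def)

lemma sgen_filt: "bv (sgen c) \<in> filt (T 1) (-1/2) (dgT 1 (sgen c))"
  by (simp add: filt_T sgen_def)

text \<open>The lowest level in \<open>T 1\<close> is -1/2, so statements on filtration levels cover
  the pieces too.\<close>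

lemma piece_T1_filt: "v \<in> piece (T 1) d \<longleftrightarrow> v \<in> filt (T 1) (-1/2) d"
proof -
  have "-1/2 \<le> lvT 1 l" if "l \<in> LT 1" for l using that by (cases rule: LT_cases) auto
  then have "{l \<in> LT 1. dgT 1 l = d \<and> -1/2 \<le> lvT 1 l} = {l \<in> LT 1. dgT 1 l = d}" by blast
  then show ?thesis by (simp add: piece_T filt_T)
qed

lemma fm_fS: "fm 0 sigma_neg (T 1) fS"
  unfolding fm_def gm_def add_0_right
proof (intro conjI allI ballI)
  show "lin fS" by (intro lins)
  have A: "pac p (bv (sgen c)) \<in> filt (T 1) (-1/2) d" if "p \<in> Qxy \<inter> homog (d + sdeg c)" for p c d
    using pac_filt[OF that[unfolded P_iff] sgen_filt[of c]] sgen_deg[of c]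
    by (metis add.assoc add.commute add_0)
  show "fS v \<in> piece (T 1) d" if "v \<in> piece sigma_neg d" for v d
    using that unfolding sigma_sel piece_T1_filt
    by (rule lin_span[OF lin_fS[OF lin_id(2)] wfspD(2)[OF wfsp_based[OF based_T]], rotated])
       (elim CollectE exE conjE, simp only: fS_incl A)
  show "fS v \<in> rels (T 1) d" if "v \<in> rels sigma_neg d" for v d
    using that unfolding sigma_sel 
    by (rule lin_span[OF lin_fS[OF lin_id(2)] wfspD(1)[OF wfsp_based[OF based_T]], rotated])
       (auto simp: fS_incl Jsig_def pac_JB sgen_def pac_JI[unfolded One_nat_def] basedD[OF based_T])
  \<comment> \<open>There are three ranges: for i up to -1/2 everything is allowed; then, in B and
    for i up to 1/2, the multiples of y_- - x_- modulo relations; otherwise the relations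
    alone.\<close>
  have F: "pac p (bv (sgen c)) \<in> filt (T 1) i d" if c: "c \<in> {0,1}" and p: "p \<in> Fsig c (i + 1/2)" "p \<in> homog (d + sdeg c)" for p c d i
  proof (cases "i \<le> -1/2")
    case True
    then have "p \<in> Qxy \<inter> homog (d + sdeg c)" using p by (auto simp: Fsig_def)
    from A[OF this] show ?thesis unfolding filt_T by (rule sp_mono[rotated]) (use True in auto)
  next
    case False
    show ?thesis
    proof (cases "c = 0 \<and> i \<le> 1/2")
      case True
      have "\<not> i + 1/2 \<le> 0" "i + 1/2 \<le> 1" using False True by linarith+
      then obtain a r where a: "p = a * (ym - xm) + r" "a \<in> Qxy" "r \<in> JB" using p True by (auto simp: Fsig_def)
      have "r \<in> Qxy" using Jsig_Qxy[of r 0] a(3) by (simp add: Jsig_def)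
      then have pQ: "p \<in> Qxy \<inter> homog (d + sdeg c)"
        using a p(2) Qxy_closed Qxy_diff Qxy_vars by simp
      have "pac p (bv (sgen c)) = pac a (lb 1 1 0 0)"
        using True by (simp add: a(1) pac_add pac_mult pac_diff pac_xy pac_JB[OF a(3)] sgen_def XYd_simps pac_simps)
      \<comment> \<open>The labels with e = 1 in position 1 span a submodule, namely F^1 of
        B.\<close>
      moreover have "pac a (lb 1 1 0 0) \<in> sp {L4 1 1 i j | i j. True}"
      proof -
        let ?A = "{L4 1 1 i j | i j. True}"
        have Z: "ZT i v \<in> sp ?A" if "v \<in> sp ?A" for i v
          using that
          by (rule lin_sp[OF lin_ZT[OF lin_id(2)] subspace_sp, rotated])
             (auto simp: ZT_def half_def intro!: sp_ops)
        have Zn: "(ZT i ^^ n) v \<in> sp ?A" if "v \<in> sp ?A" for i v n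
          using that Z by (induction n) auto
        have "mact m (lb 1 1 0 0) \<in> sp ?A" for m
          unfolding mact_def by (intro Zn) simp
        then show ?thesis
          by (induction a rule: pm_induct) (auto simp: pac_single pac_add intro!: sp_ops)
      qed
      ultimately have "keys (pac p (bv (sgen c))) \<subseteq> {L4 1 1 i j | i j. True} \<inter> {l \<in> LT 1. dgT 1 l = d \<and> -1/2 \<le> lvT 1 l}"
        using A[OF pQ] by (auto simp: sp_def filt_T)
      then have "keys (pac p (bv (sgen c))) \<subseteq> {l \<in> LT 1. dgT 1 l = d \<and> i \<le> lvT 1 l}"
        using True by (force simp: subset_iff)
      then show ?thesis by (simp add: filt_T sp_def)
    next
      case ne: False
      then have "p \<in> Jsig c" using p(1) False by (auto simp: Fsig_def)
      then have "pac p (bv (sgen c)) = 0" using c by (auto simp: Jsig_def pac_JB sgen_def pac_JI[unfolded One_nat_def])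
      then show ?thesis by (simp add: filt_T)
    qed
  qed
  show "fS v \<in> filt (T 1) i d" if "v \<in> filt sigma_neg i d" for v i d
    using that unfolding sigma_sel
    by (rule lin_span[OF lin_fS[OF lin_id(2)] wfspD(2)[OF wfsp_based[OF based_T]], rotated])
       (elim CollectE exE conjE IntE, simp only: fS_incl F)
qed

lemma bm_fS: "bm 0 sigma_neg (T 1) fS"
proof (rule bmI[OF fm_fS])
  fix i :: nat assume i: "i \<in> {1,2}"
  note wT = wfsp_based[OF based_T]
  have r: "c \<in> {0,1} \<Longrightarrow> fS (MS q (incl c (emb p))) = pac q (fS (incl c (emb p)))" for c p q
    by (auto simp: MS_incl fS_incl pac_mult)
  show "eqm (0 + deg_x) sigma_neg (T 1) (\<lambda>v. fS (xact sigma_neg i v)) (\<lambda>v. xact (T 1) i (fS v))"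
    unfolding sigma_act T_sel pac_v(1)[OF i, symmetric]
    by (rule eqm_sigma[OF _ _ wT]) (intro lins | simp add: r vec.subspace_0[OF wfspD(1)[OF wT]] del: One_nat_def)+
  show "eqm (0 + deg_x) sigma_neg (T 1) (\<lambda>v. fS (yact sigma_neg i v)) (\<lambda>v. yact (T 1) i (fS v))"
    unfolding sigma_act T_sel pac_v(2)[OF i, symmetric]
    by (rule eqm_sigma[OF _ _ wT]) (intro lins | simp add: r vec.subspace_0[OF wfspD(1)[OF wT]] del: One_nat_def)+
qed

lemma fm_gS: "fm 0 (T 1) sigma_neg gS"
proof (rule fm_based[OF based_T gm_based[OF based_T]])
  fix l assume "l \<in> LT 1"
  then obtain P E i j where l: "l = L4 P E i j" "P \<le> 1" "E \<le> 1" "P = 0 \<longrightarrow> E = 1" by (auto simp: LT_def)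
  let ?b = "bpoly P E i j"
  have c: "1 - P \<in> {0,1}" using l(2) by auto
  have b: "?b \<in> Qxy \<inter> homog (dgT 1 l + 0 + sdeg (1 - P))"
  proof -
    have "dgT 1 l + 0 + sdeg (1 - P) = dx (i + j + (if P = 0 then 0 else E))"
      using l by (cases P) (auto simp: sdeg_def dx_def)
    then show ?thesis unfolding P_iff using keys_bpoly by simp
  qed
  then show "gS (bv l) \<in> piece sigma_neg (dgT 1 l + 0)"
    unfolding l(1) gS_lb sigma_sel using c by (intro vec.span_base) blast
  fix r assume r: "r \<le> lvT 1 l"
  have "?b \<in> Fsig (1 - P) (r + 1/2)"
  proof (cases "r + 1/2 \<le> 0")
    case True then show ?thesis using b by (simp add: Fsig_def)
  next
    case False
    \<comment> \<open>Above the lowest level only y_- - x_- times a monomial is left.\<close>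
    then have PE: "P = 1" "E = 1" "r + 1/2 \<le> 1" using r l by (cases P; cases E; simp)+
    have "xm ^ i * xp ^ j \<in> Qxy" by (rule Qxy_mons[OF mons_mult[OF mons_pow[OF mons_xy(2)] mons_pow[OF mons_xy(1)]]])
    moreover have "?b = (xm ^ i * xp ^ j) * (ym - xm) + 0" using PE by (simp add: bpoly_def)
    moreover have "0 \<in> JB" by (simp add: JB_def ideal2_0)
    ultimately have "?b \<in> {p * (ym - xm) + r | p r. p \<in> Qxy \<and> r \<in> JB}" by blast
    then show ?thesis unfolding Fsig_def using False PE by simp
  qed
  then show "gS (bv l) \<in> filt sigma_neg r (dgT 1 l + 0)"
    unfolding l(1) gS_lb sigma_sel using c b l(1) by (intro vec.span_base) blast
qed (intro lins wfsp_sigma | simp add: sigma_sel)+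

lemma MS_half: "i \<in> {1,2} \<Longrightarrow> MS (xv i) v = half (MS xp) (MS xm) i v"
   "i \<in> {1,2} \<Longrightarrow> MS (yv i) v = half (MS yp) (MS ym) i v"
proof -
  have a: "MS (p + q) v = MS p v + MS q v" for p q v
  proof (rule lin_ext[where f = "MS (p + q)" and g = "\<lambda>v. MS p v + MS q v"])
    show "MS (p + q) (bv l) = MS p (bv l) + MS q (bv l)" for l
    proof (cases l)
      case (In c l')
      have "mulop (p + q) (bv l') = mulop p (bv l') + mulop q (bv l')"
        by (cases l') (simp_all add: mulop_def distrib_right emb_add)
      then show ?thesis by (simp add: In MS_def incl_add)
    qed (simp_all add: MS_def inop_def)
  qed (rule lin_MS[OF lin_id(2)] lin_plus)+
  have d: "MS (p - q) v = MS p v - MS q v" for p q v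
    using a[of "p - q" q v] by simp
  have h: "scl (1/2) (x + y + (x - y)) = x" "scl (1/2) (x + y - (x - y)) = y" for x y :: vec
    by (simp_all flip: vec.scale_left_distrib vec.scale_left_diff_distrib add: vec.scale_right_distrib vec.scale_right_diff_distrib)
  show "i \<in> {1,2} \<Longrightarrow> MS (xv i) v = half (MS xp) (MS xm) i v"
   "i \<in> {1,2} \<Longrightarrow> MS (yv i) v = half (MS yp) (MS ym) i v"
    unfolding half_def xp_def xm_def yp_def ym_def a d using h by (auto simp: scl_neg1 simp del: One_nat_def)
qed

lemma bm_gS: "bm 0 (T 1) sigma_neg gS"
proof (rule bmI[OF fm_gS])
  fix i :: nat assume i: "i \<in> {1,2}"
  have X: "eqm (0 + deg_x) (T 1) sigma_neg (\<lambda>v. gS (Xp v)) (\<lambda>v. MS xp (gS v))"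
    "eqm (0 + deg_x) (T 1) sigma_neg (\<lambda>v. gS (Xm v)) (\<lambda>v. MS xm (gS v))"
    by (rule eqm_based_eq[OF based_T _ _ wfsp_sigma], (intro lins)+,
        erule LT_cases; simp add: MS_incl bpoly_def algebra_simps)+
  show "eqm (0 + deg_x) (T 1) sigma_neg (\<lambda>v. gS (xact (T 1) i v)) (\<lambda>v. xact sigma_neg i (gS v))"
    unfolding sigma_act T_sel MS_half(1)[OF i] by (rule eqm_half[OF wfsp_sigma lin_gS[OF lin_id(2)] X])
  have Y: "gS (Xp (bv l)) - MS yp (gS (bv l)) \<in> rels sigma_neg (dgT 1 l + (0 + deg_x)) \<and>
     gS (Ym (bv l)) - MS ym (gS (bv l)) \<in> rels sigma_neg (dgT 1 l + (0 + deg_x))" if "l \<in> LT 1" for l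
  proof -
    from that obtain P E i j where l: "l = L4 P E i j" "P \<le> 1" "E \<le> 1" "P = 0 \<longrightarrow> E = 1" by (auto simp: LT_def)
    let ?b = "bpoly P E i j" and ?d = "dgT 1 l + (0 + deg_x)"
    have c: "1 - P \<in> {0,1}" using l(2) by auto
    have b: "keys ?b \<subseteq> mons (dx (i + j + (if P = 0 then 0 else E)))" by (rule keys_bpoly)
    then have bQ: "?b \<in> Qxy" "- ?b \<in> Qxy" using Qxy_mons Qxy_closed(3) by blast+
    have deg: "dx (i + j + (if P = 0 then 0 else E)) + deg_x = ?d + sdeg (1 - P)"
      using l by (cases P) (auto simp: sdeg_def dx_def deg_x_def)
    have k: "keys (q * ?b) \<subseteq> mons (?d + sdeg (1 - P))" if "keys q \<subseteq> mons deg_x" for q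
      using mons_mult[OF b that] unfolding deg by (simp add: mult.commute)
    \<comment> \<open>\<open>T 1\<close> has a single operator for x_+ and y_+; in
      \<open>sigma_neg\<close> the two agree only modulo the ideal.\<close>
    have 1: "(xp - yp) * ?b \<in> Jsig (1 - P)"
    proof (cases "P = 0")
      case True
      have "(xp - yp) * ?b = - ?b * (yv 1 - xv 1) + - ?b * (yv 2 - xv 2)"
        by (simp add: xp_def yp_def algebra_simps)
      then have "(xp - yp) * ?b \<in> JI" unfolding JI_def by (rule ideal2I[OF bQ(2) bQ(2)])
      then show ?thesis using True by (simp add: Jsig_def)
    next
      case False
      have "(xp - yp) * ?b = - ?b * (yp - xp)" by (simp add: algebra_simps)
      moreover have "- ?b * (yp - xp) \<in> JB" unfolding JB_def by (rule ideal2_gen(1)[OF bQ(2)])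
      ultimately show ?thesis using False l(2) by (simp add: Jsig_def)
    qed
    have "incl (1 - P) (emb ((xp - yp) * ?b)) \<in> rels sigma_neg ?d"
      by (rule sigma_rels[OF c 1 k]) (intro mons_diff_closed mons_xy)
    moreover have "incl (1 - P) (emb ((xp - yp) * ?b)) = gS (Xp (bv l)) - MS yp (gS (bv l))"
    proof -
      have "bpoly P E i (Suc j) = xp * ?b" by (simp add: bpoly_def algebra_simps)
      then show ?thesis using c by (auto simp: l(1) MS_incl left_diff_distrib emb_diff incl_diff)
    qed
    moreover have "gS (Ym (bv l)) - MS ym (gS (bv l)) \<in> rels sigma_neg ?d"
    proof (cases "E = 0")
      case True
      then have P: "P = 1" using l by auto
      have "bpoly 1 1 i j + bpoly 1 0 (Suc i) j = ym * bpoly 1 0 i j"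
        by (simp add: bpoly_def algebra_simps)
      then have "gS (Ym (bv l)) = MS ym (gS (bv l))"
        by (simp add: l(1) P True gS_simps MS_incl flip: incl_add emb_add)
      then show ?thesis by (simp add: sigma_sel vec.span_zero)
    next
      case False
      then have E: "E = 1" using l by auto
      show ?thesis
      proof (cases "P = 0")
        case True
        have "(xm - ym) * ?b = ?b * (yv 1 - xv 1) + - ?b * (yv 2 - xv 2)"
          by (simp add: xm_def ym_def algebra_simps)
        then have "(xm - ym) * ?b \<in> JI" unfolding JI_def by (rule ideal2I[OF bQ])
        then have "(xm - ym) * ?b \<in> Jsig (1 - P)" using True by (simp add: Jsig_def)
        then have "incl (1 - P) (emb ((xm - ym) * ?b)) \<in> rels sigma_neg ?d"
          by (rule sigma_rels[OF c _ k]) (intro mons_diff_closed mons_xy)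
        moreover have "bpoly 0 E (Suc i) j = xm * bpoly 0 E i j" by (simp add: bpoly_def algebra_simps)
        ultimately show ?thesis
          by (simp add: l(1) True E MS_incl gS_simps left_diff_distrib emb_diff incl_diff)
      next
        case False
        then have P: "P = 1" using l by auto
        \<comment> \<open>\<open>?b\<close> contains the factor y_- - x_-, and its product with y_-
          + x_- lies in the ideal of B; so y_- acts on it as -x_-.\<close>
        let ?a = "- (xm ^ i * xp ^ j)"
        have "?a \<in> Qxy"
          by (rule Qxy_closed(3)[OF Qxy_mons[OF mons_mult[OF mons_pow[OF mons_xy(2)] mons_pow[OF mons_xy(1)]]]])
        then have "?a * ((ym + xm) * (ym - xm)) \<in> JB" unfolding JB_def by (rule ideal2_gen(2))
        moreover have "?a * ((ym + xm) * (ym - xm)) = (- xm - ym) * ?b"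
          by (simp add: bpoly_def P E algebra_simps)
        ultimately have "(- xm - ym) * ?b \<in> Jsig (1 - P)" by (simp add: Jsig_def P)
        then have "incl (1 - P) (emb ((- xm - ym) * ?b)) \<in> rels sigma_neg ?d"
          by (rule sigma_rels[OF c _ k]) (use mons_xy in \<open>intro mons_diff_closed; simp\<close>)
        moreover have "bpoly P E (Suc i) j = xm * bpoly P E i j" by (simp add: bpoly_def algebra_simps)
        ultimately show ?thesis
          by (simp add: l(1) P E MS_incl gS_simps left_diff_distrib emb_diff emb_uminus incl_diff incl_uminus)
      qed
    qed
    ultimately show ?thesis by simp
  qed
  have "eqm (0 + deg_x) (T 1) sigma_neg (\<lambda>v. gS (Xp v)) (\<lambda>v. MS yp (gS v))"
    "eqm (0 + deg_x) (T 1) sigma_neg (\<lambda>v. gS (Ym v)) (\<lambda>v. MS ym (gS v))"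
    by (rule eqm_based[OF based_T _ _ wfsp_sigma], (intro lins)+, use Y in blast)+
  then show "eqm (0 + deg_x) (T 1) sigma_neg (\<lambda>v. gS (yact (T 1) i v)) (\<lambda>v. yact sigma_neg i (gS v))"
    unfolding sigma_act T_sel MS_half(2)[OF i] by (rule eqm_half[OF wfsp_sigma lin_gS[OF lin_id(2)]])
qed

text \<open>Together with the next lemma this passes from single variables to monomials when
  intertwining holds only modulo relations.\<close>

lemma eqm_intertwine_pow:
  assumes N: "wfsp N" and e: "eqm deg_x M N (\<lambda>v. g (Z v)) (\<lambda>v. Z' (g v))" and Z: "gm deg_x M M Z" and Z': "gm deg_x N N Z'"
  shows "eqm (dx n) M N (\<lambda>v. g ((Z ^^ n) v)) (\<lambda>v. (Z' ^^ n) (g v)) \<and> gm (dx n) M M (Z ^^ n) \<and> gm (dx n) N N (Z' ^^ n)"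
proof (induction n)
  case 0 then show ?case by (simp add: eqm_refl[OF N])
next
  case (Suc n)
  then have IH: "eqm (dx n) M N (\<lambda>v. g ((Z ^^ n) v)) (\<lambda>v. (Z' ^^ n) (g v))" "gm (dx n) M M (Z ^^ n)" "gm (dx n) N N (Z' ^^ n)"
    by auto
  have "eqm (dx (Suc n)) M N (\<lambda>v. g (Z ((Z ^^ n) v))) (\<lambda>v. Z' ((Z' ^^ n) (g v)))"
    by (rule eqm_trans[OF N eqm_pre[OF e IH(2)] eqm_post[OF IH(1) Z']]) simp_all
  then show ?case using gm_comp[OF IH(2) Z] gm_comp[OF IH(3) Z'] by (simp add: comp_def)
qed

lemma eqm_intertwine_comp:
  assumes N: "wfsp N" and "eqm \<delta> M N (\<lambda>v. g (F v)) (\<lambda>v. F' (g v)) \<and> gm \<delta> M M F \<and> gm \<delta> N N F'"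
    "eqm \<epsilon> M N (\<lambda>v. g (G v)) (\<lambda>v. G' (g v)) \<and> gm \<epsilon> M M G \<and> gm \<epsilon> N N G'" "\<eta> = \<epsilon> + \<delta>"
  shows "eqm \<eta> M N (\<lambda>v. g (F (G v))) (\<lambda>v. F' (G' (g v))) \<and> gm \<eta> M M (\<lambda>v. F (G v)) \<and> gm \<eta> N N (\<lambda>v. F' (G' v))"
proof (intro conjI)
  have a: "eqm \<delta> M N (\<lambda>v. g (F v)) (\<lambda>v. F' (g v))" "gm \<delta> M M F" "gm \<delta> N N F'"
    "eqm \<epsilon> M N (\<lambda>v. g (G v)) (\<lambda>v. G' (g v))" "gm \<epsilon> M M G" "gm \<epsilon> N N G'" using assms by auto
  show "eqm \<eta> M N (\<lambda>v. g (F (G v))) (\<lambda>v. F' (G' (g v)))"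
    by (rule eqm_trans[OF N eqm_pre[OF a(1) a(5)] eqm_post[OF a(4) a(3)]]) (simp_all add: assms(4))
  show "gm \<eta> M M (\<lambda>v. F (G v))" "gm \<eta> N N (\<lambda>v. F' (G' v))"
    using gm_comp[OF a(5) a(2)] gm_comp[OF a(6) a(3)] assms(4) by auto
qed

lemma single_monomial: assumes "keys m \<subseteq> {1..4}"
  shows "Poly_Mapping.single m 1 = pvar 1 ^ lookup m 1 * (pvar 2 ^ lookup m 2 * (pvar 3 ^ lookup m 3 * (pvar 4 ^ lookup m 4 :: mpoly)))"
proof -
  have "m = Poly_Mapping.single 1 (lookup m 1) + (Poly_Mapping.single 2 (lookup m 2) +
      (Poly_Mapping.single 3 (lookup m 3) + Poly_Mapping.single 4 (lookup m 4)))"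
  proof (rule poly_mapping_eqI)
    fix i :: nat
    have "i = 1 \<or> i = 2 \<or> i = 3 \<or> i = 4 \<or> i \<notin> {1..4}" by auto
    then have "i = 1 \<or> i = 2 \<or> i = 3 \<or> i = 4 \<or> lookup m i = 0"
      using assms in_keys_iff[of i m] by blast
    then show "lookup m i = lookup (Poly_Mapping.single 1 (lookup m 1) + (Poly_Mapping.single 2 (lookup m 2) +
      (Poly_Mapping.single 3 (lookup m 3) + Poly_Mapping.single 4 (lookup m 4)))) i"
      by (auto simp: lookup_add lookup_single when_def)
  qed
  then show ?thesis
    unfolding single_pow[symmetric] mult_single by (metis mult_1)
qed

text \<open>\<open>sigma_neg\<close> presents B and I as quotients of the polynomial ring,
  \<open>T 1\<close> by bases. \<open>gS\<close> intertwines the variables modulo the ideals, so the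
  composite with \<open>fS\<close> has to be compared with the identity only at the generator
  1.\<close>

lemma retr_sigma: "retr sigma_neg (T 1)"
proof (rule retr_iso[OF wfch_sigma wfch_T bm_fS bm_gS])
  note wT = wfsp_based[OF based_T]
  show "eqm deg_out sigma_neg (T 1) (\<lambda>v. fS (dout sigma_neg v)) (\<lambda>v. dout (T 1) (fS v))"
    unfolding T_sel
  proof (rule eqm_sigma[OF _ _ wT])
    fix c p d assume "c \<in> {0,1::nat}"
    then have "fS (dout sigma_neg (incl c (emb p))) = dT (fS (incl c (emb p)))"
      by (auto simp: sigma_dout sigma_dout[unfolded One_nat_def] fS_incl pac_dT sgen_def lin_0[OF lin_fS[OF lin_id(2)]] pac_simps)
    then show "fS (dout sigma_neg (incl c (emb p))) - dT (fS (incl c (emb p))) \<in> rels (T 1) (d + deg_out)"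
      by (simp add: vec.subspace_0[OF wfspD(1)[OF wT]])
  qed (intro lins lin_comp[OF lin_fS[OF lin_id(2)]] sigma_dout(3))+
  show "eqm deg_out (T 1) sigma_neg (\<lambda>v. gS (dout (T 1) v)) (\<lambda>v. dout sigma_neg (gS v))"
    unfolding T_sel
  proof (rule eqm_based[OF based_T _ _ wfsp_sigma])
    fix l assume "l \<in> LT 1"
    then show "gS (dT (bv l)) - dout sigma_neg (gS (bv l)) \<in> rels sigma_neg (dgT 1 l + deg_out)"
    proof (cases rule: LT_cases)
      case (1 i j)
      then show ?thesis
        by (simp add: gS_simps sigma_dout[unfolded One_nat_def] sigma_sel vec.span_zero)
    next
      case (2 p i j)
      then show ?thesis
        by (simp add: sigma_dout[unfolded One_nat_def] sigma_sel vec.span_zero bpoly_def)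
    next
      case (3 p i j)
      \<comment> \<open>\<open>dT\<close> kills y_- - x_- times a monomial, whereas
        \<open>dout sigma_neg\<close> keeps the polynomial and moves it to I. There it is a
        relation, as y_- - x_- = (y_2 - x_2) - (y_1 - x_1).\<close>
      let ?b = "bpoly 1 0 i j"
      have k: "keys ?b \<subseteq> mons (dx (i + j))" using keys_bpoly[of 1 0 i j] by simp
      have "?b \<in> Qxy" by (rule Qxy_mons[OF k])
      then have b: "?b \<in> Qxy" "- ?b \<in> Qxy" using Qxy_closed(3) by auto
      have "bpoly 1 1 i j = - ?b * (yv 1 - xv 1) + ?b * (yv 2 - xv 2)"
        by (simp add: bpoly_def xm_def ym_def algebra_simps)
      then have "bpoly 1 1 i j \<in> JI" unfolding JI_def by (rule ideal2I[OF b(2,1)])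
      then have "bpoly 1 1 i j \<in> Jsig 1" by (simp add: Jsig_def)
      moreover have "keys (bpoly 1 1 i j) \<subseteq> mons (dgT 1 l + deg_out + sdeg 1)"
        using keys_bpoly[of 1 1 i j] 3 by (simp add: sdeg_def deg_out_def dx_def add.commute)
      ultimately have "incl 1 (emb (bpoly 1 1 i j)) \<in> rels sigma_neg (dgT 1 l + deg_out)"
        by (intro sigma_rels) auto
      then have "- incl 1 (emb (bpoly 1 1 i j)) \<in> rels sigma_neg (dgT 1 l + deg_out)"
        by (rule vec.subspace_neg[OF wfspD(1)[OF wfsp_sigma]])
      then show ?thesis using 3 by (simp add: gS_simps sigma_dout[unfolded One_nat_def])
    qed
  qed (intro lins lin_comp[OF sigma_dout(3)])+
  show "eqm 0 (T 1) (T 1) (\<lambda>v. fS (gS v)) (\<lambda>v. v)"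
  proof (rule eqm_based_eq[OF based_T _ _ wT])
    fix l assume "l \<in> LT 1"
    moreover have "(Xm ^^ i) ((Xp ^^ j) (lb P E 0 0)) = lb P E i j" for P E i j
    proof -
      have "(Xp ^^ j) (lb P E 0 0) = lb P E 0 j" by (induction j) simp_all
      moreover have "(Xm ^^ i) (lb P E 0 j) = lb P E i j" by (induction i) simp_all
      ultimately show ?thesis by simp
    qed
    ultimately show "fS (gS (bv l)) = bv l"
      by (cases rule: LT_cases)
        (simp_all add: fS_incl bpoly_def pac_mult pac_pow pac_xy sgen_def pac_diff)
  qed (intro lins)+
  show "eqm 0 sigma_neg sigma_neg (\<lambda>v. gS (fS v)) (\<lambda>v. v)"
  proof (rule eqm_sigma[OF _ _ wfsp_sigma])
    fix c d and p :: mpoly assume c: "c \<in> {0,1::nat}" and p: "keys p \<subseteq> mons (d + sdeg c)"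
    have Z: "eqm deg_x (T 1) sigma_neg (\<lambda>v. gS (ZT i v)) (\<lambda>v. MS (pvar i) (gS v)) \<and> gm deg_x (T 1) (T 1) (ZT i)
       \<and> gm deg_x sigma_neg sigma_neg (MS (pvar i))" if "i \<in> {1..4}" for i
    proof (intro conjI fmD(1)[OF fm_ZT] gm_MS mons_pvar that)
      from that have "i = 1 \<or> i = 2 \<or> i = 3 \<or> i = 4" by auto
      then show "eqm deg_x (T 1) sigma_neg (\<lambda>v. gS (ZT i v)) (\<lambda>v. MS (pvar i) (gS v))"
        using bmD(4,5)[OF bm_gS, of 1] bmD(4,5)[OF bm_gS, of 2] 
        by (auto simp: ZT_def sigma_act xv_def yv_def numeral_3_eq_3[symmetric])
    qed
    have Zn: "eqm (dx n) (T 1) sigma_neg (\<lambda>v. gS ((ZT i ^^ n) v)) (\<lambda>v. (MS (pvar i) ^^ n) (gS v)) \<and>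
       gm (dx n) (T 1) (T 1) (ZT i ^^ n) \<and> gm (dx n) sigma_neg sigma_neg (MS (pvar i) ^^ n)" if "i \<in> {1..4}" for i n
      using Z[OF that] by (intro eqm_intertwine_pow wfsp_sigma) auto
    have mono: "gS (mact m (bv (sgen c))) - incl c (emb (Poly_Mapping.single m 1)) \<in> rels sigma_neg d"
      if m: "m \<in> mons (d + sdeg c)" for m
    proof -
      from m have km: "keys m \<subseteq> {1..4}" and dm: "d + sdeg c = dx (mdeg m)" by (auto simp: mons_iff)
      have "eqm (dx (mdeg m)) (T 1) sigma_neg (\<lambda>v. gS (mact m v)) (\<lambda>v. (MS (pvar 1) ^^ lookup m 1)
         ((MS (pvar 2) ^^ lookup m 2) ((MS (pvar 3) ^^ lookup m 3) ((MS (pvar 4) ^^ lookup m 4) (gS v)))))"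
        unfolding mact_def
        by (rule conjunct1[OF eqm_intertwine_comp[OF wfsp_sigma Zn eqm_intertwine_comp[OF wfsp_sigma Zn
              eqm_intertwine_comp[OF wfsp_sigma Zn Zn refl] refl]]]) (simp_all add: mdeg_def dx_add ac_simps)
      moreover have "bv (sgen c) \<in> piece (T 1) (dgT 1 (sgen c))" using sgen_filt piece_T1_filt by blast
      ultimately have 1: "gS (mact m (bv (sgen c))) - (MS (pvar 1) ^^ lookup m 1)
         ((MS (pvar 2) ^^ lookup m 2) ((MS (pvar 3) ^^ lookup m 3) ((MS (pvar 4) ^^ lookup m 4) (gS (bv (sgen c))))))
           \<in> rels sigma_neg (dgT 1 (sgen c) + dx (mdeg m))"
        by (rule eqmD)
      have "dgT 1 (sgen c) + dx (mdeg m) = d"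
        unfolding dm[symmetric] add.left_commute[of "dgT 1 (sgen c)"] sgen_deg by simp
      moreover have "gS (bv (sgen c)) = incl c (emb 1)" using c by (auto simp: sgen_def bpoly_def)
      moreover have "(MS q ^^ n) (incl c (emb r)) = incl c (emb (q ^ n * r))" for q n r
        using c by (induction n) (auto simp: MS_incl mult.assoc)
      ultimately show ?thesis using 1 single_monomial[OF km] by simp
    qed
    have "gS (fS (incl c v)) - incl c v \<in> rels sigma_neg d" if "v \<in> sp (Mono ` mons (d + sdeg c))" for v
      using that
    proof (rule lin_sp[where f = "\<lambda>v. gS (fS (incl c v)) - incl c v", rotated 3])
      fix l assume "l \<in> Mono ` mons (d + sdeg c)"
      then obtain m where m: "l = Mono m" "m \<in> mons (d + sdeg c)" by blast
      have "bv l = emb (Poly_Mapping.single m 1)" by (simp add: m emb_single)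
      then show "gS (fS (incl c (bv l))) - incl c (bv l) \<in> rels sigma_neg d"
        using mono[OF m(2)] by (simp add: fS_incl pac_single)
    qed (intro lins wfspD(1)[OF wfsp_sigma])+
    moreover have "emb p \<in> sp (Mono ` mons (d + sdeg c))" unfolding emb_def
      using p by (intro vec.subspace_sum[OF subspace_sp] sp_ops) auto
    ultimately show "gS (fS (incl c (emb p))) - incl c (emb p) \<in> rels sigma_neg (d + 0)" by simp
  qed (intro lins)+
qed

text \<open>Retracts are compatible with composition on both sides, so the new factor may be
  replaced by \<open>T 1\<close> and the others by their reduced complex before Gaussian elimination
  applies.\<close>

lemma retr_power: "retr (sigma_neg_power (Suc k)) (T (Suc k))"
proof (induction k)
  case 0 then show ?case using retr_sigma by simp
next
  case (Suc k)
  have w: "wfch (sigma_neg_power (Suc k))" using Suc by (simp add: retr_def)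
  show ?case
    unfolding sigma_neg_power.simps
    by (rule retr_trans[OF retr_left[OF retr_sigma w] retr_trans[OF retr_right[OF Suc wfch_T]
          retr_trans[OF retr_TT retr_K]]])
qed

subsection \<open>The Koszul complex of a reduced complex\<close>

definition kdeg :: "nat \<Rightarrow> deg" where
  "kdeg c = (if c = 0 then 0 else if c = 3 then (4, 2, 0) else (2, 1, 0))"

definition LKos :: "lab set" where "LKos = {In c (Mono m) | c m. c < 4 \<and> keys m \<subseteq> {1..4}}"

definition dgKos :: "lab \<Rightarrow> deg" where
  "dgKos l = (case l of In c (Mono m) \<Rightarrow> kdeg c + dx (mdeg m) | _ \<Rightarrow> 0)"

lemma dgKos_simp [simp]: "dgKos (In c (Mono m)) = kdeg c + dx (mdeg m)"
  by (simp add: dgKos_def)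

lemma sp_emb: "keys p \<subseteq> A \<Longrightarrow> emb p \<in> sp (Mono ` A)"
  unfolding emb_def by (intro vec.subspace_sum[OF subspace_sp] sp_ops) auto

lemma lt4_cases: "c < 4 \<Longrightarrow> c = 0 \<or> c = 1 \<or> c = 2 \<or> c = (3 :: nat)"
  by auto

lemma incl_kset: assumes "c < 4" "keys p \<subseteq> mons (d - kdeg c)" shows "incl c (emb p) \<in> kset d"
proof -
  from lt4_cases[OF assms(1)] consider "c = 0" | "c = 1" | "c = 2" | "c = 3" by blast
  then show ?thesis
  proof cases
    case 1
    have "incl c (emb p) = kv p 0 0 0" by (simp add: 1 kv_def)
    then show ?thesis using assms(2) by (auto simp: 1 kdeg_def intro!: kset_mem)
  next
    case 2
    have "incl c (emb p) = kv 0 p 0 0" by (simp add: 2 kv_def)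
    then show ?thesis using assms(2) by (auto simp: 2 kdeg_def intro!: kset_mem)
  next
    case 3
    have "incl c (emb p) = kv 0 0 p 0" by (simp add: 3 kv_def)
    then show ?thesis using assms(2) by (auto simp: 3 kdeg_def intro!: kset_mem)
  next
    case 4
    have "incl c (emb p) = kv 0 0 0 p" by (simp add: 4 kv_def)
    then show ?thesis using assms(2) by (auto simp: 4 kdeg_def intro!: kset_mem)
  qed
qed

lemma incl_LKos: assumes "c < 4" "keys p \<subseteq> mons (d - kdeg c)" shows "incl c (emb p) \<in> sp {l \<in> LKos. dgKos l = d}"
proof (rule incl_sp[OF sp_emb[OF assms(2)]])
  fix l assume "l \<in> Mono ` mons (d - kdeg c)"
  then obtain m where m: "l = Mono m" "keys m \<subseteq> {1..4}" "d - kdeg c = dx (mdeg m)" by (auto simp: mons_iff)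
  have "kdeg c + dx (mdeg m) = d" unfolding m(3)[symmetric] by simp
  then show "In c l \<in> {l \<in> LKos. dgKos l = d}" using m assms(1) by (auto simp: LKos_def)
qed

lemma kset_sp: "kset d = sp {l \<in> LKos. dgKos l = d}"
proof
  show "kset d \<subseteq> sp {l \<in> LKos. dgKos l = d}"
  proof
    fix v assume "v \<in> kset d"
    then obtain p0 p1 p2 p3 where v: "v = kv p0 p1 p2 p3" and
      k: "keys p0 \<subseteq> mons (d - kdeg 0)" "keys p1 \<subseteq> mons (d - kdeg 1)" "keys p2 \<subseteq> mons (d - kdeg 2)"
        "keys p3 \<subseteq> mons (d - kdeg 3)"
      by (auto simp: kset_def kdeg_def)
    show "v \<in> sp {l \<in> LKos. dgKos l = d}"
      unfolding v kv_def by (intro sp_ops(1) incl_LKos k) simp_all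
  qed
  show "sp {l \<in> LKos. dgKos l = d} \<subseteq> kset d"
  proof
    fix v assume "v \<in> sp {l \<in> LKos. dgKos l = d}"
    then show "v \<in> kset d"
    proof (rule lin_sp[OF lin_id(2) kset_subspace, rotated])
      fix l assume "l \<in> {l \<in> LKos. dgKos l = d}"
      then obtain c m where l: "l = In c (Mono m)" "c < 4" "keys m \<subseteq> {1..4}" "d = kdeg c + dx (mdeg m)"
        by (auto simp: LKos_def)
      then have "keys (Poly_Mapping.single m 1 :: mpoly) \<subseteq> mons (d - kdeg c)" by (simp add: mons_iff)
      from incl_kset[OF l(2) this] show "bv l \<in> kset d" by (simp add: l(1) emb_single)
    qed
  qed
qed

lemma based_koszul: "based koszul LKos dgKos (\<lambda>_. 0)"
proof -
  have "filt koszul i d = sp {l \<in> LKos. dgKos l = d \<and> i \<le> 0}" for i d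
    by (cases "i \<le> 0") (simp_all add: filt_kos piece_kos kset_sp sp_def)
  then show ?thesis by (simp add: based_def piece_kos kset_sp rels_kos)
qed

section \<open>Polynomial action and differential on the Koszul complex\<close>

definition MK :: "mpoly \<Rightarrow> vec \<Rightarrow> vec" where
  "MK q = inop (\<lambda>c v. if c < 4 then incl c (mulop q v) else 0)"

lemma lin_MK [lins]: "lin g \<Longrightarrow> lin (\<lambda>v. MK q (g v))" unfolding MK_def by (intro lins)

lemma MK_incl: "c < 4 \<Longrightarrow> MK q (incl c (emb p)) = incl c (emb (q * p))"
  unfolding MK_def by (subst inop_incl) (simp_all add: mulop_emb lins)

lemma koszul_act: "xact koszul i = MK (xv i)" "yact koszul i = MK (yv i)"
proof -
  have b: "blocks [mulop q, mulop q, mulop q, mulop q] v = MK q v" for q v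
  proof (rule lin_ext[where f = "blocks [mulop q, mulop q, mulop q, mulop q]" and g = "MK q"])
    show "blocks [mulop q, mulop q, mulop q, mulop q] (bv l) = MK q (bv l)" for l
    proof (cases l)
      case (In c l')
      show ?thesis
      proof (cases "c < 4")
        case True
        from lt4_cases[OF True] show ?thesis by (auto simp: In blocks_def MK_def)
      qed (simp add: In blocks_def MK_def)
    qed (simp_all add: blocks_def MK_def inop_def)
  qed (rule lin_MK[OF lin_id(2)] | unfold blocks_def, rule lin_lift[OF lin_id(2)])+
  show "xact koszul i = MK (xv i)" "yact koszul i = MK (yv i)"
    by (auto simp: koszul_def shift_def Let_def dsum_bim_def Rbim_def cyclic_bim_def
        fsp.defs fbim.defs fcx.defs b)
qed

lemma over_kos_T: "over_kos (T k) = {(pac q, MK q) | q. q \<in> {xv 1, xv 2, yv 1, yv 2}}"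
proof -
  have s: "{F i | i. i \<in> {1, 2 :: nat}} = {F 1, F 2}" for F :: "nat \<Rightarrow> (vec \<Rightarrow> vec) \<times> (vec \<Rightarrow> vec)"
    by auto
  have p: "half Xp Xm 1 = pac (xv 1)" "half Xp Xm 2 = pac (xv 2)" "half Xp Ym 1 = pac (yv 1)" "half Xp Ym 2 = pac (yv 2)"
    by (rule ext, simp only: pac_vars)+
  show ?thesis unfolding over_kos_def koszul_act T_sel s p by blast
qed

lemma kdiff_incl:
  "kdiff koszul (incl 0 (emb p)) = 0" "kdiff koszul (incl 1 (emb p)) = incl 0 (emb (yx1 * p))"
  "kdiff koszul (incl 2 (emb p)) = incl 0 (emb (yx2 * p))"
  "kdiff koszul (incl 3 (emb p)) = incl 2 (emb (yx1 * p)) - incl 1 (emb (yx2 * p))"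
proof -
  have *: "incl 0 (emb p) = kv p 0 0 0" "incl 1 (emb p) = kv 0 p 0 0" "incl 2 (emb p) = kv 0 0 p 0"
    "incl 3 (emb p) = kv 0 0 0 p" by (simp_all add: kv_def)
  show "kdiff koszul (incl 0 (emb p)) = 0" "kdiff koszul (incl 1 (emb p)) = incl 0 (emb (yx1 * p))"
   "kdiff koszul (incl 2 (emb p)) = incl 0 (emb (yx2 * p))"
   "kdiff koszul (incl 3 (emb p)) = incl 2 (emb (yx1 * p)) - incl 1 (emb (yx2 * p))"
    unfolding * kdiff_kv by (simp_all add: kv_def emb_uminus incl_uminus)
qed

lemma LKos_cases [consumes 1]:
  assumes "l \<in> LKos"
  obtains c m where "l = In c (Mono m)" "bv l = incl c (emb (Poly_Mapping.single m 1))" "c < 4"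
    "c \<in> {0,1,2,3}" "keys m \<subseteq> {1..4}"
proof -
  from assms obtain c m where l: "l = In c (Mono m)" "c < 4" "keys m \<subseteq> {1..4}" by (auto simp: LKos_def)
  show ?thesis using that[OF l(1) _ l(2) _ l(3)] lt4_cases[OF l(2)] by (simp add: l(1) emb_single)
qed

lemma keys_yx: "keys yx1 \<subseteq> mons deg_x" "keys yx2 \<subseteq> mons deg_x"
  by (intro mons_diff_closed mons_xy; simp)+

lemma fm_koszul:
  assumes "lin F" "\<And>c p d. c \<in> {0,1,2,3} \<Longrightarrow> keys p \<subseteq> mons (d - kdeg c) \<Longrightarrow> F (incl c (emb p)) \<in> piece koszul (d + \<delta>)"
  shows "fm \<delta> koszul koszul F"
proof (rule fm_based2[OF based_koszul based_koszul assms(1)])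
  fix l assume "l \<in> LKos"
  then show "F (bv l) \<in> sp {m \<in> LKos. dgKos m = dgKos l + \<delta> \<and> 0 \<le> (0::rat)}"
  proof (cases rule: LKos_cases)
    case (1 c m)
    have "keys (Poly_Mapping.single m 1 :: mpoly) \<subseteq> mons (dgKos l - kdeg c)"
      using 1 by (simp add: mons_iff)
    from assms(2)[OF 1(4) this] show ?thesis unfolding 1(2) by (simp add: piece_kos kset_sp)
  qed
qed

lemma fm_MK: assumes "keys q \<subseteq> mons e" shows "fm e koszul koszul (MK q)"
proof (rule fm_koszul)
  fix c d and p :: mpoly assume a: "c \<in> {0,1,2,3::nat}" "keys p \<subseteq> mons (d - kdeg c)"
  have "keys (q * p) \<subseteq> mons (d + e - kdeg c)"
    using mons_mult[OF assms a(2)] by (simp add: algebra_simps)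
  then have "incl c (emb (q * p)) \<in> kset (d + e)" using a(1) by (intro incl_kset) auto
  moreover have "c < 4" using a(1) by auto
  ultimately show "MK q (incl c (emb p)) \<in> piece koszul (d + e)" by (simp add: piece_kos MK_incl)
qed (rule lin_MK[OF lin_id(2)])

lemma kdeg_12: "kdeg (Suc 0) = kdeg 2" by (simp add: kdeg_def)

lemma fm_kdiff: "fm deg_in koszul koszul (kdiff koszul)"
proof (rule fm_koszul[OF lin_kdiff])
  fix c d and p :: mpoly assume a: "c \<in> {0,1,2,3::nat}" "keys p \<subseteq> mons (d - kdeg c)"
  have k: "keys (yx1 * p) \<subseteq> mons (deg_x + (d - kdeg c))" "keys (yx2 * p) \<subseteq> mons (deg_x + (d - kdeg c))"
    using mons_mult[OF keys_yx(1) a(2)] mons_mult[OF keys_yx(2) a(2)] .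
  have d: "deg_x + (d - kdeg 1) = d + deg_in - kdeg 0" "deg_x + (d - kdeg 2) = d + deg_in - kdeg 0"
    "deg_x + (d - kdeg 3) = d + deg_in - kdeg 2" "deg_x + (d - kdeg 3) = d + deg_in - kdeg 1"
    by (cases d; simp add: deg_x_def kdeg_def deg_in_def)+
  note sub = vec.subspace_0[OF kset_subspace] vec.subspace_diff[OF kset_subspace]
  from a(1) consider "c = 0" | "c = 1" | "c = 2" | "c = 3" by blast
  then show "kdiff koszul (incl c (emb p)) \<in> piece koszul (d + deg_in)"
    using k by cases (auto simp: kdeg_12 kdiff_incl kdiff_incl[unfolded One_nat_def] piece_kos d d[unfolded One_nat_def] intro!: sub incl_kset)
qed

lemma kdiff_MK: "v \<in> piece koszul d \<Longrightarrow> kdiff koszul (MK q v) = MK q (kdiff koszul v)"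
  unfolding piece_kos kset_sp
proof (erule lin_sp_eq[rotated 3])
  fix l assume "l \<in> {l \<in> LKos. dgKos l = d}"
  then have "l \<in> LKos" by blast
  then show "kdiff koszul (MK q (bv l)) = MK q (kdiff koszul (bv l))"
  proof (cases rule: LKos_cases)
    case (1 c m)
    note s = MK_incl lin_0[OF lin_MK[OF lin_id(2)]] lin_diff[OF lin_MK[OF lin_id(2)]]
    from 1(4) consider "c = 0" | "c = 1" | "c = 2" | "c = 3" by blast
    then show ?thesis
      unfolding 1(2) by cases (simp_all add: s kdiff_incl kdiff_incl[unfolded One_nat_def] mult.left_commute)
  qed
qed (intro lins lin_comp[OF lin_kdiff] lin_kdiff)+

section \<open>The Koszul complex of \<open>T k\<close> as four copies of \<open>T k\<close>\<close>

definition LC :: "nat \<Rightarrow> lab set" where "LC k = {In c l | c l. c < 4 \<and> l \<in> LT k}"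

definition dgC :: "nat \<Rightarrow> lab \<Rightarrow> deg" where
  "dgC k l = (case l of In c l' \<Rightarrow> dgT k l' + kdeg c | _ \<Rightarrow> 0)"

definition lvC :: "nat \<Rightarrow> lab \<Rightarrow> rat" where
  "lvC k l = (case l of In c l' \<Rightarrow> lvT k l' | _ \<Rightarrow> 0)"

lemma C_simps [simp]: "In c l \<in> LC k \<longleftrightarrow> c < 4 \<and> l \<in> LT k" "dgC k (In c l) = dgT k l + kdeg c" "lvC k (In c l) = lvT k l"
  by (auto simp: LC_def dgC_def lvC_def)

definition bsp :: "lab set \<Rightarrow> (lab \<Rightarrow> deg) \<Rightarrow> (lab \<Rightarrow> rat) \<Rightarrow> fsp" where
  "bsp L dg lv = \<lparr>piece = \<lambda>d. sp {l \<in> L. dg l = d}, rels = \<lambda>d. {0},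
     filt = \<lambda>i d. sp {l \<in> L. dg l = d \<and> i \<le> lv l}\<rparr>"

lemma based_bsp: "based (bsp L dg lv) L dg lv"
  by (simp add: based_def bsp_def)

definition C :: "nat \<Rightarrow> fsp" where "C k = bsp (LC k) (dgC k) (lvC k)"

lemma based_C: "based (C k) (LC k) (dgC k) (lvC k)"
  unfolding C_def by (rule based_bsp)

definition W :: "vec \<Rightarrow> vec" where "W v = Ym v - Xm v"

lemma lin_W [lins]: "lin g \<Longrightarrow> lin (\<lambda>v. W (g v))" unfolding W_def by (intro lins)

definition dinC :: "vec \<Rightarrow> vec" where
  "dinC = inop (\<lambda>c v. if c = 2 then incl 0 (W v) else if c = 3 then incl 1 (W v) else 0)"

lemma lin_dinC [lins]: "lin g \<Longrightarrow> lin (\<lambda>v. dinC (g v))" unfolding dinC_def by (intro lins)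

lemma lin_if [lins]: "lin f \<Longrightarrow> lin g \<Longrightarrow> lin (\<lambda>v. if P then f v else g v)"
  by (cases P) simp_all

lemma dinC_incl: "dinC (incl c v) = (if c = 2 then incl 0 (W v) else if c = 3 then incl 1 (W v) else 0)"
  unfolding dinC_def by (subst inop_incl) (simp_all add: lins)

lemmas dinC_simps = lin_simps[OF lin_dinC[OF lin_id(2)]]

text \<open>The c-th standard basis element of the Koszul complex, expressed in the basis
  \<open>kap\<close> below: e_1 and e_2 are half the difference and half the sum of e_1 + e_2 and
  e_2 - e_1. The factor -1/2 inverts the -2 in \<open>kap 3\<close>, which makes the differential of
  \<open>kap 3\<close> equal to y_- - x_- times \<open>kap 1\<close>.\<close>

definition kk :: "nat \<Rightarrow> vec \<Rightarrow> vec" where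
  "kk c v = (if c = 0 then incl 0 v else if c = 1 then scl (1/2) (incl 1 v - incl 2 v)
     else if c = 2 then scl (1/2) (incl 1 v + incl 2 v) else if c = 3 then scl (-1/2) (incl 3 v) else 0)"

lemma lin_kk [lins]: "lin g \<Longrightarrow> lin (\<lambda>v. kk c (g v))" unfolding kk_def by (intro lins)

text \<open>The Koszul complex is free, so v \<otimes> p e_c is determined by p acting on v, placed
  in the component of e_c.\<close>

definition gam :: "vec \<Rightarrow> vec \<Rightarrow> vec" where
  "gam v w = inop (\<lambda>c. lift (\<lambda>l. case l of Mono m \<Rightarrow> kk c (mact m v) | _ \<Rightarrow> 0)) w"

lemma gam_incl: "gam v (incl c (emb p)) = kk c (pac p v)"
proof -
  have "gam v (incl c (emb p)) = lift (\<lambda>l. case l of Mono m \<Rightarrow> kk c (mact m v) | _ \<Rightarrow> 0) (emb p)"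
    unfolding gam_def by (subst inop_incl) (auto intro!: lins)
  also have "\<dots> = kk c (pac p v)"
    by (induction p rule: pm_induct)
       (simp_all add: emb_single emb_add lift_add lift_scl pac_add pac_single lin_simps[OF lin_kk[OF lin_id(2)]])
  finally show ?thesis .
qed

lemma lin_gam [lins]: "lin f \<Longrightarrow> lin (\<lambda>w. gam v (f w))" "lin f \<Longrightarrow> lin (\<lambda>v. gam (f v) w)"
proof -
  show "lin f \<Longrightarrow> lin (\<lambda>w. gam v (f w))" unfolding gam_def by (intro lins)
  have "lin (\<lambda>v. gam v w)"
    unfolding gam_def inop_def
  proof (rule lin_lift_fun)
    show "lin (\<lambda>v. case l of In c l' \<Rightarrow> lift (\<lambda>l. case l of Mono m \<Rightarrow> kk c (mact m v) | _ \<Rightarrow> 0) (bv l') | _ \<Rightarrow> 0)" for l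
    proof (cases l)
      case (In c l') then show ?thesis by (cases l') (simp_all add: lins)
    qed (simp_all add: lins)
  qed
  then show "lin f \<Longrightarrow> lin (\<lambda>v. gam (f v) w)" by (rule lin_comp)
qed

definition fC :: "vec \<Rightarrow> vec" where
  "fC = lift (\<lambda>l. case l of Tn d e k l' \<Rightarrow> gam (bv k) (bv l') | _ \<Rightarrow> 0)"

lemma lin_fC [lins]: "lin g \<Longrightarrow> lin (\<lambda>v. fC (g v))" unfolding fC_def by (intro lins)

lemma fC_tn: "fC (tn d e v w) = gam v w"
  by (rule lin2_ext[where F = "\<lambda>v w. fC (tn d e v w)" and G = gam]) (intro lins | simp add: fC_def)+

lemma pac_comm: "pac p (pac q v) = pac q (pac p v)"
  by (metis pac_mult mult.commute)

text \<open>y_1 - x_1 and y_2 - x_2 are half of (y_+ - x_+) minus and plus (y_- - x_-), and y_+ -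
  x_+ acts by 0.\<close>

lemma pac_yx: "pac yx1 v = scl (-1/2) (W v)" "pac yx2 v = scl (1/2) (W v)"
  unfolding pac_diff pac_vars
  by (simp_all add: half_def W_def vec.scale_right_diff_distrib vec.scale_right_distrib)

lemma kk_sp: assumes "v \<in> filt (T k) r d" "c < 4" shows "kk c v \<in> filt (C k) r (d + kdeg c)"
proof -
  have i: "incl c' v \<in> filt (C k) r (d + kdeg c)" if "c' < 4" "kdeg c' = kdeg c" for c'
    using assms(1) unfolding filt_T basedD[OF based_C] by (rule incl_sp) (use that in auto)
  have s: "filt (C k) r (d + kdeg c) = sp {l \<in> LC k. dgC k l = d + kdeg c \<and> r \<le> lvC k l}"
    by (rule basedD[OF based_C])
  from lt4_cases[OF assms(2)] i show ?thesis unfolding kk_def s by (auto simp: kdeg_def intro!: sp_ops)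
qed

lemma bv_filt_T: "l \<in> LT k \<Longrightarrow> bv l \<in> filt (T k) (lvT k l) (dgT k l)"
  by (simp add: filt_T)

lemma fm_fC: "fm 0 (kos_tens (T k)) (C k) fC"
proof (rule fm_tens_based[OF based_T based_koszul])
  have F: "fC (bv (Tn (dgT k l) (dgKos m) l m)) \<in> filt (C k) (lvT k l) (dgT k l + dgKos m + 0)" if "l \<in> LT k" "m \<in> LKos" for l m
    using that(2)
  proof (cases rule: LKos_cases)
    case (1 c n)
    have "keys (Poly_Mapping.single n 1 :: mpoly) \<subseteq> mons (dx (mdeg n))" using 1 by (simp add: mons_iff)
    from kk_sp[OF pac_filt[OF this bv_filt_T[OF that(1)]] 1(3)] show ?thesis
      unfolding tn_bv[symmetric] fC_tn unfolding 1(2) gam_incl unfolding 1(1) by (simp add: ac_simps)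
  qed
  fix l m assume a: "l \<in> LT k" "m \<in> LKos"
  show "fC (bv (Tn (dgT k l) (dgKos m) l m)) \<in> piece (C k) (dgT k l + dgKos m + 0)"
    using F[OF a] unfolding basedD[OF based_C] by (rule sp_mono[rotated]) auto
  show "fC (bv (Tn (dgT k l) (dgKos m) l m)) \<in> filt (C k) i (dgT k l + dgKos m + 0)" if "i \<le> lvT k l + 0" for i
    using F[OF a] unfolding basedD[OF based_C] by (rule sp_mono[rotated]) (use that in auto)
next
  fix l m f g assume "(f, g) \<in> over_kos (T k)" "m \<in> LKos"
  then obtain q where q: "f = pac q" "g = MK q" unfolding over_kos_T by blast
  from \<open>m \<in> LKos\<close> show "fC (tn (dgT k l + deg_x) (dgKos m) (f (bv l)) (bv m)) - fC (tn (dgT k l) (dgKos m + deg_x) (bv l) (g (bv m)))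
      \<in> rels (C k) (dgT k l + dgKos m + deg_x + 0)"
    by (cases rule: LKos_cases)
       (simp add: fC_tn q gam_incl MK_incl basedD[OF based_C] pac_mult pac_comm[of q])
qed (auto simp: over_kos_T intro!: lins wfsp_based[OF based_C] subspace_based[OF based_C])

lemma fC_din: "eqm deg_in (kos_tens (T k)) (C k) (\<lambda>v. fC (tm (\<lambda>_. 1) 0 deg_in id (kdiff koszul) v)) (\<lambda>v. dinC (fC v))"
proof (rule eqm_tens_based[OF based_T based_koszul _ _ wfsp_based[OF based_C]])
  fix l m assume "m \<in> LKos"
  then have "gam (bv l) (kdiff koszul (bv m)) = dinC (gam (bv l) (bv m))"
  proof (cases rule: LKos_cases)
    case (1 c n)
    note s = lin_simps[OF lin_gam(1)[OF lin_id(2)]]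
    from 1(4) consider "c = 0" | "c = 1" | "c = 2" | "c = 3" by blast
    then show ?thesis unfolding 1(2)
      by cases (simp_all add: kdiff_incl kdiff_incl[unfolded One_nat_def] gam_incl pac_mult pac_yx[unfolded One_nat_def] s kk_def dinC_simps dinC_incl
         incl_simps, (rule poly_mapping_eqI, simp add: lookup_scl lookup_add lookup_minus field_simps)+)
  qed
  then show "fC (tm (\<lambda>_. 1) 0 deg_in id (kdiff koszul) (bv (Tn (dgT k l) (dgKos m) l m))) - dinC (fC (bv (Tn (dgT k l) (dgKos m) l m)))
     \<in> rels (C k) (dgT k l + dgKos m + deg_in)"
    unfolding tn_bv[symmetric] by (simp add: tm_tn lins lin_kdiff fC_tn basedD[OF based_C] del: tn_bv)
qed (intro lins)+

lemma KX_kk: "lin X \<Longrightarrow> KX X (kk c v) = kk c (X v)"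
  by (simp add: kk_def KX_incl K_simps)

lemma fC_dout: "eqm deg_out (kos_tens (T k)) (C k) (\<lambda>v. fC (tm (\<lambda>_. 1) deg_out 0 (dout (T k)) id v)) (\<lambda>v. KX dT (fC v))"
proof (rule eqm_tens_based[OF based_T based_koszul _ _ wfsp_based[OF based_C]])
  fix l m assume "m \<in> LKos"
  then have "gam (dT (bv l)) (bv m) = KX dT (gam (bv l) (bv m))"
    by (cases rule: LKos_cases) (simp add: gam_incl KX_kk lins pac_dT)
  then show "fC (tm (\<lambda>_. 1) deg_out 0 (dout (T k)) id (bv (Tn (dgT k l) (dgKos m) l m))) - KX dT (fC (bv (Tn (dgT k l) (dgKos m) l m)))
     \<in> rels (C k) (dgT k l + dgKos m + deg_out)"
    unfolding tn_bv[symmetric] by (simp add: tm_tn lins fC_tn basedD[OF based_C] del: tn_bv)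
qed (intro lins)+

text \<open>A basis of the Koszul complex consisting of \<open>1\<close>, \<open>e\<^sub>1 + e\<^sub>2\<close>, \<open>e\<^sub>2 - e\<^sub>1\<close> and \<open>-2 e\<^sub>1 e\<^sub>2\<close>. Since
  \<open>y\<^sub>+ - x\<^sub>+\<close> acts by \<open>0\<close>, only the last two have a nonzero differential.\<close>

definition kap :: "nat \<Rightarrow> vec" where
  "kap c = (if c = 0 then incl 0 (emb 1) else if c = 1 then incl 1 (emb 1) + incl 2 (emb 1)
     else if c = 2 then incl 2 (emb 1) - incl 1 (emb 1) else scl (-2) (incl 3 (emb 1)))"

lemma kap_piece: "c < 4 \<Longrightarrow> kap c \<in> piece koszul (kdeg c)"
proof -
  assume c: "c < 4"
  have i: "incl c' (emb 1) \<in> kset (kdeg c)" if "c' < 4" "kdeg c' = kdeg c" for c'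
    using mons_1 that by (intro incl_kset) auto
  from lt4_cases[OF c] i show ?thesis unfolding kap_def piece_kos kset_sp by (auto simp: kdeg_def intro!: sp_ops)
qed

lemma kap_filt: "c < 4 \<Longrightarrow> i \<le> 0 \<Longrightarrow> kap c \<in> filt koszul i (kdeg c)"
  using kap_piece by (simp add: filt_kos)

definition gC :: "nat \<Rightarrow> vec \<Rightarrow> vec" where
  "gC k = inop (\<lambda>c. lift (\<lambda>l. tn (dgT k l) (kdeg c) (bv l) (kap c)))"

lemma lin_gC [lins]: "lin g \<Longrightarrow> lin (\<lambda>v. gC k (g v))" unfolding gC_def by (intro lins)

lemma gC_bv: "gC k (bv (In c l)) = tn (dgT k l) (kdeg c) (bv l) (kap c)" by (simp add: gC_def)

lemma gC_incl: "v \<in> piece (T k) d \<Longrightarrow> gC k (incl c v) = tn d (kdeg c) v (kap c)"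
  unfolding piece_T by (rule lin_sp_eq[where f = "\<lambda>v. gC k (incl c v)"]) (intro lins | auto simp: gC_bv)+

lemma fm_gC: "fm 0 (C k) (kos_tens (T k)) (gC k)"
proof (rule fm_based[OF based_C gm_based[OF based_C]])
  fix l assume "l \<in> LC k"
  then obtain c l' where l: "l = In c l'" "c < 4" "l' \<in> LT k" by (auto simp: LC_def)
  show "gC k (bv l) \<in> piece (kos_tens (T k)) (dgC k l + 0)"
    unfolding l(1) gC_bv using l kap_piece by (intro tn_piece) (auto simp: piece_T)
  show "gC k (bv l) \<in> filt (kos_tens (T k)) i (dgC k l + 0)" if "i \<le> lvC k l" for i
    unfolding l(1) gC_bv using l kap_filt that by (intro tn_filt[where j = i and j' = 0]) (auto simp: filt_T)
qed (intro lins wfsp_tens_over subspace_tens_over)+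

lemma fC_gC: "eqm 0 (C k) (C k) (\<lambda>v. fC (gC k v)) (\<lambda>v. v)"
proof (rule eqm_based_eq[OF based_C _ _ wfsp_based[OF based_C]])
  fix l assume "l \<in> LC k"
  then obtain c l' where l: "l = In c l'" "c < 4" "l' \<in> LT k" by (auto simp: LC_def)
  note s = lin_simps[OF lin_gam(1)[OF lin_id(2)]]
  from lt4_cases[OF l(2)] show "fC (gC k (bv l)) = bv l"
    by (auto simp: l(1) gC_bv fC_tn kap_def s gam_incl kk_def vec.scale_right_diff_distrib vec.scale_right_distrib
       simp flip: vec.scale_left_distrib)
qed (intro lins)+

lemma gC_kk: assumes v: "v \<in> piece (T k) d" and c: "c < 4"
  shows "gC k (kk c v) = tn d (kdeg c) v (incl c (emb 1))"
proof -
  note g = gC_incl[OF v] and s = lin_simps[OF lin_gC[OF lin_id(2)]]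
  have "kdeg 1 = kdeg 2" by (simp add: kdeg_def)
  then show ?thesis using lt4_cases[OF c]
    by (auto simp: kk_def s g g[unfolded One_nat_def] kap_def tn_simps vec.scale_right_diff_distrib vec.scale_right_distrib
       simp flip: vec.scale_left_distrib)
qed

lemma gC_fC: "eqm 0 (kos_tens (T k)) (kos_tens (T k)) (\<lambda>v. gC k (fC v)) (\<lambda>v. v)"
proof (rule eqm_tens_based[OF based_T based_koszul])
  fix l m assume l: "l \<in> LT k" and "m \<in> LKos"
  let ?R = "rels (kos_tens (T k)) (dgT k l + dgKos m)"
  from \<open>m \<in> LKos\<close> show "gC k (fC (bv (Tn (dgT k l) (dgKos m) l m))) - bv (Tn (dgT k l) (dgKos m) l m)
      \<in> rels (kos_tens (T k)) (dgT k l + dgKos m + 0)"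
  proof (cases rule: LKos_cases)
    case (1 c n)
    let ?p = "Poly_Mapping.single n 1 :: mpoly"
    have pT: "bv l \<in> piece (T k) (dgT k l)" using l by (simp add: piece_T)
    have it: "tn (d + dx i) e ((ZT j ^^ i) v) w - tn d (e + dx i) v ((MK (pvar j) ^^ i) w) \<in> rels (kos_tens (T k)) (d + e + dx i)"
      if "j \<in> {1..4}" "v \<in> piece (T k) d" "w \<in> piece koszul e" for j i d e v w
    proof (rule tn_iter)
      have j: "j = 1 \<or> j = 2 \<or> j = 3 \<or> j = 4" using that(1) by auto
      then have q: "pvar j \<in> {xv 1, xv 2, yv 1, yv 2}" by (elim disjE) (simp_all add: xv_def yv_def del: One_nat_def)
      have "ZT j = pac (pvar j)"
        using mact_single[OF that(1)] by (auto simp: pvar_def pac_single)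
      then have "(ZT j, MK (pvar j)) \<in> over_kos (T k)" unfolding over_kos_T using q by auto
      then show "tn (d + deg_x) e (ZT j v) w - tn d (e + deg_x) v (MK (pvar j) w) \<in> rels (kos_tens (T k)) (d + e + deg_x)"
        if "v \<in> piece (T k) d" "w \<in> piece koszul e" for d e v w
        using that by (intro tn_over) auto
    qed (use that fm_MK[OF mons_pvar[OF that(1)]] fm_ZT fmD in blast)+
    have K: "(MK (pvar j) ^^ i) (incl c (emb r)) = incl c (emb (pvar j ^ i * r))" for i j r
      using 1(3) by (induction i) (auto simp: MK_incl mult.assoc)
    have Kp: "incl c (emb r) \<in> piece koszul (kdeg c + d)" if "keys r \<subseteq> mons d" for r d
      unfolding piece_kos using that 1(3) by (intro incl_kset) auto
    have Zp: "(ZT j ^^ i) v \<in> piece (T k) (d + dx i)" if "v \<in> piece (T k) d" for j i v d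
      by (rule gmD(2)[OF fmD(1)[OF fm_funpow[OF fm_ZT]] that])
    define a1 a2 a3 a4 where a: "a1 = lookup n 1" "a2 = lookup n 2" "a3 = lookup n 3" "a4 = lookup n 4"
    define v4 v3 v2 where v: "v4 = (ZT 4 ^^ a4) (bv l)" "v3 = (ZT 3 ^^ a3) v4" "v2 = (ZT 2 ^^ a2) v3"
    define q1 q2 q3 where q: "q1 = pvar 1 ^ a1" "q2 = pvar 2 ^ a2 * q1" "q3 = pvar 3 ^ a3 * q2"
    have vp: "v4 \<in> piece (T k) (dgT k l + dx a4)" "v3 \<in> piece (T k) (dgT k l + dx a4 + dx a3)"
      "v2 \<in> piece (T k) (dgT k l + dx a4 + dx a3 + dx a2)"
      unfolding v by (intro Zp pT)+
    have kq: "keys q1 \<subseteq> mons (dx a1)" "keys q2 \<subseteq> mons (dx a2 + dx a1)" "keys q3 \<subseteq> mons (dx a3 + (dx a2 + dx a1))"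
      unfolding q by (intro mons_mult mons_pow mons_pvar; simp)+
    let ?d = "dgT k l + kdeg c + dx a1 + dx a2 + dx a3 + dx a4"
    have dd: "dgT k l + dgKos m = ?d" "mdeg n = a1 + a2 + a3 + a4"
      unfolding 1(1) by (simp_all add: mdeg_def a dx_add ac_simps)
    have K0: "incl c (emb 1) \<in> piece koszul (kdeg c)" using Kp[of 1 0] mons_1 by simp
    let ?e = "dgT k l"
    \<comment> \<open>The monomial is moved across the tensor sign one variable at a time; the four
      congruences telescope.\<close>
    have r1: "tn (?e + dx a4 + dx a3 + dx a2 + dx a1) (kdeg c) ((ZT 1 ^^ a1) v2) (incl c (emb 1)) -
        tn (?e + dx a4 + dx a3 + dx a2) (kdeg c + dx a1) v2 (incl c (emb q1)) \<in> rels (kos_tens (T k)) ?d"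
      using it[of 1 v2, OF _ vp(3) K0, of a1] by (simp add: K[unfolded One_nat_def] q ac_simps)
    have r2: "tn (?e + dx a4 + dx a3 + dx a2) (kdeg c + dx a1) v2 (incl c (emb q1)) -
        tn (?e + dx a4 + dx a3) (kdeg c + dx a1 + dx a2) v3 (incl c (emb q2)) \<in> rels (kos_tens (T k)) ?d"
      using it[of 2 v3, OF _ vp(2) Kp[OF kq(1)], of a2] by (simp add: K q v ac_simps)
    have r3: "tn (?e + dx a4 + dx a3) (kdeg c + dx a1 + dx a2) v3 (incl c (emb q2)) -
        tn (?e + dx a4) (kdeg c + dx a1 + dx a2 + dx a3) v4 (incl c (emb q3)) \<in> rels (kos_tens (T k)) ?d"
      using it[of 3 v4, OF _ vp(1) Kp[OF kq(2)], of a3] by (simp add: K q v ac_simps)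
    have r4: "tn (?e + dx a4) (kdeg c + dx a1 + dx a2 + dx a3) v4 (incl c (emb q3)) -
        tn ?e (kdeg c + dx a1 + dx a2 + dx a3 + dx a4) (bv l) (incl c (emb (pvar 4 ^ a4 * q3))) \<in> rels (kos_tens (T k)) ?d"
      using it[of 4 "bv l", OF _ pT Kp[OF kq(3)], of a4] by (simp add: K q v ac_simps)
    note add = vec.subspace_add[OF subspace_tens_over(2)]
    have r: "tn (?e + dx a4 + dx a3 + dx a2 + dx a1) (kdeg c) ((ZT 1 ^^ a1) v2) (incl c (emb 1)) -
       tn ?e (kdeg c + dx a1 + dx a2 + dx a3 + dx a4) (bv l) (incl c (emb (pvar 4 ^ a4 * q3))) \<in> rels (kos_tens (T k)) ?d"
      using add[OF add[OF r1 r2] add[OF r3 r4]] by simp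
    have p: "?p = pvar 4 ^ a4 * q3"
      unfolding single_monomial[OF 1(5)] q a by (simp add: ac_simps)
    have mv: "(ZT 1 ^^ a1) v2 = mact n (bv l)" by (simp add: mact_def v a)
    have mp: "mact n (bv l) \<in> piece (T k) (?e + dx a4 + dx a3 + dx a2 + dx a1)"
      unfolding mv[symmetric] by (rule Zp[OF vp(3)])
    have "fC (bv (Tn (dgT k l) (dgKos m) l m)) = kk c (mact n (bv l))"
      unfolding tn_bv[symmetric] fC_tn unfolding 1(2) gam_incl by (simp add: pac_single)
    then have "gC k (fC (bv (Tn (dgT k l) (dgKos m) l m))) = tn (?e + dx a4 + dx a3 + dx a2 + dx a1) (kdeg c) ((ZT 1 ^^ a1) v2) (incl c (emb 1))"
      by (simp only: gC_kk[OF mp 1(3)] mv)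
    moreover have "bv (Tn (dgT k l) (dgKos m) l m) = tn ?e (kdeg c + dx a1 + dx a2 + dx a3 + dx a4) (bv l) (incl c (emb (pvar 4 ^ a4 * q3)))"
      unfolding tn_bv[symmetric] unfolding 1(2) p unfolding 1(1) by (simp add: dd(2) dx_add ac_simps)
    ultimately show ?thesis using r unfolding dd(1) by simp
  qed
qed (intro lins wfsp_tens_over)+

text \<open>Modulo relations, g D' = g D' f g = g f D g = D g. This gives the commutation for
  \<open>gC\<close> and \<open>phi\<close> from that of their inverses, which is easier to
  check.\<close>

lemma eqm_inverse:
  assumes w: "wfsp M" "wfsp N" and f: "gm 0 M N f" and g: "gm 0 N M g"
    and D: "gm \<delta> M M D" and D': "gm \<delta> N N D'"
    and c: "eqm \<delta> M N (\<lambda>v. f (D v)) (\<lambda>v. D' (f v))"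
    and fg: "eqm 0 N N (\<lambda>v. f (g v)) (\<lambda>v. v)" and gf: "eqm 0 M M (\<lambda>v. g (f v)) (\<lambda>v. v)"
  shows "eqm \<delta> N M (\<lambda>v. g (D' v)) (\<lambda>v. D (g v))"
proof -
  have 1: "eqm \<delta> N M (\<lambda>v. g (D' (f (g v)))) (\<lambda>v. g (D' v))"
    using eqm_post[OF eqm_post[OF fg D'] g] by simp
  have 2: "eqm \<delta> N M (\<lambda>v. g (f (D (g v)))) (\<lambda>v. g (D' (f (g v))))"
    using eqm_post[OF eqm_pre[OF c g] g] by simp
  have 3: "eqm \<delta> N M (\<lambda>v. g (f (D (g v)))) (\<lambda>v. D (g v))"
    using eqm_pre[OF eqm_pre[OF gf D] g] by simp
  show ?thesis using eqm_trans[OF w(1) eqm_sym[OF w(1) 1] eqm_trans[OF w(1) eqm_sym[OF w(1) 2] 3]] .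
qed

definition HC :: "nat \<Rightarrow> fsp" where "HC k = homology deg_in dinC (C k)"

lemma wf_HC: "wfsp (HC k)" "vec.subspace (piece (HC k) d)"
  unfolding HC_def by (intro wfsp_homology subspace_piece_homology wfsp_based[OF based_C] subspace_based[OF based_C] lins)+

lemma gm_zero: "wfsp N \<Longrightarrow> (\<And>d. vec.subspace (piece N d)) \<Longrightarrow> gm \<delta> M N (\<lambda>_. 0)"
  by (simp add: gm_def lins vec.subspace_0 wfsp_def)

lemma hretr_iso:
  assumes "fm 0 M N f" "fm 0 N M g" "wfsp M" "\<And>d. vec.subspace (piece M d)" "lin D"
    "eqm \<delta> M N (\<lambda>v. f (D v)) (\<lambda>v. D' (f v))" "eqm \<delta> N M (\<lambda>v. g (D' v)) (\<lambda>v. D (g v))"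
    "eqm 0 N N (\<lambda>v. f (g v)) (\<lambda>v. v)" "eqm 0 M M (\<lambda>v. g (f v)) (\<lambda>v. v)"
  shows "hretr \<delta> M D N D' f g (\<lambda>_. 0)"
  unfolding hretr_def using assms by (auto simp: lin_0 intro!: gm_zero)

lemma fm_dinC: "fm deg_in (C k) (C k) dinC"
proof (rule fm_based2[OF based_C based_C])
  fix l assume "l \<in> LC k"
  then obtain c l' where l: "l = In c l'" "c < 4" "l' \<in> LT k" by (auto simp: LC_def)
  from l(3) lt4_cases[OF l(2)] show "dinC (bv l) \<in> sp {m \<in> LC k. dgC k m = dgC k l + deg_in \<and> lvC k l \<le> lvC k m}"
    by (cases rule: LT_cases)
       (auto simp: l(1) dinC_def W_def incl_simps kdeg_def deg_in_def intro!: sp_ops)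
qed (intro lins)

lemma fm_doutC: "fm deg_out (C k) (C k) (KX dT)"
proof (rule fm_based2[OF based_C based_C])
  fix l assume "l \<in> LC k"
  then obtain c l' where l: "l = In c l'" "c < 4" "l' \<in> LT k" by (auto simp: LC_def)
  from l(3) show "KX dT (bv l) \<in> sp {m \<in> LC k. dgC k m = dgC k l + deg_out \<and> lvC k l \<le> lvC k m}"
    by (cases rule: LT_cases) (auto simp: l(1,2) deg_out_def)
qed (intro lins)

lemma dinC_doutC: "dinC (KX dT v) = KX dT (dinC v)"
proof (rule lin_ext[where f = "\<lambda>v. dinC (KX dT v)" and g = "\<lambda>v. KX dT (dinC v)"])
  show "dinC (KX dT (bv l)) = KX dT (dinC (bv l))" for l
  proof (cases l)
    case (In c l')
    have "KX dT (incl c v) = incl c (dT v)" for c v by (rule KX_incl) (intro lins)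
    then show ?thesis
      by (simp add: In dinC_def[THEN fun_cong, of "bv (In c l')"] dinC_incl K_simps W_def XYd_simps dT_comm incl_simps)
  qed (simp_all add: KX_def dinC_def inop_def)
qed (intro lins)+

lemma fm_din_kos: "fm deg_in (kos_tens (T k)) (kos_tens (T k)) (tm (\<lambda>_. 1) 0 deg_in id (kdiff koszul))"
proof (rule fm_tm)
  fix f g assume fg: "(f, g) \<in> over_kos (T k)"
  then obtain q where q: "f = pac q" "g = MK q" unfolding over_kos_T by blast
  have "eqm (deg_in + deg_x) koszul koszul (\<lambda>v. kdiff koszul (g v)) (\<lambda>v. g (kdiff koszul v))"
    unfolding q eqm_def by (simp add: kdiff_MK rels_kos)
  moreover have "eqm (0 + deg_x) (T k) (T k) (\<lambda>v. id (f v)) (\<lambda>v. f (id v))"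
    using eqm_refl[OF wfsp_based[OF based_T]] by simp
  ultimately show "\<exists>f' g'. (f', g') \<in> over_kos (T k) \<and> eqm (0 + deg_x) (T k) (T k) (\<lambda>v. id (f v)) (\<lambda>v. f' (id v)) \<and>
     eqm (deg_in + deg_x) koszul koszul (\<lambda>v. kdiff koszul (g v)) (\<lambda>v. g' (kdiff koszul v))"
    using fg by blast
qed (use fm_kdiff in simp_all)

lemma gC_dout: "eqm deg_out (C k) (kos_tens (T k)) (\<lambda>v. gC k (KX dT v)) (\<lambda>v. tm (\<lambda>_. 1) deg_out 0 (dout (T k)) id (gC k v))"
proof (rule eqm_based_eq[OF based_C _ _ wfsp_tens_over])
  fix l assume "l \<in> LC k"
  then obtain c l' where l: "l = In c l'" "c < 4" "l' \<in> LT k" by (auto simp: LC_def)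
  have "dT (bv l') \<in> piece (T k) (dgT k l' + deg_out)"
    using l(3) by (cases rule: LT_cases) (auto simp: piece_T deg_out_def)
  from gC_incl[OF this] show "gC k (KX dT (bv l)) = tm (\<lambda>_. 1) deg_out 0 (dout (T k)) id (gC k (bv l))"
    by (simp add: l(1) gC_bv tm_tn lins)
qed (intro lins)+

lemma H3'_T: "eqv (H3' (T k)) (homology deg_out (KX dT) (HC k))"
  unfolding H3'_def
proof (rule hretr_eqv)
  note wC = wfsp_based[OF based_C] and sC = subspace_based[OF based_C]
  have lins': "lin dinC" "lin (tm (\<lambda>_. 1) 0 deg_in id (kdiff koszul))" "lin (KX dT)" by (intro lins)+
  have gin: "eqm deg_in (C k) (kos_tens (T k)) (\<lambda>v. gC k (dinC v)) (\<lambda>v. tm (\<lambda>_. 1) 0 deg_in id (kdiff koszul) (gC k v))"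
    by (rule eqm_inverse[OF wfsp_tens_over wC fmD(1)[OF fm_fC] fmD(1)[OF fm_gC] fmD(1)[OF fm_din_kos] fmD(1)[OF fm_dinC]
          fC_din fC_gC gC_fC])
  show "hretr deg_out (H2 (T k)) (tm (\<lambda>_. 1) deg_out 0 (dout (T k)) id) (HC k) (KX dT) fC (gC k) (\<lambda>_. 0)"
  proof (rule hretr_iso)
    show "fm 0 (H2 (T k)) (HC k) fC" "fm 0 (HC k) (H2 (T k)) (gC k)"
      unfolding H2_def HC_def using fC_din gin by (auto intro!: fm_homology fm_fC fm_gC wC)
    show "eqm deg_out (H2 (T k)) (HC k) (\<lambda>v. fC (tm (\<lambda>_. 1) deg_out 0 (dout (T k)) id v)) (\<lambda>v. KX dT (fC v))"
      "eqm 0 (HC k) (HC k) (\<lambda>v. fC (gC k v)) (\<lambda>v. v)"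
      unfolding H2_def HC_def by (intro eqm_homology fC_dout fC_gC sC lins')+
    show "eqm deg_out (HC k) (H2 (T k)) (\<lambda>v. gC k (KX dT v)) (\<lambda>v. tm (\<lambda>_. 1) deg_out 0 (dout (T k)) id (gC k v))"
      "eqm 0 (H2 (T k)) (H2 (T k)) (\<lambda>v. gC k (fC v)) (\<lambda>v. v)"
      unfolding H2_def HC_def by (intro eqm_homology gC_dout gC_fC subspace_tens_over lins')+
  qed (intro wf_H2 lins)+
qed (intro wf_H2 wf_HC lins)+

subsection \<open>Inner homology\<close>

text \<open>The kernel of \<open>W\<close> gives the components \<open>c \<ge> 2\<close> and its cokernel the components \<open>c < 2\<close>. For odd \<open>p\<close>
  and \<open>c \<ge> 2\<close> the label \<open>L4 p 1 i j\<close> represents the cycle \<open>psi\<close> of it, that is \<open>y\<^sub>- + x\<^sub>-\<close> times a monomial,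
  which lies one filtration level lower than \<open>y\<^sub>- - x\<^sub>-\<close>.\<close>

definition LE :: "nat \<Rightarrow> lab set" where
  "LE k = {In c (L4 p e i j) | c p e i j. c < 4 \<and> L4 p e i j \<in> LT k \<and>
     (if c < 2 then (if odd p then e = 0 else e = 1 \<or> i = 0) else e = 1)}"

definition lvE :: "nat \<Rightarrow> lab \<Rightarrow> rat" where
  "lvE k l = (case l of In c l' \<Rightarrow> lvT k l' -
     (if 2 \<le> c \<and> (case q4 l' of Some (p, _) \<Rightarrow> odd p | None \<Rightarrow> False) then 1 else 0) | _ \<Rightarrow> 0)"

lemma lvE_simp [simp]: "lvE k (In c (L4 p e i j)) = lvT k (L4 p e i j) - (if 2 \<le> c \<and> odd p then 1 else 0)"
  by (simp add: lvE_def)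

lemma LE_iff: "In c (L4 p e i j) \<in> LE k \<longleftrightarrow> c < 4 \<and> p \<le> k \<and> e \<le> 1 \<and> (p = 0 \<longrightarrow> e = 1) \<and>
    (if c < 2 then (if odd p then e = 0 else e = 1 \<or> i = 0) else e = 1)"
  by (auto simp: LE_def)

definition E :: "nat \<Rightarrow> fsp" where "E k = bsp (LE k) (dgC k) (lvE k)"

lemma based_E: "based (E k) (LE k) (dgC k) (lvE k)"
  unfolding E_def by (rule based_bsp)

abbreviation l5 :: "nat \<Rightarrow> nat \<Rightarrow> nat \<Rightarrow> nat \<Rightarrow> nat \<Rightarrow> vec" where
  "l5 c p e i j \<equiv> bv (In c (L4 p e i j))"

text \<open>Cokernel, c < 2: for odd p the image of W is spanned by the labels with e = 1. For even
  p > 0, y_- + x_- is identified with 2 x_-, and the representative with e = 1 is kept because it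
  has the higher level. Kernel, c \<ge> 2: for odd p the complement of the cycles is spanned by the
  labels with e = 1 and those with e = i = 0; labels with e = 1 are sent to 0 since the cycles lie
  one level lower.\<close>

definition phi :: "vec \<Rightarrow> vec" where
  "phi = inop (\<lambda>c. opl (\<lambda>p e i j.
     if c < 2 then
       (if odd p then (if e = 0 then l5 c p 0 i j else 0)
        else if e \<noteq> 0 then l5 c p e i j else if i = 0 then l5 c p 0 0 j else scl (1/2) (l5 c p 1 (i - 1) j))
     else
       (if odd p then (if e = 0 \<and> i > 0 then scl (1/2) (l5 c p 1 (i - 1) j) else 0)
        else if e \<noteq> 0 then l5 c p e i j else 0)))"

definition psi :: "vec \<Rightarrow> vec" where
  "psi = inop (\<lambda>c. opl (\<lambda>p e i j. if 2 \<le> c \<and> odd p then l5 c p 1 i j + scl 2 (l5 c p 0 (Suc i) j)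
     else l5 c p e i j))"

text \<open>Minus the inverse of W from its image to the complement of the kernel used in
  \<open>phi\<close>, extended by 0 to the representatives of the cokernel. For odd p it sends y_- -
  x_- to minus the generator and so drops a filtration level.\<close>

definition eta :: "vec \<Rightarrow> vec" where
  "eta = inop (\<lambda>c. opl (\<lambda>p e i j.
     if c < 2 then
       (if odd p then (if e = 0 then 0 else if i = 0 then - l5 (if c = 0 then 2 else 3) p 0 0 j else scl (1/2) (l5 (if c = 0 then 2 else 3) p 1 (i - 1) j))
        else if e = 0 \<and> i > 0 then scl (1/2) (l5 (if c = 0 then 2 else 3) p 0 (i - 1) j) else 0)
     else 0))"

text \<open>For odd p and c \<ge> 2 the cycle y_- + x_- = (y_- - x_-) + 2 x_- goes to 2 x_- times
  the generator of F^1, or of I, one position lower: this is the factor 2 and the shift of i. For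
  even p the induced differential vanishes.\<close>

definition dE :: "vec \<Rightarrow> vec" where
  "dE = inop (\<lambda>c. opl (\<lambda>p e i j. if odd p then
     (if c < 2 then l5 c (p - 1) 1 i j else scl 2 (l5 c (p - 1) 1 (Suc i) j)) else 0))"

lemma lin_EC [lins]: assumes "lin g"
  shows "lin (\<lambda>v. phi (g v))" "lin (\<lambda>v. psi (g v))" "lin (\<lambda>v. eta (g v))" "lin (\<lambda>v. dE (g v))"
  unfolding phi_def psi_def eta_def dE_def using assms by (intro lins; assumption)+

lemmas EC_simps = lin_EC[OF lin_id(2), THEN lin_add] lin_EC[OF lin_id(2), THEN lin_scl]
   lin_EC[OF lin_id(2), THEN lin_uminus] lin_EC[OF lin_id(2), THEN lin_0] lin_EC[OF lin_id(2), THEN lin_diff]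

lemma l5_simps:
  "phi (l5 c p e i j) = (if c < 2 then
       (if odd p then (if e = 0 then l5 c p 0 i j else 0)
        else if e \<noteq> 0 then l5 c p e i j else if i = 0 then l5 c p 0 0 j else scl (1/2) (l5 c p 1 (i - 1) j))
     else
       (if odd p then (if e = 0 \<and> i > 0 then scl (1/2) (l5 c p 1 (i - 1) j) else 0)
        else if e \<noteq> 0 then l5 c p e i j else 0))"
  "psi (l5 c p e i j) = (if 2 \<le> c \<and> odd p then l5 c p 1 i j + scl 2 (l5 c p 0 (Suc i) j) else l5 c p e i j)"
  "eta (l5 c p e i j) = (if c < 2 then
       (if odd p then (if e = 0 then 0 else if i = 0 then - l5 (if c = 0 then 2 else 3) p 0 0 j else scl (1/2) (l5 (if c = 0 then 2 else 3) p 1 (i - 1) j))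
        else if e = 0 \<and> i > 0 then scl (1/2) (l5 (if c = 0 then 2 else 3) p 0 (i - 1) j) else 0)
     else 0)"
  "dE (l5 c p e i j) = (if odd p then
     (if c < 2 then l5 c (p - 1) 1 i j else scl 2 (l5 c (p - 1) 1 (Suc i) j)) else 0)"
  by (simp_all add: phi_def psi_def eta_def dE_def)

lemma W_lb: "W (lb p 0 i j) = lb p 1 i j + (if odd p then 0 else scl (-2) (lb p 0 (Suc i) j))"
  "W (lb p (Suc 0) i j) = (if odd p then scl (-2) (lb p 1 (Suc i) j) else 0)"
  by (auto simp: W_def eps_def lookup_scl lookup_add lookup_minus intro!: poly_mapping_eqI)

lemma dinC_l5:
  "dinC (l5 c p 0 i j) = (if c = 2 \<or> c = 3 then l5 (if c = 2 then 0 else 1) p 1 i j +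
     (if odd p then 0 else scl (-2) (l5 (if c = 2 then 0 else 1) p 0 (Suc i) j)) else 0)"
  "dinC (l5 c p (Suc 0) i j) = (if (c = 2 \<or> c = 3) \<and> odd p then
     scl (-2) (l5 (if c = 2 then 0 else 1) p 1 (Suc i) j) else 0)"
  by (auto simp: dinC_def W_lb incl_simps)

lemma doutC_l5: "KX dT (l5 c p e i j) = (if e = 0 \<and> p > 0 then l5 c (p - 1) 1 i j else 0)"
  by (cases p; cases "e = 0") auto

lemmas E_all = EC_simps dinC_simps K_simps l5_simps dinC_l5 doutC_l5 kdeg_def deg_in_def deg_out_def

lemma LC_cases [consumes 1]:
  assumes "l \<in> LC k" obtains c p e i j where "c \<in> {0,1,2,3}" "c < 4" "l = In c (L4 p e i j)" "p \<le> k" "e = 0 \<or> e = Suc 0" "e = 0 \<Longrightarrow> 0 < p"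
proof -
  from assms obtain c l' where l: "l = In c l'" "c < 4" "l' \<in> LT k" by (auto simp: LC_def)
  from l(3) obtain p e i j where "l' = L4 p e i j" "p \<le> k" "e \<le> 1" "p = 0 \<longrightarrow> e = 1" by (auto simp: LT_def)
  then show ?thesis using l lt4_cases[OF l(2)] by (intro that[of c p e i j]) auto
qed

lemma LE_cases [consumes 1]:
  assumes "l \<in> LE k"
  obtains (odd0) c q i j where "c = 0 \<or> c = 1" "even q" "Suc q \<le> k" "l = In c (L4 (Suc q) 0 i j)"
    | (even0) c q i j where "c = 0 \<or> c = 1" "even q" "q \<le> k" "l = In c (L4 q (Suc 0) i j)"
    | (gen0) c q j where "c = 0 \<or> c = 1" "odd q" "Suc q \<le> k" "l = In c (L4 (Suc q) 0 0 j)"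
    | (odd1) c q i j where "c = 2 \<or> c = 3" "even q" "Suc q \<le> k" "l = In c (L4 (Suc q) (Suc 0) i j)"
    | (even1) c q i j where "c = 2 \<or> c = 3" "even q" "q \<le> k" "l = In c (L4 q (Suc 0) i j)"
proof -
  from assms obtain c p e i j where l: "l = In c (L4 p e i j)" "c < 4" "p \<le> k" "e \<le> 1" "p = 0 \<longrightarrow> e = 1"
    "if c < 2 then (if odd p then e = 0 else e = 1 \<or> i = 0) else e = 1"
    unfolding LE_def by auto
  have e: "e = 0 \<or> e = Suc 0" using l(4) by auto
  show ?thesis
  proof (cases "c < 2")
    case c: True
    then have c': "c = 0 \<or> c = 1" by auto
    show ?thesis
    proof (cases "odd p")
      case True
      then obtain q where "p = Suc q" "even q" by (cases p) auto
      then show ?thesis using odd0[of c q i j] l c c' True by simp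
    next
      case False
      show ?thesis
      proof (cases "e = 0")
        case True
        then obtain q where "p = Suc q" "odd q" using l(5) False by (cases p) auto
        then show ?thesis using gen0[of c q j] l c c' True False by simp
      next
        case ne: False
        then show ?thesis using even0[of c p i j] l c' e False by simp
      qed
    qed
  next
    case c: False
    then have c': "c = 2 \<or> c = 3" "e = Suc 0" using l(2,6) by auto
    show ?thesis
    proof (cases "odd p")
      case True
      then obtain q where "p = Suc q" "even q" by (cases p) auto
      then show ?thesis using odd1[of c q i j] l c' by simp
    next
      case False
      then show ?thesis using even1[of c p i j] l c' by simp
    qed
  qed
qed

text \<open>Allows a based space to be regarded as its own homology, so that the rules for maps
  between homologies apply to \<open>E k\<close> and \<open>F k\<close>.\<close>

lemma homology_zero:
  assumes "based M L dg lv" shows "homology \<delta> (\<lambda>_. 0) (M :: fsp) = M"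
proof -
  let ?H = "homology \<delta> (\<lambda>_. 0) M"
  note b = basedD[OF assms]
  have ex: "\<exists>w. w \<in> piece M d" for d unfolding b by (rule exI[of _ 0]) simp
  have P: "piece ?H d = piece M d" for d by (simp add: homology_sel b(2))
  have R: "rels ?H d = rels M d" for d using ex[of "d - \<delta>"] by (auto simp: homology_sel b(2))
  have F: "filt ?H i d = filt M i d" for i d
  proof -
    have "v \<in> piece M d" if "v \<in> filt M i d" for v using that unfolding b by (rule sp_mono[rotated]) blast
    then show ?thesis unfolding homology_sel(3) R unfolding b(2) by auto
  qed
  show ?thesis by (intro fsp.equality ext) (simp_all add: P R F)
qed

lemma fm_phi: "fm 0 (C k) (E k) phi"
proof (rule fm_based2[OF based_C based_E])
  fix l assume "l \<in> LC k"
  then show "phi (bv l) \<in> sp {m \<in> LE k. dgC k m = dgC k l + 0 \<and> lvC k l \<le> lvE k m}"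
  proof (cases rule: LC_cases)
    case (1 c p e i j)
    show ?thesis
    proof (cases i)
      case 0 then show ?thesis using 1 by (auto simp: l5_simps LE_iff)
    next
      case (Suc i') then show ?thesis using 1 by (auto simp: l5_simps LE_iff intro!: sp_ops)
    qed
  qed
qed (intro lins)

lemma fm_psi: "fm 0 (E k) (C k) psi"
proof (rule fm_based2[OF based_E based_C])
  fix l assume a: "l \<in> LE k"
  then show "psi (bv l) \<in> sp {m \<in> LC k. dgC k m = dgC k l + 0 \<and> lvE k l \<le> lvC k m}"
    by (cases rule: LE_cases) (auto simp: l5_simps intro!: sp_ops)
qed (intro lins)

lemma gm_eta: "gm (- deg_in) (C k) (C k) eta"
proof (rule gm_based[OF based_C])
  fix l assume "l \<in> LC k"
  then show "eta (bv l) \<in> piece (C k) (dgC k l + - deg_in)"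
  proof (cases rule: LC_cases)
    case (1 c p e i j)
    show ?thesis
    proof (cases i)
      case 0 then show ?thesis using 1 by (auto simp: l5_simps basedD[OF based_C] kdeg_def deg_in_def odd_pos intro!: sp_ops)
    next
      case (Suc i') then show ?thesis using 1 by (auto simp: l5_simps basedD[OF based_C] kdeg_def deg_in_def intro!: sp_ops)
    qed
  qed
qed (intro lins wfsp_based[OF based_C] subspace_based[OF based_C])+

lemma fm_dE: "fm deg_out (E k) (E k) dE"
proof (rule fm_based2[OF based_E based_E])
  fix l assume a: "l \<in> LE k"
  then show "dE (bv l) \<in> sp {m \<in> LE k. dgC k m = dgC k l + deg_out \<and> lvE k l \<le> lvE k m}"
    by (cases rule: LE_cases) (auto simp: l5_simps LE_iff deg_out_def kdeg_def intro!: sp_ops)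
qed (intro lins)

lemma phi_dinC: "l \<in> LC k \<Longrightarrow> phi (dinC (bv l)) = 0"
  by (cases rule: LC_cases) (auto simp: E_all)

lemma dinC_psi: assumes "l \<in> LE k" shows "dinC (psi (bv l)) = 0"
  using assms by (cases rule: LE_cases) (auto simp: E_all)

lemma phi_psi: assumes "l \<in> LE k" shows "phi (psi (bv l)) = bv l"
  using assms by (cases rule: LE_cases) (auto simp: E_all)

lemma psi_phi: assumes "l \<in> LC k" shows "psi (phi (bv l)) = bv l + (dinC (eta (bv l)) + eta (dinC (bv l)))"
  using assms
proof (cases rule: LC_cases)
  case (1 c p e i j)
  show ?thesis
  proof (cases i)
    case 0 then show ?thesis using 1 by (auto simp: E_all vec.scale_right_distrib)
  next
    case (Suc i') then show ?thesis using 1 by (auto simp: E_all vec.scale_right_distrib vec.scale_right_diff_distrib)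
  qed
qed

lemma HC_E: "eqv (homology deg_out (KX dT) (HC k)) (homology deg_out dE (E k))"
proof (rule hretr_eqv)
  note wC = wfsp_based[OF based_C] and sC = subspace_based[OF based_C]
  note wE = wfsp_based[OF based_E] and sE = subspace_based[OF based_E]
  note hE = homology_zero[OF based_E[of k], of deg_in]
  have z: "lin (\<lambda>_. 0 :: vec)" by (intro lins)
  have e1: "eqm deg_in (C k) (E k) (\<lambda>v. phi (dinC v)) (\<lambda>_. 0)"
    by (rule eqm_based_eq[OF based_C _ _ wE], (intro lins)+, erule phi_dinC)
  have e2: "eqm deg_in (E k) (C k) (\<lambda>_. 0) (\<lambda>v. dinC (psi v))"
    by (rule eqm_based_eq[OF based_E _ _ wC], (intro lins)+, erule dinC_psi[symmetric])
  have phi: "fm 0 (HC k) (E k) phi"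
    using fm_homology[OF fm_phi[of k] _ wE, where \<delta> = deg_in and D = dinC and D' = "\<lambda>_. 0"] e1
    unfolding hE HC_def by simp
  have psi: "fm 0 (E k) (HC k) psi"
    using fm_homology[OF fm_psi[of k] _ wC, where \<delta> = deg_in and D = "\<lambda>_. 0" and D' = dinC] e2
    unfolding hE HC_def by (simp add: EC_simps)
  have fg: "eqm 0 (E k) (E k) (\<lambda>v. phi (psi v)) (\<lambda>v. v)"
    by (rule eqm_based_eq[OF based_E _ _ wE], (intro lins)+, erule phi_psi)
  have gf: "eqm 0 (HC k) (HC k) (\<lambda>v. psi (phi v)) (\<lambda>v. v)"
    unfolding HC_def
    by (rule eqm_homotopic[OF gm_eta _ wC], rule eqm_based_eq[OF based_C _ _ wC], (intro lins)+, erule psi_phi)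
  have dC: "fm deg_out (HC k) (HC k) (KX dT)"
    unfolding HC_def
    by (rule fm_homology[OF fm_doutC eqm_eq wC]) (simp_all add: dinC_doutC wC)
  have c: "eqm deg_out (E k) (HC k) (\<lambda>v. psi (dE v)) (\<lambda>v. KX dT (psi v))"
  proof (rule eqm_based[OF based_E _ _ wf_HC(1)])
    fix l assume a: "l \<in> LE k"
    have z: "0 \<in> rels (HC k) d" for d by (rule vec.subspace_0[OF wfspD(1)[OF wf_HC(1)]])
    from a show "psi (dE (bv l)) - KX dT (psi (bv l)) \<in> rels (HC k) (dgC k l + deg_out)"
    proof (cases rule: LE_cases)
      \<comment> \<open>The generator of B^tw goes to y_- - x_- in the B below, which is the image
        of 1 under W. Here \<open>psi\<close> commutes with the outer differentials only up to an
        inner boundary; in the other cases it does so exactly.\<close>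
      case (gen0 c q j)
      let ?w = "- l5 (if c = 0 then 2 else 3) q 0 0 j"
      have "q \<noteq> 0" using gen0(2) by (rule odd_pos[THEN neq0_conv[THEN iffD2]])
      then have "?w \<in> piece (C k) (dgC k l + deg_out - deg_in)"
        using gen0 by (auto simp: basedD[OF based_C] deg_in_def deg_out_def kdeg_def intro!: sp_ops)
      moreover have "psi (dE (bv l)) - KX dT (psi (bv l)) = 0 + dinC ?w"
        using gen0 by (auto simp: E_all)
      ultimately show ?thesis unfolding HC_def homology_sel basedD(2)[OF based_C] by blast
    qed (use z in \<open>auto simp: E_all\<close>)
  qed (intro lins)+
  show "hretr deg_out (HC k) (KX dT) (E k) dE phi psi (\<lambda>_. 0)"
  proof (rule hretr_iso[OF phi psi wf_HC])
    show "eqm deg_out (HC k) (E k) (\<lambda>v. phi (KX dT v)) (\<lambda>v. dE (phi v))"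
      by (rule eqm_inverse[OF wE wf_HC(1) fmD(1)[OF psi] fmD(1)[OF phi] fmD(1)[OF fm_dE] fmD(1)[OF dC] c gf fg])
  qed (intro lins c fg gf)+
qed (intro wf_HC wfsp_based[OF based_E] subspace_based[OF based_E] lins)+

subsection \<open>Outer homology\<close>

text \<open>The labels that are not matched by \<open>dE\<close>: every label with \<open>p\<close> odd is cancelled.\<close>

definition LF :: "nat \<Rightarrow> lab set" where
  "LF k = {In c (L4 p e i j) | c p e i j. In c (L4 p e i j) \<in> LE k \<and> even p \<and>
     (p = k \<or> c < 2 \<and> e = 0 \<or> 2 \<le> c \<and> i = 0)}"

lemma LF_iff: "In c (L4 p e i j) \<in> LF k \<longleftrightarrow> In c (L4 p e i j) \<in> LE k \<and> even p \<and>
     (p = k \<or> c < 2 \<and> e = 0 \<or> 2 \<le> c \<and> i = 0)"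
  by (auto simp: LF_def)

lemma LF_LE: "l \<in> LF k \<Longrightarrow> l \<in> LE k" by (auto simp: LF_def)

definition F :: "nat \<Rightarrow> fsp" where "F k = bsp (LF k) (dgC k) (lvE k)"

lemma based_F: "based (F k) (LF k) (dgC k) (lvE k)"
  unfolding F_def by (rule based_bsp)

definition fF :: "nat \<Rightarrow> vec \<Rightarrow> vec" where "fF k = lift (\<lambda>l. if l \<in> LF k then bv l else 0)"

text \<open>Minus the inverse of the matching given by \<open>dE\<close>; the coefficient 1/2 undoes
  its factor 2.\<close>

definition hF :: "nat \<Rightarrow> vec \<Rightarrow> vec" where
  "hF k = inop (\<lambda>c. opl (\<lambda>p e i j. if even p \<and> p < k then
     (if c < 2 then (if e = 0 then 0 else - l5 c (Suc p) 0 i j)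
      else if i > 0 then scl (-1/2) (l5 c (Suc p) 1 (i - 1) j) else 0) else 0))"

lemma lin_F [lins]: assumes "lin g" shows "lin (\<lambda>v. fF k (g v))" "lin (\<lambda>v. hF k (g v))"
  unfolding fF_def hF_def using assms by (intro lins; assumption)+

lemmas F_simps = lin_F[OF lin_id(2), THEN lin_add] lin_F[OF lin_id(2), THEN lin_scl]
   lin_F[OF lin_id(2), THEN lin_uminus] lin_F[OF lin_id(2), THEN lin_0] lin_F[OF lin_id(2), THEN lin_diff]

lemma F_l5: "fF k (bv l) = (if l \<in> LF k then bv l else 0)"
  "hF k (l5 c p e i j) = (if even p \<and> p < k then
     (if c < 2 then (if e = 0 then 0 else - l5 c (Suc p) 0 i j)
      else if i > 0 then scl (-1/2) (l5 c (Suc p) 1 (i - 1) j) else 0) else 0)"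
  by (simp_all add: fF_def hF_def)

text \<open>\<open>dE\<close> maps the span of the labels with p odd isomorphically onto that of the
  labels with p even outside \<open>LF k\<close>. Projection to the remaining labels and their
  inclusion preserve levels label by label.\<close>

lemma E_F: "eqv (homology deg_out dE (E k)) (F k)"
proof -
  note wE = wfsp_based[OF based_E] and sE = subspace_based[OF based_E]
  note wF = wfsp_based[OF based_F] and sF = subspace_based[OF based_F]
  have "hretr deg_out (E k) dE (F k) (\<lambda>_. 0) (fF k) (\<lambda>v. v) (hF k)"
    unfolding hretr_def
  proof (intro conjI)
    show "fm 0 (E k) (F k) (fF k)"
      by (rule fm_based2[OF based_E based_F]) (intro lins, simp add: F_l5)
    show "fm 0 (F k) (E k) (\<lambda>v. v)"
      by (rule fm_based2[OF based_F based_E]) (intro lins, simp add: LF_LE)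
    show "gm (- deg_out) (E k) (E k) (hF k)"
    proof (rule gm_based[OF based_E _ wE sE])
      fix l assume a: "l \<in> LE k"
      then show "hF k (bv l) \<in> piece (E k) (dgC k l + - deg_out)"
      proof (cases rule: LE_cases)
        case (even1 c q i j)
        then show ?thesis
          by (cases i) (auto simp: F_l5 basedD[OF based_E] LE_iff deg_out_def kdeg_def intro!: sp_ops)
      qed (auto simp: F_l5 basedD[OF based_E] LE_iff deg_out_def kdeg_def intro!: sp_ops)
    qed (intro lins)
    have "fF k (dE (bv l)) = 0" if a: "l \<in> LE k" for l
      using a by (cases rule: LE_cases) (auto simp: F_l5 F_simps l5_simps LF_iff)
    then show "eqm deg_out (E k) (F k) (\<lambda>v. fF k (dE v)) (\<lambda>v. 0)"
      by (intro eqm_based_eq[OF based_E _ _ wF] lins)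
    have dE0: "dE (bv l) = 0" if a: "l \<in> LF k" for l
      using LF_LE[OF a] a by (cases rule: LE_cases) (auto simp: l5_simps LF_iff)
    then show "eqm deg_out (F k) (E k) (\<lambda>v. 0) dE"
      by (intro eqm_based_eq[OF based_F _ _ wE] lins lin_EC(4)[OF lin_id(2)]) simp
    show "eqm 0 (F k) (F k) (\<lambda>v. fF k v) (\<lambda>v. v)"
      by (intro eqm_based_eq[OF based_F _ _ wF] lins) (simp add: F_l5)
    have "fF k (bv l) = bv l + (dE (hF k (bv l)) + hF k (dE (bv l)))" if a: "l \<in> LE k" for l
      using a
    proof (cases rule: LE_cases)
      case (even1 c q i j)
      then show ?thesis
        by (cases i) (auto simp: F_l5 F_simps l5_simps EC_simps LF_iff LE_iff)
    qed (auto simp: F_l5 F_simps l5_simps EC_simps LF_iff LE_iff)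
    then show "eqm 0 (E k) (E k) (\<lambda>v. fF k v) (\<lambda>v. v + (dE (hF k v) + hF k (dE v)))"
      by (intro eqm_based_eq[OF based_E _ _ wE] lins)
  qed
  from hretr_eqv[OF this wE sE _ wF sF] show ?thesis
    unfolding homology_zero[OF based_F] by (simp add: lins)
qed

lemma H3_F: "eqv (H3 (Suc k)) (sh_ts ^ 2 \<triangleright> F (Suc k))"
  unfolding H3_def H3_trunc
  by (intro eqv_shift eqv_trans[OF retr_H3'[OF retr_power] eqv_trans[OF H3'_T eqv_trans[OF HC_E E_F]]])

subsection \<open>Homogeneous bases of direct sums and tensor products\<close>

lemma based_shift: assumes "based M L dg lv"
  shows "based (g \<triangleright> M) L (\<lambda>l. dg l + (qexp g, aexp g, texp g)) (\<lambda>l. lv l + sexp g)"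
proof -
  have 1: "dg l = d - e \<longleftrightarrow> dg l + e = d" for l d e by (auto simp: algebra_simps)
  have 2: "i - s \<le> lv l \<longleftrightarrow> i \<le> lv l + s" for i s l by (simp add: algebra_simps)
  show ?thesis unfolding based_def sel_shift basedD[OF assms] 1 2 by simp
qed

lemma span_sp: "vec.span (\<Union>k\<in>A. incl k ` sp (B k)) = sp {In k l | k l. k \<in> A \<and> l \<in> B k}"
proof
  show "vec.span (\<Union>k\<in>A. incl k ` sp (B k)) \<subseteq> sp {In k l | k l. k \<in> A \<and> l \<in> B k}"
    by (rule vec.span_minimal) (auto intro!: incl_sp)
  show "sp {In k l | k l. k \<in> A \<and> l \<in> B k} \<subseteq> vec.span (\<Union>k\<in>A. incl k ` sp (B k))"
    unfolding sp_span[of "{In k l | k l. k \<in> A \<and> l \<in> B k}"]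
  proof (rule vec.span_mono)
    show "bv ` {In k l |k l. k \<in> A \<and> l \<in> B k} \<subseteq> (\<Union>k\<in>A. incl k ` sp (B k))"
    proof clarify
      fix k l assume "k \<in> A" "l \<in> B k"
      then have "incl k (bv l) \<in> (\<Union>k\<in>A. incl k ` sp (B k))" by (metis UN_I bv_sp imageI)
      then show "bv (In k l) \<in> (\<Union>k\<in>A. incl k ` sp (B k))" by simp
    qed
  qed
qed

definition LD :: "nat \<Rightarrow> (nat \<Rightarrow> lab set) \<Rightarrow> lab set" where
  "LD n L = {In k l | k l. k < n \<and> l \<in> L k}"

definition dD :: "(nat \<Rightarrow> lab \<Rightarrow> 'a) \<Rightarrow> lab \<Rightarrow> 'a::zero" where
  "dD dg l = (case l of In k l' \<Rightarrow> dg k l' | _ \<Rightarrow> 0)"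

lemma LD_iff [simp]: "In k l \<in> LD n L \<longleftrightarrow> k < n \<and> l \<in> L k" by (simp add: LD_def)

lemma dD_In [simp]: "dD dg (In k l) = dg k l" by (simp add: dD_def)

lemma based_dsum:
  assumes "\<And>k. k < length Ms \<Longrightarrow> based (Ms ! k) (L k) (dg k) (lv k)" "n = length Ms"
  shows "based (dsum Ms) (LD n L) (dD dg) (dD lv)"
  unfolding based_def assms(2)
proof (intro conjI allI)
  fix d i
  let ?A = "{..<length Ms}"
  have "piece (dsum Ms) d = vec.span (\<Union>k\<in>?A. incl k ` sp {l \<in> L k. dg k l = d})"
    unfolding dsum_def fsp.select_convs by (intro arg_cong[of _ _ vec.span] SUP_cong) (simp_all add: basedD[OF assms(1)])
  also have "\<dots> = sp {l \<in> LD (length Ms) L. dD dg l = d}"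
    unfolding span_sp by (intro arg_cong[of _ _ sp]) (auto simp: LD_def)
  finally show "piece (dsum Ms) d = sp {l \<in> LD (length Ms) L. dD dg l = d}" .
  have "filt (dsum Ms) i d = vec.span (\<Union>k\<in>?A. incl k ` sp {l \<in> L k. dg k l = d \<and> i \<le> lv k l})"
    unfolding dsum_def fsp.select_convs by (intro arg_cong[of _ _ vec.span] SUP_cong) (simp_all add: basedD[OF assms(1)])
  also have "\<dots> = sp {l \<in> LD (length Ms) L. dD dg l = d \<and> i \<le> dD lv l}"
    unfolding span_sp by (intro arg_cong[of _ _ sp]) (auto simp: LD_def)
  finally show "filt (dsum Ms) i d = sp {l \<in> LD (length Ms) L. dD dg l = d \<and> i \<le> dD lv l}" .
  have "(\<Union>k\<in>?A. incl k ` rels (Ms ! k) d) \<subseteq> {0}"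
    by (auto simp: basedD[OF assms(1)])
  then have "vec.span (\<Union>k\<in>?A. incl k ` rels (Ms ! k) d) \<subseteq> {0}"
    by (intro vec.span_minimal) (simp_all add: vec.subspace_single_0)
  then show "rels (dsum Ms) d = {0}"
    unfolding dsum_def fsp.select_convs using vec.span_zero by blast
qed

lemma based_dsum_nested:
  assumes "\<And>k. k < n \<Longrightarrow> based (f k) (L k) (dg k) (lv k)"
  shows "based (dsum (map f [0..<n])) (LD n L) (dD dg) (dD lv)"
  by (rule based_dsum) (simp_all add: assms)

definition LTn :: "lab set \<Rightarrow> lab set \<Rightarrow> (lab \<Rightarrow> deg) \<Rightarrow> (lab \<Rightarrow> deg) \<Rightarrow> lab set" where
  "LTn L L' dg dg' = {Tn (dg k) (dg' l) k l | k l. k \<in> L \<and> l \<in> L'}"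

definition dTn :: "(lab \<Rightarrow> 'a) \<Rightarrow> (lab \<Rightarrow> 'a) \<Rightarrow> lab \<Rightarrow> 'a :: {zero, plus}" where
  "dTn dg dg' l = (case l of Tn _ _ k l' \<Rightarrow> dg k + dg' l' | _ \<Rightarrow> 0)"

lemma LTn_iff [simp]: "Tn d e k l \<in> LTn L L' dg dg' \<longleftrightarrow> d = dg k \<and> e = dg' l \<and> k \<in> L \<and> l \<in> L'"
  by (auto simp: LTn_def)

lemma dTn_Tn [simp]: "dTn dg dg' (Tn d e k l) = dg k + dg' l" by (simp add: dTn_def)

lemma based_tens:
  assumes M: "based M L dg lv" and N: "based N L' dg' lv'"
  shows "based (M \<otimes> N) (LTn L L' dg dg') (dTn dg dg') (dTn lv lv')"
proof -
  have r: "tens_rels M N d = {0}" for d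
  proof -
    have "{tn e e' v w |e e' v w. e + e' = d \<and> v \<in> rels M e \<and> w \<in> piece N e'} \<union>
      {tn e e' v w |e e' v w. e + e' = d \<and> v \<in> piece M e \<and> w \<in> rels N e'} \<subseteq> {0}"
      by (auto simp: basedD(2)[OF M] basedD(2)[OF N] tn_simps)
    then have "tens_rels M N d \<subseteq> {0}" unfolding tens_rels_def
      by (intro vec.span_minimal) (simp_all add: vec.subspace_single_0)
    then show ?thesis unfolding tens_rels_def using vec.span_zero by blast
  qed
  show ?thesis unfolding based_def
  proof (intro conjI allI)
    fix d i
    let ?P = "{l \<in> LTn L L' dg dg'. dTn dg dg' l = d}"
    have p: "piece (M \<otimes> N) d = vec.span {tn e e' v w | e e' v w. e + e' = d \<and> v \<in> piece M e \<and> w \<in> piece N e'}"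
      by (simp add: tens_def)
    show "piece (M \<otimes> N) d = sp ?P"
    proof
      show "piece (M \<otimes> N) d \<subseteq> sp ?P" unfolding p
      proof (rule vec.span_minimal[OF _ subspace_sp], clarify)
        fix e e' v w assume a: "v \<in> piece M e" "w \<in> piece N e'"
        from a show "tn e e' v w \<in> sp {l \<in> LTn L L' dg dg'. dTn dg dg' l = e + e'}" unfolding basedD[OF M] basedD[OF N]
          by (rule lin2_sp[where F = "tn e e'", rotated 4]) (auto intro!: lins simp: LTn_def)
      qed
      show "sp ?P \<subseteq> piece (M \<otimes> N) d" unfolding p sp_span[of ?P]
      proof (rule vec.span_mono, clarify)
        fix l assume "l \<in> LTn L L' dg dg'" "d = dTn dg dg' l"
        then obtain k k' where k: "l = Tn (dg k) (dg' k') k k'" "k \<in> L" "k' \<in> L'" by (auto simp: LTn_def)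
        have "bv k \<in> piece M (dg k)" "bv k' \<in> piece N (dg' k')" using k by (simp_all add: basedD[OF M] basedD[OF N])
        moreover have "bv l = tn (dg k) (dg' k') (bv k) (bv k')" "dg k + dg' k' = dTn dg dg' l" using k by simp_all
        ultimately show "\<exists>e e' v w. bv l = tn e e' v w \<and> e + e' = dTn dg dg' l \<and> v \<in> piece M e \<and> w \<in> piece N e'" by blast
      qed
    qed
    show "rels (M \<otimes> N) d = {0}" by (simp add: tens_def r)
    let ?Q = "{l \<in> LTn L L' dg dg'. dTn dg dg' l = d \<and> i \<le> dTn lv lv' l}"
    let ?G = "{tn e e' v w | e e' v w j j'. e + e' = d \<and> j + j' = i \<and> v \<in> filt M j e \<and> w \<in> filt N j' e'}"
    have q: "filt (M \<otimes> N) i d = vec.span (?G \<union> {0})" by (simp add: tens_def r)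
    show "filt (M \<otimes> N) i d = sp ?Q"
    proof
      have "?G \<subseteq> sp ?Q"
      proof clarify
        fix e e' v w j j' assume a: "v \<in> filt M j e" "w \<in> filt N j' e'" and d: "d = e + e'" "i = j + j'"
        have "tn e e' v w \<in> sp {l \<in> LTn L L' dg dg'. dTn dg dg' l = e + e' \<and> j + j' \<le> dTn lv lv' l}"
          using a unfolding basedD[OF M] basedD[OF N]
          by (rule lin2_sp[where F = "tn e e'", rotated 4]) (auto intro!: lins simp: LTn_def intro: add_mono)
        then show "tn e e' v w \<in> sp {l \<in> LTn L L' dg dg'. dTn dg dg' l = e + e' \<and> j + j' \<le> dTn lv lv' l}" .
      qed
      then show "filt (M \<otimes> N) i d \<subseteq> sp ?Q" unfolding q by (intro vec.span_minimal) simp_all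
      show "sp ?Q \<subseteq> filt (M \<otimes> N) i d" unfolding q sp_span[of ?Q]
      proof (rule vec.span_mono, rule subsetI, rule UnI1)
        fix x assume "x \<in> bv ` ?Q"
        then obtain l where l: "x = bv l" "l \<in> LTn L L' dg dg'" "d = dTn dg dg' l" "i \<le> dTn lv lv' l" by blast
        then obtain k k' where k: "l = Tn (dg k) (dg' k') k k'" "k \<in> L" "k' \<in> L'" by (auto simp: LTn_def)
        \<comment> \<open>The level i is split off with the exact level of the first factor; the
          rest is then at most the level of the second one.\<close>
        have "bv k \<in> filt M (lv k) (dg k)" "bv k' \<in> filt N (i - lv k) (dg' k')"
          using k l(4) by (simp_all add: basedD[OF M] basedD[OF N] algebra_simps)
        moreover have "x = tn (dg k) (dg' k') (bv k) (bv k')" "dg k + dg' k' = d" "lv k + (i - lv k) = i"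
          using k l by simp_all
        ultimately show "x \<in> ?G" by blast
      qed
    qed
  qed
qed

text \<open>A bijection of bases through a common index set is filtered in both directions as soon
  as degrees and levels agree. The remaining comparison is arithmetic with \<open>dg\<close> and
  \<open>lv\<close>.\<close>

lemma eqv_based:
  assumes M: "based M (\<alpha> ` I) dg lv" and N: "based N (\<beta> ` I) dg' lv'" and inj: "inj_on \<alpha> I" "inj_on \<beta> I"
    and d: "\<And>x. x \<in> I \<Longrightarrow> dg (\<alpha> x) = dg' (\<beta> x)" and l: "\<And>x. x \<in> I \<Longrightarrow> lv (\<alpha> x) = lv' (\<beta> x)"
  shows "eqv M N"
proof -
  define f where "f = lift (\<lambda>l. bv (\<beta> (inv_into I \<alpha> l)))"
  define g where "g = lift (\<lambda>l. bv (\<alpha> (inv_into I \<beta> l)))"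
  have lf: "lin f" "lin g" unfolding f_def g_def by (intro lins)+
  have f: "f (bv (\<alpha> x)) = bv (\<beta> x)" "g (bv (\<beta> x)) = bv (\<alpha> x)" if "x \<in> I" for x
    using that inj by (simp_all add: f_def g_def)
  show ?thesis
  proof (rule eqvI[OF wfsp_based[OF M] wfsp_based[OF N]])
    show "fm 0 M N f" by (rule fm_based2[OF M N lf(1)]) (auto simp: f d l)
    show "fm 0 N M g" by (rule fm_based2[OF N M lf(2)]) (auto simp: f d l)
    show "eqm 0 M M (\<lambda>v. g (f v)) (\<lambda>v. v)"
      by (rule eqm_based_eq[OF M lin_comp[OF lf(2,1)] lin_id(2) wfsp_based[OF M]]) (auto simp: f)
    show "eqm 0 N N (\<lambda>v. f (g v)) (\<lambda>v. v)"
      by (rule eqm_based_eq[OF N lin_comp[OF lf] lin_id(2) wfsp_based[OF N]]) (auto simp: f)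
  qed
qed

lemma wfsp_dsum: assumes "\<And>M. M \<in> set Ms \<Longrightarrow> wfsp M" shows "wfsp (dsum Ms)"
proof -
  have "rels (Ms ! k) d \<subseteq> filt (Ms ! k) i d" if "k < length Ms" for k i d
    using assms[OF nth_mem[OF that]] by (simp add: wfsp_def)
  then have "rels (dsum Ms) d \<subseteq> filt (dsum Ms) i d" for i d
    unfolding dsum_def fsp.select_convs by (intro vec.span_mono UN_mono image_mono) auto
  then show ?thesis by (simp add: wfsp_def dsum_def)
qed

lemma fm_dsum2:
  assumes f: "fm 0 M M' f" and f': "fm 0 N N' f'"
  shows "fm 0 (dsum [M, N]) (dsum [M', N']) (inop (\<lambda>c. if c = 0 then (\<lambda>v. incl 0 (f v)) else (\<lambda>v. incl 1 (f' v))))"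
    (is "fm 0 _ _ ?F")
proof -
  note l = fm0D(4)[OF f] fm0D(4)[OF f']
  have F: "?F (incl 0 v) = incl 0 (f v)" "?F (incl 1 v) = incl 1 (f' v)" for v
    using l by (subst inop_incl; simp add: lins)+
  have lF: "lin ?F" by (intro lins)
  have s: "?F v \<in> vec.span (incl 0 ` A' \<union> incl 1 ` B')"
    if "v \<in> vec.span (incl 0 ` A \<union> incl 1 ` B)" "\<And>x. x \<in> A \<Longrightarrow> f x \<in> A'" "\<And>x. x \<in> B \<Longrightarrow> f' x \<in> B'" for v A B A' B'
    using that(1)
  proof (rule lin_span[OF lF vec.subspace_span, rotated])
    fix x assume "x \<in> incl 0 ` A \<union> incl 1 ` B"
    then have "?F x \<in> incl 0 ` A' \<union> incl 1 ` B'" using that(2,3) F by auto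
    then show "?F x \<in> vec.span (incl 0 ` A' \<union> incl 1 ` B')" by (rule vec.span_base)
  qed
  show ?thesis unfolding fm_def gm_def dsum2 add_0_right
    by (intro conjI allI ballI lF) (erule s; (erule fm0D[OF f] | erule fm0D[OF f']))+
qed

text \<open>The statement for even exponents contains the homology for 2 n - 1 itself, which is
  known only up to \<open>eqv\<close>.\<close>

lemma eqv_dsum2: fixes M M' N :: fsp assumes MN: "eqv M M'" and N: "wfsp N" shows "eqv (dsum [M, N]) (dsum [M', N])"
proof -
  from MN obtain f g where w: "wfsp M" "wfsp M'" and m: "fm 0 M M' f" "fm 0 M' M g"
    and e: "eqm 0 M M (\<lambda>v. g (f v)) (\<lambda>v. v)" "eqm 0 M' M' (\<lambda>v. f (g v)) (\<lambda>v. v)" by (rule eqvE)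
  let ?F = "\<lambda>f. inop (\<lambda>c. if c = 0 then (\<lambda>v. incl 0 (f v)) else (\<lambda>v. incl 1 v))"
  have F: "?F f (incl 0 v) = incl 0 (f v)" "?F f (incl 1 v) = incl 1 v" if "lin f" for f v
    using that by (subst inop_incl; simp add: lins)+
  have lF: "lin (?F f)" for f by (intro lins)
  have E: "eqm 0 (dsum [M, N]) (dsum [M, N]) (\<lambda>v. ?F g (?F f v)) (\<lambda>v. v)"
    if l: "lin f" "lin g" and e: "eqm 0 M M (\<lambda>v. g (f v)) (\<lambda>v. v)" for f g and M :: fsp
    unfolding eqm_def dsum2
  proof (intro allI ballI)
    fix d v
    have lE: "lin (\<lambda>v. ?F g (?F f v) - v)" by (intro lins)
    assume "v \<in> vec.span (incl 0 ` piece M d \<union> incl 1 ` piece N d)"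
    then show "?F g (?F f v) - v \<in> vec.span (incl 0 ` rels M (d + 0) \<union> incl 1 ` rels N (d + 0))"
    proof (rule lin_span[OF lE vec.subspace_span, rotated])
      fix x assume "x \<in> incl 0 ` piece M d \<union> incl 1 ` piece N d"
      then show "?F g (?F f x) - x \<in> vec.span (incl 0 ` rels M (d + 0) \<union> incl 1 ` rels N (d + 0))"
      proof
        assume "x \<in> incl 0 ` piece M d"
        then obtain v where v: "x = incl 0 v" "v \<in> piece M d" by blast
        have "?F g (?F f x) - x = incl 0 (g (f v) - v)" by (simp add: v F[OF l(1)] F[OF l(2)] incl_diff)
        then show ?thesis using eqmD[OF e v(2)] by (intro vec.span_base) auto
      next
        assume "x \<in> incl 1 ` piece N d"
        then obtain v where v: "x = incl 1 v" by blast
        have "?F g (?F f x) - x = 0" unfolding v F[OF l(1)] F[OF l(2)] by simp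
        then show ?thesis by (simp add: vec.span_zero)
      qed
    qed
  qed
  show ?thesis
    by (rule eqvI[where f = "?F f" and g = "?F g"])
       (intro wfsp_dsum fm_dsum2 m gm_id E fm0D(4)[OF m(1)] fm0D(4)[OF m(2)] e | auto simp: w N)+
qed

subsection \<open>The right-hand sides\<close>

lemma emb_image_sp: "emb ` {p. keys p \<subseteq> A} = sp (Mono ` A)"
proof
  show "emb ` {p. keys p \<subseteq> A} \<subseteq> sp (Mono ` A)" using sp_emb by blast
  have sub: "vec.subspace (emb ` {p. keys p \<subseteq> A})"
  proof (rule vec.subspaceI)
    show "0 \<in> emb ` {p. keys p \<subseteq> A}" by (rule image_eqI[of _ _ 0]) simp_all
    fix x y c assume "x \<in> emb ` {p. keys p \<subseteq> A}"
    then obtain p where p: "x = emb p" "keys p \<subseteq> A" by blast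
    show "scl c x \<in> emb ` {p. keys p \<subseteq> A}"
      using p keys_pscl[of c p] by (intro image_eqI[of _ _ "pscl c p"]) (auto simp: emb_pscl)
    assume "y \<in> emb ` {p. keys p \<subseteq> A}"
    then obtain q where q: "y = emb q" "keys q \<subseteq> A" by blast
    show "x + y \<in> emb ` {p. keys p \<subseteq> A}"
      using p q keys_add[of p q] by (intro image_eqI[of _ _ "p + q"]) (auto simp: emb_add)
  qed
  show "sp (Mono ` A) \<subseteq> emb ` {p. keys p \<subseteq> A}"
  proof
    fix v assume "v \<in> sp (Mono ` A)"
    then show "v \<in> emb ` {p. keys p \<subseteq> A}"
    proof (rule lin_sp[OF lin_id(2) sub, rotated])
      fix l assume "l \<in> Mono ` A"
      then obtain m where "l = Mono m" "m \<in> A" by blast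
      then show "bv l \<in> emb ` {p. keys p \<subseteq> A}"
        by (intro image_eqI[of _ _ "Poly_Mapping.single m 1"]) (auto simp: emb_single)
    qed
  qed
qed

definition dgP :: "lab \<Rightarrow> deg" where
  "dgP l = (case l of Mono m \<Rightarrow> (2 * int (\<Sum>i\<in>keys m. lookup m i), 0, 0) | _ \<Rightarrow> 0)"

lemma dgP_simps [simp]: "dgP (Mono 0) = 0" "dgP (Mono (Poly_Mapping.single i j)) = dx j"
  by (auto simp: dgP_def dx_def zero_prod_def)

lemma based_poly: "based (poly_space S) (Mono ` {m. keys m \<subseteq> S}) dgP (\<lambda>_. 0)"
proof -
  let ?A = "\<lambda>d. {m. keys m \<subseteq> S \<and> d = (2 * int (\<Sum>i\<in>keys m. lookup m i), 0, 0)}"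
  have 1: "Qpoly S \<inter> homog d = {p. keys p \<subseteq> ?A d}" for d
    by (auto simp: Qpoly_def homog_def)
  have 2: "{l \<in> Mono ` {m. keys m \<subseteq> S}. dgP l = d} = Mono ` ?A d" for d
    by (auto simp: dgP_def)
  have 3: "{0} \<inter> homog d = {0}" for d by (auto simp: homog_def)
  have 4: "{l \<in> Mono ` {m. keys m \<subseteq> S}. dgP l = d \<and> i \<le> (0::rat)} =
     (if i \<le> 0 then {l \<in> Mono ` {m. keys m \<subseteq> S}. dgP l = d} else {})" for d i by auto
  have 5: "sp {} = {0}" by (auto simp: sp_def)
  show ?thesis
    unfolding based_def poly_space_def cyclic_def fsp.select_convs 4
    by (simp add: 1 2 3 5 emb_image_sp trivial_filt_def)
qed

lemma based_QQ: "based QQ {Mono 0} dgP (\<lambda>_. 0)"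
  using based_poly[of "{}"] by (simp add: QQ_def)

lemma based_QQ1: "based QQ1 (range (\<lambda>j. Mono (Poly_Mapping.single 1 j))) dgP (\<lambda>_. 0)"
proof -
  have "m = Poly_Mapping.single 1 (lookup m 1)" if "keys m \<subseteq> {1}" for m :: "nat \<Rightarrow>\<^sub>0 nat"
    using that by (intro poly_mapping_eqI) (auto simp: lookup_single when_def in_keys_iff)
  then have "{m :: nat \<Rightarrow>\<^sub>0 nat. keys m \<subseteq> {1}} = range (\<lambda>j. Poly_Mapping.single 1 j)"
    by (auto split: if_splits)
  then have "Mono ` {m. keys m \<subseteq> {1}} = range (\<lambda>j. Mono (Poly_Mapping.single 1 j))"
    by (simp add: image_image)
  then show ?thesis using based_poly[of "{1}"] by (simp add: QQ1_def)
qed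

lemma shift_pow: "g ^ n = Shift (int n * qexp g) (int n * aexp g) (of_nat n * texp g) (of_nat n * sexp g)"
  by (induction n) (simp_all add: one_shift_def times_shift_def algebra_simps)

lemma shift_exps: "sh_ts = Shift 0 0 (1/2) (1/2)" "sh_sq = Shift 2 0 0 1" "sh_ttot = Shift 2 1 1 1" "sh_aq = Shift 2 1 0 0"
  "sh_ta = Shift 0 1 1 0" "inverse (Shift a b c d) = Shift (-a) (-b) (-c) (-d)"
  "Shift a b c d * Shift a' b' c' d' = Shift (a + a') (b + b') (c + c') (d + d')"
  by (simp_all add: sh_ts_def sh_sq_def sh_ttot_def sh_aq_def sh_ta_def sh_s_def sh_q_def sh_a_def sh_t_def shift_pow
      times_shift_def inverse_shift_def)

lemma shift_powi: "(sh_ts * sh_aq) powi (- (2 * int n)) = Shift (- 4 * int n) (- 2 * int n) (- of_nat n) (- of_nat n)"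
  by (simp add: power_int_def shift_exps shift_pow one_shift_def nat_mult_distrib)

definition dgU :: "lab \<Rightarrow> deg" where
  "dgU = (\<lambda>l. dD (\<lambda>a l. dgP l + (if a = 0 then (2, 1, 0) else 0)) l + (0, 0, 1/2))"

definition LU :: "lab set" where "LU = LD 2 (\<lambda>_. range (\<lambda>j. Mono (Poly_Mapping.single 1 j)))"

lemma based_U: "based H3_unknot LU dgU (\<lambda>l. dD (\<lambda>_ _. 0) l + 1/2)"
proof -
  have "based (dsum [sh_aq \<triangleright> QQ1, QQ1]) LU (dD (\<lambda>a l. dgP l + (if a = 0 then (2, 1, 0) else 0))) (dD (\<lambda>_ _. 0))"
    unfolding LU_def
  proof (rule based_dsum)
    fix k assume "k < length [sh_aq \<triangleright> QQ1, QQ1]"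
    then consider "k = 0" | "k = 1" by fastforce
    then show "based ([sh_aq \<triangleright> QQ1, QQ1] ! k) (range (\<lambda>j. Mono (Poly_Mapping.single 1 j)))
        (\<lambda>l. dgP l + (if k = 0 then (2, 1, 0) else 0)) (\<lambda>_. 0)"
      using based_shift[OF based_QQ1, of sh_aq] based_QQ1 by cases (simp_all add: shift_exps)
  qed simp
  from based_shift[OF this, of sh_ts] show ?thesis
    unfolding H3_unknot_def dgU_def by (simp add: shift_exps)
qed

lemma based_odd_term:
  "based (sh_ttot ^ (2 * q + 1) \<triangleright> dsum [sh_sq \<triangleright> QQ, inverse sh_aq \<triangleright> QQ]) (LD 2 (\<lambda>_. {Mono 0}))
     (\<lambda>l. dD (\<lambda>b l. dgP l + (if b = 0 then (2, 0, 0) else (-2, -1, 0))) l +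
        (2 * (2 * int q + 1), 2 * int q + 1, 2 * of_nat q + 1))
     (\<lambda>l. dD (\<lambda>b l. if b = 0 then 1 else 0) l + (2 * of_nat q + 1))"
proof -
  have "based (dsum [sh_sq \<triangleright> QQ, inverse sh_aq \<triangleright> QQ]) (LD 2 (\<lambda>_. {Mono 0}))
     (dD (\<lambda>b l. dgP l + (if b = 0 then (2, 0, 0) else (-2, -1, 0)))) (dD (\<lambda>b l. if b = 0 then 1 else 0))"
  proof (rule based_dsum)
    fix k assume "k < length [sh_sq \<triangleright> QQ, inverse sh_aq \<triangleright> QQ]"
    then consider "k = 0" | "k = 1" by fastforce
    then show "based ([sh_sq \<triangleright> QQ, inverse sh_aq \<triangleright> QQ] ! k) {Mono 0}
       (\<lambda>l. dgP l + (if k = 0 then (2, 0, 0) else (-2, -1, 0))) (\<lambda>l. if k = 0 then 1 else 0)"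
      using based_shift[OF based_QQ, of sh_sq] based_shift[OF based_QQ, of "inverse sh_aq"]
      by cases (simp_all add: shift_exps)
  qed simp
  from based_shift[OF this, of "sh_ttot ^ (2 * q + 1)"] show ?thesis
    by (simp add: shift_pow shift_exps add.commute del: power_Suc)
qed

definition LR1 :: "nat \<Rightarrow> lab set" where
  "LR1 n = LD 2 (\<lambda>i. if i = 0 then {Mono 0} else LD n (\<lambda>_. LD 2 (\<lambda>_. {Mono 0})))"

definition dgR1 :: "lab \<Rightarrow> deg" where
  "dgR1 = dD (\<lambda>i. if i = 0 then dgP else (\<lambda>l. dD (\<lambda>q l. dD (\<lambda>b l. dgP l + (if b = 0 then (2, 0, 0) else (-2, -1, 0))) l +
        (2 * (2 * int q + 1), 2 * int q + 1, 2 * of_nat q + 1)) l + (0, 1, 1)))"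

definition lvR1 :: "lab \<Rightarrow> rat" where
  "lvR1 = dD (\<lambda>i. if i = 0 then (\<lambda>_. 0) else dD (\<lambda>q l. dD (\<lambda>b l. if b = 0 then 1 else 0) l + (2 * of_nat q + 1)))"

lemma based_R1: "based (dsum [QQ, sh_ta \<triangleright> dsum (map (\<lambda>k. sh_ttot ^ (2 * k + 1) \<triangleright>
    dsum [sh_sq \<triangleright> QQ, inverse sh_aq \<triangleright> QQ]) [0..<n])]) (LR1 n) dgR1 lvR1"
  unfolding LR1_def dgR1_def lvR1_def
proof (rule based_dsum)
  let ?D = "dsum (map (\<lambda>k. sh_ttot ^ (2 * k + 1) \<triangleright> dsum [sh_sq \<triangleright> QQ, inverse sh_aq \<triangleright> QQ]) [0..<n])"
  note D = based_shift[OF based_dsum_nested[where n = n, OF based_odd_term], where g = sh_ta]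
  fix k assume "k < length [QQ, sh_ta \<triangleright> ?D]"
  then consider "k = 0" | "k = 1" by fastforce
  then show "based ([QQ, sh_ta \<triangleright> ?D] ! k) (if k = 0 then {Mono 0} else LD n (\<lambda>_. LD 2 (\<lambda>_. {Mono 0})))
     (if k = 0 then dgP else (\<lambda>l. dD (\<lambda>q l. dD (\<lambda>b l. dgP l + (if b = 0 then (2, 0, 0) else (-2, -1, 0))) l +
        (2 * (2 * int q + 1), 2 * int q + 1, 2 * of_nat q + 1)) l + (0, 1, 1)))
     (if k = 0 then (\<lambda>_. 0) else dD (\<lambda>q l. dD (\<lambda>b l. if b = 0 then 1 else 0) l + (2 * of_nat q + 1)))"
  proof cases
    case 1 then show ?thesis using based_QQ by simp
  next
    case 2 then show ?thesis using D by (simp add: shift_exps)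
  qed
qed simp

definition LR2 :: "lab set" where
  "LR2 = LD 3 (\<lambda>i. if i = 2 then {Mono 0} else range (\<lambda>j. Mono (Poly_Mapping.single 1 j)))"

definition dgR2 :: "lab \<Rightarrow> deg" where
  "dgR2 = dD (\<lambda>i l. dgP l + (if i = 0 then (4, 1, 0) else if i = 1 then (2, 0, 0) else 0))"

definition lvR2 :: "lab \<Rightarrow> rat" where
  "lvR2 = dD (\<lambda>i l. if i = 2 then 0 else 1)"

lemma based_R2: "based (dsum [(sh_aq * sh_sq) \<triangleright> QQ1, sh_sq \<triangleright> QQ1, QQ]) LR2 dgR2 lvR2"
  unfolding LR2_def dgR2_def lvR2_def
proof (rule based_dsum)
  fix k assume "k < length [(sh_aq * sh_sq) \<triangleright> QQ1, sh_sq \<triangleright> QQ1, QQ]"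
  then have "k < 3" by simp
  then consider "k = 0" | "k = 1" | "k = 2" by linarith
  then show "based ([(sh_aq * sh_sq) \<triangleright> QQ1, sh_sq \<triangleright> QQ1, QQ] ! k)
     (if k = 2 then {Mono 0} else range (\<lambda>j. Mono (Poly_Mapping.single 1 j)))
     (\<lambda>l. dgP l + (if k = 0 then (4, 1, 0) else if k = 1 then (2, 0, 0) else 0)) (\<lambda>l. if k = 2 then 0 else 1)"
    using based_shift[OF based_QQ1, of "sh_aq * sh_sq"] based_shift[OF based_QQ1, of sh_sq] based_QQ
    by cases (simp_all add: shift_exps)
qed simp

section \<open>Odd exponents: matching the two bases\<close>

definition Iodd :: "nat \<Rightarrow> (nat \<times> nat \<times> nat \<times> nat) set" where
  "Iodd n = {(a, b, q, j). a < 2 \<and> (b = 2 \<and> q = 0 \<or> b < 2 \<and> q < n)}"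

text \<open>In the index \<open>(a, b, q, j)\<close>, \<open>a\<close> is the summand of the unknot and \<open>j\<close> the power of \<open>w\<close>. The value
  \<open>b = 2\<close> belongs to the summand \<open>\<rat>\<close>; otherwise \<open>b\<close> is the summand of the bracket and \<open>q\<close> the index of
  the sum.\<close>

definition alpha :: "nat \<times> nat \<times> nat \<times> nat \<Rightarrow> lab" where
  "alpha = (\<lambda>(a, b, q, j). In (if b = 1 then 1 - a else 3 - a)
     (L4 (if b = 2 then 0 else 2 * q + 2) (if b = 1 then 0 else 1) 0 j))"

definition beta :: "nat \<times> nat \<times> nat \<times> nat \<Rightarrow> lab" where
  "beta = (\<lambda>(a, b, q, j). let l = In a (Mono (Poly_Mapping.single 1 j));
     r = (if b = 2 then In 0 (Mono 0) else In 1 (In q (In b (Mono 0)))) in Tn (dgU l) (dgR1 r) l r)"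

text \<open>As 2 n + 1 is odd, no label of \<open>LF\<close> sits in the top position. Position 0
  contributes the kernel with x_-^0, each position 2 q + 2 the generator e = 0 in the cokernel and
  the cycle e = 1 in the kernel. Components 1 and 3 are 0 and 2 shifted by a_q, which gives the two
  summands of the unknot, and w is x_+.\<close>

lemma alpha_image: "alpha ` Iodd n = LF (2 * n + 1)"
proof
  show "alpha ` Iodd n \<subseteq> LF (2 * n + 1)"
  proof clarify
    fix a b q j assume "(a, b, q, j) \<in> Iodd n"
    then have "a = 0 \<or> a = 1" "b = 2 \<and> q = 0 \<or> b = 0 \<and> q < n \<or> b = 1 \<and> q < n" by (auto simp: Iodd_def)
    then show "alpha (a, b, q, j) \<in> LF (2 * n + 1)"
      by (auto simp: alpha_def LF_iff LE_iff)
  qed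
  show "LF (2 * n + 1) \<subseteq> alpha ` Iodd n"
  proof
    fix l assume l: "l \<in> LF (2 * n + 1)"
    from LF_LE[OF l] show "l \<in> alpha ` Iodd n"
    proof (cases rule: LE_cases)
      case (gen0 c q j)
      from gen0(2) obtain r where q: "q = 2 * r + 1" by (elim oddE)
      have "l = alpha (1 - c, 1, r, j)" "(1 - c, 1, r, j) \<in> Iodd n"
        using gen0 q by (auto simp: alpha_def Iodd_def)
      then show ?thesis by blast
    next
      case (even1 c q i j)
      have i: "i = 0" using l even1 by (auto simp: LF_iff)
      from even1(2) obtain r where q: "q = 2 * r" by (elim evenE)
      show ?thesis
      proof (cases r)
        case 0
        have "l = alpha (3 - c, 2, 0, j)" "(3 - c, 2, 0, j) \<in> Iodd n"
          using even1 q i 0 by (auto simp: alpha_def Iodd_def)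
        then show ?thesis by blast
      next
        case (Suc r')
        have "l = alpha (3 - c, 0, r', j)" "(3 - c, 0, r', j) \<in> Iodd n"
          using even1 q i Suc by (auto simp: alpha_def Iodd_def)
        then show ?thesis by blast
      qed
    qed (use l in \<open>auto simp: LF_iff\<close>)
  qed
qed

lemma inj_alpha: "inj_on alpha (Iodd n)"
proof (rule inj_onI)
  fix x y assume xy: "x \<in> Iodd n" "y \<in> Iodd n" "alpha x = alpha y"
  obtain a b q j a' b' q' j' where x: "x = (a, b, q, j)" "y = (a', b', q', j')"
    by (cases x, cases y) blast
  from xy(1,2) have "a = 0 \<or> a = 1" "b = 2 \<and> q = 0 \<or> b = 0 \<or> b = 1" "a' = 0 \<or> a' = 1" "b' = 2 \<and> q' = 0 \<or> b' = 0 \<or> b' = 1"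
    by (auto simp: Iodd_def x)
  then show "x = y"
    using xy(3) unfolding x by (elim disjE conjE) (simp_all add: alpha_def)
qed

lemma single_1_inj: "Poly_Mapping.single (1::nat) j = Poly_Mapping.single 1 j' \<longleftrightarrow> j = (j' :: nat)"
  by (metis lookup_single_eq)

lemma beta_image: "beta ` Iodd n = LTn LU (LR1 n) dgU dgR1"
proof
  show "beta ` Iodd n \<subseteq> LTn LU (LR1 n) dgU dgR1"
    by (auto simp: Iodd_def beta_def Let_def LU_def LR1_def)
  show "LTn LU (LR1 n) dgU dgR1 \<subseteq> beta ` Iodd n"
  proof
    fix x assume "x \<in> LTn LU (LR1 n) dgU dgR1"
    then obtain l r where x: "x = Tn (dgU l) (dgR1 r) l r" "l \<in> LU" "r \<in> LR1 n" by (auto simp: LTn_def)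
    from x(2) obtain a j where l: "a < 2" "l = In a (Mono (Poly_Mapping.single 1 j))" by (auto simp: LU_def LD_def)
    from x(3) have "r = In 0 (Mono 0) \<or> (\<exists>q b. q < n \<and> b < 2 \<and> r = In 1 (In q (In b (Mono 0))))"
      by (fastforce simp: LR1_def LD_def split: if_splits)
    then show "x \<in> beta ` Iodd n"
    proof (elim disjE exE conjE)
      assume "r = In 0 (Mono 0)"
      then have "x = beta (a, 2, 0, j)" "(a, 2, 0, j) \<in> Iodd n" using l by (auto simp: x(1) beta_def Let_def Iodd_def)
      then show ?thesis by blast
    next
      fix q b assume "q < n" "b < 2" "r = In 1 (In q (In b (Mono 0)))"
      then have "x = beta (a, b, q, j)" "(a, b, q, j) \<in> Iodd n" using l by (auto simp: x(1) beta_def Let_def Iodd_def)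
      then show ?thesis by blast
    qed
  qed
qed

lemma inj_beta: "inj_on beta (Iodd n)"
  by (rule inj_onI) (auto simp: Iodd_def beta_def Let_def single_1_inj[unfolded One_nat_def] split: if_splits)

lemma H3_odd: "eqv (H3 (2 * n + 1)) ((sh_ts * sh_aq) powi (- (2 * int n)) \<triangleright>
        (H3_unknot \<otimes>
          dsum [QQ,
                sh_ta \<triangleright> dsum (map (\<lambda>k. sh_ttot ^ (2 * k + 1) \<triangleright>
                    dsum [sh_sq \<triangleright> QQ, inverse sh_aq \<triangleright> QQ]) [0..<n])]))"
proof -
  have 1: "eqv (H3 (2 * n + 1)) (sh_ts ^ 2 \<triangleright> F (2 * n + 1))" using H3_F[of "2 * n"] by simp
  have "eqv (sh_ts ^ 2 \<triangleright> F (2 * n + 1)) ((sh_ts * sh_aq) powi (- (2 * int n)) \<triangleright>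
        (H3_unknot \<otimes>
          dsum [QQ,
                sh_ta \<triangleright> dsum (map (\<lambda>k. sh_ttot ^ (2 * k + 1) \<triangleright>
                    dsum [sh_sq \<triangleright> QQ, inverse sh_aq \<triangleright> QQ]) [0..<n])]))"
  proof (rule eqv_based[OF based_shift[OF based_F[of "2 * n + 1", folded alpha_image]]
        based_shift[OF based_tens[OF based_U based_R1, folded beta_image]] inj_alpha inj_beta])
    fix x assume "x \<in> Iodd n"
    then obtain a b q j where x: "x = (a, b, q, j)" "a = 0 \<or> a = 1" "b = 2 \<and> q = 0 \<or> b = 0 \<and> q < n \<or> b = 1 \<and> q < n"
      by (cases x) (fastforce simp: Iodd_def)
    from x(2,3) show "dgC (2 * n + 1) (alpha x) + (qexp (sh_ts ^ 2), aexp (sh_ts ^ 2), texp (sh_ts ^ 2)) =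
      dTn dgU dgR1 (beta x) + (qexp ((sh_ts * sh_aq) powi (- (2 * int n))), aexp ((sh_ts * sh_aq) powi (- (2 * int n))),
         texp ((sh_ts * sh_aq) powi (- (2 * int n))))"
      unfolding shift_powi x(1)
      by (elim disjE conjE)
         (simp_all add: alpha_def beta_def Let_def dgU_def dgR1_def shift_pow shift_exps kdeg_def dx_def field_simps)
    from x(2,3) show "lvE (2 * n + 1) (alpha x) + sexp (sh_ts ^ 2) =
      dTn (\<lambda>l. dD (\<lambda>_ _. 0) l + 1/2) lvR1 (beta x) + sexp ((sh_ts * sh_aq) powi (- (2 * int n)))"
      unfolding shift_powi x(1)
      by (elim disjE conjE)
         (simp_all add: alpha_def beta_def Let_def lvR1_def shift_pow shift_exps field_simps)
  qed
  then show ?thesis by (rule eqv_trans[OF 1])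
qed

section \<open>Even exponents: splitting off the top position\<close>

definition Ieven :: "nat \<Rightarrow> (nat \<times> nat \<times> nat \<times> nat \<times> nat) set" where
  "Ieven n = {(c, p, e, i, j). In c (L4 p e i j) \<in> LF (2 * n)}"

definition gamma :: "nat \<times> nat \<times> nat \<times> nat \<times> nat \<Rightarrow> lab" where
  "gamma = (\<lambda>(c, p, e, i, j). In c (L4 p e i j))"

text \<open>Labels below the top position \<open>2 n\<close> give the homology for \<open>2 n - 1\<close>, those in it the second summand.\<close>

definition delta :: "nat \<Rightarrow> nat \<times> nat \<times> nat \<times> nat \<times> nat \<Rightarrow> lab" where
  "delta n = (\<lambda>(c, p, e, i, j). if p < 2 * n then In 0 (In c (L4 p e i j)) else
     let l = In (if odd c then 0 else 1) (Mono (Poly_Mapping.single 1 j));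
       r = (if 2 \<le> c then In 0 (Mono (Poly_Mapping.single 1 i)) else if e = 1 then In 1 (Mono (Poly_Mapping.single 1 i))
         else In 2 (Mono 0))
     in In 1 (Tn (dgU l) (dgR2 r) l r))"

lemma gamma_image: "gamma ` Ieven n = LF (2 * n)"
proof
  show "gamma ` Ieven n \<subseteq> LF (2 * n)" by (auto simp: gamma_def Ieven_def)
  show "LF (2 * n) \<subseteq> gamma ` Ieven n"
  proof
    fix l assume l: "l \<in> LF (2 * n)"
    then obtain c p e i j where "l = In c (L4 p e i j)" unfolding LF_def by blast
    then have "l = gamma (c, p, e, i, j)" "(c, p, e, i, j) \<in> Ieven n" using l by (simp_all add: gamma_def Ieven_def)
    then show "l \<in> gamma ` Ieven n" by (rule image_eqI)
  qed
qed

lemma inj_gamma: "inj_on gamma (Ieven n)"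
  by (auto simp: gamma_def inj_on_def)

text \<open>Strictly below the top position, membership in \<open>LF k\<close> does not depend on k.
  For 2 n - 1 the top position is odd and contributes nothing, so the labels below position 2 n are
  those for 2 n - 1. In position 2 n no label is cancelled.\<close>

lemma Ieven_cases [consumes 2]:
  assumes "x \<in> Ieven n" "1 \<le> n"
  obtains (low) c p e i j where "x = (c, p, e, i, j)" "p < 2 * n" "In c (L4 p e i j) \<in> LF (2 * n - 1)" "c < 4" "even p" "e \<le> 1"
  | (top0) c i j where "x = (c, 2 * n, 1, i, j)" "c = 0 \<or> c = 1"
  | (gen) c j where "x = (c, 2 * n, 0, 0, j)" "c = 0 \<or> c = 1"
  | (top1) c i j where "x = (c, 2 * n, 1, i, j)" "c = 2 \<or> c = 3"
proof -
  from assms obtain c p e i j where x: "x = (c, p, e, i, j)" and F: "In c (L4 p e i j) \<in> LF (2 * n)"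
    by (cases x) (auto simp: Ieven_def)
  from F have F': "c < 4" "p \<le> 2 * n" "e \<le> 1" "even p" "p = 2 * n \<or> c < 2 \<and> e = 0 \<or> 2 \<le> c \<and> i = 0"
    "c < 2 \<longrightarrow> e = 1 \<or> i = 0" "2 \<le> c \<longrightarrow> e = 1" "p = 0 \<longrightarrow> e = 1"
    by (simp_all add: LF_iff LE_iff split: if_splits)
  show ?thesis
  proof (cases "p < 2 * n")
    case True
    have "p \<le> 2 * n - 1" using True by simp
    then have "In c (L4 p e i j) \<in> LF (2 * n - 1)"
      using F' True unfolding LF_iff LE_iff by auto
    then show ?thesis using low[OF x True] F'(1,3,4) by blast
  next
    case False
    then have p: "p = 2 * n" using F'(2) by simp
    consider "c = 0 \<or> c = 1" "e = 0" | "c = 0 \<or> c = 1" "e = 1" | "c = 2 \<or> c = 3"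
      using F'(1,3) by linarith
    then show ?thesis
    proof cases
      case 1
      then have "i = 0" using F'(6) by auto
      then show ?thesis using gen x p 1 by blast
    next
      case 2 then show ?thesis using top0 x p by blast
    next
      case 3
      then have "e = 1" using F'(7) by auto
      then show ?thesis using top1 x p 3 by blast
    qed
  qed
qed

definition LR3 :: "nat \<Rightarrow> lab set" where
  "LR3 n = LD 2 (\<lambda>t. if t = 0 then LF (2 * n - 1) else LTn LU LR2 dgU dgR2)"

text \<open>In the top position all powers of x_- survive in the kernel and on the labels with e = 1
  of the cokernel, which gives the variable z; the generator e = 0 of the cokernel comes with x_-^0
  alone.\<close>

lemma delta_image: assumes n: "1 \<le> n" shows "delta n ` Ieven n = LR3 n"
proof
  show "delta n ` Ieven n \<subseteq> LR3 n"
  proof (rule image_subsetI)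
    fix x assume "x \<in> Ieven n"
    then show "delta n x \<in> LR3 n" using n
      by (cases rule: Ieven_cases) (auto simp: delta_def LR3_def LU_def LR2_def Let_def)
  qed
  show "LR3 n \<subseteq> delta n ` Ieven n"
  proof
    fix y assume "y \<in> LR3 n"
    then consider l where "y = In 0 l" "l \<in> LF (2 * n - 1)" | l r where "y = In 1 (Tn (dgU l) (dgR2 r) l r)" "l \<in> LU" "r \<in> LR2"
      by (auto simp: LR3_def LD_def LTn_def less_2_cases_iff)
    then show "y \<in> delta n ` Ieven n"
    proof cases
      case 1
      then obtain c p e i j where l: "l = In c (L4 p e i j)" by (auto simp: LF_def)
      have F: "In c (L4 p e i j) \<in> LF (2 * n - 1)" using 1 l by simp
      have F': "c < 4" "p \<le> 2 * n - 1" "e \<le> 1" "even p" "p = 2 * n - 1 \<or> c < 2 \<and> e = 0 \<or> 2 \<le> c \<and> i = 0"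
        "c < 2 \<longrightarrow> e = 1 \<or> i = 0" "2 \<le> c \<longrightarrow> e = 1" "p = 0 \<longrightarrow> e = 1"
        using F by (simp_all add: LF_iff LE_iff split: if_splits)
      have p: "p < 2 * n" using F'(2) n by linarith
      \<comment> \<open>Parity excludes the clause of \<open>LF\<close> for the top position, so the
        others apply and carry over to 2 n.\<close>
      have "p \<noteq> 2 * n - 1" using F'(4) n by presburger
      then have "In c (L4 p e i j) \<in> LF (2 * n)" using F' p unfolding LF_iff LE_iff by auto
      then have "(c, p, e, i, j) \<in> Ieven n" by (simp add: Ieven_def)
      moreover have "y = delta n (c, p, e, i, j)" using 1 l p by (simp add: delta_def)
      ultimately show ?thesis by blast
    next
      case 2
      from 2(2) obtain a j where l: "a = 0 \<or> a = 1" "l = In a (Mono (Poly_Mapping.single 1 j))"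
        by (auto simp: LU_def LD_def less_2_cases_iff)
      from 2(3) obtain t m where r: "r = In t m" "t < 3" "m \<in> (if t = 2 then {Mono 0} else range (\<lambda>j. Mono (Poly_Mapping.single 1 j)))"
        by (auto simp: LR2_def LD_def)
      from r(2) consider "t = 0" | "t = 1" | "t = 2" by linarith
      then show ?thesis
      proof cases
        case 1
        then obtain i where "m = Mono (Poly_Mapping.single 1 i)" using r by auto
        then have "y = delta n (3 - a, 2 * n, 1, i, j)" "(3 - a, 2 * n, 1, i, j) \<in> Ieven n"
          using 2 l r 1 by (auto simp: delta_def Let_def Ieven_def LF_iff LE_iff)
        then show ?thesis by blast
      next
        case t: 2
        then obtain i where "m = Mono (Poly_Mapping.single 1 i)" using r by auto
        then have "y = delta n (1 - a, 2 * n, 1, i, j)" "(1 - a, 2 * n, 1, i, j) \<in> Ieven n"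
          using 2 l r t by (auto simp: delta_def Let_def Ieven_def LF_iff LE_iff)
        then show ?thesis by blast
      next
        case t: 3
        then have "m = Mono 0" using r by auto
        then have "y = delta n (1 - a, 2 * n, 0, 0, j)" "(1 - a, 2 * n, 0, 0, j) \<in> Ieven n"
          using 2 l r t n by (auto simp: delta_def Let_def Ieven_def LF_iff LE_iff)
        then show ?thesis by blast
      qed
    qed
  qed
qed

lemma inj_delta: assumes n: "1 \<le> n" shows "inj_on (delta n) (Ieven n)"
proof (rule inj_onI)
  fix x y assume x: "x \<in> Ieven n" and y: "y \<in> Ieven n" and e: "delta n x = delta n y"
  from x n show "x = y"
  proof (cases rule: Ieven_cases)
    case (low c p e i j)
    note X = low
    from y n show ?thesis
      by (cases rule: Ieven_cases) (use X e in \<open>auto simp: delta_def Let_def single_1_inj[unfolded One_nat_def]\<close>)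
  next
    case (top0 c i j)
    note X = top0
    from y n show ?thesis
      by (cases rule: Ieven_cases) (use X e in \<open>auto simp: delta_def Let_def single_1_inj[unfolded One_nat_def]\<close>)
  next
    case (gen c j)
    note X = gen
    from y n show ?thesis
      by (cases rule: Ieven_cases) (use X e in \<open>auto simp: delta_def Let_def single_1_inj[unfolded One_nat_def]\<close>)
  next
    case (top1 c i j)
    note X = top1
    from y n show ?thesis
      by (cases rule: Ieven_cases) (use X e in \<open>auto simp: delta_def Let_def single_1_inj[unfolded One_nat_def]\<close>)
  qed
qed

lemma H3_even: assumes n: "1 \<le> n" shows "eqv (H3 (2 * n))
      (dsum [inverse (sh_ts * sh_aq) \<triangleright> H3 (2 * n - 1),
            (sh_ts ^ (2 * n - 1) * inverse sh_aq * sh_ta) \<triangleright>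
              (H3_unknot \<otimes>
                dsum [(sh_aq * sh_sq) \<triangleright> QQ1, sh_sq \<triangleright> QQ1, QQ])])"
proof -
  let ?g = "inverse (sh_ts * sh_aq)" and ?g' = "sh_ts ^ (2 * n - 1) * inverse sh_aq * sh_ta"
  let ?X = "?g' \<triangleright> (H3_unknot \<otimes> dsum [(sh_aq * sh_sq) \<triangleright> QQ1, sh_sq \<triangleright> QQ1, QQ])"
  let ?S = "\<lambda>g. (qexp g, aexp g, texp g)"
  note X = based_shift[OF based_tens[OF based_U based_R2], of ?g']
  note Fl = based_shift[OF based_shift[OF based_F[of "2 * n - 1"], of "sh_ts ^ 2"], of ?g]
  \<comment> \<open>The t-exponent is (2 n - 1)/2 from t_s plus 1 from t_a; the a-degrees of
    a_q^(-1) and t_a cancel.\<close>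
  have g': "?g' = Shift (-2) 0 (of_nat n + 1/2) (of_nat n - 1/2)"
    using n by (simp add: shift_pow shift_exps of_nat_diff field_simps)
  have gg: "?g = Shift (-2) (-1) (-1/2) (-1/2)" by (simp add: shift_exps)
  \<comment> \<open>\<open>H3_F\<close> is stated for successors, hence these two identities on
    truncated differences.\<close>
  have "Suc (2 * n - 1) = 2 * n" "Suc (2 * n - 2) = 2 * n - 1" using n by simp_all
  then have F1: "eqv (H3 (2 * n)) (sh_ts ^ 2 \<triangleright> F (2 * n))" and F2: "eqv (H3 (2 * n - 1)) (sh_ts ^ 2 \<triangleright> F (2 * n - 1))"
    using H3_F[of "2 * n - 1"] H3_F[of "2 * n - 2"] by metis+
  have R: "eqv (dsum [?g \<triangleright> H3 (2 * n - 1), ?X]) (dsum [?g \<triangleright> sh_ts ^ 2 \<triangleright> F (2 * n - 1), ?X])"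
    by (rule eqv_dsum2[OF eqv_shift[OF F2] wfsp_based[OF X]])
  let ?dg = "\<lambda>t. if t = 0 then (\<lambda>l. dgC (2 * n - 1) l + ?S (sh_ts ^ 2) + ?S ?g) else (\<lambda>l. dTn dgU dgR2 l + ?S ?g')"
  let ?lv = "\<lambda>t. if t = 0 then (\<lambda>l. lvE (2 * n - 1) l + sexp (sh_ts ^ 2) + sexp ?g) else
     (\<lambda>l. dTn (\<lambda>l. dD (\<lambda>_ _. 0) l + 1/2) lvR2 l + sexp ?g')"
  have B: "based (dsum [?g \<triangleright> sh_ts ^ 2 \<triangleright> F (2 * n - 1), ?X]) (LR3 n) (dD ?dg) (dD ?lv)"
    unfolding LR3_def
  proof (rule based_dsum)
    fix t assume "t < length [?g \<triangleright> sh_ts ^ 2 \<triangleright> F (2 * n - 1), ?X]"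
    then consider "t = 0" | "t = 1" by fastforce
    then show "based ([?g \<triangleright> sh_ts ^ 2 \<triangleright> F (2 * n - 1), ?X] ! t) (if t = 0 then LF (2 * n - 1) else LTn LU LR2 dgU dgR2) (?dg t) (?lv t)"
    proof cases
      case 1 show ?thesis unfolding 1 using Fl by simp
    next
      case 2 show ?thesis unfolding 2 using X by simp
    qed
  qed simp
  have "eqv (sh_ts ^ 2 \<triangleright> F (2 * n)) (dsum [?g \<triangleright> sh_ts ^ 2 \<triangleright> F (2 * n - 1), ?X])"
  proof (rule eqv_based[OF based_shift[OF based_F[of "2 * n", folded gamma_image]] B[folded delta_image[OF n]] inj_gamma inj_delta[OF n]])
    fix x assume "x \<in> Ieven n"
    then show "dgC (2 * n) (gamma x) + ?S (sh_ts ^ 2) = dD ?dg (delta n x)"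
      using n
    proof (cases rule: Ieven_cases)
      \<comment> \<open>In \<open>dgT\<close> and \<open>lvT\<close> the parameter k enters only
        through the shift (t_s a_q)^(-k), so the same label for 2 n and 2 n - 1 differs by (t_s
        a_q)^(-1).\<close>
      case (low c p e i j)
      then show ?thesis unfolding g' gg using n
        by (simp add: gamma_def delta_def shift_pow shift_exps of_nat_diff field_simps)
    qed (unfold g' gg, auto simp: gamma_def delta_def Let_def dgU_def dgR2_def shift_pow shift_exps kdeg_def dx_def field_simps)
    from \<open>x \<in> Ieven n\<close> show "lvE (2 * n) (gamma x) + sexp (sh_ts ^ 2) = dD ?lv (delta n x)"
      using n
    proof (cases rule: Ieven_cases)
      case (low c p e i j)
      then show ?thesis unfolding g' gg using n
        by (simp add: gamma_def delta_def shift_pow shift_exps of_nat_diff field_simps)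
    qed (unfold g' gg, auto simp: gamma_def delta_def Let_def lvR2_def shift_pow shift_exps field_simps)
  qed
  from eqv_trans[OF F1 eqv_trans[OF this eqv_sym[OF R]]] show ?thesis .
qed

theorem theorem7p3:
  fixes n :: nat
  shows "H3 (2 * n + 1) \<cong>
      (sh_ts * sh_aq) powi (- (2 * int n)) \<triangleright>
        (H3_unknot \<otimes>
          dsum [QQ,
                sh_ta \<triangleright> dsum (map (\<lambda>k. sh_ttot ^ (2 * k + 1) \<triangleright>
                    dsum [sh_sq \<triangleright> QQ, inverse sh_aq \<triangleright> QQ]) [0..<n])])
    \<and> (1 \<le> n \<longrightarrow> H3 (2 * n) \<cong>
      dsum [inverse (sh_ts * sh_aq) \<triangleright> H3 (2 * n - 1),
            (sh_ts ^ (2 * n - 1) * inverse sh_aq * sh_ta) \<triangleright>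
              (H3_unknot \<otimes>
                dsum [(sh_aq * sh_sq) \<triangleright> QQ1, sh_sq \<triangleright> QQ1, QQ])])"
  using eqv_fiso[OF H3_odd] eqv_fiso[OF H3_even] by blast

end
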